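(* Let $(p_n)_{n\ge 2}$ be positive integers and let $(\sigma_n)_{n\ge2}$, $(\Delta_n)_{n\ge 2}$ be positive reals (write $p=p_n$, $\sigma=\sigma_n$), and let $$\mathbf r_n=\frac{\Delta_n^2/\sigma^2}{\sqrt{\Delta_n^2/\sigma^2+p/n}} .$$ (i) Almost full recovery is possible for $(\Omega_{\Delta_n})_{n\ge2}$ if and only if $\Phi^{\mathsf c}(\mathbf r_n)\to0$ as $n\to\infty$. In this case, the estimator $\eta^k$ (spectral initialization followed by $k$ iterations, as defined in the context) with $k=\lfloor 3\log n\rfloor$ achieves almost full recovery. (ii) Exact recovery is impossible for $(\Omega_{\Delta_n})_{n\ge2}$ if for some $\epsilon>0$ $$\liminf_{n\to\infty} n\Phi^{\mathsf c}(\mathbf r_n(1+\epsilon))>0,$$ and possible if for some $\epsilon>0$ $$n\Phi^{\mathsf c}(\mathbf r_n(1-\epsilon))\to0\quad\text{as } n\to\infty .$$ In this latter case, the estimator $\eta^k$ with $k=\lfloor3\log n\rfloor$ achieves exact recovery.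
   Context: Model: for $n\ge 2$, $p\ge1$, $\sigma>0$, one observes $Y_i=\boldsymbol\theta\eta_i+\sigma\xi_i\in\mathbf R^p$, $i=1,\dots,n$, where $\boldsymbol\theta\in\mathbf R^p$ and $\eta\in\{-1,1\}^n$ are unknown and $\xi_1,\dots,\xi_n$ are i.i.d. standard Gaussian vectors in $\mathbf R^p$. $Y$ is the $p\times n$ matrix with columns $Y_1,\dots,Y_n$; $\mathbf E_{(\boldsymbol\theta,\eta)}$ is expectation under the law of $Y$. $\|\cdot\|$ is the Euclidean norm. $\Phi^{\mathsf c}(t)=\mathbf P(z>t)$ for $z$ standard Gaussian. For $\Delta>0$, $\Omega_\Delta=\{\boldsymbol\theta\in\mathbf R^p:\|\boldsymbol\theta\|\ge\Delta\}\times\{-1,1\}^n$. An estimator is a measurable function of $Y$ with values in $\{-1,1\}^n$. Loss: $r(\hat\eta,\eta)=\min_{\nu\in\{-1,1\}}\sum_{j=1}^n|\hat\eta_j-\nu\eta_j|$. Almost full recovery is possible for $(\Omega_{\Delta_n})_{n\ge2}$ if there is an estimator $\hat\eta$ (one for each $n$) with $\lim_{n\to\infty}\sup_{(\boldsymbol\theta,\eta)\in\Omega_{\Delta_n}}\frac1n\mathbf E_{(\boldsymbol\theta,\eta)}r(\hat\eta,\eta)=0$; then $\hat\eta$ is said to achieve almost full recovery. Exact recovery is possible if there is an estimator $\hat\eta$ with $\lim_{n\to\infty}\sup_{(\boldsymbol\theta,\eta)\in\Omega_{\Delta_n}}\mathbf E_{(\boldsymbol\theta,\eta)}r(\hat\eta,\eta)=0$;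 then $\hat\eta$ is said to achieve exact recovery. Exact recovery is impossible if $\liminf_{n\to\infty}\inf_{\tilde\eta}\sup_{(\boldsymbol\theta,\eta)\in\Omega_{\Delta_n}}\mathbf E_{(\boldsymbol\theta,\eta)}r(\tilde\eta,\eta)>0$, the infimum being over all estimators. Estimator $\eta^k$: for a square matrix $M$, $\mathbf H(M)=M-\mathrm{diag}(M)$, where $\mathrm{diag}(M)$ is the diagonal matrix with the same diagonal as $M$. Let $\hat v$ be an eigenvector of $\mathbf H(Y^\top Y)$ for its top (largest) eigenvalue, $\eta^0=\mathrm{sign}(\hat v)$, and $\eta^{j+1}=\mathrm{sign}(\mathbf H(Y^\top Y)\eta^j)$ for $j\ge0$; $\mathrm{sign}$ is applied entrywise, with any fixed convention $\mathrm{sign}(0)\in\{-1,1\}$. *)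

theory Defs
  imports "HOL-Probability.Probability" "Jordan_Normal_Form.Char_Poly"
begin

text \<open>
  A real \<open>p \<times> n\<close> matrix is handled as a family \<open>Y :: nat \<times> nat \<Rightarrow> real\<close> indexed by
  \<open>{..<p} \<times> {..<n}\<close> (row first), because the finite product supplies the Borel sigma-algebra;
  the observation \<open>Y\<^sub>j\<close> is the column \<open>\<lambda>i. Y (i, j)\<close>. \<open>Matrix.mat p n Y\<close> is the same matrix
  as an object of linear algebra. Indices start at \<open>0\<close>.
\<close>

definition obs_space :: "nat \<Rightarrow> nat \<Rightarrow> (nat \<times> nat \<Rightarrow> real) measure" where
  "obs_space p n = (\<Pi>\<^sub>M ij \<in> {..<p} \<times> {..<n}. borel)"

definition noise :: "nat \<Rightarrow> nat \<Rightarrow> (nat \<times> nat \<Rightarrow> real) measure" where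
  "noise p n = (\<Pi>\<^sub>M ij \<in> {..<p} \<times> {..<n}. density lborel std_normal_density)"

definition obs_law ::
  "nat \<Rightarrow> nat \<Rightarrow> real \<Rightarrow> (nat \<Rightarrow> real) \<Rightarrow> (nat \<Rightarrow> real) \<Rightarrow> (nat \<times> nat \<Rightarrow> real) measure" where
  "obs_law p n \<sigma> \<theta> \<eta> = distr (noise p n) (obs_space p n)
     (\<lambda>\<xi>. \<lambda>(i, j) \<in> {..<p} \<times> {..<n}. \<theta> i * \<eta> j + \<sigma> * \<xi> (i, j))"

definition gauss_tail :: "real \<Rightarrow> real" where
  "gauss_tail t = measure (density lborel std_normal_density) {t<..}"

definition label_vectors :: "nat \<Rightarrow> (nat \<Rightarrow> real) set" where
  "label_vectors n = {..<n} \<rightarrow>\<^sub>E {-1, 1}"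

definition Omega :: "nat \<Rightarrow> nat \<Rightarrow> real \<Rightarrow> ((nat \<Rightarrow> real) \<times> (nat \<Rightarrow> real)) set" where
  "Omega p n \<Delta> = {\<theta> \<in> {..<p} \<rightarrow>\<^sub>E UNIV. L2_set \<theta> {..<p} \<ge> \<Delta>} \<times> label_vectors n"

definition estimators :: "nat \<Rightarrow> nat \<Rightarrow> ((nat \<times> nat \<Rightarrow> real) \<Rightarrow> (nat \<Rightarrow> real)) set" where
  "estimators p n = obs_space p n \<rightarrow>\<^sub>M (\<Pi>\<^sub>M j \<in> {..<n}. count_space {-1, 1})"

definition loss :: "nat \<Rightarrow> (nat \<Rightarrow> real) \<Rightarrow> (nat \<Rightarrow> real) \<Rightarrow> real" where
  "loss n \<eta>' \<eta> = (MIN \<nu> \<in> {-1, 1}. \<Sum>j<n. \<bar>\<eta>' j - \<nu> * \<eta> j\<bar>)"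

definition risk ::
  "nat \<Rightarrow> nat \<Rightarrow> real \<Rightarrow> ((nat \<times> nat \<Rightarrow> real) \<Rightarrow> (nat \<Rightarrow> real)) \<Rightarrow>
   (nat \<Rightarrow> real) \<times> (nat \<Rightarrow> real) \<Rightarrow> real" where
  "risk p n \<sigma> est = (\<lambda>(\<theta>, \<eta>). \<integral>Y. loss n (est Y) \<eta> \<partial>(obs_law p n \<sigma> \<theta> \<eta>))"

text \<open>
  Below, \<open>p\<close>, \<open>\<sigma>\<close>, \<open>\<Delta>\<close> are sequences in the sample size \<open>n\<close>, and \<open>est n\<close> is the estimator
  used for sample size \<open>n\<close>. Suprema and infima are taken in the complete lattice of the extended
  reals, so that none of them is an unspecified value.
\<close>

definition achieves_almost_full_recovery ::
  "(nat \<Rightarrow> nat) \<Rightarrow> (nat \<Rightarrow> real) \<Rightarrow> (nat \<Rightarrow> real) \<Rightarrow>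
   (nat \<Rightarrow> (nat \<times> nat \<Rightarrow> real) \<Rightarrow> (nat \<Rightarrow> real)) \<Rightarrow> bool" where
  "achieves_almost_full_recovery p \<sigma> \<Delta> est \<longleftrightarrow>
     (\<forall>n\<ge>2. est n \<in> estimators (p n) n) \<and>
     (\<lambda>n. SUP \<omega> \<in> Omega (p n) n (\<Delta> n). ereal (1 / real n * risk (p n) n (\<sigma> n) (est n) \<omega>))
       \<longlonglongrightarrow> 0"

definition almost_full_recovery_possible ::
  "(nat \<Rightarrow> nat) \<Rightarrow> (nat \<Rightarrow> real) \<Rightarrow> (nat \<Rightarrow> real) \<Rightarrow> bool" where
  "almost_full_recovery_possible p \<sigma> \<Delta> \<longleftrightarrow>
     (\<exists>est. achieves_almost_full_recovery p \<sigma> \<Delta> est)"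

definition achieves_exact_recovery ::
  "(nat \<Rightarrow> nat) \<Rightarrow> (nat \<Rightarrow> real) \<Rightarrow> (nat \<Rightarrow> real) \<Rightarrow>
   (nat \<Rightarrow> (nat \<times> nat \<Rightarrow> real) \<Rightarrow> (nat \<Rightarrow> real)) \<Rightarrow> bool" where
  "achieves_exact_recovery p \<sigma> \<Delta> est \<longleftrightarrow>
     (\<forall>n\<ge>2. est n \<in> estimators (p n) n) \<and>
     (\<lambda>n. SUP \<omega> \<in> Omega (p n) n (\<Delta> n). ereal (risk (p n) n (\<sigma> n) (est n) \<omega>))
       \<longlonglongrightarrow> 0"

definition exact_recovery_possible ::
  "(nat \<Rightarrow> nat) \<Rightarrow> (nat \<Rightarrow> real) \<Rightarrow> (nat \<Rightarrow> real) \<Rightarrow> bool" where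
  "exact_recovery_possible p \<sigma> \<Delta> \<longleftrightarrow> (\<exists>est. achieves_exact_recovery p \<sigma> \<Delta> est)"

definition exact_recovery_impossible ::
  "(nat \<Rightarrow> nat) \<Rightarrow> (nat \<Rightarrow> real) \<Rightarrow> (nat \<Rightarrow> real) \<Rightarrow> bool" where
  "exact_recovery_impossible p \<sigma> \<Delta> \<longleftrightarrow>
     liminf (\<lambda>n. INF est \<in> estimators (p n) n.
       SUP \<omega> \<in> Omega (p n) n (\<Delta> n). ereal (risk (p n) n (\<sigma> n) est \<omega>)) > 0"

definition hollow :: "real mat \<Rightarrow> real mat" where
  "hollow M = M - mat_diag (dim_row M) (\<lambda>i. M $$ (i, i))"

definition hollow_gram :: "nat \<Rightarrow> nat \<Rightarrow> (nat \<times> nat \<Rightarrow> real) \<Rightarrow> real mat" where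
  "hollow_gram p n Y = hollow (transpose_mat (Matrix.mat p n Y) * Matrix.mat p n Y)"

definition top_eigenvector :: "real mat \<Rightarrow> real Matrix.vec \<Rightarrow> bool" where
  "top_eigenvector A v \<longleftrightarrow> (\<exists>l. eigenvector A v l \<and> (\<forall>m. eigenvalue A m \<longrightarrow> m \<le> l))"

definition sign_with :: "real \<Rightarrow> real \<Rightarrow> real" where
  "sign_with s\<^sub>0 x = (if x = 0 then s\<^sub>0 else sgn x)"

primrec sign_iterate :: "real \<Rightarrow> real mat \<Rightarrow> real Matrix.vec \<Rightarrow> nat \<Rightarrow> real Matrix.vec" where
  "sign_iterate s\<^sub>0 A v 0 = map_vec (sign_with s\<^sub>0) v"
| "sign_iterate s\<^sub>0 A v (Suc k) = map_vec (sign_with s\<^sub>0) (A *\<^sub>v sign_iterate s\<^sub>0 A v k)"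

text \<open>
  An eigenvector is determined at best up to a scalar factor, so the spectral initialisation is
  relative to a choice \<open>vhat\<close> of a top eigenvector for every data set \<open>Y\<close>. The choice has to be
  measurable for the resulting iterates to be estimators.
\<close>

definition spectral_choice ::
  "nat \<Rightarrow> nat \<Rightarrow> ((nat \<times> nat \<Rightarrow> real) \<Rightarrow> real Matrix.vec) \<Rightarrow> bool" where
  "spectral_choice p n vhat \<longleftrightarrow>
     (\<forall>Y \<in> space (obs_space p n). top_eigenvector (hollow_gram p n Y) (vhat Y)) \<and>
     (\<forall>j<n. (\<lambda>Y. Matrix.vec_index (vhat Y) j) \<in> borel_measurable (obs_space p n))"

definition spectral_iterate ::
  "nat \<Rightarrow> nat \<Rightarrow> real \<Rightarrow> ((nat \<times> nat \<Rightarrow> real) \<Rightarrow> real Matrix.vec) \<Rightarrow> nat \<Rightarrow>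
   (nat \<times> nat \<Rightarrow> real) \<Rightarrow> (nat \<Rightarrow> real)" where
  "spectral_iterate p n s\<^sub>0 vhat k Y =
     (\<lambda>j \<in> {..<n}. Matrix.vec_index (sign_iterate s\<^sub>0 (hollow_gram p n Y) (vhat Y) k) j)"

definition snr :: "nat \<Rightarrow> nat \<Rightarrow> real \<Rightarrow> real \<Rightarrow> real" where
  "snr p n \<sigma> \<Delta> = (\<Delta>\<^sup>2 / \<sigma>\<^sup>2) / sqrt (\<Delta>\<^sup>2 / \<sigma>\<^sup>2 + real p / real n)"

end

theory Submission
  imports Defs "HOL-Real_Asymp.Real_Asymp"
begin

text \<open>
  Put \<open>S = \<parallel>\<theta>\<parallel>\<^sup>2/\<sigma>\<^sup>2\<close>, \<open>q =
  p/n\<close> and \<open>\<rho> = S\<^sup>2/(S+q)\<close>, so that \<open>snr\<close> is the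
  square root of \<open>\<rho>\<close> at the smallest admissible signal. Both halves of the
  theorem say that a label is lost with probability about \<open>\<Phi>\<^sup>c(snr)\<close>.

  Upper bound. The hollow Gram matrix is
  \<open>\<parallel>\<theta>\<parallel>\<^sup>2(\<eta>\<eta>\<^sup>T - I)\<close> plus a noise
  matrix \<open>W\<close> (\<open>deviation\<close>). With probability at least \<open>1 -
  4e\<^bsup>-2n\<^esup>\<close> the quadratic form of \<open>W\<close> is small compared with
  \<open>n\<parallel>\<theta>\<parallel>\<^sup>2\<close> (\<open>deviation_bound_whp\<close>:
  exponential moments of the Gaussian chaos, and a union bound over integer points). On this event
  the rest is deterministic (locale \<open>planted_labels\<close>): a vector whose Rayleigh
  quotient is at least that of \<open>\<eta>\<close> has the right signs up to a global sign in
  all but few places, and one sign step turns \<open>N\<close> wrong labels into at most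
  \<open>N\<^sub>* + N/16\<close>, where \<open>N\<^sub>*\<close> is the number of indices
  \<open>i\<close> whose margin \<open>\<eta>\<^sub>i\<Sum>\<^sub>j
  H\<^sub>i\<^sub>j\<eta>\<^sub>j\<close> is small although the true labels are used. After
  \<open>\<lfloor>3 ln n\<rfloor>\<close> steps only a multiple of \<open>N\<^sub>*\<close> is
  left, and a small margin has probability at most \<open>exp(-(1-o(1))\<rho>/2)\<close>
  (\<open>margin_tail\<close>). Summing up gives \<open>risk_rayleigh_iterate\<close>. Top
  eigenvectors satisfy the Rayleigh condition, and so does a label vector that maximises the
  quadratic form. The maximiser runs over a finite set, hence is a measurable choice, and this
  shows that recovery is possible without any question about measurable choices of eigenvectors.

  Lower bound. For a label vector with uniform prior the risk is bounded from below by the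
  probability, under \<open>\<eta>\<close>, of data that are at least as likely under
  \<open>\<eta>\<close> with one label flipped (\<open>bayes_risk_lower_bound\<close>); the global
  sign is harmless because relative labels of pairs are counted. Two priors for
  \<open>\<theta>\<close> suffice. A known \<open>\<theta>\<close> gives the error
  \<open>\<Phi>\<^sup>c(\<Delta>/\<sigma>)\<close> (\<open>minimax_known_signal\<close>), which is
  sharp if \<open>p/n\<close> is negligible compared with
  \<open>\<Delta>\<^sup>2/\<sigma>\<^sup>2\<close>. A Gaussian \<open>\<theta>\<close> with
  \<open>\<parallel>\<theta>\<parallel>\<close> slightly larger than \<open>\<Delta>\<close> gives
  \<open>\<Phi>\<^sup>c(snr(1+\<delta>)\<^sup>2)\<close> up to constants
  (\<open>minimax_gaussian_prior\<close>) and an error exponentially small in \<open>p\<close> for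
  the event \<open>\<parallel>\<theta>\<parallel> < \<Delta>\<close>. If the first prior is not
  sharp enough, then \<open>p\<close> is at least a multiple of \<open>n\<close>, so that this
  error is negligible; \<open>minimax_lower_bound\<close> combines the two.

  Every Gaussian computation is one identity, \<open>gauss_tilt\<close>: the density of a standard
  Gaussian vector multiplied by \<open>exp(\<Sum> a\<^sub>k x\<^sub>k + b\<^sub>k
  x\<^sub>k\<^sup>2)\<close> is, up to a constant, the density of another Gaussian vector with
  independent components. It gives the exponential moments, the change of measure from noise to
  data, the marginal density of the data under the Gaussian prior, and the posterior of a column
  given the others.
\<close>

section \<open>Gaussian integrals and exponential tilting\<close>

abbreviation std_normal :: "real measure" where
  "std_normal \<equiv> density lborel std_normal_density"

text \<open>
  The exponential moment of \<open>a x + b x\<^sup>2\<close> for a standard Gaussian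
  \<open>x\<close>, finite for \<open>b < 1/2\<close>.
\<close>

definition tilt_factor :: "real \<Rightarrow> real \<Rightarrow> real" where
  "tilt_factor a b = exp (a\<^sup>2 / (2 * (1 - 2 * b))) / sqrt (1 - 2 * b)"

lemma prob_space_std_normal: "prob_space std_normal"
  by (rule prob_space_normal_density) simp

lemma tilt_factor_nonneg: "b < 1/2 \<Longrightarrow> tilt_factor a b \<ge> 0"
  by (simp add: tilt_factor_def)

text \<open>
  Completing the square: the tilted density is a constant times the Gaussian density with mean
  \<open>a/(1-2b)\<close> and variance \<open>1/(1-2b)\<close>, and an affine substitution makes
  it standard again.
\<close>

lemma std_normal_tilt:
  fixes a b :: real and f :: "real \<Rightarrow> ennreal"
  assumes b: "b < 1/2" and [measurable]: "f \<in> borel_measurable borel"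
  shows "(\<integral>\<^sup>+x. f x * ennreal (exp (a * x + b * x\<^sup>2)) \<partial>std_normal) =
    ennreal (tilt_factor a b) * (\<integral>\<^sup>+x. f (a / (1 - 2 * b) + x / sqrt (1 - 2 * b)) \<partial>std_normal)"
proof -
  define c where "c = 1 - 2 * b"
  have c: "c > 0" using b by (simp add: c_def)
  define s where "s = 1 / sqrt c"
  have s: "s > 0" "c * s\<^sup>2 = 1" using c by (auto simp: s_def power_divide)
  define m where "m = a / c"
  have cm: "c * m = a" using c by (simp add: m_def)
  have key: "s * (std_normal_density (m + s * x) * exp (a * (m + s * x) + b * (m + s * x)\<^sup>2)) =
      tilt_factor a b * std_normal_density x" for x
  proof -
    have b': "b = (1 - c) / 2" by (simp add: c_def)
    have "- (m + s * x)\<^sup>2 / 2 + (a * (m + s * x) + b * (m + s * x)\<^sup>2) =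
        - (c * m * m + 2 * (c * m) * s * x + (c * s\<^sup>2) * x\<^sup>2) / 2 + a * m + a * s * x"
      unfolding b' by (simp add: field_simps power2_eq_square)
    also have "\<dots> = a * m / 2 - x\<^sup>2 / 2" unfolding cm s by (simp add: field_simps)
    also have "a * m / 2 = a\<^sup>2 / (2 * (1 - 2 * b))"
      by (simp add: m_def c_def[symmetric] power2_eq_square)
    finally have "exp (- (m + s * x)\<^sup>2 / 2) * exp (a * (m + s * x) + b * (m + s * x)\<^sup>2) =
        exp (a\<^sup>2 / (2 * (1 - 2 * b))) * exp (- x\<^sup>2 / 2)"
      by (simp flip: exp_add)
    then show ?thesis
      unfolding std_normal_density_def tilt_factor_def s_def c_def by (simp add: field_simps)
  qed
  have "(\<integral>\<^sup>+x. f x * ennreal (exp (a * x + b * x\<^sup>2)) \<partial>std_normal) =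
      (\<integral>\<^sup>+x. std_normal_density x * (f x * ennreal (exp (a * x + b * x\<^sup>2))) \<partial>lborel)"
    by (subst nn_integral_density) auto
  also have "\<dots> = \<bar>s\<bar> * (\<integral>\<^sup>+x. std_normal_density (m + s * x) *
      (f (m + s * x) * ennreal (exp (a * (m + s * x) + b * (m + s * x)\<^sup>2))) \<partial>lborel)"
    using s by (intro nn_integral_real_affine) auto
  also have "\<dots> = (\<integral>\<^sup>+x. ennreal (tilt_factor a b) * (std_normal_density x * f (m + s * x)) \<partial>lborel)"
  proof (subst nn_integral_cmult[symmetric], simp, intro nn_integral_cong)
    fix x
    have "ennreal \<bar>s\<bar> * (ennreal (std_normal_density (m + s * x)) *
      (f (m + s * x) * ennreal (exp (a * (m + s * x) + b * (m + s * x)\<^sup>2)))) =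
      ennreal (s * (std_normal_density (m + s * x) * exp (a * (m + s * x) + b * (m + s * x)\<^sup>2))) * f (m + s * x)"
      using s by (simp add: ennreal_mult ac_simps)
    then show "ennreal \<bar>s\<bar> * (ennreal (std_normal_density (m + s * x)) *
      (f (m + s * x) * ennreal (exp (a * (m + s * x) + b * (m + s * x)\<^sup>2)))) =
      ennreal (tilt_factor a b) * (std_normal_density x * f (m + s * x))"
      unfolding key using tilt_factor_nonneg[OF b] by (simp add: ennreal_mult ac_simps)
  qed
  also have "\<dots> = ennreal (tilt_factor a b) * (\<integral>\<^sup>+x. f (m + s * x) \<partial>std_normal)"
    by (subst nn_integral_cmult, simp, subst nn_integral_density) auto
  finally show ?thesis by (simp add: m_def s_def c_def)
qed

abbreviation gauss :: "'i set \<Rightarrow> ('i \<Rightarrow> real) measure" where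
  "gauss K \<equiv> PiM K (\<lambda>_. std_normal)"

lemma product_prob_std_normal: "product_prob_space (\<lambda>_::'i. std_normal)"
  by (intro product_prob_spaceI prob_space_std_normal)

lemma product_sigma_std_normal: "product_sigma_finite (\<lambda>_::'i. std_normal)"
  using product_prob_std_normal unfolding product_prob_space_def by blast

lemma prob_space_gauss: "prob_space (gauss K)"
  by (intro prob_space_PiM prob_space_std_normal)

lemma sets_gauss[measurable_cong]: "sets (gauss K) = sets (PiM K (\<lambda>_. borel))"
  by (intro sets_PiM_cong) auto

text \<open>
  The components are independent, so the one-dimensional identity may be used for one coordinate
  after another. All later Chernoff bounds, changes of measure and posterior computations are
  instances.
\<close>

lemma gauss_tilt:
  fixes a b :: "'i \<Rightarrow> real" and f :: "('i \<Rightarrow> real) \<Rightarrow> ennreal"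
  assumes K: "finite K" and b: "\<And>k. k \<in> K \<Longrightarrow> b k < 1/2"
    and f: "f \<in> borel_measurable (PiM K (\<lambda>_. borel))"
  shows "(\<integral>\<^sup>+\<xi>. f \<xi> * ennreal (exp (\<Sum>k\<in>K. a k * \<xi> k + b k * (\<xi> k)\<^sup>2)) \<partial>gauss K) =
    ennreal (\<Prod>k\<in>K. tilt_factor (a k) (b k)) *
    (\<integral>\<^sup>+\<xi>. f (\<lambda>k\<in>K. a k / (1 - 2 * b k) + \<xi> k / sqrt (1 - 2 * b k)) \<partial>gauss K)"
  using K b f
proof (induction K arbitrary: f rule: finite_induct)
  case empty
  interpret product_sigma_finite "\<lambda>_::'i. std_normal" by (rule product_sigma_std_normal)
  show ?case by (simp add: nn_integral_empty PiM_empty nn_integral_count_space_finite restrict_def)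
next
  case (insert k K)
  interpret product_sigma_finite "\<lambda>_::'i. std_normal" by (rule product_sigma_std_normal)
  note [measurable] = insert.prems(2)
  have bK: "\<And>k. k \<in> K \<Longrightarrow> b k < 1/2" and bk: "b k < 1/2" using insert.prems(1) by auto
  define g where "g x = a k / (1 - 2 * b k) + x / sqrt (1 - 2 * b k)" for x :: real
  have [measurable]: "g \<in> borel_measurable borel" unfolding g_def by measurable
  define G where "G \<xi> = (\<lambda>k\<in>K. a k / (1 - 2 * b k) + \<xi> k / sqrt (1 - 2 * b k))" for \<xi> :: "'i \<Rightarrow> real"
  have [measurable]: "G \<in> PiM K (\<lambda>_. borel) \<rightarrow>\<^sub>M PiM K (\<lambda>_. borel)"
    unfolding G_def by (rule measurable_restrict) auto
  have sumeq: "(\<Sum>j\<in>insert k K. a j * (\<xi>(k := y)) j + b j * ((\<xi>(k := y)) j)\<^sup>2) =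
      (a k * y + b k * y\<^sup>2) + (\<Sum>j\<in>K. a j * \<xi> j + b j * (\<xi> j)\<^sup>2)" for \<xi> y
    using insert.hyps by (simp add: sum.insert) (auto intro!: sum.cong)
  have "(\<integral>\<^sup>+\<xi>. f \<xi> * ennreal (exp (\<Sum>j\<in>insert k K. a j * \<xi> j + b j * (\<xi> j)\<^sup>2)) \<partial>gauss (insert k K)) =
     (\<integral>\<^sup>+\<xi>. (\<integral>\<^sup>+y. f (\<xi>(k := y)) * ennreal (exp (\<Sum>j\<in>insert k K. a j * (\<xi>(k := y)) j + b j * ((\<xi>(k := y)) j)\<^sup>2)) \<partial>std_normal) \<partial>gauss K)"
    using insert.hyps by (intro product_nn_integral_insert) measurable
  also have "\<dots> = (\<integral>\<^sup>+\<xi>. (\<integral>\<^sup>+y. f (\<xi>(k := y)) * ennreal (exp (a k * y + b k * y\<^sup>2)) \<partial>std_normal) *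
       ennreal (exp (\<Sum>j\<in>K. a j * \<xi> j + b j * (\<xi> j)\<^sup>2)) \<partial>gauss K)"
  proof (intro nn_integral_cong)
    fix \<xi> assume "\<xi> \<in> space (gauss K)"
    then have [measurable]: "(\<lambda>y. f (\<xi>(k := y))) \<in> borel_measurable borel"
      using insert.hyps
      by (intro measurable_compose[OF measurable_component_update insert.prems(2)])
        (auto simp: space_PiM)
    show "(\<integral>\<^sup>+y. f (\<xi>(k := y)) * ennreal (exp (\<Sum>j\<in>insert k K. a j * (\<xi>(k := y)) j + b j * ((\<xi>(k := y)) j)\<^sup>2)) \<partial>std_normal)
      = (\<integral>\<^sup>+y. f (\<xi>(k := y)) * ennreal (exp (a k * y + b k * y\<^sup>2)) \<partial>std_normal) *
       ennreal (exp (\<Sum>j\<in>K. a j * \<xi> j + b j * (\<xi> j)\<^sup>2))"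
      unfolding sumeq exp_add by (subst nn_integral_multc[symmetric]) (auto simp: ennreal_mult ac_simps)
  qed
  also have "\<dots> = (\<integral>\<^sup>+\<xi>. ennreal (tilt_factor (a k) (b k)) * ((\<integral>\<^sup>+y. f (\<xi>(k := g y)) \<partial>std_normal) *
       ennreal (exp (\<Sum>j\<in>K. a j * \<xi> j + b j * (\<xi> j)\<^sup>2))) \<partial>gauss K)"
  proof (intro nn_integral_cong)
    fix \<xi> assume "\<xi> \<in> space (gauss K)"
    then have [measurable]: "(\<lambda>y. f (\<xi>(k := y))) \<in> borel_measurable borel"
      using insert.hyps
      by (intro measurable_compose[OF measurable_component_update insert.prems(2)])
        (auto simp: space_PiM)
    show "(\<integral>\<^sup>+y. f (\<xi>(k := y)) * ennreal (exp (a k * y + b k * y\<^sup>2)) \<partial>std_normal) *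
       ennreal (exp (\<Sum>j\<in>K. a j * \<xi> j + b j * (\<xi> j)\<^sup>2)) =
       ennreal (tilt_factor (a k) (b k)) * ((\<integral>\<^sup>+y. f (\<xi>(k := g y)) \<partial>std_normal) *
       ennreal (exp (\<Sum>j\<in>K. a j * \<xi> j + b j * (\<xi> j)\<^sup>2)))"
      by (subst std_normal_tilt[OF bk]) (auto simp: g_def ac_simps)
  qed
  also have "\<dots> = ennreal (tilt_factor (a k) (b k)) * (\<integral>\<^sup>+\<xi>. (\<integral>\<^sup>+y. f (\<xi>(k := g y)) \<partial>std_normal) *
       ennreal (exp (\<Sum>j\<in>K. a j * \<xi> j + b j * (\<xi> j)\<^sup>2)) \<partial>gauss K)"
    by (intro nn_integral_cmult) measurable
  also have "\<dots> = ennreal (tilt_factor (a k) (b k)) * (ennreal (\<Prod>k\<in>K. tilt_factor (a k) (b k)) *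
      (\<integral>\<^sup>+\<xi>. (\<integral>\<^sup>+y. f ((G \<xi>)(k := g y)) \<partial>std_normal) \<partial>gauss K))"
    unfolding G_def by (subst insert.IH[OF bK]) (auto intro: bK)
  also have "(\<integral>\<^sup>+\<xi>. (\<integral>\<^sup>+y. f ((G \<xi>)(k := g y)) \<partial>std_normal) \<partial>gauss K) =
     (\<integral>\<^sup>+\<xi>. (\<integral>\<^sup>+y. f (\<lambda>j\<in>insert k K. a j / (1 - 2 * b j) + (\<xi>(k := y)) j / sqrt (1 - 2 * b j)) \<partial>std_normal) \<partial>gauss K)"
    using insert.hyps by (intro nn_integral_cong arg_cong[where f=f]) (auto simp: fun_eq_iff G_def g_def)
  also have "\<dots> = (\<integral>\<^sup>+\<xi>. f (\<lambda>j\<in>insert k K. a j / (1 - 2 * b j) + \<xi> j / sqrt (1 - 2 * b j)) \<partial>gauss (insert k K))"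
    using insert.hyps
  proof (intro product_nn_integral_insert[symmetric])
    show "(\<lambda>\<xi>. f (\<lambda>j\<in>insert k K. a j / (1 - 2 * b j) + \<xi> j / sqrt (1 - 2 * b j)))
      \<in> borel_measurable (gauss (insert k K))"
      by (rule measurable_compose[OF _ insert.prems(2)], rule measurable_restrict) auto
  qed auto
  finally have "(\<integral>\<^sup>+\<xi>. f \<xi> * ennreal (exp (\<Sum>j\<in>insert k K. a j * \<xi> j + b j * (\<xi> j)\<^sup>2)) \<partial>gauss (insert k K)) =
    ennreal (tilt_factor (a k) (b k)) * (ennreal (\<Prod>k\<in>K. tilt_factor (a k) (b k)) *
     (\<integral>\<^sup>+\<xi>. f (\<lambda>j\<in>insert k K. a j / (1 - 2 * b j) + \<xi> j / sqrt (1 - 2 * b j)) \<partial>gauss (insert k K)))" .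
  also have "\<dots> = ennreal (\<Prod>k\<in>insert k K. tilt_factor (a k) (b k)) *
     (\<integral>\<^sup>+\<xi>. f (\<lambda>j\<in>insert k K. a j / (1 - 2 * b j) + \<xi> j / sqrt (1 - 2 * b j)) \<partial>gauss (insert k K))"
    using insert.hyps bK bk
    by (subst prod.insert) (auto simp only: ennreal_mult tilt_factor_nonneg prod_nonneg mult.assoc)
  finally show ?case .
qed

text \<open>
  The Cameron-Martin formula: data with mean \<open>c\<close> have a density with respect to pure
  noise. All data models are thereby compared on one probability space.
\<close>

lemma gauss_shift:
  fixes c :: "'i \<Rightarrow> real" and f :: "('i \<Rightarrow> real) \<Rightarrow> ennreal"
  assumes K: "finite K" and f: "f \<in> borel_measurable (PiM K (\<lambda>_. borel))"
  shows "(\<integral>\<^sup>+\<xi>. f (\<lambda>k\<in>K. c k + \<xi> k) \<partial>gauss K) =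
    (\<integral>\<^sup>+\<xi>. f \<xi> * ennreal (exp (\<Sum>k\<in>K. c k * \<xi> k - (c k)\<^sup>2 / 2)) \<partial>gauss K)"
proof -
  note [measurable] = f
  define C where "C = (\<Sum>k\<in>K. (c k)\<^sup>2 / 2)"
  have P: "(\<Prod>k\<in>K. tilt_factor (c k) 0) = exp C"
    using K by (simp add: tilt_factor_def C_def exp_sum)
  have "(\<integral>\<^sup>+\<xi>. f \<xi> * ennreal (exp (\<Sum>k\<in>K. c k * \<xi> k - (c k)\<^sup>2 / 2)) \<partial>gauss K) =
    (\<integral>\<^sup>+\<xi>. ennreal (exp (- C)) * (f \<xi> * ennreal (exp (\<Sum>k\<in>K. c k * \<xi> k + 0 * (\<xi> k)\<^sup>2))) \<partial>gauss K)"
  proof (intro nn_integral_cong)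
    fix \<xi> :: "'i \<Rightarrow> real"
    have "(\<Sum>k\<in>K. c k * \<xi> k - (c k)\<^sup>2 / 2) = - C + (\<Sum>k\<in>K. c k * \<xi> k + 0 * (\<xi> k)\<^sup>2)"
      by (simp add: C_def sum_subtractf)
    then show "f \<xi> * ennreal (exp (\<Sum>k\<in>K. c k * \<xi> k - (c k)\<^sup>2 / 2)) =
        ennreal (exp (- C)) * (f \<xi> * ennreal (exp (\<Sum>k\<in>K. c k * \<xi> k + 0 * (\<xi> k)\<^sup>2)))"
      by (simp only: exp_add ennreal_mult exp_ge_zero ac_simps)
  qed
  also have "\<dots> = ennreal (exp (- C)) * (\<integral>\<^sup>+\<xi>. f \<xi> * ennreal (exp (\<Sum>k\<in>K. c k * \<xi> k + 0 * (\<xi> k)\<^sup>2)) \<partial>gauss K)"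
    by (intro nn_integral_cmult) measurable
  also have "\<dots> = ennreal (exp (- C)) * (ennreal (exp C) * (\<integral>\<^sup>+\<xi>. f (\<lambda>k\<in>K. c k + \<xi> k) \<partial>gauss K))"
    by (subst gauss_tilt[OF K _ f]) (auto simp: P)
  also have "\<dots> = (ennreal (exp (- C)) * ennreal (exp C)) * (\<integral>\<^sup>+\<xi>. f (\<lambda>k\<in>K. c k + \<xi> k) \<partial>gauss K)"
    by (simp only: mult.assoc)
  also have "ennreal (exp (- C)) * ennreal (exp C) = 1"
    by (simp flip: ennreal_mult exp_add)
  finally show ?thesis by (simp only: mult_1_left)
qed

lemma std_normal_exp_quadratic:
  assumes "b < 1/2"
  shows "(\<integral>\<^sup>+x. ennreal (exp (a * x + b * x\<^sup>2)) \<partial>std_normal) = ennreal (tilt_factor a b)"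
  using std_normal_tilt[OF assms, of "\<lambda>_. 1" a] prob_space.emeasure_space_1[OF prob_space_std_normal]
  by simp

lemma gauss_exp_quadratic:
  assumes K: "finite K" and b: "\<And>k. k \<in> K \<Longrightarrow> b k < 1/2"
  shows "(\<integral>\<^sup>+\<xi>. ennreal (exp (\<Sum>k\<in>K. a k * \<xi> k + b k * (\<xi> k)\<^sup>2)) \<partial>gauss K) =
    ennreal (\<Prod>k\<in>K. tilt_factor (a k) (b k))"
  using gauss_tilt[where f = "\<lambda>_. 1" and a = a, OF K b] prob_space.emeasure_space_1[OF prob_space_gauss, of K]
  by simp

text \<open>
  A linear form in independent Gaussians is a Gaussian with the sum of the variances. Coordinates
  with coefficient 0 are left out first, as a normal density needs positive variance.
\<close>

lemma gauss_linear:
  fixes x :: "'i \<Rightarrow> real" and f :: "real \<Rightarrow> ennreal"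
  assumes K: "finite K" and [measurable]: "f \<in> borel_measurable borel"
  shows "(\<integral>\<^sup>+\<xi>. f (\<Sum>k\<in>K. x k * \<xi> k) \<partial>gauss K) = (\<integral>\<^sup>+z. f (sqrt (\<Sum>k\<in>K. (x k)\<^sup>2) * z) \<partial>std_normal)"
proof -
  interpret prob_space "gauss K" by (rule prob_space_gauss)
  define J where "J = {k\<in>K. x k \<noteq> 0}"
  have J: "finite J" "J \<subseteq> K" using K by (auto simp: J_def)
  have sumJ: "(\<Sum>k\<in>K. x k * \<xi> k) = (\<Sum>k\<in>J. x k * \<xi> k)" for \<xi>
    using K by (intro sum.mono_neutral_right) (auto simp: J_def)
  have sqJ: "(\<Sum>k\<in>K. (x k)\<^sup>2) = (\<Sum>k\<in>J. (x k)\<^sup>2)"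
    using K by (intro sum.mono_neutral_right) (auto simp: J_def)
  show ?thesis
  proof (cases "J = {}")
    case True
    then show ?thesis
      using prob_space.emeasure_space_1[OF prob_space_std_normal]
      by (simp add: sumJ sqJ emeasure_space_1)
  next
    case False
    then have "K \<noteq> {}" using J by auto
    have dist: "distributed (gauss K) lborel (\<lambda>\<xi>. \<xi> k) std_normal_density" if "k \<in> K" for k
      unfolding distributed_def
    proof (intro conjI)
      show "distr (gauss K) lborel (\<lambda>\<xi>. \<xi> k) = density lborel std_normal_density"
        using distr_PiM_component[of K "\<lambda>_. std_normal" k, OF prob_space_std_normal that]
        by (metis (no_types, lifting) distr_cong sets_density sets_lborel)
    qed (use that in auto)
    have dist': "distributed (gauss K) lborel (\<lambda>\<xi>. x k * \<xi> k) (normal_density 0 \<bar>x k\<bar>)" if "k \<in> J" for k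
      using normal_density_affine[OF dist, of k "x k" 0] that by (simp add: J_def)
    have "distr (gauss K) (PiM K (\<lambda>_. borel)) (\<lambda>\<xi>. \<lambda>k\<in>K. \<xi> k) = PiM K (\<lambda>k. distr (gauss K) borel (\<lambda>\<xi>. \<xi> k))"
    proof -
      have "distr (gauss K) (PiM K (\<lambda>_. borel)) (\<lambda>\<xi>. \<lambda>k\<in>K. \<xi> k) = distr (gauss K) (gauss K) (\<lambda>\<xi>. \<xi>)"
        by (intro distr_cong) (auto simp: sets_gauss space_PiM)
      also have "\<dots> = gauss K" by (rule distr_id)
      also have "\<dots> = PiM K (\<lambda>k. distr (gauss K) borel (\<lambda>\<xi>. \<xi> k))"
      proof (intro PiM_cong refl)
        fix k assume "k \<in> K"
        have "std_normal = distr (gauss K) std_normal (\<lambda>\<xi>. \<xi> k)"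
          using distr_PiM_component[of K "\<lambda>_. std_normal" k, OF prob_space_std_normal \<open>k \<in> K\<close>] by simp
        also have "\<dots> = distr (gauss K) borel (\<lambda>\<xi>. \<xi> k)" by (intro distr_cong) auto
        finally show "std_normal = distr (gauss K) borel (\<lambda>\<xi>. \<xi> k)" .
      qed
      finally show ?thesis .
    qed
    then have "indep_vars (\<lambda>_. borel) (\<lambda>k \<xi>. \<xi> k) K"
      by (intro indep_vars_iff_distr_eq_PiM'[THEN iffD2, OF \<open>K \<noteq> {}\<close>]) (auto intro: measurable_component_singleton)
    then have "indep_vars (\<lambda>_. borel) (\<lambda>k \<xi>. \<xi> k) J"
      using J(2) by (rule indep_vars_subset)
    then have "indep_vars (\<lambda>_. borel) (\<lambda>k \<xi>. x k * \<xi> k) J"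
      by (rule indep_vars_compose2[where Y = "\<lambda>k z. x k * z"]) measurable
    then have D: "distributed (gauss K) lborel (\<lambda>\<xi>. \<Sum>k\<in>J. x k * \<xi> k) (normal_density (\<Sum>k\<in>J. 0) (sqrt (\<Sum>k\<in>J. \<bar>x k\<bar>\<^sup>2)))"
      using J False dist' by (intro sum_indep_normal) (auto simp: J_def)
    define s where "s = sqrt (\<Sum>k\<in>J. (x k)\<^sup>2)"
    have "(\<Sum>k\<in>J. (x k)\<^sup>2) > 0" using J False by (intro sum_pos) (auto simp: J_def)
    then have s: "s > 0" by (simp add: s_def)
    have D: "distributed (gauss K) lborel (\<lambda>\<xi>. \<Sum>k\<in>J. x k * \<xi> k) (normal_density 0 s)"
      using D by (simp only: s_def sum.neutral_const power2_abs)
    interpret Z: prob_space std_normal by (rule prob_space_std_normal)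
    have "distributed std_normal lborel (\<lambda>z. z) std_normal_density"
      unfolding distributed_def by (auto intro!: distr_id2)
    from Z.normal_density_affine[OF this, of s 0] s
    have D': "distributed std_normal lborel (\<lambda>z. s * z) (normal_density 0 s)" by simp
    have fl: "f \<in> borel_measurable lborel" by simp
    show ?thesis
      unfolding sumJ sqJ s_def[symmetric]
      using distributed_nn_integral[OF D fl]
        distributed_nn_integral[OF D' fl] by (rule trans[OF sym])
  qed
qed

text \<open>
  A noise matrix is a family of independent noise rows; exponential moments of sums over rows
  factor accordingly.
\<close>

lemma gauss_rows:
  assumes fin: "finite I" "finite J" and [measurable]: "f \<in> borel_measurable (PiM (I \<times> J) (\<lambda>_. borel))"
  shows "(\<integral>\<^sup>+\<xi>. f \<xi> \<partial>gauss (I \<times> J)) = (\<integral>\<^sup>+\<omega>. f (\<lambda>ij\<in>I \<times> J. \<omega> (fst ij) (snd ij)) \<partial>PiM I (\<lambda>_. gauss J))"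
proof -
  interpret S: product_sigma_finite "\<lambda>_::'a \<times> 'b. std_normal" by (rule product_sigma_std_normal)
  interpret S1: product_sigma_finite "\<lambda>_::'b. std_normal" by (rule product_sigma_std_normal)
  interpret R: product_sigma_finite "\<lambda>_::'a. gauss J"
    by (intro product_sigma_finite.intro prob_space_imp_sigma_finite prob_space_gauss)
  define U where "U \<omega> = (\<lambda>ij\<in>I \<times> J. \<omega> (fst ij) (snd ij))" for \<omega> :: "'a \<Rightarrow> 'b \<Rightarrow> real"
  have U[measurable]: "U \<in> PiM I (\<lambda>_. gauss J) \<rightarrow>\<^sub>M gauss (I \<times> J)"
    unfolding U_def
  proof (rule measurable_restrict)
    fix ij assume "ij \<in> I \<times> J"
    then have ij: "fst ij \<in> I" "snd ij \<in> J" by auto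
    have "(\<lambda>\<omega>. \<omega> (fst ij)) \<in> PiM I (\<lambda>_. gauss J) \<rightarrow>\<^sub>M gauss J"
      using ij by (rule_tac measurable_component_singleton)
    moreover have "(\<lambda>x. x (snd ij)) \<in> gauss J \<rightarrow>\<^sub>M std_normal"
      using ij by (rule_tac measurable_component_singleton)
    ultimately show "(\<lambda>\<omega>. \<omega> (fst ij) (snd ij)) \<in> PiM I (\<lambda>_. gauss J) \<rightarrow>\<^sub>M std_normal"
      by (rule measurable_compose)
  qed
  have "distr (PiM I (\<lambda>_. gauss J)) (gauss (I \<times> J)) U = gauss (I \<times> J)"
  proof (rule S.PiM_eqI)
    fix A :: "'a \<times> 'b \<Rightarrow> real set" assume A: "\<And>ij. ij \<in> I \<times> J \<Longrightarrow> A ij \<in> sets std_normal"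
    have pre: "U -` (PiE (I \<times> J) A) \<inter> space (PiM I (\<lambda>_. gauss J)) = PiE I (\<lambda>i. PiE J (\<lambda>j. A (i, j)))"
      by (auto simp: U_def space_PiM PiE_iff extensional_def) 
    have "emeasure (distr (PiM I (\<lambda>_. gauss J)) (gauss (I \<times> J)) U) (PiE (I \<times> J) A)
       = emeasure (PiM I (\<lambda>_. gauss J)) (PiE I (\<lambda>i. PiE J (\<lambda>j. A (i, j))))"
      using A fin by (subst emeasure_distr) (auto simp: pre intro!: sets_PiM_I_finite)
    also have "\<dots> = (\<Prod>i\<in>I. \<Prod>j\<in>J. emeasure std_normal (A (i, j)))"
      using A fin by (subst R.emeasure_PiM) (auto intro!: sets_PiM_I_finite prod.cong S1.emeasure_PiM)
    also have "\<dots> = (\<Prod>ij\<in>I \<times> J. emeasure std_normal (A ij))"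
      by (simp add: prod.cartesian_product)
    finally show "emeasure (distr (PiM I (\<lambda>_. gauss J)) (gauss (I \<times> J)) U) (PiE (I \<times> J) A) =
       (\<Prod>ij\<in>I \<times> J. emeasure std_normal (A ij))" .
  qed (use fin in auto)
  then have "(\<integral>\<^sup>+\<xi>. f \<xi> \<partial>gauss (I \<times> J)) = (\<integral>\<^sup>+\<xi>. f \<xi> \<partial>distr (PiM I (\<lambda>_. gauss J)) (gauss (I \<times> J)) U)" by simp
  also have "\<dots> = (\<integral>\<^sup>+\<omega>. f (U \<omega>) \<partial>PiM I (\<lambda>_. gauss J))"
    by (rule nn_integral_distr) measurable
  finally show ?thesis unfolding U_def .
qed

lemma gauss_rows_prod:
  assumes fin: "finite I" "finite J"
    and h: "\<And>i. i \<in> I \<Longrightarrow> h i \<in> borel_measurable (PiM J (\<lambda>_. borel))"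
  shows "(\<integral>\<^sup>+\<xi>. (\<Prod>i\<in>I. h i (\<lambda>j\<in>J. \<xi> (i, j))) \<partial>gauss (I \<times> J)) = (\<Prod>i\<in>I. \<integral>\<^sup>+\<omega>. h i \<omega> \<partial>gauss J)"
proof -
  interpret R: product_sigma_finite "\<lambda>_::'a. gauss J"
    by (intro product_sigma_finite.intro prob_space_imp_sigma_finite prob_space_gauss)
  have "(\<integral>\<^sup>+\<xi>. (\<Prod>i\<in>I. h i (\<lambda>j\<in>J. \<xi> (i, j))) \<partial>gauss (I \<times> J)) =
     (\<integral>\<^sup>+\<omega>. (\<Prod>i\<in>I. h i (\<lambda>j\<in>J. (\<lambda>ij\<in>I \<times> J. \<omega> (fst ij) (snd ij)) (i, j))) \<partial>PiM I (\<lambda>_. gauss J))"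
  proof (rule gauss_rows[OF fin])
    show "(\<lambda>\<xi>. \<Prod>i\<in>I. h i (\<lambda>j\<in>J. \<xi> (i, j))) \<in> borel_measurable (PiM (I \<times> J) (\<lambda>_. borel))"
      by (intro borel_measurable_prod_ennreal measurable_compose[OF measurable_restrict h]) auto
  qed
  also have "\<dots> = (\<integral>\<^sup>+\<omega>. (\<Prod>i\<in>I. h i (\<omega> i)) \<partial>PiM I (\<lambda>_. gauss J))"
    by (intro nn_integral_cong prod.cong refl arg_cong[where f = "h _"])
      (auto simp: fun_eq_iff space_PiM PiE_iff extensional_def)
  also have "\<dots> = (\<Prod>i\<in>I. \<integral>\<^sup>+\<omega>. h i \<omega> \<partial>gauss J)"
  proof (intro R.product_nn_integral_prod fin)
    fix i assume "i \<in> I"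
    note [measurable] = h[OF this]
    show "h i \<in> borel_measurable (gauss J)" by measurable
  qed
  finally show ?thesis .
qed

section \<open>Quadratic forms\<close>

definition bilin :: "nat \<Rightarrow> (nat \<Rightarrow> nat \<Rightarrow> real) \<Rightarrow> (nat \<Rightarrow> real) \<Rightarrow> (nat \<Rightarrow> real) \<Rightarrow> real" where
  "bilin n A x y = (\<Sum>i<n. \<Sum>j<n. A i j * x i * y j)"

definition sqnorm :: "nat \<Rightarrow> (nat \<Rightarrow> real) \<Rightarrow> real" where
  "sqnorm n x = (\<Sum>i<n. (x i)\<^sup>2)"

lemma sqnorm_nonneg: "sqnorm n x \<ge> 0"
  by (simp add: sqnorm_def sum_nonneg)

lemma sqnorm_scale: "sqnorm n (\<lambda>i. c * x i) = c\<^sup>2 * sqnorm n x"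
  by (simp add: sqnorm_def sum_distrib_left power_mult_distrib)

lemma sqnorm_eq_0: "sqnorm n x = 0 \<longleftrightarrow> (\<forall>i<n. x i = 0)"
  by (auto simp: sqnorm_def sum_nonneg_eq_0_iff)

lemma bilin_add_left: "bilin n A (\<lambda>i. x i + y i) z = bilin n A x z + bilin n A y z"
  and bilin_add_right: "bilin n A z (\<lambda>i. x i + y i) = bilin n A z x + bilin n A z y"
  and bilin_diff_left: "bilin n A (\<lambda>i. x i - y i) z = bilin n A x z - bilin n A y z"
  and bilin_diff_right: "bilin n A z (\<lambda>i. x i - y i) = bilin n A z x - bilin n A z y"
  and bilin_scale_left: "bilin n A (\<lambda>i. c * x i) z = c * bilin n A x z"
  and bilin_scale_right: "bilin n A z (\<lambda>i. c * x i) = c * bilin n A z x"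
  by (simp_all add: bilin_def algebra_simps sum.distrib sum_subtractf sum_distrib_left)

lemma bilin_left: "bilin n A x y = (\<Sum>i<n. x i * (\<Sum>j<n. A i j * y j))"
  by (simp add: bilin_def sum_distrib_left mult_ac)

lemma bilin_commute:
  assumes "\<And>i j. i < n \<Longrightarrow> j < n \<Longrightarrow> A i j = A j i"
  shows "bilin n A x y = bilin n A y x"
proof -
  have "bilin n A x y = (\<Sum>j<n. \<Sum>i<n. A i j * x i * y j)"
    unfolding bilin_def by (rule sum.swap)
  also have "\<dots> = bilin n A y x"
    unfolding bilin_def using assms by (intro sum.cong) (auto simp: mult_ac)
  finally show ?thesis .
qed

text \<open>
  Polarisation, \<open>4 B(x,y) = Q(x+y) - Q(x-y)\<close>, and the parallelogram law.
\<close>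

lemma bilin_le_of_quadratic:
  assumes sym: "\<And>i j. i < n \<Longrightarrow> j < n \<Longrightarrow> A i j = A j i"
    and Q: "\<And>x. \<bar>bilin n A x x\<bar> \<le> M * sqnorm n x"
  shows "\<bar>bilin n A x y\<bar> \<le> M * (sqnorm n x + sqnorm n y) / 2"
proof -
  have "4 * bilin n A x y = bilin n A (\<lambda>i. x i + y i) (\<lambda>i. x i + y i) - bilin n A (\<lambda>i. x i - y i) (\<lambda>i. x i - y i)"
    using bilin_commute[OF sym, where x = x and y = y]
    by (simp add: bilin_add_left bilin_add_right bilin_diff_left bilin_diff_right)
  also have "\<bar>\<dots>\<bar> \<le> M * sqnorm n (\<lambda>i. x i + y i) + M * sqnorm n (\<lambda>i. x i - y i)"
    using Q[of "\<lambda>i. x i + y i"] Q[of "\<lambda>i. x i - y i"] by linarith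
  also have "\<dots> = 2 * M * (sqnorm n x + sqnorm n y)"
    by (simp add: sqnorm_def power2_eq_square algebra_simps sum.distrib sum_subtractf)
  finally show ?thesis by simp
qed

lemma bilin_crude: "\<bar>bilin n A x x\<bar> \<le> (\<Sum>i<n. \<Sum>j<n. \<bar>A i j\<bar>) * sqnorm n x"
proof -
  have "\<bar>bilin n A x x\<bar> \<le> (\<Sum>i<n. \<Sum>j<n. \<bar>A i j * x i * x j\<bar>)"
    unfolding bilin_def by (intro order_trans[OF sum_abs] sum_mono sum_abs)
  also have "\<dots> \<le> (\<Sum>i<n. \<Sum>j<n. \<bar>A i j\<bar> * sqnorm n x)"
  proof (intro sum_mono)
    fix i j assume ij: "i \<in> {..<n}" "j \<in> {..<n}"
    have "(x i)\<^sup>2 \<le> sqnorm n x" "(x j)\<^sup>2 \<le> sqnorm n x"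
      unfolding sqnorm_def using ij by (auto intro!: member_le_sum)
    moreover have "2 * (\<bar>x i\<bar> * \<bar>x j\<bar>) \<le> (x i)\<^sup>2 + (x j)\<^sup>2"
      using sum_squares_bound[of "\<bar>x i\<bar>" "\<bar>x j\<bar>"] by (simp add: mult_ac)
    ultimately have "\<bar>x i\<bar> * \<bar>x j\<bar> \<le> sqnorm n x" by linarith
    then show "\<bar>A i j * x i * x j\<bar> \<le> \<bar>A i j\<bar> * sqnorm n x"
      by (simp add: abs_mult mult_left_mono mult.assoc)
  qed
  finally show ?thesis by (simp add: sum_distrib_right)
qed

text \<open>
  At scale \<open>4\<surd>n\<close> a sphere contains enough integer points: rounding moves a
  vector of norm \<open>4\<surd>n\<close> by at most \<open>\<surd>n\<close>, so these points act
  as a net of mesh \<open>1/4\<close> for the unit sphere.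
\<close>

definition int_net :: "nat \<Rightarrow> (nat \<Rightarrow> int) set" where
  "int_net n = {z \<in> {..<n} \<rightarrow>\<^sub>E UNIV. sqnorm n (\<lambda>i. real_of_int (z i)) \<le> 16 * real n}"

text \<open>
  Any bound \<open>M\<close> for the form on the unit sphere can be improved to \<open>t + 9/16
  M\<close>: scale \<open>x\<close> to norm \<open>4\<surd>n\<close>, round it, and use
  \<open>M\<close> only for the rounding error. Iterating from a crude bound leads to the fixed
  point \<open>16/7 t\<close>.
\<close>

lemma quadratic_bound_from_net:
  assumes sym: "\<And>i j. i < n \<Longrightarrow> j < n \<Longrightarrow> A i j = A j i" and "n > 0" and t: "t \<ge> 0"
    and net: "\<And>z. z \<in> int_net n \<Longrightarrow>
      \<bar>bilin n A (\<lambda>i. real_of_int (z i)) (\<lambda>i. real_of_int (z i))\<bar> \<le> 16 * real n * t"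
  shows "\<bar>bilin n A x x\<bar> \<le> 3 * t * sqnorm n x"
proof -
  define Q where "Q x = bilin n A x x" for x
  have improve: "\<bar>Q x\<bar> \<le> (t + 9/16 * M) * sqnorm n x"
    if M: "M \<ge> 0" "\<And>x. \<bar>Q x\<bar> \<le> M * sqnorm n x" for M x
  proof (cases "sqnorm n x = 0")
    case True
    then show ?thesis using M(2)[of x] by simp
  next
    case False
    then have pos: "sqnorm n x > 0" using sqnorm_nonneg[of n x] by simp
    define c where "c = sqrt (16 * real n / sqnorm n x)"
    have c2: "c\<^sup>2 * sqnorm n x = 16 * real n" using pos by (simp add: c_def)
    define y where "y = (\<lambda>i. c * x i)"
    \<comment> \<open>rounding towards 0 keeps the norm at most \<open>4\<surd>n\<close>, so that the rounded
        vector is in the net\<close>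
    define z where "z = (\<lambda>i\<in>{..<n}. (if y i \<ge> 0 then \<lfloor>y i\<rfloor> else - \<lfloor>- y i\<rfloor>))"
    define w where "w = (\<lambda>i. real_of_int (z i))"
    define e where "e = (\<lambda>i. y i - w i)"
    have w: "\<bar>w i\<bar> \<le> \<bar>y i\<bar>" "\<bar>e i\<bar> \<le> 1" if "i < n" for i
    proof -
      show "\<bar>w i\<bar> \<le> \<bar>y i\<bar>" "\<bar>e i\<bar> \<le> 1"
        using that unfolding w_def e_def z_def by (auto split: if_splits) linarith+
    qed
    have sy: "sqnorm n y = 16 * real n" unfolding y_def sqnorm_scale c2 ..
    have "sqnorm n w \<le> sqnorm n y"
      unfolding sqnorm_def using w by (intro sum_mono) (auto simp: abs_le_square_iff)
    then have "z \<in> int_net n" unfolding sy int_net_def w_def by (auto simp: z_def)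
    then have Qw: "\<bar>Q w\<bar> \<le> 16 * real n * t" unfolding Q_def w_def by (rule net)
    have "sqnorm n e \<le> (\<Sum>i<n. 1)"
      unfolding sqnorm_def using w by (intro sum_mono) (auto simp: abs_square_le_1)
    then have se: "sqnorm n e \<le> real n" by simp
    have "Q y = Q (\<lambda>i. w i + e i)" by (simp add: Q_def e_def)
    have Qy: "Q w = Q y - 2 * bilin n A e y + Q e"
    proof -
      have w': "w = (\<lambda>i. y i - e i)" by (simp add: e_def)
      show ?thesis unfolding Q_def w'
        using bilin_commute[OF sym, where x = e and y = y] by (simp add: bilin_diff_left bilin_diff_right)
    qed
    \<comment> \<open>the factor 4 makes both arguments equally long, which is optimal in the polarisation bound\<close>
    have "\<bar>bilin n A (\<lambda>i. 4 * e i) y\<bar> \<le> M * (sqnorm n (\<lambda>i. 4 * e i) + sqnorm n y) / 2"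
      using M(2) unfolding Q_def by (intro bilin_le_of_quadratic sym)
    also have "\<dots> \<le> M * (16 * real n + 16 * real n) / 2"
      using M(1) se by (intro divide_right_mono mult_left_mono) (auto simp: sqnorm_scale sy)
    finally have ey: "\<bar>bilin n A e y\<bar> \<le> 4 * real n * M" by (simp add: bilin_scale_left abs_mult mult.commute[of M])
    have "\<bar>Q e\<bar> \<le> M * real n" using M(2)[of e] mult_left_mono[OF se M(1)] by simp
    then have "\<bar>Q y\<bar> \<le> 16 * real n * t + 8 * real n * M + real n * M"
      using Qw Qy ey by (simp add: mult.commute)
    also have "\<dots> = (t + 9/16 * M) * (16 * real n)" by (simp add: algebra_simps)
    also have "Q y = c\<^sup>2 * Q x" by (simp add: Q_def y_def bilin_scale_left bilin_scale_right power2_eq_square)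
    finally have "c\<^sup>2 * \<bar>Q x\<bar> \<le> (t + 9/16 * M) * (c\<^sup>2 * sqnorm n x)"
      by (simp add: c2 abs_mult)
    moreover have "c\<^sup>2 > 0" using pos \<open>n > 0\<close> by (simp add: c_def)
    ultimately show ?thesis by (simp add: mult.left_commute)
  qed
  define M where "M = (\<Sum>i<n. \<Sum>j<n. \<bar>A i j\<bar>)"
  have M0: "M \<ge> 0" by (simp add: M_def sum_nonneg)
  have iter: "\<bar>Q x\<bar> \<le> (16/7 * t + (9/16) ^ k * M) * sqnorm n x" for k x
  proof (induction k arbitrary: x)
    case 0
    have "M * sqnorm n x \<le> (16/7 * t + M) * sqnorm n x"
      using t sqnorm_nonneg[of n x] by (intro mult_right_mono) auto
    then show ?case using bilin_crude[of n A x] unfolding Q_def M_def by simp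
  next
    case (Suc k)
    have "\<bar>Q x\<bar> \<le> (t + 9/16 * (16/7 * t + (9/16) ^ k * M)) * sqnorm n x"
      using t M0 Suc by (intro improve) auto
    then show ?case by (simp add: algebra_simps)
  qed
  have "(\<lambda>k. (16/7 * t + (9/16) ^ k * M) * sqnorm n x) \<longlonglongrightarrow> (16/7 * t + 0 * M) * sqnorm n x"
    by (intro tendsto_intros LIMSEQ_power_zero) auto
  then have "\<bar>Q x\<bar> \<le> (16/7 * t + 0 * M) * sqnorm n x"
    using iter by (intro LIMSEQ_le_const) auto
  also have "\<dots> \<le> 3 * t * sqnorm n x"
    using t sqnorm_nonneg[of n x] by (intro mult_right_mono) auto
  finally show ?thesis unfolding Q_def .
qed

lemma int_net_bound: "z \<in> int_net n \<Longrightarrow> i < n \<Longrightarrow> \<bar>z i\<bar> \<le> 16 * int n"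
proof -
  assume z: "z \<in> int_net n" and i: "i < n"
  have "(real_of_int (z i))\<^sup>2 \<le> sqnorm n (\<lambda>i. real_of_int (z i))"
    unfolding sqnorm_def using i by (intro member_le_sum) auto
  also have "\<dots> \<le> 16 * real n" using z by (simp add: int_net_def)
  finally have "real_of_int ((z i)\<^sup>2) \<le> real_of_int (16 * int n)" by simp
  then have "(z i)\<^sup>2 \<le> 16 * int n" by linarith
  moreover have "\<bar>z i\<bar> \<le> (z i)\<^sup>2"
    using self_le_power[of "\<bar>z i\<bar>" 2] by (cases "z i = 0") auto
  ultimately show ?thesis by linarith
qed

text \<open>
  Counting by weights: the weight \<open>2\<^bsup>16-|k|\<^esup>\<close> per coordinate makes the
  product weight of every net point at least 1, since \<open>\<Sum>|z\<^sub>i| \<le> \<Sum>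
  z\<^sub>i\<^sup>2 \<le> 16 n\<close>, while the total weight of one coordinate is at most
  \<open>3\<cdot>2\<^sup>1\<^sup>6\<close>.
\<close>

lemma finite_int_net: "finite (int_net n)"
  and card_int_net: "real (card (int_net n)) \<le> 2 ^ (18 * n)"
proof -
  define B where "B = {- (16 * int n)..16 * int n}"
  have sub: "int_net n \<subseteq> PiE {..<n} (\<lambda>_. B)"
  proof
    fix z assume z: "z \<in> int_net n"
    have "z i \<in> B" if "i < n" for i using int_net_bound[OF z that] unfolding B_def by auto
    then show "z \<in> PiE {..<n} (\<lambda>_. B)" using z by (auto simp: int_net_def PiE_iff)
  qed
  have finB: "finite (PiE {..<n} (\<lambda>_. B))" by (intro finite_PiE) (auto simp: B_def)
  show fin: "finite (int_net n)" using sub finB by (rule finite_subset)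
  define g :: "int \<Rightarrow> real" where "g k = 2 ^ 16 * (1/2) ^ nat \<bar>k\<bar>" for k
  have g1: "1 \<le> (\<Prod>i<n. g (z i))" if z: "z \<in> int_net n" for z
  proof -
    have "(\<Sum>i<n. real (nat \<bar>z i\<bar>)) \<le> sqnorm n (\<lambda>i. real_of_int (z i))"
      unfolding sqnorm_def
    proof (intro sum_mono)
      fix i
      have "\<bar>z i\<bar> \<le> (z i)\<^sup>2" using self_le_power[of "\<bar>z i\<bar>" 2] by (cases "z i = 0") auto
      then have "real_of_int \<bar>z i\<bar> \<le> real_of_int ((z i)\<^sup>2)" by (simp only: of_int_le_iff)
      then show "real (nat \<bar>z i\<bar>) \<le> (real_of_int (z i))\<^sup>2" by simp
    qed
    also have "\<dots> \<le> 16 * real n" using z by (simp add: int_net_def)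
    finally have "real (\<Sum>i<n. nat \<bar>z i\<bar>) \<le> real (16 * n)" by simp
    then have le: "(\<Sum>i<n. nat \<bar>z i\<bar>) \<le> 16 * n" by (simp only: of_nat_le_iff)
    have "(\<Prod>i<n. g (z i)) = (2 ^ 16) ^ n * (1/2) ^ (\<Sum>i<n. nat \<bar>z i\<bar>)"
      by (simp add: g_def prod.distrib power_sum del: power_one_over)
    moreover have "(2 ^ 16) ^ n * (1/2) ^ (16 * n) \<le> (2 ^ 16) ^ n * (1/2 :: real) ^ (\<Sum>i<n. nat \<bar>z i\<bar>)"
      by (rule mult_left_mono[OF power_decreasing[OF le]]) simp_all
    moreover have "((2 ^ 16) ^ n * (1/2) ^ (16 * n) :: real) = (2 ^ 16 * (1/2) ^ 16) ^ n"
      unfolding power_mult power_mult_distrib ..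
    moreover have "(2 ^ 16 * (1/2) ^ 16 :: real) = 1" by (simp add: power_divide)
    ultimately show ?thesis by (simp only: power_one)
  qed
  have half: "(\<Sum>k\<in>{- int N..int N}. (1/2::real) ^ nat \<bar>k\<bar>) \<le> 3" for N
  proof -
    have "(\<Sum>k\<in>{- int N..int N}. (1/2::real) ^ nat \<bar>k\<bar>) = 3 - 2 * (1/2) ^ N"
    proof (induction N)
      case (Suc N)
      have "{- int (Suc N)..int (Suc N)} = insert (- int (Suc N)) (insert (int (Suc N)) {- int N..int N})"
        by auto
      then show ?case using Suc by (simp add: nat_add_distrib del: power_one_over)
    qed simp
    then show ?thesis by simp
  qed
  have "real (card (int_net n)) = (\<Sum>z\<in>int_net n. 1)" by simp
  also have "\<dots> \<le> (\<Sum>z\<in>int_net n. \<Prod>i<n. g (z i))" using g1 by (rule sum_mono)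
  also have "\<dots> \<le> (\<Sum>z\<in>PiE {..<n} (\<lambda>_. B). \<Prod>i<n. g (z i))"
    using sub finB by (intro sum_mono2) (auto simp: g_def intro!: prod_nonneg)
  also have "\<dots> = (\<Prod>i<n. \<Sum>k\<in>B. g k)"
    by (subst prod_sum_PiE) (auto simp: B_def)
  also have "\<dots> \<le> (\<Prod>i<n. 2 ^ 18)"
  proof (intro prod_mono conjI)
    have "(\<Sum>k\<in>B. g k) \<le> 2 ^ 16 * 3"
      using half[of "16 * n"] by (simp add: g_def B_def flip: sum_distrib_left)
    then show "(\<Sum>k\<in>B. g k) \<le> 2 ^ 18" by simp
  qed (auto simp: g_def intro!: sum_nonneg)
  also have "\<dots> = 2 ^ (18 * n)" by (simp add: power_mult)
  finally show "real (card (int_net n)) \<le> 2 ^ (18 * n)" .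
qed

text \<open>
  Let \<open>M\<close> be the supremum of the Rayleigh quotient. If \<open>M\<close> were not an
  eigenvalue, then \<open>b = M I - A\<close> would be invertible and positive semidefinite. For
  such \<open>b\<close> the form is bounded below by a multiple of \<open>|b x|\<^sup>2\<close>,
  hence of \<open>|x|\<^sup>2\<close>, and the quotient would stay away from \<open>M\<close>. So
  \<open>M\<close> is an eigenvalue.
\<close>

lemma rayleigh_le_top_eigenvalue:
  fixes A :: "real mat"
  assumes A: "A \<in> carrier_mat n n"
    and sym: "\<And>i j. i < n \<Longrightarrow> j < n \<Longrightarrow> A $$ (i, j) = A $$ (j, i)"
    and top: "\<And>m. eigenvalue A m \<Longrightarrow> m \<le> l"
  shows "bilin n (\<lambda>i j. A $$ (i, j)) x x \<le> l * sqnorm n x"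
proof -
  define a where "a i j = A $$ (i, j)" for i j
  define S where "S = {bilin n a x x | x. sqnorm n x = 1}"
  have bdd: "bdd_above S"
  proof (rule bdd_aboveI)
    fix q assume "q \<in> S"
    then obtain x where x: "q = bilin n a x x" "sqnorm n x = 1" by (auto simp: S_def)
    show "q \<le> (\<Sum>i<n. \<Sum>j<n. \<bar>a i j\<bar>)" using bilin_crude[of n a x] x by simp
  qed
  define M where "M = Sup S"
  have QM: "bilin n a x x \<le> M * sqnorm n x" for x
  proof (cases "sqnorm n x = 0")
    case True
    then show ?thesis using bilin_crude[of n a x] by simp
  next
    case False
    then have pos: "sqnorm n x > 0" using sqnorm_nonneg[of n x] by simp
    define c where "c = 1 / sqrt (sqnorm n x)"
    have c: "c\<^sup>2 * sqnorm n x = 1" "c\<^sup>2 > 0" using pos by (auto simp: c_def power_divide)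
    have "bilin n a (\<lambda>i. c * x i) (\<lambda>i. c * x i) \<in> S"
      unfolding S_def using c by (auto simp: sqnorm_scale)
    then have "c\<^sup>2 * bilin n a x x \<le> M"
      unfolding M_def using bdd by (auto dest: cSup_upper simp: bilin_scale_left bilin_scale_right power2_eq_square mult.assoc)
    then have "c\<^sup>2 * bilin n a x x \<le> c\<^sup>2 * (M * sqnorm n x)" using c(1) by (simp add: mult.left_commute)
    then show ?thesis using c(2) by simp
  qed
  have "M \<le> l \<or> sqnorm n x = 0"
  proof (rule ccontr)
    assume neg: "\<not> (M \<le> l \<or> sqnorm n x = 0)"
    then have "\<not> eigenvalue A M" using top by force
    then have "det (char_matrix A M) \<noteq> 0" using eigenvalue_det[OF A] by simp
    from det_non_zero_imp_unit[OF char_matrix_closed[OF A] this, of "()"]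
    obtain C where C: "C \<in> carrier_mat n n" "C * char_matrix A M = 1\<^sub>m n"
      by (auto simp: Units_def ring_mat_def)
    define b where "b i j = M * (if i = j then 1 else 0) - a i j" for i j
    have symb: "b i j = b j i" if "i < n" "j < n" for i j
      using sym[OF that] by (simp add: b_def a_def)
    have inv: "(\<Sum>k<n. - C $$ (i, k) * b k j) = (if i = j then 1 else 0)" if ij: "i < n" "j < n" for i j
    proof -
      have "(C * char_matrix A M) $$ (i, j) = (\<Sum>k<n. C $$ (i, k) * char_matrix A M $$ (k, j))"
        using ij C(1) A by (simp add: scalar_prod_def atLeast0LessThan char_matrix_def)
      also have "\<dots> = (\<Sum>k<n. - C $$ (i, k) * b k j)"
        using ij A by (intro sum.cong refl) (auto simp: char_matrix_def b_def a_def algebra_simps)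
      finally show ?thesis using C(2) ij by simp
    qed
    define Bx where "Bx x i = (\<Sum>j<n. b i j * x j)" for x i
    \<comment> \<open>the squared Frobenius norm of the inverse, which bounds its operator norm\<close>
    define KC where "KC = (\<Sum>i<n. \<Sum>j<n. (C $$ (i, j))\<^sup>2)"
    have KC: "KC \<ge> 0" by (simp add: KC_def sum_nonneg)
    have invx: "sqnorm n x \<le> KC * sqnorm n (Bx x)" for x
    proof -
      have "x i = (\<Sum>k<n. - C $$ (i, k) * Bx x k)" if "i < n" for i
      proof -
        have "(\<Sum>k<n. - C $$ (i, k) * Bx x k) = (\<Sum>k<n. \<Sum>j<n. - C $$ (i, k) * b k j * x j)"
          by (simp add: Bx_def sum_distrib_left mult.assoc)
        also have "\<dots> = (\<Sum>j<n. (\<Sum>k<n. - C $$ (i, k) * b k j) * x j)"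
          by (subst sum.swap) (simp add: sum_distrib_right)
        also have "\<dots> = (\<Sum>j<n. (if i = j then 1 else 0) * x j)"
          using inv that by (intro sum.cong) auto
        also have "\<dots> = x i" using that by (simp add: if_distrib[of "\<lambda>t. t * _"] cong: if_cong)
        finally show ?thesis by simp
      qed
      then have "sqnorm n x = (\<Sum>i<n. (\<Sum>k<n. - C $$ (i, k) * Bx x k)\<^sup>2)"
        unfolding sqnorm_def by (intro sum.cong) auto
      also have "\<dots> \<le> (\<Sum>i<n. (\<Sum>k<n. (- C $$ (i, k))\<^sup>2) * (\<Sum>k<n. (Bx x k)\<^sup>2))"
        by (intro sum_mono Cauchy_Schwarz_ineq_sum)
      finally show ?thesis by (simp add: KC_def sqnorm_def sum_distrib_right)
    qed
    define KB where "KB = 1 + (\<Sum>i<n. \<Sum>j<n. \<bar>b i j\<bar>)"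
    have KB: "KB > 0" by (simp add: KB_def add_pos_nonneg sum_nonneg)
    have bq: "bilin n b x x = M * sqnorm n x - bilin n a x x" for x
    proof -
      have "bilin n b x x = (\<Sum>i<n. \<Sum>j<n. (if i = j then M * x i * x j else 0) - a i j * x i * x j)"
        unfolding bilin_def b_def by (intro sum.cong refl) (simp add: algebra_simps)
      also have "\<dots> = M * sqnorm n x - bilin n a x x"
        by (simp add: sum_subtractf bilin_def sqnorm_def sum_distrib_left power2_eq_square mult.assoc)
      finally show ?thesis .
    qed
    \<comment> \<open>a positive semidefinite form is nonnegative at \<open>x - t b x\<close>; with
        \<open>t\<close> the inverse of a bound for the form this gives \<open>t |b x|\<^sup>2
        \<le> x\<^sup>T b x\<close>\<close>
    have psd: "sqnorm n (Bx x) \<le> KB * bilin n b x x" for x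
    proof -
      define t where "t = 1 / KB"
      have t: "t > 0" "t * KB = 1" using KB by (auto simp: t_def)
      have xB: "bilin n b (Bx x) x = sqnorm n (Bx x)"
        by (simp add: bilin_left sqnorm_def Bx_def power2_eq_square)
      have "0 \<le> bilin n b (\<lambda>i. x i - t * Bx x i) (\<lambda>i. x i - t * Bx x i)"
        unfolding bq using QM[of "\<lambda>i. x i - t * Bx x i"] by simp
      also have "\<dots> = bilin n b x x - 2 * t * sqnorm n (Bx x) + t * (t * bilin n b (Bx x) (Bx x))"
        using bilin_commute[OF symb, where x = x and y = "Bx x"] xB
        by (simp add: bilin_diff_left bilin_diff_right bilin_scale_left bilin_scale_right algebra_simps)
      also have "t * bilin n b (Bx x) (Bx x) \<le> t * (KB * sqnorm n (Bx x))"
        using bilin_crude[of n b "Bx x"] t sqnorm_nonneg[of n "Bx x"]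
        by (intro mult_left_mono) (auto simp: KB_def algebra_simps)
      finally have "0 \<le> bilin n b x x - 2 * t * sqnorm n (Bx x) + t * (t * (KB * sqnorm n (Bx x)))"
        using t by (simp add: mult_left_mono)
      moreover have "t * (KB * sqnorm n (Bx x)) = sqnorm n (Bx x)"
        by (simp only: mult.assoc[symmetric] t(2) mult_1_left)
      ultimately have "t * sqnorm n (Bx x) \<le> bilin n b x x" by simp
      then have "KB * (t * sqnorm n (Bx x)) \<le> KB * bilin n b x x" using KB by (intro mult_left_mono) auto
      then show ?thesis using t by (simp add: mult.assoc[symmetric] mult.commute[of KB])
    qed
    define D where "D = 1 / (KC * KB + 1)"
    have D: "D > 0" using KC KB by (simp add: D_def add_nonneg_pos)
    have "q \<le> M - D" if q: "q \<in> S" for q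
    proof -
      obtain y where y: "q = bilin n a y y" "sqnorm n y = 1" using q by (auto simp: S_def)
      have "1 \<le> KC * (KB * bilin n b y y)"
        using order_trans[OF invx[of y] mult_left_mono[OF psd[of y] KC]] y by simp
      moreover have "bilin n b y y \<ge> 0" using bq[of y] QM[of y] by simp
      ultimately have "1 \<le> (KC * KB + 1) * bilin n b y y" by (simp add: algebra_simps)
      then have "D \<le> bilin n b y y" using KC KB
        by (simp add: D_def divide_le_eq mult.commute add_nonneg_pos)
      then show ?thesis using bq[of y] y by simp
    qed
    moreover have "S \<noteq> {}"
    proof -
      define c where "c = 1 / sqrt (sqnorm n x)"
      have "sqnorm n x > 0" using neg sqnorm_nonneg[of n x] by simp
      then have "c\<^sup>2 * sqnorm n x = 1" by (auto simp: c_def power_divide)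
      then have "sqnorm n (\<lambda>i. c * x i) = 1" by (simp add: sqnorm_scale)
      then show ?thesis by (auto simp: S_def)
    qed
    ultimately have "M \<le> M - D" unfolding M_def by (intro cSup_least) auto
    then show False using D by simp
  qed
  moreover have "a = (\<lambda>i j. A $$ (i, j))" by (simp add: a_def fun_eq_iff)
  ultimately show ?thesis
    using QM[of x] mult_right_mono[OF _ sqnorm_nonneg, of M l n x] by auto
qed

section \<open>Sign iteration with planted labels\<close>

text \<open>
  The sign iteration for a matrix and a starting vector given as functions, in which all estimates
  are carried out.
\<close>

primrec label_iterate ::
  "real \<Rightarrow> nat \<Rightarrow> (nat \<Rightarrow> nat \<Rightarrow> real) \<Rightarrow> (nat \<Rightarrow> real) \<Rightarrow> nat \<Rightarrow> nat \<Rightarrow> real" where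
  "label_iterate s n a v 0 = (\<lambda>i. sign_with s (v i))"
| "label_iterate s n a v (Suc k) = (\<lambda>i. sign_with s (\<Sum>j<n. a i j * label_iterate s n a v k j))"

lemma sign_with_label: "s \<in> {-1, 1} \<Longrightarrow> sign_with s x \<in> {-1, 1}"
  by (auto simp: sign_with_def sgn_real_def)

lemma label_iterate_label:
  assumes s: "s \<in> {-1, 1}"
  shows "label_iterate s n a v k i \<in> {-1, 1}"
proof (cases k)
  case 0
  then show ?thesis using sign_with_label[OF s, of "v i"] by (simp only: label_iterate.simps(1))
next
  case (Suc m)
  then show ?thesis using sign_with_label[OF s] by (simp only: label_iterate.simps(2))
qed

lemma sign_iterate_eq_label_iterate:
  assumes A: "A \<in> carrier_mat n n" and v: "v \<in> carrier_vec n"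
  shows "sign_iterate s A v k \<in> carrier_vec n \<and> (\<forall>i<n. vec_index (sign_iterate s A v k) i =
      label_iterate s n (\<lambda>i j. A $$ (i, j)) (\<lambda>i. vec_index v i) k i)"
proof (induction k)
  case 0
  show ?case
  proof (intro conjI allI impI)
    show "sign_iterate s A v 0 \<in> carrier_vec n" using v unfolding sign_iterate.simps by (rule map_carrier_vec[THEN iffD2])
    fix i assume "i < n"
    then show "vec_index (sign_iterate s A v 0) i = label_iterate s n (\<lambda>i j. A $$ (i, j)) (\<lambda>i. vec_index v i) 0 i"
      using v by (simp only: sign_iterate.simps label_iterate.simps index_map_vec carrier_vecD)
  qed
next
  case (Suc k)
  define w where "w = sign_iterate s A v k"
  have w: "w \<in> carrier_vec n" and
    wi: "\<And>i. i < n \<Longrightarrow> vec_index w i = label_iterate s n (\<lambda>i j. A $$ (i, j)) (\<lambda>i. vec_index v i) k i"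
    using Suc unfolding w_def by blast+
  have Aw: "A *\<^sub>v w \<in> carrier_vec n" using A by (rule mult_mat_vec_carrier[OF _ w])
  have it: "sign_iterate s A v (Suc k) = map_vec (sign_with s) (A *\<^sub>v w)" by (simp add: w_def)
  show ?case unfolding it
  proof (intro conjI allI impI)
    show "map_vec (sign_with s) (A *\<^sub>v w) \<in> carrier_vec n" using Aw by simp
    fix i assume i: "i < n"
    have "vec_index (A *\<^sub>v w) i = (\<Sum>j<n. A $$ (i, j) * vec_index w j)"
      using A i w by (auto simp: scalar_prod_def atLeast0LessThan)
    also have "\<dots> = (\<Sum>j<n. A $$ (i, j) * label_iterate s n (\<lambda>i j. A $$ (i, j)) (\<lambda>i. vec_index v i) k j)"
      using wi by (intro sum.cong) auto
    finally show "vec_index (map_vec (sign_with s) (A *\<^sub>v w)) i =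
        label_iterate s n (\<lambda>i j. A $$ (i, j)) (\<lambda>i. vec_index v i) (Suc k) i"
      using i by (simp only: label_iterate.simps index_map_vec(1) carrier_vecD[OF Aw])
  qed
qed

definition errors :: "nat \<Rightarrow> (nat \<Rightarrow> real) \<Rightarrow> (nat \<Rightarrow> real) \<Rightarrow> nat" where
  "errors n x \<eta> = card {i. i < n \<and> x i \<noteq> \<eta> i}"

lemma errors_le: "errors n x \<eta> \<le> n"
  using card_mono[of "{..<n}" "{i. i < n \<and> x i \<noteq> \<eta> i}"] by (auto simp: errors_def)

lemma label_distance_sum:
  assumes "\<And>i. i < n \<Longrightarrow> x i \<in> {-1, 1}" "\<And>i. i < n \<Longrightarrow> y i \<in> {-1, 1}"
  shows "(\<Sum>i<n. \<bar>x i - y i\<bar>) = 2 * real (errors n x y)"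
proof -
  have "(\<Sum>i<n. \<bar>x i - y i\<bar>) = (\<Sum>i<n. if x i \<noteq> y i then 2 else 0)"
    using assms by (intro sum.cong) fastforce+
  also have "\<dots> = 2 * real (errors n x y)"
    by (simp add: errors_def sum.If_cases Int_def)
  finally show ?thesis .
qed

text \<open>
  Changing the global sign turns the \<open>N\<close> wrong labels into \<open>n - N\<close>.
\<close>

lemma loss_eq_errors:
  assumes "\<And>i. i < n \<Longrightarrow> x i \<in> {-1, 1}" "\<And>i. i < n \<Longrightarrow> \<eta> i \<in> {-1, 1}"
  shows "loss n x \<eta> = 2 * min (real (errors n x \<eta>)) (real n - real (errors n x \<eta>))"
proof -
  have "errors n x (\<lambda>i. - \<eta> i) = card ({..<n} - {i. i < n \<and> x i \<noteq> \<eta> i})"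
    unfolding errors_def using assms by (intro arg_cong[where f = card]) fastforce
  also have "\<dots> = n - errors n x \<eta>"
    unfolding errors_def by (subst card_Diff_subset) auto
  finally have neg: "real (errors n x (\<lambda>i. - \<eta> i)) = real n - real (errors n x \<eta>)"
    using errors_le[of n x \<eta>] by simp
  have "loss n x \<eta> = min (\<Sum>j<n. \<bar>x j - - \<eta> j\<bar>) (\<Sum>j<n. \<bar>x j - \<eta> j\<bar>)"
    unfolding loss_def by simp
  also have "\<dots> = min (2 * real (errors n x (\<lambda>i. - \<eta> i))) (2 * real (errors n x \<eta>))"
    using assms by (subst (1 2) label_distance_sum) fastforce+
  finally show ?thesis using neg by (simp add: min_def)
qed

lemma loss_le_n:
  assumes "\<And>i. i < n \<Longrightarrow> x i \<in> {-1, 1}" "\<And>i. i < n \<Longrightarrow> \<eta> i \<in> {-1, 1}"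
  shows "loss n x \<eta> \<le> real n"
  using loss_eq_errors[OF assms] by (simp add: min_def)

lemma loss_nonneg: "loss n x \<eta> \<ge> 0"
  unfolding loss_def by (subst Min_ge_iff) (auto simp: sum_nonneg)

lemma loss_le_errors:
  assumes "\<And>i. i < n \<Longrightarrow> x i \<in> {-1, 1}" "\<And>i. i < n \<Longrightarrow> \<eta> i \<in> {-1, 1}" and \<nu>: "\<nu> \<in> {-1, 1}"
  shows "loss n x \<eta> \<le> 2 * real (errors n x (\<lambda>i. \<nu> * \<eta> i))"
proof -
  have "loss n x \<eta> \<le> (\<Sum>j<n. \<bar>x j - \<nu> * \<eta> j\<bar>)"
    unfolding loss_def using \<nu> by (intro Min_le) auto
  also have "\<dots> = 2 * real (errors n x (\<lambda>i. \<nu> * \<eta> i))"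
    using assms by (intro label_distance_sum) fastforce+
  finally show ?thesis .
qed

text \<open>
  The number of labels that a sign step started at the true labels would get wrong, or right only
  with margin below \<open>c\<close>.
\<close>

definition low_margin :: "nat \<Rightarrow> (nat \<Rightarrow> nat \<Rightarrow> real) \<Rightarrow> (nat \<Rightarrow> real) \<Rightarrow> real \<Rightarrow> nat" where
  "low_margin n a \<eta> c = card {i. i < n \<and> \<eta> i * (\<Sum>j<n. a i j * \<eta> j) \<le> c}"

text \<open>
  The noise part of a matrix with signal part \<open>\<tau>(\<eta>\<eta>\<^sup>T - I)\<close>. The
  diagonal is removed because a hollow matrix is to be approximated.
\<close>

definition deviation :: "(nat \<Rightarrow> nat \<Rightarrow> real) \<Rightarrow> (nat \<Rightarrow> real) \<Rightarrow> real \<Rightarrow> nat \<Rightarrow> nat \<Rightarrow> real" where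
  "deviation a \<eta> \<tau> i j = a i j - \<tau> * (\<eta> i * \<eta> j - (if i = j then 1 else 0))"

text \<open>
  A symmetric matrix that is close in operator norm to the signal
  \<open>\<tau>\<eta>\<eta>\<^sup>T\<close> of norm \<open>n\<tau>\<close>. The tolerance
  \<open>\<beta>/16\<close> is small enough for the threshold \<open>\<beta> n \<tau>\<close> on
  margins to dominate the effect of up to \<open>\<beta> n/4\<close> wrong labels.
\<close>

locale planted_labels =
  fixes n :: nat and a :: "nat \<Rightarrow> nat \<Rightarrow> real" and \<eta> :: "nat \<Rightarrow> real" and \<tau> \<beta> :: real
  assumes n_pos: "n > 0" and \<tau>_pos: "\<tau> > 0" and \<beta>_pos: "\<beta> > 0" and \<beta>_le: "\<beta> \<le> 1"
    and sym: "i < n \<Longrightarrow> j < n \<Longrightarrow> a i j = a j i"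
    and label: "i < n \<Longrightarrow> \<eta> i \<in> {-1, 1}"
    and noise: "\<bar>bilin n (deviation a \<eta> \<tau>) x x\<bar> \<le> \<beta> / 16 * real n * \<tau> * sqnorm n x"
begin

lemma label_square: "i < n \<Longrightarrow> \<eta> i * \<eta> i = 1"
  using label[of i] by auto

lemma bilin_decompose:
  "bilin n a x y = \<tau> * ((\<Sum>i<n. x i * \<eta> i) * (\<Sum>i<n. y i * \<eta> i) - (\<Sum>i<n. x i * y i))
    + bilin n (deviation a \<eta> \<tau>) x y"
proof -
  have "bilin n a x y = (\<Sum>i<n. \<Sum>j<n. \<tau> * (x i * \<eta> i * (y j * \<eta> j)) - (if i = j then \<tau> * (x i * y j) else 0)
      + deviation a \<eta> \<tau> i j * x i * y j)"
    unfolding bilin_def deviation_def by (intro sum.cong refl) (simp add: algebra_simps)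
  also have "\<dots> = \<tau> * ((\<Sum>i<n. x i * \<eta> i) * (\<Sum>i<n. y i * \<eta> i)) - \<tau> * (\<Sum>i<n. x i * y i)
      + bilin n (deviation a \<eta> \<tau>) x y"
    by (simp add: sum.distrib sum_subtractf bilin_def sum_product flip: sum_distrib_left)
  finally show ?thesis by (simp add: algebra_simps)
qed

lemma deviation_sym: "i < n \<Longrightarrow> j < n \<Longrightarrow> deviation a \<eta> \<tau> i j = deviation a \<eta> \<tau> j i"
  using sym by (simp add: deviation_def)

lemma sqnorm_label: "sqnorm n \<eta> = real n"
  using label_square by (simp add: sqnorm_def power2_eq_square)

text \<open>
  If the quadratic form is at least as large at \<open>v\<close> as at \<open>\<eta>\<close>, both
  scaled to norm \<open>\<surd>n\<close>, then the signal part must be nearly maximal at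
  \<open>v\<close>. So \<open>v\<close> has inner product at least \<open>n(1-\<beta>/8)\<close>
  with one of \<open>\<plusminus>\<eta>\<close> and squared distance at most
  \<open>\<beta>n/4\<close> from it, and every wrong sign costs at least 1 in squared distance.
\<close>

lemma initial_errors:
  assumes v: "sqnorm n v > 0" and rq: "bilin n a \<eta> \<eta> * sqnorm n v \<le> bilin n a v v * real n"
    and s: "s \<in> {-1, 1}"
  shows "\<exists>\<nu>\<in>{-1, 1}. real (errors n (\<lambda>i. sign_with s (v i)) (\<lambda>i. \<nu> * \<eta> i)) \<le> \<beta> * real n / 4"
proof -
  define c where "c = sqrt (real n / sqnorm n v)"
  have c: "c > 0" "c\<^sup>2 * sqnorm n v = real n" using v n_pos by (auto simp: c_def)
  define u where "u i = c * v i" for i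
  have u': "u = (\<lambda>i. c * v i)" by (simp add: u_def fun_eq_iff)
  have u: "sqnorm n u = real n" unfolding u_def sqnorm_scale c(2) ..
  define D where "D = (\<Sum>i<n. u i * \<eta> i)"
  define N where "N = real n"
  have N: "N > 0" using n_pos by (simp add: N_def)
  have "bilin n a u u * N = c\<^sup>2 * (bilin n a v v * real n)"
    unfolding u' bilin_scale_left bilin_scale_right by (simp add: power2_eq_square N_def)
  also have "\<dots> \<ge> c\<^sup>2 * (bilin n a \<eta> \<eta> * sqnorm n v)" using rq by (intro mult_left_mono) auto
  also have "c\<^sup>2 * (bilin n a \<eta> \<eta> * sqnorm n v) = bilin n a \<eta> \<eta> * N"
    by (subst mult.left_commute) (simp only: c(2) N_def)
  finally have "bilin n a \<eta> \<eta> * N \<le> bilin n a u u * N" .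
  then have "bilin n a \<eta> \<eta> \<le> bilin n a u u" using N by simp
  moreover have "bilin n a \<eta> \<eta> = \<tau> * (N * N - N) + bilin n (deviation a \<eta> \<tau>) \<eta> \<eta>"
    using label_square by (simp add: bilin_decompose N_def)
  moreover have "bilin n a u u = \<tau> * (D * D - N) + bilin n (deviation a \<eta> \<tau>) u u"
    using u by (simp add: bilin_decompose D_def N_def sqnorm_def power2_eq_square)
  moreover have "\<bar>bilin n (deviation a \<eta> \<tau>) \<eta> \<eta>\<bar> \<le> \<beta> / 16 * N * \<tau> * N"
    using noise[of \<eta>] by (simp add: sqnorm_label N_def)
  moreover have "\<bar>bilin n (deviation a \<eta> \<tau>) u u\<bar> \<le> \<beta> / 16 * N * \<tau> * N"
    using noise[of u] by (simp add: u N_def)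
  ultimately have "\<tau> * (N * N - N) \<le> \<tau> * (D * D - N) + 2 * (\<beta> / 16 * N * \<tau> * N)"
    by linarith
  also have "\<dots> = \<tau> * (D * D - N + \<beta> / 8 * (N * N))" by (simp add: algebra_simps)
  finally have "N * N - N \<le> D * D - N + \<beta> / 8 * (N * N)"
    using \<tau>_pos by (simp only: mult_le_cancel_left_pos)
  then have "N * N * (1 - \<beta> / 8) \<le> D * D" by (simp add: algebra_simps)
  moreover have "(1 - \<beta> / 8) * (1 - \<beta> / 8) \<le> 1 * (1 - \<beta> / 8)"
    using \<beta>_pos \<beta>_le by (intro mult_right_mono) auto
  then have "N * N * ((1 - \<beta> / 8) * (1 - \<beta> / 8)) \<le> N * N * (1 - \<beta> / 8)"
    using N by (intro mult_left_mono) auto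
  ultimately have "(N * (1 - \<beta> / 8))\<^sup>2 \<le> D\<^sup>2" by (simp add: power2_eq_square mult_ac)
  then have D: "N * (1 - \<beta> / 8) \<le> \<bar>D\<bar>"
    using N \<beta>_le by (simp add: abs_le_square_iff[symmetric])
  define \<nu> :: real where "\<nu> = (if D \<ge> 0 then 1 else -1)"
  have \<nu>: "\<nu> \<in> {-1, 1}" "\<nu> * D = \<bar>D\<bar>" "\<nu> * \<nu> = 1" by (auto simp: \<nu>_def)
  have "(\<Sum>i<n. (u i - \<nu> * \<eta> i)\<^sup>2) = (\<Sum>i<n. (u i)\<^sup>2 - 2 * \<nu> * (u i * \<eta> i) + 1)"
  proof (intro sum.cong refl)
    fix i assume "i \<in> {..<n}"
    then have "(\<nu> * \<eta> i)\<^sup>2 = 1" using label_square[of i] \<nu>(3) by (simp add: power2_eq_square mult_ac)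
    then show "(u i - \<nu> * \<eta> i)\<^sup>2 = (u i)\<^sup>2 - 2 * \<nu> * (u i * \<eta> i) + 1" by (simp add: power2_diff)
  qed
  also have "\<dots> = N - 2 * (\<nu> * D) + N"
    using u by (simp add: sum.distrib sum_subtractf sqnorm_def N_def D_def sum_distrib_left mult.assoc)
  also have "\<dots> = 2 * N - 2 * \<bar>D\<bar>" unfolding \<nu>(2) by simp
  also have "\<dots> \<le> \<beta> * N / 4" using D by (simp add: algebra_simps)
  finally have close: "(\<Sum>i<n. (u i - \<nu> * \<eta> i)\<^sup>2) \<le> \<beta> * N / 4" .
  have "real (errors n (\<lambda>i. sign_with s (v i)) (\<lambda>i. \<nu> * \<eta> i)) =
      (\<Sum>i<n. if sign_with s (v i) \<noteq> \<nu> * \<eta> i then 1 else 0)"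
    by (simp add: errors_def sum.If_cases Int_def)
  also have "\<dots> \<le> (\<Sum>i<n. (u i - \<nu> * \<eta> i)\<^sup>2)"
  proof (intro sum_mono)
    fix i assume i: "i \<in> {..<n}"
    \<comment> \<open>a wrong sign means that \<open>u i\<close> and the label lie on different sides of 0; at 0
        itself the sign convention may decide either way, and the distance is exactly 1\<close>
    have "1 \<le> (u i - \<nu> * \<eta> i)\<^sup>2" if ne: "sign_with s (v i) \<noteq> \<nu> * \<eta> i"
    proof -
      have "\<nu> * \<eta> i = 1 \<or> \<nu> * \<eta> i = -1" using label[of i] i \<nu>(1) by auto
      then have "1 \<le> \<bar>u i - \<nu> * \<eta> i\<bar>"
      proof
        assume l: "\<nu> * \<eta> i = 1"
        then have "v i \<le> 0" using ne by (auto simp: sign_with_def sgn_real_def split: if_splits)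
        then have "u i \<le> 0" using c by (simp add: u_def mult_nonneg_nonpos)
        then show ?thesis using l by simp
      next
        assume l: "\<nu> * \<eta> i = -1"
        then have "v i \<ge> 0" using ne by (auto simp: sign_with_def sgn_real_def split: if_splits)
        then have "u i \<ge> 0" using c by (simp add: u_def)
        then show ?thesis using l by simp
      qed
      then show ?thesis using abs_le_square_iff[of 1 "u i - \<nu> * \<eta> i"] by simp
    qed
    then show "(if sign_with s (v i) \<noteq> \<nu> * \<eta> i then 1 else 0) \<le> (u i - \<nu> * \<eta> i)\<^sup>2" by auto
  qed
  finally have "real (errors n (\<lambda>i. sign_with s (v i)) (\<lambda>i. \<nu> * \<eta> i)) \<le> \<beta> * real n / 4"
    using close unfolding N_def by linarith
  then show ?thesis using \<nu>(1) by blast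
qed

text \<open>
  Let \<open>y\<close> be the vector \<open>(\<eta>-x)/2\<close>, supported on the
  \<open>e\<close> current errors, and \<open>z\<close> the vector \<open>\<eta>\<close>
  restricted to the \<open>b\<close> new errors of large margin. A new error of large margin needs
  a contribution of the old errors of half the threshold, so \<open>z\<^sup>T a y\<close> is at
  least \<open>b\<close> times half the threshold. The signal part contributes at most half of
  that because the old errors are few, and so the noise part must contribute the rest. Its
  operator norm then forces \<open>b \<le> e/16\<close>.
\<close>

lemma errors_contract:
  assumes x: "\<And>i. i < n \<Longrightarrow> x i \<in> {-1, 1}" and few: "real (errors n x \<eta>) \<le> \<beta> * real n / 4"
  shows "real (errors n (\<lambda>i. sign_with s (\<Sum>j<n. a i j * x j)) \<eta>) \<le>
    real (low_margin n a \<eta> (\<beta> * real n * \<tau>)) + real (errors n x \<eta>) / 16"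
proof -
  define y where "y i = (\<eta> i - x i) / 2" for i
  define L where "L = {i. i < n \<and> \<eta> i * (\<Sum>j<n. a i j * \<eta> j) \<le> \<beta> * real n * \<tau>}"
  define E where "E = {i. i < n \<and> sign_with s (\<Sum>j<n. a i j * x j) \<noteq> \<eta> i}"
  define B where "B = E - L"
  define z where "z i = (if i \<in> B then \<eta> i else 0)" for i
  define b where "b = real (card B)"
  define e where "e = real (errors n x \<eta>)"
  define T where "T = \<beta> * real n * \<tau>"
  have T: "T > 0" using \<beta>_pos n_pos \<tau>_pos by (simp add: T_def)
  have finB: "finite B" "B \<subseteq> {..<n}" by (auto simp: B_def E_def)
  have y: "y i = (if x i \<noteq> \<eta> i then \<eta> i else 0)" if "i < n" for i
    using x[OF that] label[OF that] by (auto simp: y_def)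
  have e_sum: "e = (\<Sum>i<n. if x i \<noteq> \<eta> i then 1 else 0)"
    by (simp add: e_def errors_def sum.If_cases Int_def)
  have b_sum: "b = (\<Sum>i<n. if i \<in> B then 1 else 0)"
    using finB by (simp add: b_def sum.If_cases Int_absorb1)
  have "sqnorm n y = e"
    unfolding sqnorm_def e_sum using y label_square by (intro sum.cong) (auto simp: power2_eq_square)
  moreover have ye: "(\<Sum>i<n. y i * \<eta> i) = e"
    unfolding e_sum using y label_square by (intro sum.cong) auto
  moreover have "sqnorm n z = b"
    unfolding sqnorm_def b_sum using label_square by (intro sum.cong) (auto simp: power2_eq_square z_def)
  moreover have zb: "(\<Sum>i<n. z i * \<eta> i) = b"
    unfolding b_sum using label_square by (intro sum.cong) (auto simp: z_def)
  moreover have zy: "(\<Sum>i<n. z i * y i) \<ge> 0"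
    using y label_square by (intro sum_nonneg) (auto simp: z_def)
  ultimately have sq: "sqnorm n y = e" "sqnorm n z = b" by auto
  have margin: "T / 2 \<le> \<eta> i * (\<Sum>j<n. a i j * y j)" if i: "i \<in> B" for i
  proof -
    have i': "i < n" "sign_with s (\<Sum>j<n. a i j * x j) \<noteq> \<eta> i" "T < \<eta> i * (\<Sum>j<n. a i j * \<eta> j)"
      using i by (auto simp: B_def E_def L_def T_def)
    have "\<eta> i * (\<Sum>j<n. a i j * x j) \<le> 0"
      using i'(2) label[OF i'(1)] by (auto simp: sign_with_def sgn_real_def split: if_splits)
    moreover have "(\<Sum>j<n. a i j * x j) = (\<Sum>j<n. a i j * \<eta> j - 2 * (a i j * y j))"
      by (intro sum.cong refl) (simp add: y_def field_simps)
    then have "(\<Sum>j<n. a i j * x j) = (\<Sum>j<n. a i j * \<eta> j) - 2 * (\<Sum>j<n. a i j * y j)"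
      by (simp add: sum_subtractf sum_distrib_left)
    then have "\<eta> i * (\<Sum>j<n. a i j * x j) = \<eta> i * (\<Sum>j<n. a i j * \<eta> j) - 2 * (\<eta> i * (\<Sum>j<n. a i j * y j))"
      by (simp add: right_diff_distrib)
    ultimately show ?thesis using i'(3) by linarith
  qed
  have "b * (T / 2) = (\<Sum>i\<in>B. T / 2)" by (simp add: b_def)
  also have "\<dots> \<le> (\<Sum>i\<in>B. \<eta> i * (\<Sum>j<n. a i j * y j))" using margin by (intro sum_mono)
  also have "\<dots> = (\<Sum>i\<in>B. z i * (\<Sum>j<n. a i j * y j))" by (intro sum.cong) (auto simp: z_def)
  also have "\<dots> = (\<Sum>i<n. z i * (\<Sum>j<n. a i j * y j))"
    using finB by (intro sum.mono_neutral_left) (auto simp: z_def)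
  also have "\<dots> = bilin n a z y" by (simp add: bilin_left)
  also have "\<dots> = \<tau> * (b * e - (\<Sum>i<n. z i * y i)) + bilin n (deviation a \<eta> \<tau>) z y"
    by (simp add: bilin_decompose zb ye)
  also have "\<dots> \<le> \<tau> * (b * e) + bilin n (deviation a \<eta> \<tau>) z y"
    using zy \<tau>_pos by simp
  also have "\<tau> * (b * e) \<le> \<tau> * (b * (\<beta> * real n / 4))"
    using few \<tau>_pos by (intro mult_left_mono) (auto simp: b_def e_def)
  also have "\<tau> * (b * (\<beta> * real n / 4)) = b * T / 4" by (simp add: T_def)
  finally have low: "b * T \<le> 4 * bilin n (deviation a \<eta> \<tau>) z y" by (simp add: algebra_simps)
  \<comment> \<open>the factor 4 balances \<open>b\<close> against \<open>e/16\<close> in the bound by the mean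
      of the squared norms\<close>
  have "\<bar>bilin n (deviation a \<eta> \<tau>) (\<lambda>i. 4 * z i) y\<bar> \<le>
      \<beta> / 16 * real n * \<tau> * (sqnorm n (\<lambda>i. 4 * z i) + sqnorm n y) / 2"
    by (intro bilin_le_of_quadratic deviation_sym noise)
  then have "4 * bilin n (deviation a \<eta> \<tau>) z y \<le> \<beta> / 16 * real n * \<tau> * (4\<^sup>2 * b + e) / 2"
    unfolding bilin_scale_left sqnorm_scale sq by (rule order_trans[OF abs_ge_self])
  also have "\<dots> = T / 32 * (16 * b + e)" by (simp add: T_def)
  finally have "4 * bilin n (deviation a \<eta> \<tau>) z y \<le> T / 32 * (16 * b + e)" .
  with low have "T * b \<le> T * ((16 * b + e) / 32)" by (simp add: algebra_simps)
  then have be: "b \<le> e / 16" using T by (simp add: field_simps)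
  have "card E \<le> card (L \<union> B)" by (intro card_mono) (auto simp: B_def L_def E_def)
  also have "\<dots> \<le> card L + card B" by (rule card_Un_le)
  finally have "real (card E) \<le> real (card L) + b" unfolding b_def by linarith
  then show ?thesis using be by (simp add: errors_def low_margin_def E_def L_def e_def)
qed

text \<open>
  Iterating \<open>N \<mapsto> N\<^sub>* + N/16\<close>. The bound \<open>\<beta>n/4\<close> has
  to be carried along, as the contraction is only available below it.
\<close>

lemma errors_label_iterate:
  assumes s: "s \<in> {-1, 1}"
    and init: "real (errors n (\<lambda>i. sign_with s (v i)) \<eta>) \<le> \<beta> * real n / 4"
    and low: "real (low_margin n a \<eta> (\<beta> * real n * \<tau>)) \<le> \<beta> * real n / 8"
  shows "real (errors n (label_iterate s n a v k) \<eta>) \<le> \<beta> * real n / 4 \<and>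
    real (errors n (label_iterate s n a v k) \<eta>) \<le>
      real n / 16 ^ k + 2 * real (low_margin n a \<eta> (\<beta> * real n * \<tau>))"
proof (induction k)
  case 0
  show ?case using init errors_le[of n "\<lambda>i. sign_with s (v i)" \<eta>] by (simp add: add_increasing2)
next
  case (Suc k)
  have "real (errors n (label_iterate s n a v (Suc k)) \<eta>) \<le>
    real (low_margin n a \<eta> (\<beta> * real n * \<tau>)) + real (errors n (label_iterate s n a v k) \<eta>) / 16"
    unfolding label_iterate.simps using Suc label_iterate_label[OF s] by (intro errors_contract) auto
  moreover have "\<beta> * real n / 8 + \<beta> * real n / 4 / 16 \<le> \<beta> * real n / 4"
    using \<beta>_pos by (simp add: field_simps)
  moreover define X where "X = real n / 16 ^ k"
  moreover have "real n / 16 ^ Suc k = X / 16" by (simp add: X_def)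
  moreover define l where "l = real (low_margin n a \<eta> (\<beta> * real n * \<tau>))"
  moreover have "0 \<le> l" by (simp add: l_def)
  ultimately show ?case
    using Suc[folded X_def l_def] low[folded l_def] by (auto simp del: label_iterate.simps power_Suc)
qed

lemma planted_labels_flip: "\<nu> \<in> {-1, 1} \<Longrightarrow> planted_labels n a (\<lambda>i. \<nu> * \<eta> i) \<tau> \<beta>"
proof -
  assume \<nu>: "\<nu> \<in> {-1, 1}"
  then have "deviation a (\<lambda>i. \<nu> * \<eta> i) \<tau> = deviation a \<eta> \<tau>"
    by (auto simp: deviation_def fun_eq_iff)
  then show ?thesis
    using n_pos \<tau>_pos \<beta>_pos \<beta>_le sym noise \<nu>
    by unfold_locales (use label in fastforce)+
qed

text \<open>
  If more than \<open>\<beta>n/8\<close> margins are low, the trivial bound \<open>n\<close> on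
  the loss is already at most \<open>8/\<beta>\<close> times their number; otherwise the
  contraction applies. The factor \<open>4 + 8/\<beta>\<close> covers both cases.
\<close>

lemma loss_label_iterate:
  assumes s: "s \<in> {-1, 1}"
    and v: "sqnorm n v > 0" and rq: "bilin n a \<eta> \<eta> * sqnorm n v \<le> bilin n a v v * real n"
  shows "loss n (label_iterate s n a v k) \<eta> \<le>
    2 * real n / 16 ^ k + (4 + 8 / \<beta>) * real (low_margin n a \<eta> (\<beta> * real n * \<tau>))"
proof (cases "real (low_margin n a \<eta> (\<beta> * real n * \<tau>)) \<le> \<beta> * real n / 8")
  case True
  obtain \<nu> where \<nu>: "\<nu> \<in> {-1, 1}"
    "real (errors n (\<lambda>i. sign_with s (v i)) (\<lambda>i. \<nu> * \<eta> i)) \<le> \<beta> * real n / 4"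
    using initial_errors[OF v rq s] by blast
  interpret F: planted_labels n a "\<lambda>i. \<nu> * \<eta> i" \<tau> \<beta> by (rule planted_labels_flip[OF \<nu>(1)])
  have flip: "low_margin n a (\<lambda>i. \<nu> * \<eta> i) c = low_margin n a \<eta> c" for c
    using \<nu>(1) by (auto simp: low_margin_def sum_negf)
  have "real (errors n (label_iterate s n a v k) (\<lambda>i. \<nu> * \<eta> i)) \<le>
      real n / 16 ^ k + 2 * real (low_margin n a \<eta> (\<beta> * real n * \<tau>))"
    using F.errors_label_iterate[OF s \<nu>(2), of k] True by (simp add: flip)
  moreover have "loss n (label_iterate s n a v k) \<eta> \<le> 2 * real (errors n (label_iterate s n a v k) (\<lambda>i. \<nu> * \<eta> i))"
    using label_iterate_label[OF s] label \<nu>(1) by (intro loss_le_errors) auto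
  moreover have "0 \<le> 8 / \<beta> * real (low_margin n a \<eta> (\<beta> * real n * \<tau>))" using \<beta>_pos by simp
  moreover have "2 * real n / 16 ^ k = 2 * (real n / 16 ^ k)" by simp
  ultimately show ?thesis unfolding distrib_right by linarith
next
  case False
  have "loss n (label_iterate s n a v k) \<eta> \<le> real n"
    using label_iterate_label[OF s] label by (intro loss_le_n) auto
  also have "\<dots> \<le> 8 / \<beta> * real (low_margin n a \<eta> (\<beta> * real n * \<tau>))"
    using False \<beta>_pos by (simp add: field_simps)
  also have "\<dots> \<le> 2 * real n / 16 ^ k + (4 + 8 / \<beta>) * real (low_margin n a \<eta> (\<beta> * real n * \<tau>))"
    by (simp add: algebra_simps add_increasing)
  finally show ?thesis .
qed

end

section \<open>Tails of Gaussian chaos\<close>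

text \<open>
  The entries of the hollow Gram matrix as a function, in the form that fits \<open>bilin\<close>
  and \<open>label_iterate\<close>.
\<close>

definition gram_offdiag :: "nat \<Rightarrow> (nat \<times> nat \<Rightarrow> real) \<Rightarrow> nat \<Rightarrow> nat \<Rightarrow> real" where
  "gram_offdiag p Y i j = (if i = j then 0 else \<Sum>r<p. Y (r, i) * Y (r, j))"

lemma hollow_gram_carrier: "hollow_gram p n Y \<in> carrier_mat n n"
  by (intro carrier_matI) (simp_all add: hollow_gram_def hollow_def mat_diag_def)

lemma hollow_gram_index:
  assumes "i < n" "j < n"
  shows "hollow_gram p n Y $$ (i, j) = gram_offdiag p Y i j"
  using assms
  by (simp add: hollow_gram_def hollow_def mat_diag_def gram_offdiag_def scalar_prod_def atLeast0LessThan)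

lemma gram_offdiag_sym: "gram_offdiag p Y i j = gram_offdiag p Y j i"
  by (simp add: gram_offdiag_def mult.commute)

lemma bilin_cong: "(\<And>i j. i < n \<Longrightarrow> j < n \<Longrightarrow> A i j = B i j) \<Longrightarrow> bilin n A x y = bilin n B x y"
  by (simp add: bilin_def)

text \<open>
  A top eigenvector maximises the Rayleigh quotient; this is the only property of the spectral
  initialisation that enters the analysis.
\<close>

lemma top_eigenvector_rayleigh:
  assumes v: "top_eigenvector (hollow_gram p n Y) v"
  shows "v \<in> carrier_vec n" and "sqnorm n (\<lambda>i. vec_index v i) > 0"
    and "bilin n (gram_offdiag p Y) x x * sqnorm n (\<lambda>i. vec_index v i) \<le>
      bilin n (gram_offdiag p Y) (\<lambda>i. vec_index v i) (\<lambda>i. vec_index v i) * sqnorm n x"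
proof -
  let ?H = "hollow_gram p n Y"
  let ?v = "\<lambda>i. vec_index v i"
  obtain l where l: "eigenvector ?H v l" "\<And>m. eigenvalue ?H m \<Longrightarrow> m \<le> l"
    using v by (auto simp: top_eigenvector_def)
  have dim: "dim_row ?H = n" "dim_col ?H = n" using hollow_gram_carrier[of p n Y] by auto
  show vc: "v \<in> carrier_vec n" using l(1) dim by (simp add: eigenvector_def)
  have "\<not> (\<forall>i<n. ?v i = 0)"
  proof
    assume "\<forall>i<n. ?v i = 0"
    then have "v = 0\<^sub>v n" using vc by (intro eq_vecI) auto
    then show False using l(1) dim by (simp add: eigenvector_def)
  qed
  then show pos: "sqnorm n ?v > 0" using sqnorm_eq_0[of n ?v] sqnorm_nonneg[of n ?v] by (metis less_le)
  have row: "(\<Sum>j<n. gram_offdiag p Y i j * ?v j) = l * ?v i" if "i < n" for i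
  proof -
    have "l * ?v i = vec_index (?H *\<^sub>v v) i" using l(1) that vc by (auto simp: eigenvector_def)
    also have "\<dots> = (\<Sum>j<n. ?H $$ (i, j) * ?v j)"
      using that dim vc by (auto simp: scalar_prod_def atLeast0LessThan)
    also have "\<dots> = (\<Sum>j<n. gram_offdiag p Y i j * ?v j)"
      using that by (intro sum.cong) (auto simp: hollow_gram_index)
    finally show ?thesis by simp
  qed
  have "bilin n (gram_offdiag p Y) ?v ?v = (\<Sum>i<n. ?v i * (l * ?v i))"
    unfolding bilin_left using row by (intro sum.cong) auto
  then have q: "bilin n (gram_offdiag p Y) ?v ?v = l * sqnorm n ?v"
    by (simp add: sqnorm_def sum_distrib_left power2_eq_square mult_ac)
  have "bilin n (\<lambda>i j. ?H $$ (i, j)) x x \<le> l * sqnorm n x"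
    using l(2) by (intro rayleigh_le_top_eigenvalue hollow_gram_carrier)
      (auto simp: hollow_gram_index gram_offdiag_sym)
  also have "bilin n (\<lambda>i j. ?H $$ (i, j)) x x = bilin n (gram_offdiag p Y) x x"
    by (intro bilin_cong) (simp add: hollow_gram_index)
  finally have "bilin n (gram_offdiag p Y) x x * sqnorm n ?v \<le> l * sqnorm n x * sqnorm n ?v"
    using pos by (intro mult_right_mono) auto
  then show "bilin n (gram_offdiag p Y) x x * sqnorm n ?v \<le> bilin n (gram_offdiag p Y) ?v ?v * sqnorm n x"
    by (simp add: q mult_ac)
qed

text \<open>
  The exponential Markov inequality, in the form in which all Chernoff bounds use it.
\<close>

lemma measure_le_exp_moment:
  assumes "prob_space M" and [measurable]: "X \<in> borel_measurable M"
    and le: "(\<integral>\<^sup>+x. ennreal (exp (X x)) \<partial>M) \<le> ennreal c" and c: "c \<ge> 0"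
  shows "measure M {x \<in> space M. 0 \<le> X x} \<le> c"
proof -
  interpret prob_space M by fact
  have "emeasure M {x \<in> space M. 0 \<le> X x} = (\<integral>\<^sup>+x. indicator {x \<in> space M. 0 \<le> X x} x \<partial>M)"
    by (intro nn_integral_indicator[symmetric]) measurable
  also have "\<dots> \<le> (\<integral>\<^sup>+x. ennreal (exp (X x)) \<partial>M)"
    by (intro nn_integral_mono) (auto simp: indicator_def)
  also note le
  finally show ?thesis using c by (simp add: emeasure_eq_measure)
qed

text \<open>
  Chernoff with parameter \<open>u/C\<close>, the optimal one if the variance is \<open>C\<close>.
\<close>

lemma gauss_linear_tail:
  assumes K: "finite K" and C: "(\<Sum>k\<in>K. (c k)\<^sup>2) \<le> C" "C > 0" and u: "u \<ge> 0"
  shows "measure (gauss K) {\<xi> \<in> space (gauss K). u \<le> (\<Sum>k\<in>K. c k * \<xi> k)} \<le> exp (- (u\<^sup>2 / (2 * C)))"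
proof -
  define l where "l = u / C"
  have l: "l \<ge> 0" using u C by (simp add: l_def)
  define X where "X \<xi> = l * (\<Sum>k\<in>K. c k * \<xi> k) - l * u" for \<xi> :: "'a \<Rightarrow> real"
  have [measurable]: "X \<in> borel_measurable (gauss K)" unfolding X_def by measurable
  have "(\<integral>\<^sup>+\<xi>. ennreal (exp (X \<xi>)) \<partial>gauss K) =
      (\<integral>\<^sup>+\<xi>. ennreal (exp (- l * u)) * ennreal (exp (\<Sum>k\<in>K. (l * c k) * \<xi> k + 0 * (\<xi> k)\<^sup>2)) \<partial>gauss K)"
    by (intro nn_integral_cong)
      (simp add: X_def sum_distrib_left mult_ac flip: ennreal_mult exp_add)
  also have "\<dots> = ennreal (exp (- l * u)) * ennreal (\<Prod>k\<in>K. tilt_factor (l * c k) 0)"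
    using K by (subst nn_integral_cmult) (auto simp: gauss_exp_quadratic[where b = "\<lambda>_. 0", simplified])
  also have "(\<Prod>k\<in>K. tilt_factor (l * c k) 0) = exp (l\<^sup>2 * (\<Sum>k\<in>K. (c k)\<^sup>2) / 2)"
    using K by (simp add: tilt_factor_def exp_sum[symmetric] sum_distrib_left power_mult_distrib sum_divide_distrib)
  also have "ennreal (exp (- l * u)) * ennreal (exp (l\<^sup>2 * (\<Sum>k\<in>K. (c k)\<^sup>2) / 2)) =
      ennreal (exp (- l * u + l\<^sup>2 * (\<Sum>k\<in>K. (c k)\<^sup>2) / 2))"
    by (simp only: exp_add ennreal_mult exp_ge_zero)
  also have "\<dots> \<le> ennreal (exp (- (u\<^sup>2 / (2 * C))))"
  proof (intro ennreal_leI, simp only: exp_le_cancel_iff)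
    have "l\<^sup>2 * (\<Sum>k\<in>K. (c k)\<^sup>2) \<le> l\<^sup>2 * C" using C(1) by (intro mult_left_mono) auto
    also have "l\<^sup>2 * C = l * u" using C(2) by (simp add: l_def power2_eq_square)
    finally have "- l * u + l\<^sup>2 * (\<Sum>k\<in>K. (c k)\<^sup>2) / 2 \<le> - (l * u / 2)" by simp
    also have "l * u / 2 = u\<^sup>2 / (2 * C)" by (simp add: l_def power2_eq_square)
    finally show "- l * u + l\<^sup>2 * (\<Sum>k\<in>K. (c k)\<^sup>2) / 2 \<le> - (u\<^sup>2 / (2 * C))" .
  qed
  finally have "measure (gauss K) {\<xi> \<in> space (gauss K). 0 \<le> X \<xi>} \<le> exp (- (u\<^sup>2 / (2 * C)))"
    by (intro measure_le_exp_moment prob_space_gauss) auto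
  moreover have "measure (gauss K) {\<xi> \<in> space (gauss K). u \<le> (\<Sum>k\<in>K. c k * \<xi> k)} \<le>
      measure (gauss K) {\<xi> \<in> space (gauss K). 0 \<le> X \<xi>}"
  proof (rule finite_measure.finite_measure_mono)
    show "finite_measure (gauss K)" using prob_space_gauss by (rule prob_space.finite_measure)
    show "{\<xi> \<in> space (gauss K). u \<le> (\<Sum>k\<in>K. c k * \<xi> k)} \<subseteq> {\<xi> \<in> space (gauss K). 0 \<le> X \<xi>}"
      using l by (auto simp: X_def intro: mult_left_mono)
  qed measurable
  ultimately show ?thesis by linarith
qed

lemma gauss_linear_abs_tail:
  assumes K: "finite K" and C: "(\<Sum>k\<in>K. (c k)\<^sup>2) \<le> C" "C > 0" and u: "u \<ge> 0"
  shows "measure (gauss K) {\<xi> \<in> space (gauss K). u \<le> \<bar>\<Sum>k\<in>K. c k * \<xi> k\<bar>} \<le> 2 * exp (- (u\<^sup>2 / (2 * C)))"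
proof -
  interpret prob_space "gauss K" by (rule prob_space_gauss)
  let ?P = "{\<xi> \<in> space (gauss K). u \<le> (\<Sum>k\<in>K. c k * \<xi> k)}"
  let ?N = "{\<xi> \<in> space (gauss K). u \<le> (\<Sum>k\<in>K. - c k * \<xi> k)}"
  have "{\<xi> \<in> space (gauss K). u \<le> \<bar>\<Sum>k\<in>K. c k * \<xi> k\<bar>} \<subseteq> ?P \<union> ?N"
    by (auto simp: sum_negf abs_if split: if_splits)
  then have "measure (gauss K) {\<xi> \<in> space (gauss K). u \<le> \<bar>\<Sum>k\<in>K. c k * \<xi> k\<bar>} \<le> measure (gauss K) (?P \<union> ?N)"
    by (intro finite_measure_mono) measurable
  also have "\<dots> \<le> measure (gauss K) ?P + measure (gauss K) ?N"
    by (intro measure_Un_le) measurable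
  also have "\<dots> \<le> exp (- (u\<^sup>2 / (2 * C))) + exp (- (u\<^sup>2 / (2 * C)))"
    using C by (intro add_mono gauss_linear_tail K u) auto
  finally show ?thesis by simp
qed

text \<open>
  The centred exponential moment of a squared Gaussian is of second order in \<open>s\<close>, by
  \<open>|ln(1+x) - x| \<le> 2x\<^sup>2\<close>.
\<close>

lemma tilt_factor_chi_square: "\<bar>s\<bar> \<le> 1/4 \<Longrightarrow> exp (- s) * tilt_factor 0 s \<le> exp (4 * s\<^sup>2)"
proof -
  assume s: "\<bar>s\<bar> \<le> 1/4"
  then have pos: "1 - 2 * s > 0" by linarith
  have "\<bar>ln (1 + (- 2 * s)) - (- 2 * s)\<bar> \<le> 2 * (- 2 * s)\<^sup>2"
    using s by (intro abs_ln_one_plus_x_minus_x_bound) auto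
  then have "- (ln (1 - 2 * s) / 2) \<le> s + 4 * s\<^sup>2" by (simp add: power_mult_distrib)
  moreover have "tilt_factor 0 s = exp (- (ln (1 - 2 * s) / 2))"
    using pos by (simp add: tilt_factor_def exp_minus ln_sqrt[symmetric] field_simps)
  ultimately show ?thesis by (simp flip: exp_add)
qed

lemma ennreal_half_sum:
  fixes x y :: real
  assumes "x \<ge> 0" "y \<ge> 0"
  shows "ennreal (1/2 * x + 1/2 * y) = ennreal (1/2) * ennreal x + ennreal (1/2) * ennreal y"
proof -
  have "ennreal (1/2 * x + 1/2 * y) = ennreal (1/2 * x) + ennreal (1/2 * y)"
    using assms by (intro ennreal_plus) auto
  moreover have "ennreal (1/2 * x) = ennreal (1/2) * ennreal x" "ennreal (1/2 * y) = ennreal (1/2) * ennreal y"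
    by (rule ennreal_mult; use assms in simp)+
  ultimately show ?thesis by (simp only:)
qed

text \<open>
  The off-diagonal form \<open>(z\<cdot>\<omega>)\<^sup>2 - \<Sum>
  z\<^sub>i\<^sup>2\<omega>\<^sub>i\<^sup>2\<close> is a difference of two chi-square type
  variables with the same mean \<open>|z|\<^sup>2\<close>. They are dependent, but the inequality
  of arithmetic and geometric means separates them at the price of doubling \<open>l\<close>.
\<close>

lemma row_chaos_mgf:
  assumes l: "\<bar>l\<bar> * sqnorm n z \<le> 1/8"
  shows "(\<integral>\<^sup>+\<omega>. ennreal (exp (l * ((\<Sum>i<n. z i * \<omega> i)\<^sup>2 - (\<Sum>i<n. (z i)\<^sup>2 * (\<omega> i)\<^sup>2)))) \<partial>gauss {..<n}) \<le>
    ennreal (exp (16 * l\<^sup>2 * (sqnorm n z)\<^sup>2))"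
proof -
  define v where "v = sqnorm n z"
  have v: "v \<ge> 0" "v = (\<Sum>i<n. (z i)\<^sup>2)" 
    using sqnorm_nonneg[of n z] by (simp_all add: v_def sqnorm_def)
  define A where "A \<omega> = (\<Sum>i<n. z i * \<omega> i)\<^sup>2" for \<omega> :: "nat \<Rightarrow> real"
  define B where "B \<omega> = (\<Sum>i<n. (z i)\<^sup>2 * (\<omega> i)\<^sup>2)" for \<omega> :: "nat \<Rightarrow> real"
  have [measurable]: "A \<in> borel_measurable (gauss {..<n})" "B \<in> borel_measurable (gauss {..<n})"
    unfolding A_def B_def by measurable
  have amgm: "exp (l * (A \<omega> - B \<omega>)) \<le> 1/2 * exp (2 * l * (A \<omega> - v)) + 1/2 * exp (- 2 * l * (B \<omega> - v))" for \<omega>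
  proof -
    have "exp (l * (A \<omega> - B \<omega>)) = exp (l * (A \<omega> - v)) * exp (- l * (B \<omega> - v))"
      by (simp add: algebra_simps flip: exp_add)
    also have "\<dots> \<le> ((exp (l * (A \<omega> - v)))\<^sup>2 + (exp (- l * (B \<omega> - v)))\<^sup>2) / 2"
      using sum_squares_bound[of "exp (l * (A \<omega> - v))" "exp (- l * (B \<omega> - v))"] by simp
    also have "\<dots> = 1/2 * exp (2 * l * (A \<omega> - v)) + 1/2 * exp (- 2 * l * (B \<omega> - v))"
      by (simp add: exp_double[symmetric] algebra_simps)
    finally show ?thesis .
  qed
  define s where "s = 2 * l * v"
  have s: "\<bar>s\<bar> \<le> 1/4" using l v by (simp add: s_def abs_mult v_def[symmetric])
  have IA: "(\<integral>\<^sup>+\<omega>. ennreal (exp (2 * l * (A \<omega> - v))) \<partial>gauss {..<n}) \<le> ennreal (exp (16 * l\<^sup>2 * v\<^sup>2))"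
  proof -
    have "(\<integral>\<^sup>+\<omega>. ennreal (exp (2 * l * (A \<omega> - v))) \<partial>gauss {..<n}) =
        (\<integral>\<^sup>+x. ennreal (exp (2 * l * ((sqrt v * x)\<^sup>2 - v))) \<partial>std_normal)"
      unfolding A_def v(2) by (rule gauss_linear[where f = "\<lambda>w. ennreal (exp (2 * l * (w\<^sup>2 - (\<Sum>i<n. (z i)\<^sup>2))))"]) auto
    also have "\<dots> = (\<integral>\<^sup>+x. ennreal (exp (- s)) * ennreal (exp (0 * x + s * x\<^sup>2)) \<partial>std_normal)"
      using v(1) by (intro nn_integral_cong)
        (simp add: s_def power_mult_distrib algebra_simps flip: ennreal_mult exp_add)
    also have "\<dots> = ennreal (exp (- s)) * ennreal (tilt_factor 0 s)"
      using s by (subst nn_integral_cmult) (auto simp: std_normal_exp_quadratic[of s 0, simplified])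
    also have "\<dots> = ennreal (exp (- s) * tilt_factor 0 s)"
      using s by (subst ennreal_mult) (auto intro: tilt_factor_nonneg)
    also have "\<dots> \<le> ennreal (exp (16 * l\<^sup>2 * v\<^sup>2))"
      using tilt_factor_chi_square[OF s] by (intro ennreal_leI) (simp add: s_def power_mult_distrib mult.assoc)
    finally show ?thesis .
  qed
  have IB: "(\<integral>\<^sup>+\<omega>. ennreal (exp (- 2 * l * (B \<omega> - v))) \<partial>gauss {..<n}) \<le> ennreal (exp (16 * l\<^sup>2 * v\<^sup>2))"
  proof -
    define q where "q i = - 2 * l * (z i)\<^sup>2" for i
    have q: "\<bar>q i\<bar> \<le> 1/4" if "i \<in> {..<n}" for i
    proof -
      have "(z i)\<^sup>2 \<le> v" unfolding v(2) using that by (intro member_le_sum) auto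
      then have "\<bar>l\<bar> * (z i)\<^sup>2 \<le> \<bar>l\<bar> * v" by (intro mult_left_mono) auto
      then show ?thesis using l by (simp add: q_def abs_mult v_def[symmetric])
    qed
    have q': "q i < 1/2" if "i \<in> {..<n}" for i using q[OF that] by linarith
    have "(\<integral>\<^sup>+\<omega>. ennreal (exp (- 2 * l * (B \<omega> - v))) \<partial>gauss {..<n}) =
      (\<integral>\<^sup>+\<omega>. ennreal (exp (- (\<Sum>i<n. q i))) * ennreal (exp (\<Sum>i<n. 0 * \<omega> i + q i * (\<omega> i)\<^sup>2)) \<partial>gauss {..<n})"
      by (intro nn_integral_cong)
        (simp add: q_def B_def v(2) right_diff_distrib sum_distrib_left sum_negf mult.assoc flip: ennreal_mult exp_add)
    also have "\<dots> = ennreal (exp (- (\<Sum>i<n. q i))) * ennreal (\<Prod>i<n. tilt_factor 0 (q i))"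
      by (subst nn_integral_cmult, measurable) (subst gauss_exp_quadratic[OF _ q'], auto)
    also have "\<dots> = ennreal (\<Prod>i<n. exp (- q i) * tilt_factor 0 (q i))"
      using q' by (subst ennreal_mult[symmetric])
        (auto simp: prod.distrib exp_sum sum_negf[symmetric] intro!: prod_nonneg tilt_factor_nonneg)
    also have "\<dots> \<le> ennreal (\<Prod>i<n. exp (4 * (q i)\<^sup>2))"
      using q q' by (intro ennreal_leI prod_mono conjI tilt_factor_chi_square mult_nonneg_nonneg tilt_factor_nonneg) auto
    also have "(\<Prod>i<n. exp (4 * (q i)\<^sup>2)) = exp (\<Sum>i<n. 4 * (q i)\<^sup>2)" by (simp add: exp_sum)
    also have "ennreal \<dots> \<le> ennreal (exp (16 * l\<^sup>2 * v\<^sup>2))"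
    proof (intro ennreal_leI, simp only: exp_le_cancel_iff)
      have "(\<Sum>i<n. 4 * (q i)\<^sup>2) \<le> (\<Sum>i<n. 16 * l\<^sup>2 * ((z i)\<^sup>2 * v))"
      proof (intro sum_mono)
        fix i assume "i \<in> {..<n}"
        then have "(z i)\<^sup>2 \<le> v" unfolding v(2) by (intro member_le_sum) auto
        then have "(z i)\<^sup>2 * (z i)\<^sup>2 \<le> (z i)\<^sup>2 * v" by (intro mult_left_mono) auto
        moreover have "4 * (q i)\<^sup>2 = 16 * l\<^sup>2 * ((z i)\<^sup>2 * (z i)\<^sup>2)"
          by (simp add: q_def power2_eq_square)
        ultimately show "4 * (q i)\<^sup>2 \<le> 16 * l\<^sup>2 * ((z i)\<^sup>2 * v)"
          by (simp add: mult_left_mono)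
      qed
      also have "\<dots> = 16 * l\<^sup>2 * v\<^sup>2"
        by (simp add: v(2) power2_eq_square sum_distrib_left sum_distrib_right mult_ac)
      finally show "(\<Sum>i<n. 4 * (q i)\<^sup>2) \<le> 16 * l\<^sup>2 * v\<^sup>2" .
    qed
    finally show ?thesis .
  qed
  have "(\<integral>\<^sup>+\<omega>. ennreal (exp (l * (A \<omega> - B \<omega>))) \<partial>gauss {..<n}) \<le>
      (\<integral>\<^sup>+\<omega>. ennreal (1/2) * ennreal (exp (2 * l * (A \<omega> - v))) + ennreal (1/2) * ennreal (exp (- 2 * l * (B \<omega> - v))) \<partial>gauss {..<n})"
  proof (intro nn_integral_mono)
    fix \<omega> :: "nat \<Rightarrow> real"
    have "ennreal (exp (l * (A \<omega> - B \<omega>))) \<le> ennreal (1/2 * exp (2 * l * (A \<omega> - v)) + 1/2 * exp (- 2 * l * (B \<omega> - v)))"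
      using amgm by (rule ennreal_leI)
    also have "\<dots> = ennreal (1/2) * ennreal (exp (2 * l * (A \<omega> - v))) + ennreal (1/2) * ennreal (exp (- 2 * l * (B \<omega> - v)))"
      by (rule ennreal_half_sum) simp_all
    finally show "ennreal (exp (l * (A \<omega> - B \<omega>))) \<le> \<dots>" .
  qed
  also have "\<dots> = ennreal (1/2) * (\<integral>\<^sup>+\<omega>. ennreal (exp (2 * l * (A \<omega> - v))) \<partial>gauss {..<n}) +
      ennreal (1/2) * (\<integral>\<^sup>+\<omega>. ennreal (exp (- 2 * l * (B \<omega> - v))) \<partial>gauss {..<n})"
    by (subst nn_integral_add, measurable) (subst (1 2) nn_integral_cmult, auto)
  also have "\<dots> \<le> ennreal (1/2) * ennreal (exp (16 * l\<^sup>2 * v\<^sup>2)) + ennreal (1/2) * ennreal (exp (16 * l\<^sup>2 * v\<^sup>2))"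
    by (intro add_mono mult_left_mono IA IB) auto
  also have "\<dots> = ennreal (1/2 * exp (16 * l\<^sup>2 * v\<^sup>2) + 1/2 * exp (16 * l\<^sup>2 * v\<^sup>2))"
    by (rule ennreal_half_sum[symmetric]) simp_all
  finally show ?thesis by (simp add: A_def B_def v_def)
qed

text \<open>
  The quadratic form of the hollow Gram matrix of pure noise.
\<close>

definition chaos :: "nat \<Rightarrow> nat \<Rightarrow> (nat \<Rightarrow> real) \<Rightarrow> (nat \<times> nat \<Rightarrow> real) \<Rightarrow> real" where
  "chaos p n z \<xi> = (\<Sum>r<p. (\<Sum>i<n. z i * \<xi> (r, i))\<^sup>2 - (\<Sum>i<n. (z i)\<^sup>2 * (\<xi> (r, i))\<^sup>2))"

lemma chaos_measurable[measurable]: "chaos p n z \<in> borel_measurable (PiM ({..<p} \<times> {..<n}) (\<lambda>_. borel))"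
  unfolding chaos_def by measurable

lemma chaos_mgf:
  assumes l: "\<bar>l\<bar> * sqnorm n z \<le> 1/8"
  shows "(\<integral>\<^sup>+\<xi>. ennreal (exp (l * chaos p n z \<xi>)) \<partial>gauss ({..<p} \<times> {..<n})) \<le>
    ennreal (exp (16 * real p * l\<^sup>2 * (sqnorm n z)\<^sup>2))"
proof -
  define h where "h \<omega> = ennreal (exp (l * ((\<Sum>i<n. z i * \<omega> i)\<^sup>2 - (\<Sum>i<n. (z i)\<^sup>2 * (\<omega> i)\<^sup>2))))" for \<omega> :: "nat \<Rightarrow> real"
  have "(\<integral>\<^sup>+\<xi>. ennreal (exp (l * chaos p n z \<xi>)) \<partial>gauss ({..<p} \<times> {..<n})) =
    (\<integral>\<^sup>+\<xi>. (\<Prod>r<p. h (\<lambda>j\<in>{..<n}. \<xi> (r, j))) \<partial>gauss ({..<p} \<times> {..<n}))"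
    by (intro nn_integral_cong) (simp add: chaos_def h_def sum_distrib_left exp_sum prod_ennreal)
  also have "\<dots> = (\<Prod>r<p. \<integral>\<^sup>+\<omega>. h \<omega> \<partial>gauss {..<n})"
    by (rule gauss_rows_prod) (auto simp: h_def)
  also have "\<dots> \<le> (\<Prod>r<p. ennreal (exp (16 * l\<^sup>2 * (sqnorm n z)\<^sup>2)))"
    using row_chaos_mgf[OF l] unfolding h_def by (intro prod_mono_ennreal)
  also have "\<dots> = ennreal (exp (16 * real p * l\<^sup>2 * (sqnorm n z)\<^sup>2))"
    by (simp add: ennreal_power exp_of_nat_mult[symmetric] mult_ac)
  finally show ?thesis .
qed

text \<open>
  The parameter \<open>l\<close> is left free: it has to be at most \<open>1/8\<close>, and the
  best value depends on the regime.
\<close>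

lemma chaos_tail:
  assumes v: "sqnorm n z > 0" and l: "0 \<le> l" "l \<le> 1/8" and u: "u \<ge> 0"
  shows "measure (gauss ({..<p} \<times> {..<n})) {\<xi> \<in> space (gauss ({..<p} \<times> {..<n})). u * sqnorm n z \<le> \<bar>chaos p n z \<xi>\<bar>}
    \<le> 2 * exp (16 * real p * l\<^sup>2 - l * u)"
proof -
  let ?M = "gauss ({..<p} \<times> {..<n})"
  interpret prob_space ?M by (rule prob_space_gauss)
  define v where "v = sqnorm n z"
  have v: "v > 0" using assms by (simp add: v_def)
  define L where "L = l / v"
  have L: "L \<ge> 0" "L * v = l" using l v by (auto simp: L_def)
  have one: "measure ?M {\<xi> \<in> space ?M. 0 \<le> s * L * chaos p n z \<xi> - l * u} \<le> exp (16 * real p * l\<^sup>2 - l * u)"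
    if s: "s \<in> {-1, 1}" for s
  proof (rule measure_le_exp_moment)
    have "(\<integral>\<^sup>+\<xi>. ennreal (exp (s * L * chaos p n z \<xi> - l * u)) \<partial>?M) =
        (\<integral>\<^sup>+\<xi>. ennreal (exp (- l * u)) * ennreal (exp (s * L * chaos p n z \<xi>)) \<partial>?M)"
      by (intro nn_integral_cong) (simp flip: ennreal_mult exp_add)
    also have "\<dots> = ennreal (exp (- l * u)) * (\<integral>\<^sup>+\<xi>. ennreal (exp (s * L * chaos p n z \<xi>)) \<partial>?M)"
      by (rule nn_integral_cmult) measurable
    also have "\<dots> \<le> ennreal (exp (- l * u)) * ennreal (exp (16 * real p * (s * L)\<^sup>2 * v\<^sup>2))"
      unfolding v_def using s L l by (intro mult_left_mono chaos_mgf) (auto simp: v_def[symmetric] abs_mult)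
    also have "\<dots> = ennreal (exp (16 * real p * l\<^sup>2 - l * u))"
      using s L(2) by (auto simp: power_mult_distrib mult.assoc L(2)[symmetric] simp flip: ennreal_mult exp_add)
    finally show "(\<integral>\<^sup>+\<xi>. ennreal (exp (s * L * chaos p n z \<xi> - l * u)) \<partial>?M) \<le> ennreal (exp (16 * real p * l\<^sup>2 - l * u))" .
  qed (auto intro: prob_space_axioms)
  let ?P = "{\<xi> \<in> space ?M. 0 \<le> 1 * L * chaos p n z \<xi> - l * u}"
  let ?N = "{\<xi> \<in> space ?M. 0 \<le> -1 * L * chaos p n z \<xi> - l * u}"
  have "{\<xi> \<in> space ?M. u * v \<le> \<bar>chaos p n z \<xi>\<bar>} \<subseteq> ?P \<union> ?N"
  proof safe
    fix \<xi> assume "\<xi> \<in> space ?M" "u * v \<le> \<bar>chaos p n z \<xi>\<bar>" and n: "\<not> 0 \<le> -1 * L * chaos p n z \<xi> - l * u"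
    have "L * (u * v) \<le> L * \<bar>chaos p n z \<xi>\<bar>" using \<open>u * v \<le> _\<close> L(1) by (rule mult_left_mono)
    moreover have "L * (u * v) = (L * v) * u" by simp
    ultimately have "l * u \<le> L * \<bar>chaos p n z \<xi>\<bar>" unfolding L(2) by simp
    then show "0 \<le> 1 * L * chaos p n z \<xi> - l * u" using n by (simp add: abs_if split: if_splits)
  qed
  then have "measure ?M {\<xi> \<in> space ?M. u * v \<le> \<bar>chaos p n z \<xi>\<bar>} \<le> measure ?M (?P \<union> ?N)"
    by (intro finite_measure_mono) measurable
  also have "\<dots> \<le> measure ?M ?P + measure ?M ?N"
    by (intro measure_Un_le) measurable
  also have "\<dots> \<le> exp (16 * real p * l\<^sup>2 - l * u) + exp (16 * real p * l\<^sup>2 - l * u)"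
    by (intro add_mono one) auto
  finally show ?thesis by (simp add: v_def)
qed

section \<open>Operator norm of the noise and margins\<close>

text \<open>
  The data divided by the noise level.
\<close>

definition signal_plus :: "(nat \<Rightarrow> real) \<Rightarrow> (nat \<Rightarrow> real) \<Rightarrow> (nat \<times> nat \<Rightarrow> real) \<Rightarrow> nat \<times> nat \<Rightarrow> real" where
  "signal_plus t \<eta> \<xi> = (\<lambda>(r, i). t r * \<eta> i + \<xi> (r, i))"

text \<open>
  The coefficients of the part of the quadratic form \<open>z\<^sup>T W z\<close> that is linear
  in the noise: the interaction of signal and noise in the hollow Gram matrix.
\<close>

definition cross_coeff :: "nat \<Rightarrow> (nat \<Rightarrow> real) \<Rightarrow> (nat \<Rightarrow> real) \<Rightarrow> (nat \<Rightarrow> real) \<Rightarrow> nat \<times> nat \<Rightarrow> real" where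
  "cross_coeff n t \<eta> z = (\<lambda>(r, i). 2 * t r * z i * ((\<Sum>j<n. z j * \<eta> j) - z i * \<eta> i))"

lemma bilin_gram:
  "bilin n (gram_offdiag p X) z z = (\<Sum>r<p. (\<Sum>i<n. z i * X (r, i))\<^sup>2 - (\<Sum>i<n. (z i)\<^sup>2 * (X (r, i))\<^sup>2))"
proof -
  have "bilin n (gram_offdiag p X) z z =
     (\<Sum>i<n. \<Sum>j<n. (\<Sum>r<p. (z i * X (r, i)) * (z j * X (r, j))) - (if i = j then \<Sum>r<p. (z i)\<^sup>2 * (X (r, i))\<^sup>2 else 0))"
    unfolding bilin_def gram_offdiag_def
    by (intro sum.cong refl) (auto simp: sum_distrib_left sum_distrib_right power2_eq_square mult_ac intro!: sum.cong)
  also have "\<dots> = (\<Sum>i<n. \<Sum>j<n. \<Sum>r<p. (z i * X (r, i)) * (z j * X (r, j))) - (\<Sum>i<n. \<Sum>r<p. (z i)\<^sup>2 * (X (r, i))\<^sup>2)"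
    by (simp add: sum_subtractf)
  also have "(\<Sum>i<n. \<Sum>j<n. \<Sum>r<p. (z i * X (r, i)) * (z j * X (r, j))) =
      (\<Sum>i<n. \<Sum>r<p. \<Sum>j<n. (z i * X (r, i)) * (z j * X (r, j)))"
    by (intro sum.cong refl sum.swap)
  also have "\<dots> = (\<Sum>r<p. \<Sum>i<n. \<Sum>j<n. (z i * X (r, i)) * (z j * X (r, j)))"
    by (rule sum.swap)
  also have "\<dots> = (\<Sum>r<p. (\<Sum>i<n. z i * X (r, i))\<^sup>2)"
    by (simp add: power2_eq_square sum_product)
  also have "(\<Sum>i<n. \<Sum>r<p. (z i)\<^sup>2 * (X (r, i))\<^sup>2) = (\<Sum>r<p. \<Sum>i<n. (z i)\<^sup>2 * (X (r, i))\<^sup>2)"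
    by (rule sum.swap)
  finally show ?thesis by (simp add: sum_subtractf)
qed

lemma deviation_quadratic:
  assumes label: "\<And>i. i < n \<Longrightarrow> \<eta> i \<in> {-1, 1}"
  shows "bilin n (deviation (gram_offdiag p (signal_plus t \<eta> \<xi>)) \<eta> (\<Sum>r<p. (t r)\<^sup>2)) z z =
    chaos p n z \<xi> + (\<Sum>k\<in>{..<p} \<times> {..<n}. cross_coeff n t \<eta> z k * \<xi> k)"
proof -
  define D where "D = (\<Sum>j<n. z j * \<eta> j)"
  define S where "S = (\<Sum>r<p. (t r)\<^sup>2)"
  have sq: "(\<eta> i)\<^sup>2 = 1" if "i < n" for i using label[OF that] by auto
  have "bilin n (deviation (gram_offdiag p (signal_plus t \<eta> \<xi>)) \<eta> S) z z =
     bilin n (gram_offdiag p (signal_plus t \<eta> \<xi>)) z z -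
     (\<Sum>i<n. \<Sum>j<n. S * ((z i * \<eta> i) * (z j * \<eta> j)) - (if i = j then S * (z i)\<^sup>2 else 0))"
    unfolding bilin_def deviation_def
    by (simp add: sum_subtractf[symmetric]) (auto intro!: sum.cong simp: algebra_simps power2_eq_square)
  also have "(\<Sum>i<n. \<Sum>j<n. S * ((z i * \<eta> i) * (z j * \<eta> j)) - (if i = j then S * (z i)\<^sup>2 else 0)) =
     S * (D\<^sup>2 - sqnorm n z)"
    by (simp add: sum_subtractf D_def power2_eq_square sqnorm_def sum_product right_diff_distrib flip: sum_distrib_left)
  also have "bilin n (gram_offdiag p (signal_plus t \<eta> \<xi>)) z z =
     (\<Sum>r<p. (t r)\<^sup>2 * (D\<^sup>2 - sqnorm n z) + (\<Sum>i<n. cross_coeff n t \<eta> z (r, i) * \<xi> (r, i)) +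
        ((\<Sum>i<n. z i * \<xi> (r, i))\<^sup>2 - (\<Sum>i<n. (z i)\<^sup>2 * (\<xi> (r, i))\<^sup>2)))"
    unfolding bilin_gram
  proof (intro sum.cong refl)
    fix r
    define G where "G = (\<Sum>i<n. z i * \<xi> (r, i))"
    define E where "E = (\<Sum>i<n. (z i)\<^sup>2 * \<eta> i * \<xi> (r, i))"
    have 1: "(\<Sum>i<n. z i * signal_plus t \<eta> \<xi> (r, i)) = t r * D + G"
      by (simp add: signal_plus_def D_def G_def sum.distrib sum_distrib_left algebra_simps)
    have 2: "(\<Sum>i<n. (z i)\<^sup>2 * (signal_plus t \<eta> \<xi> (r, i))\<^sup>2) =
        (t r)\<^sup>2 * sqnorm n z + 2 * t r * E + (\<Sum>i<n. (z i)\<^sup>2 * (\<xi> (r, i))\<^sup>2)"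
    proof -
      have "(\<Sum>i<n. (z i)\<^sup>2 * (signal_plus t \<eta> \<xi> (r, i))\<^sup>2) =
        (\<Sum>i<n. (t r)\<^sup>2 * (z i)\<^sup>2 + 2 * t r * ((z i)\<^sup>2 * \<eta> i * \<xi> (r, i)) + (z i)\<^sup>2 * (\<xi> (r, i))\<^sup>2)"
        using sq by (intro sum.cong refl) (simp add: signal_plus_def power2_sum power_mult_distrib algebra_simps)
      then show ?thesis by (simp add: sum.distrib sqnorm_def E_def flip: sum_distrib_left)
    qed
    have 3: "(\<Sum>i<n. cross_coeff n t \<eta> z (r, i) * \<xi> (r, i)) = 2 * t r * (D * G - E)"
    proof -
      have "(\<Sum>i<n. cross_coeff n t \<eta> z (r, i) * \<xi> (r, i)) =
        (\<Sum>i<n. 2 * t r * (D * (z i * \<xi> (r, i)) - (z i)\<^sup>2 * \<eta> i * \<xi> (r, i)))"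
        unfolding cross_coeff_def prod.case D_def[symmetric]
        by (intro sum.cong refl) (simp add: power2_eq_square algebra_simps)
      then show ?thesis by (simp add: sum_subtractf G_def E_def flip: sum_distrib_left)
    qed
    show "(\<Sum>i<n. z i * signal_plus t \<eta> \<xi> (r, i))\<^sup>2 - (\<Sum>i<n. (z i)\<^sup>2 * (signal_plus t \<eta> \<xi> (r, i))\<^sup>2) =
       (t r)\<^sup>2 * (D\<^sup>2 - sqnorm n z) + (\<Sum>i<n. cross_coeff n t \<eta> z (r, i) * \<xi> (r, i)) +
        ((\<Sum>i<n. z i * \<xi> (r, i))\<^sup>2 - (\<Sum>i<n. (z i)\<^sup>2 * (\<xi> (r, i))\<^sup>2))"
      unfolding 1 2 3 G_def[symmetric] by (simp add: power2_eq_square algebra_simps)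
  qed
  also have "\<dots> = S * (D\<^sup>2 - sqnorm n z) + (\<Sum>k\<in>{..<p} \<times> {..<n}. cross_coeff n t \<eta> z k * \<xi> k) + chaos p n z \<xi>"
    by (simp add: sum.distrib S_def sum_distrib_right sum.cartesian_product chaos_def)
  finally show ?thesis by (simp add: S_def)
qed

lemma cross_coeff_sum:
  assumes label: "\<And>i. i < n \<Longrightarrow> \<eta> i \<in> {-1, 1}"
  shows "(\<Sum>k\<in>{..<p} \<times> {..<n}. (cross_coeff n t \<eta> z k)\<^sup>2) \<le> 4 * (\<Sum>r<p. (t r)\<^sup>2) * real n * (sqnorm n z)\<^sup>2"
proof -
  have sq: "(\<eta> i)\<^sup>2 = 1" if "i < n" for i using label[OF that] by auto
  have bound: "((\<Sum>j<n. z j * \<eta> j) - z i * \<eta> i)\<^sup>2 \<le> real n * sqnorm n z" if i: "i < n" for i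
  proof -
    have "(\<Sum>j<n. z j * \<eta> j) - z i * \<eta> i = (\<Sum>j<n. z j * (if j = i then 0 else \<eta> j))"
      using i by (subst (1 2) sum.remove[of _ i]) (auto intro!: sum.cong)
    then have "((\<Sum>j<n. z j * \<eta> j) - z i * \<eta> i)\<^sup>2 \<le> (\<Sum>j<n. (z j)\<^sup>2) * (\<Sum>j<n. (if j = i then 0 else \<eta> j)\<^sup>2)"
      by (simp only: Cauchy_Schwarz_ineq_sum)
    also have "\<dots> \<le> (\<Sum>j<n. (z j)\<^sup>2) * (\<Sum>j<n. 1)"
      using sq by (intro mult_left_mono sum_mono sum_nonneg) auto
    finally show ?thesis by (simp add: sqnorm_def mult.commute)
  qed
  have "(\<Sum>k\<in>{..<p} \<times> {..<n}. (cross_coeff n t \<eta> z k)\<^sup>2) =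
      (\<Sum>r<p. \<Sum>i<n. 4 * (t r)\<^sup>2 * ((z i)\<^sup>2 * ((\<Sum>j<n. z j * \<eta> j) - z i * \<eta> i)\<^sup>2))"
    by (simp add: sum.cartesian_product cross_coeff_def power_mult_distrib split_def mult.assoc)
  also have "\<dots> \<le> (\<Sum>r<p. \<Sum>i<n. 4 * (t r)\<^sup>2 * ((z i)\<^sup>2 * (real n * sqnorm n z)))"
    using bound by (intro sum_mono mult_left_mono) auto
  also have "\<dots> = (\<Sum>r<p. 4 * (t r)\<^sup>2 * (sqnorm n z * (real n * sqnorm n z)))"
  proof -
    have "(\<Sum>i<n. 4 * (t r)\<^sup>2 * ((z i)\<^sup>2 * C)) = 4 * (t r)\<^sup>2 * (sqnorm n z * C)" for r C
      by (simp add: sqnorm_def sum_distrib_left sum_distrib_right)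
    then show ?thesis by simp
  qed
  also have "\<dots> = 4 * (\<Sum>r<p. (t r)\<^sup>2) * (sqnorm n z * (real n * sqnorm n z))"
    by (simp only: sum_distrib_left sum_distrib_right)
  also have "\<dots> = 4 * (\<Sum>r<p. (t r)\<^sup>2) * real n * (sqnorm n z)\<^sup>2"
    by (simp add: power2_eq_square)
  finally show ?thesis .
qed

text \<open>
  Used to compare the size of the net with exponentially small probabilities.
\<close>

lemma two_power_le_exp: "(2::real) ^ k \<le> exp (real k)"
proof -
  have "(2::real) ^ k \<le> exp 1 ^ k" using exp_ge_add_one_self[of 1] by (intro power_mono) auto
  then show ?thesis by (simp add: exp_of_nat_mult[symmetric])
qed

text \<open>
  For a fixed net point both parts of the quadratic form, the chaos and the linear part, exceed
  their allowance with probability at most \<open>2e\<^bsup>-20n\<^esup>\<close>, which beats the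
  at most \<open>2\<^bsup>18n\<^esup> \<le> e\<^bsup>18n\<^esup>\<close> points of the net. The
  two conditions on \<open>R\<close> say that \<open>S\<close> is large compared with 1 and with
  \<open>\<surd>(p/n)\<close>, as the linear part and the chaos require respectively.
\<close>

lemma deviation_bound_whp:
  fixes t \<eta> :: "nat \<Rightarrow> real" and \<gamma> R :: real
  assumes n: "n > 0" and \<gamma>: "0 < \<gamma>" "\<gamma> \<le> 1" and R: "R \<ge> 1000 / \<gamma>"
    and label: "\<And>i. i < n \<Longrightarrow> \<eta> i \<in> {-1, 1}"
    and S_def: "S = (\<Sum>r<p. (t r)\<^sup>2)" and S1: "S \<ge> R\<^sup>2" and S2: "real n * S\<^sup>2 \<ge> R\<^sup>2 * real p"
  shows "\<exists>B \<in> sets (gauss ({..<p} \<times> {..<n})). measure (gauss ({..<p} \<times> {..<n})) B \<le> 4 * exp (- 2 * real n) \<and>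
    (\<forall>\<xi>\<in>space (gauss ({..<p} \<times> {..<n})) - B. \<forall>x.
      \<bar>bilin n (deviation (gram_offdiag p (signal_plus t \<eta> \<xi>)) \<eta> S) x x\<bar> \<le> \<gamma> * real n * S * sqnorm n x)"
proof -
  let ?K = "{..<p} \<times> {..<n}"
  let ?M = "gauss ?K"
  interpret prob_space ?M by (rule prob_space_gauss)
  have R1: "R \<ge> 1000" 
  proof -
    have "1000 \<le> 1000 / \<gamma>" using \<gamma> by (simp add: le_divide_eq)
    then show ?thesis using R by linarith
  qed
  have R\<gamma>: "R * \<gamma> \<ge> 1000" using R \<gamma> by (simp add: pos_divide_le_eq)
  have RR: "R \<le> R\<^sup>2" using R1 self_le_power[of R 2] by simp
  have S: "S > 0" "S \<ge> R" using S1 RR R1 by auto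
  \<comment> \<open>\<open>u\<close> is the allowance per unit of \<open>|z|\<^sup>2\<close>: two parts, and the
      factor 3 lost in passing from the net to all vectors\<close>
  define u where "u = \<gamma> * real n * S / 6"
  have u: "u \<ge> 0" using \<gamma> S by (simp add: u_def)
  define C where "C z = {\<xi> \<in> space ?M. u * sqnorm n z \<le> \<bar>chaos p n z \<xi>\<bar>}" for z
  define L where "L z = {\<xi> \<in> space ?M. u * sqnorm n z \<le> \<bar>\<Sum>k\<in>?K. cross_coeff n t \<eta> z k * \<xi> k\<bar>}" for z
  have [measurable]: "C z \<in> sets ?M" "L z \<in> sets ?M" for z
    unfolding C_def L_def by measurable
  have PC: "measure ?M (C z) \<le> 2 * exp (- 20 * real n)" if z: "sqnorm n z > 0" for z
  proof -
    \<comment> \<open>then \<open>16 p l\<^sup>2 \<le> n/4\<close> and \<open>l u \<ge> 1000 n/48\<close>, which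
        exceeds \<open>20 n + n/4\<close>\<close>
    define l where "l = R / (8 * S)"
    have l: "0 \<le> l" "l \<le> 1/8" using S R1 by (auto simp: l_def divide_le_eq)
    have "measure ?M (C z) \<le> 2 * exp (16 * real p * l\<^sup>2 - l * u)"
      unfolding C_def by (rule chaos_tail[OF z l u])
    moreover have "16 * real p * l\<^sup>2 \<le> real n / 4"
    proof -
      have "16 * real p * l\<^sup>2 = (R\<^sup>2 * real p) / (4 * S\<^sup>2)" by (simp add: l_def power_divide power_mult_distrib)
      also have "\<dots> \<le> (real n * S\<^sup>2) / (4 * S\<^sup>2)" using S2 S by (intro divide_right_mono) auto
      finally show ?thesis using S by simp
    qed
    moreover have "l * u = (R * \<gamma>) * real n / 48" using S by (simp add: l_def u_def)
    moreover have "(R * \<gamma>) * real n \<ge> 1000 * real n" using R\<gamma> by (intro mult_right_mono) auto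
    ultimately have "measure ?M (C z) \<le> 2 * exp (16 * real p * l\<^sup>2 - l * u)"
      and "16 * real p * l\<^sup>2 - l * u \<le> - 20 * real n" by linarith+
    then show ?thesis by (meson exp_le_cancel_iff mult_left_mono order_trans zero_le_numeral)
  qed
  have PL: "measure ?M (L z) \<le> 2 * exp (- 20 * real n)" if z: "sqnorm n z > 0" for z
  proof -
    define v where "v = sqnorm n z"
    have v: "v > 0" using z by (simp add: v_def)
    have "measure ?M (L z) \<le> 2 * exp (- ((u * v)\<^sup>2 / (2 * (4 * S * real n * v\<^sup>2))))"
      unfolding L_def v_def S_def
      using cross_coeff_sum[OF label, where p = p and t = t and z = z] u v S n
      by (intro gauss_linear_abs_tail) (auto simp: v_def S_def)
    also have "(u * v)\<^sup>2 / (2 * (4 * S * real n * v\<^sup>2)) = \<gamma>\<^sup>2 * S * real n / 288"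
      using v S n by (simp add: u_def power2_eq_square field_simps)
    also have "2 * exp (- (\<gamma>\<^sup>2 * S * real n / 288)) \<le> 2 * exp (- 20 * real n)"
    proof -
      have "(1000::real)\<^sup>2 \<le> (R * \<gamma>)\<^sup>2" using R\<gamma> by (intro power_mono) auto
      also have "(R * \<gamma>)\<^sup>2 \<le> \<gamma>\<^sup>2 * S" using S1 \<gamma> by (simp add: power_mult_distrib mult.commute mult_left_mono)
      finally have "1000000 * real n \<le> \<gamma>\<^sup>2 * S * real n" by (intro mult_right_mono) auto
      then show ?thesis by simp
    qed
    finally show ?thesis .
  qed
  define Z where "Z = {z \<in> int_net n. sqnorm n (\<lambda>i. real_of_int (z i)) > 0}"
  have Z: "finite Z" "real (card Z) \<le> 2 ^ (18 * n)"
  proof -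
    show "finite Z" using finite_int_net by (simp add: Z_def)
    have "card Z \<le> card (int_net n)" using finite_int_net by (intro card_mono) (auto simp: Z_def)
    then show "real (card Z) \<le> 2 ^ (18 * n)" using card_int_net[of n] by linarith
  qed
  define B where "B = (\<Union>z\<in>Z. C (\<lambda>i. real_of_int (z i)) \<union> L (\<lambda>i. real_of_int (z i)))"
  have B[measurable]: "B \<in> sets ?M" unfolding B_def using Z(1) by (intro sets.finite_UN) auto
  have "measure ?M B \<le> (\<Sum>z\<in>Z. measure ?M (C (\<lambda>i. real_of_int (z i)) \<union> L (\<lambda>i. real_of_int (z i))))"
    unfolding B_def using Z(1) by (intro finite_measure_subadditive_finite) auto
  also have "\<dots> \<le> (\<Sum>z\<in>Z. 4 * exp (- 20 * real n))"
  proof (intro sum_mono)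
    fix z assume "z \<in> Z"
    then have z: "sqnorm n (\<lambda>i. real_of_int (z i)) > 0" by (simp add: Z_def)
    have "measure ?M (C (\<lambda>i. real_of_int (z i)) \<union> L (\<lambda>i. real_of_int (z i))) \<le>
      measure ?M (C (\<lambda>i. real_of_int (z i))) + measure ?M (L (\<lambda>i. real_of_int (z i)))"
      by (intro measure_Un_le) measurable
    then show "measure ?M (C (\<lambda>i. real_of_int (z i)) \<union> L (\<lambda>i. real_of_int (z i))) \<le> 4 * exp (- 20 * real n)"
      using PC[OF z] PL[OF z] by linarith
  qed
  also have "\<dots> = real (card Z) * (4 * exp (- 20 * real n))" by simp
  also have "\<dots> \<le> exp (18 * real n) * (4 * exp (- 20 * real n))"
    using order_trans[OF Z(2) two_power_le_exp[of "18 * n"]] by (intro mult_right_mono) auto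
  also have "\<dots> = 4 * exp (- 2 * real n)" by (simp flip: exp_add)
  finally have PB: "measure ?M B \<le> 4 * exp (- 2 * real n)" .
  have good: "\<bar>bilin n (deviation (gram_offdiag p (signal_plus t \<eta> \<xi>)) \<eta> S) x x\<bar> \<le> \<gamma> * real n * S * sqnorm n x"
    if \<xi>: "\<xi> \<in> space ?M - B" for \<xi> x
  proof -
    let ?W = "deviation (gram_offdiag p (signal_plus t \<eta> \<xi>)) \<eta> S"
    have "\<bar>bilin n ?W x x\<bar> \<le> 3 * (\<gamma> * real n * S / 3) * sqnorm n x"
    proof (rule quadratic_bound_from_net)
      show "?W i j = ?W j i" for i j
        by (simp add: deviation_def gram_offdiag_sym[of _ _ i j] mult.commute)
      show "\<gamma> * real n * S / 3 \<ge> 0" using \<gamma> S by simp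
      fix z assume z: "z \<in> int_net n"
      let ?z = "\<lambda>i. real_of_int (z i)"
      show "\<bar>bilin n ?W ?z ?z\<bar> \<le> 16 * real n * (\<gamma> * real n * S / 3)"
      proof (cases "z \<in> Z")
        case True
        then have "\<xi> \<notin> C ?z" "\<xi> \<notin> L ?z" using \<xi> by (auto simp: B_def)
        then have "\<bar>chaos p n ?z \<xi>\<bar> < u * sqnorm n ?z" "\<bar>\<Sum>k\<in>?K. cross_coeff n t \<eta> ?z k * \<xi> k\<bar> < u * sqnorm n ?z"
          using \<xi> by (auto simp: C_def L_def)
        moreover have "bilin n ?W ?z ?z = chaos p n ?z \<xi> + (\<Sum>k\<in>?K. cross_coeff n t \<eta> ?z k * \<xi> k)"
          unfolding S_def by (rule deviation_quadratic) (rule label)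
        ultimately have "\<bar>bilin n ?W ?z ?z\<bar> \<le> 2 * (u * sqnorm n ?z)"
          by linarith
        also have "u * sqnorm n ?z \<le> u * (16 * real n)"
          using z u by (intro mult_left_mono) (auto simp: int_net_def)
        also have "2 * (u * (16 * real n)) = 16 * real n * (\<gamma> * real n * S / 3)"
          by (simp add: u_def)
        finally show ?thesis by simp
      next
        case False
        then have "sqnorm n ?z = 0" using z sqnorm_nonneg[of n ?z] by (simp add: Z_def)
        then have "\<bar>bilin n ?W ?z ?z\<bar> \<le> 0" using bilin_crude[of n ?W ?z] by simp
        also have "0 \<le> 16 * real n * (\<gamma> * real n * S / 3)" using \<gamma> S by simp
        finally show ?thesis .
      qed
    qed (use n in auto)
    then show ?thesis by simp
  qed
  show ?thesis using B PB good by blast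
qed

text \<open>
  Given the other columns, the noise of column \<open>i\<close> is Gaussian and enters linearly;
  integrating it out leaves a quadratic exponential in the sum \<open>\<Sum>\<^sub>j
  \<eta>\<^sub>j\<omega>\<^sub>j\<close>, a Gaussian of variance \<open>m = n-1\<close>.
\<close>

lemma row_margin_mgf:
  fixes \<eta> :: "nat \<Rightarrow> real"
  assumes i: "i < n" and n: "n \<ge> 3" and label: "\<And>j. j < n \<Longrightarrow> \<eta> j \<in> {-1, 1}"
    and \<kappa>: "0 \<le> \<kappa>" "\<kappa> \<le> 1" and m_def: "m = real n - 1"
  shows "(\<integral>\<^sup>+\<omega>. ennreal (exp (- (\<kappa> / m) * ((t + \<eta> i * \<omega> i) * (m * t + (\<Sum>j\<in>{..<n} - {i}. \<eta> j * \<omega> j))))) \<partial>gauss {..<n})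
    \<le> ennreal (exp (- \<kappa> * t\<^sup>2 + \<kappa>\<^sup>2 / 2 * t\<^sup>2 + \<kappa>\<^sup>2 * t\<^sup>2 / (2 * (m - 1)) + \<kappa>\<^sup>2 / (2 * (m - 1))))"
proof -
  define J where "J = {..<n} - {i}"
  have J: "finite J" "i \<notin> J" "{..<n} = insert i J" using i by (auto simp: J_def)
  interpret product_sigma_finite "\<lambda>_::nat. std_normal" by (rule product_sigma_std_normal)
  have m: "m \<ge> 2" using n by (simp add: m_def)
  define l where "l = \<kappa> / m"
  have lm: "l * m = \<kappa>" using m by (simp add: l_def)
  define A where "A \<omega> = m * t + (\<Sum>j\<in>J. \<eta> j * \<omega> j)" for \<omega> :: "nat \<Rightarrow> real"
  have [measurable]: "A \<in> borel_measurable (gauss J)" "A \<in> borel_measurable (gauss (insert i J))"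
    unfolding A_def by measurable
  have \<eta>2: "(\<eta> j)\<^sup>2 = 1" if "j < n" for j using label[OF that] by auto
  have "(\<integral>\<^sup>+\<omega>. ennreal (exp (- l * ((t + \<eta> i * \<omega> i) * A \<omega>))) \<partial>gauss (insert i J)) =
     (\<integral>\<^sup>+\<omega>. (\<integral>\<^sup>+y. ennreal (exp (- l * ((t + \<eta> i * (fun_upd \<omega> i y) i) * A (fun_upd \<omega> i y)))) \<partial>std_normal) \<partial>gauss J)"
    using J by (intro product_nn_integral_insert) measurable
  also have "\<dots> = (\<integral>\<^sup>+\<omega>. ennreal (exp (- l * t * A \<omega> + l\<^sup>2 * (A \<omega>)\<^sup>2 / 2)) \<partial>gauss J)"
  proof (intro nn_integral_cong)
    fix \<omega> :: "nat \<Rightarrow> real"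
    have Aeq: "A (fun_upd \<omega> i y) = A \<omega>" for y
      unfolding A_def using J(2) by (intro arg_cong2[where f = "(+)"] refl sum.cong) auto
    define a where "a = - l * \<eta> i * A \<omega>"
    have "(\<integral>\<^sup>+y. ennreal (exp (- l * ((t + \<eta> i * (fun_upd \<omega> i y) i) * A (fun_upd \<omega> i y)))) \<partial>std_normal) =
       (\<integral>\<^sup>+y. ennreal (exp (- l * t * A \<omega>)) * ennreal (exp (a * y + 0 * y\<^sup>2)) \<partial>std_normal)"
      unfolding Aeq by (intro nn_integral_cong) (simp add: a_def algebra_simps flip: ennreal_mult exp_add)
    also have "\<dots> = ennreal (exp (- l * t * A \<omega>)) * ennreal (tilt_factor a 0)"
      by (subst nn_integral_cmult, measurable) (subst std_normal_exp_quadratic, auto)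
    also have "tilt_factor a 0 = exp (l\<^sup>2 * (A \<omega>)\<^sup>2 / 2)"
      using \<eta>2[OF i] by (simp add: tilt_factor_def a_def power_mult_distrib)
    also have "ennreal (exp (- l * t * A \<omega>)) * ennreal (exp (l\<^sup>2 * (A \<omega>)\<^sup>2 / 2)) =
      ennreal (exp (- l * t * A \<omega> + l\<^sup>2 * (A \<omega>)\<^sup>2 / 2))"
      by (simp only: exp_add ennreal_mult exp_ge_zero)
    finally show "(\<integral>\<^sup>+y. ennreal (exp (- l * ((t + \<eta> i * (fun_upd \<omega> i y) i) * A (fun_upd \<omega> i y)))) \<partial>std_normal) =
      ennreal (exp (- l * t * A \<omega> + l\<^sup>2 * (A \<omega>)\<^sup>2 / 2))" .
  qed
  also have "\<dots> = (\<integral>\<^sup>+\<omega>. (\<lambda>w. ennreal (exp (- l * t * (m * t + w) + l\<^sup>2 * (m * t + w)\<^sup>2 / 2))) (\<Sum>j\<in>J. \<eta> j * \<omega> j) \<partial>gauss J)"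
    by (simp add: A_def)
  also have "\<dots> = (\<integral>\<^sup>+z. ennreal (exp (- l * t * (m * t + sqrt (\<Sum>j\<in>J. (\<eta> j)\<^sup>2) * z) +
      l\<^sup>2 * (m * t + sqrt (\<Sum>j\<in>J. (\<eta> j)\<^sup>2) * z)\<^sup>2 / 2)) \<partial>std_normal)"
    using J(1) by (rule gauss_linear) measurable
  also have "(\<Sum>j\<in>J. (\<eta> j)\<^sup>2) = m"
  proof -
    have "(\<Sum>j\<in>J. (\<eta> j)\<^sup>2) = (\<Sum>j\<in>J. 1)" using \<eta>2 J(3) by (intro sum.cong) auto
    also have "\<dots> = real n - 1" using i by (simp add: J_def card_Diff_singleton of_nat_diff)
    finally show ?thesis by (simp add: m_def)
  qed
  also have "(\<integral>\<^sup>+z. ennreal (exp (- l * t * (m * t + sqrt m * z) + l\<^sup>2 * (m * t + sqrt m * z)\<^sup>2 / 2)) \<partial>std_normal) =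
     (\<integral>\<^sup>+z. ennreal (exp (- \<kappa> * t\<^sup>2 + \<kappa>\<^sup>2 / 2 * t\<^sup>2)) * ennreal (exp (sqrt m * l * t * (\<kappa> - 1) * z + (\<kappa> * l / 2) * z\<^sup>2)) \<partial>std_normal)"
  proof (intro nn_integral_cong)
    fix z
    define q where "q = sqrt m"
    have q: "q * q = m" using m by (simp add: q_def)
    have "- l * t * (m * t + q * z) + l\<^sup>2 * (m * t + q * z)\<^sup>2 / 2 =
      - (l * m) * t\<^sup>2 + (l * m)\<^sup>2 / 2 * t\<^sup>2 + (q * l * t * ((l * m) - 1) * z + (l * (l * (q * q)) / 2) * z\<^sup>2)"
      by (simp add: power2_eq_square algebra_simps)
    also have "\<dots> = - \<kappa> * t\<^sup>2 + \<kappa>\<^sup>2 / 2 * t\<^sup>2 + (q * l * t * (\<kappa> - 1) * z + (\<kappa> * l / 2) * z\<^sup>2)"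
      unfolding q lm by (simp add: mult.commute)
    finally have e: "- l * t * (m * t + q * z) + l\<^sup>2 * (m * t + q * z)\<^sup>2 / 2 =
      (- \<kappa> * t\<^sup>2 + \<kappa>\<^sup>2 / 2 * t\<^sup>2) + (q * l * t * (\<kappa> - 1) * z + (\<kappa> * l / 2) * z\<^sup>2)" .
    show "ennreal (exp (- l * t * (m * t + sqrt m * z) + l\<^sup>2 * (m * t + sqrt m * z)\<^sup>2 / 2)) =
      ennreal (exp (- \<kappa> * t\<^sup>2 + \<kappa>\<^sup>2 / 2 * t\<^sup>2)) * ennreal (exp (sqrt m * l * t * (\<kappa> - 1) * z + (\<kappa> * l / 2) * z\<^sup>2))"
      unfolding e[unfolded q_def] exp_add[of "- \<kappa> * t\<^sup>2 + \<kappa>\<^sup>2 / 2 * t\<^sup>2"] by (rule ennreal_mult) simp_all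
  qed
  also have "\<dots> = ennreal (exp (- \<kappa> * t\<^sup>2 + \<kappa>\<^sup>2 / 2 * t\<^sup>2)) * ennreal (tilt_factor (sqrt m * l * t * (\<kappa> - 1)) (\<kappa> * l / 2))"
  proof -
    have "\<kappa> * l \<le> 1 * (1 / 2)" unfolding l_def using \<kappa> m by (intro mult_mono) (auto simp: divide_le_eq)
    then show ?thesis by (subst nn_integral_cmult, measurable) (subst std_normal_exp_quadratic, auto)
  qed
  also have "tilt_factor (sqrt m * l * t * (\<kappa> - 1)) (\<kappa> * l / 2) \<le> exp (\<kappa>\<^sup>2 * t\<^sup>2 / (2 * (m - 1)) + \<kappa>\<^sup>2 / (2 * (m - 1)))"
  proof -
    define c where "c = 1 - \<kappa> * l"
    have \<kappa>2: "\<kappa>\<^sup>2 \<le> 1" "\<kappa> * \<kappa> \<le> 1" using \<kappa> by (auto simp: power_le_one mult_le_one)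
    have cm: "c * m = m - \<kappa>\<^sup>2" using lm by (simp add: c_def power2_eq_square algebra_simps)
    have "c * m > 0" unfolding cm using m \<kappa>2 by linarith
    then have c: "c > 0" using m by (simp add: zero_less_mult_iff)
    have "(sqrt m * l * t * (\<kappa> - 1))\<^sup>2 / (2 * c) = (l * m) * l * t\<^sup>2 * (1 - \<kappa>)\<^sup>2 / (2 * c)"
      using m by (simp add: power_mult_distrib power2_commute[of \<kappa>]) (simp add: power2_eq_square)
    also have "\<dots> = \<kappa>\<^sup>2 * t\<^sup>2 * (1 - \<kappa>)\<^sup>2 / (2 * (c * m))"
      unfolding lm using m c by (simp add: l_def power2_eq_square field_simps)
    also have "\<dots> \<le> \<kappa>\<^sup>2 * t\<^sup>2 * 1 / (2 * (m - 1))"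
      unfolding cm using \<kappa> \<kappa>2 m by (intro frac_le mult_left_mono) (auto simp: power_le_one)
    finally have 1: "(sqrt m * l * t * (\<kappa> - 1))\<^sup>2 / (2 * c) \<le> \<kappa>\<^sup>2 * t\<^sup>2 / (2 * (m - 1))" by simp
    have "- ln c = ln (1 / c)" using c by (simp add: ln_div)
    also have "\<dots> \<le> 1 / c - 1" using c by (intro ln_le_minus_one) simp
    also have "\<dots> = (m - c * m) / (c * m)"
      using c m by (simp add: field_simps)
    also have "\<dots> = \<kappa>\<^sup>2 / (c * m)" by (simp add: cm)
    also have "\<dots> \<le> \<kappa>\<^sup>2 / (m - 1)" unfolding cm using \<kappa>2 m by (intro divide_left_mono) auto
    finally have "- ln c / 2 \<le> \<kappa>\<^sup>2 / (m - 1) / 2" by (rule divide_right_mono) simp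
    then have 2: "- (ln c / 2) \<le> \<kappa>\<^sup>2 / (2 * (m - 1))"
      by (simp only: divide_divide_eq_left mult.commute[of 2] minus_divide_left)
    have cc: "1 - 2 * (\<kappa> * l / 2) = c" by (simp add: c_def)
    have e: "exp (- (ln c / 2)) = 1 / sqrt c"
      using c by (simp add: exp_minus ln_sqrt[symmetric] field_simps)
    have "tilt_factor (sqrt m * l * t * (\<kappa> - 1)) (\<kappa> * l / 2) =
        exp ((sqrt m * l * t * (\<kappa> - 1))\<^sup>2 / (2 * c) + - (ln c / 2))"
      unfolding tilt_factor_def cc exp_add e by simp
    then show ?thesis using 1 2 by simp
  qed
  finally have main: "(\<integral>\<^sup>+\<omega>. ennreal (exp (- l * ((t + \<eta> i * \<omega> i) * A \<omega>))) \<partial>gauss (insert i J)) \<le>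
     ennreal (exp (- \<kappa> * t\<^sup>2 + \<kappa>\<^sup>2 / 2 * t\<^sup>2)) * ennreal (exp (\<kappa>\<^sup>2 * t\<^sup>2 / (2 * (m - 1)) + \<kappa>\<^sup>2 / (2 * (m - 1))))"
    by (simp add: mult_left_mono ennreal_leI)
  show ?thesis
    using main[folded J(3)] unfolding A_def J_def l_def
    by (simp only: ennreal_mult[symmetric] exp_add[symmetric] exp_ge_zero add.assoc)
qed

lemma margin_expand:
  assumes i: "i < n" and label: "\<And>j. j < n \<Longrightarrow> \<eta> j \<in> {-1, 1}"
  shows "\<eta> i * (\<Sum>j<n. gram_offdiag p (signal_plus t \<eta> \<xi>) i j * \<eta> j) =
    (\<Sum>r<p. (t r + \<eta> i * \<xi> (r, i)) * ((real n - 1) * t r + (\<Sum>j\<in>{..<n} - {i}. \<eta> j * \<xi> (r, j))))"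
proof -
  let ?X = "signal_plus t \<eta> \<xi>"
  have sq: "\<eta> j * \<eta> j = 1" if "j < n" for j using label[OF that] by auto
  have "\<eta> i * (\<Sum>j<n. gram_offdiag p ?X i j * \<eta> j) =
      \<eta> i * (\<Sum>j\<in>{..<n} - {i}. \<Sum>r<p. ?X (r, i) * (\<eta> j * ?X (r, j)))"
    using i by (subst sum.remove[of _ i]) (auto simp: gram_offdiag_def sum_distrib_left sum_distrib_right mult_ac intro!: sum.cong)
  also have "\<dots> = \<eta> i * (\<Sum>r<p. \<Sum>j\<in>{..<n} - {i}. ?X (r, i) * (\<eta> j * ?X (r, j)))"
    by (subst sum.swap) simp
  also have "\<dots> = (\<Sum>r<p. (\<eta> i * ?X (r, i)) * (\<Sum>j\<in>{..<n} - {i}. \<eta> j * ?X (r, j)))"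
    by (simp add: sum_distrib_left mult.assoc)
  also have "\<dots> = (\<Sum>r<p. (t r + \<eta> i * \<xi> (r, i)) * ((real n - 1) * t r + (\<Sum>j\<in>{..<n} - {i}. \<eta> j * \<xi> (r, j))))"
  proof (intro sum.cong refl arg_cong2[where f = "(*)"])
    fix r
    show "\<eta> i * ?X (r, i) = t r + \<eta> i * \<xi> (r, i)"
      using sq[OF i] by (simp add: signal_plus_def algebra_simps)
    have "(\<Sum>j\<in>{..<n} - {i}. \<eta> j * ?X (r, j)) = (\<Sum>j\<in>{..<n} - {i}. t r + \<eta> j * \<xi> (r, j))"
      using sq by (intro sum.cong refl) (simp add: signal_plus_def algebra_simps)
    also have "\<dots> = real (n - 1) * t r + (\<Sum>j\<in>{..<n} - {i}. \<eta> j * \<xi> (r, j))"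
      using i by (simp add: sum.distrib)
    finally show "(\<Sum>j\<in>{..<n} - {i}. \<eta> j * ?X (r, j)) =
        (real n - 1) * t r + (\<Sum>j\<in>{..<n} - {i}. \<eta> j * \<xi> (r, j))"
      using i by (simp add: of_nat_diff)
  qed
  finally show ?thesis .
qed

text \<open>
  Chernoff with \<open>\<kappa> = S/(S+p/n)\<close>. For large \<open>n\<close> the exponent of
  the moment is close to \<open>-\<kappa>S + \<kappa>\<^sup>2(S + p/n)/2\<close>, and this
  \<open>\<kappa>\<close> minimises it, with value \<open>-\<rho>/2\<close>. The factors
  \<open>(n-4)/(n-2)\<close> and \<open>4\<beta>\<close> account for finite \<open>n\<close> and
  for the positive threshold.
\<close>

lemma margin_tail:
  assumes i: "i < n" and n: "n \<ge> 5" and label: "\<And>j. j < n \<Longrightarrow> \<eta> j \<in> {-1, 1}"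
    and S_def: "S = (\<Sum>r<p. (t r)\<^sup>2)" and S: "S > 0" and \<beta>: "\<beta> \<ge> 0"
    and \<rho>_def: "\<rho> = S\<^sup>2 / (S + real p / real n)"
  shows "measure (gauss ({..<p} \<times> {..<n})) {\<xi> \<in> space (gauss ({..<p} \<times> {..<n})).
      \<eta> i * (\<Sum>j<n. gram_offdiag p (signal_plus t \<eta> \<xi>) i j * \<eta> j) \<le> \<beta> * real n * S} \<le>
    exp (- (\<rho> / 2 * ((real n - 4) / (real n - 2) - 4 * \<beta>)))"
proof -
  let ?K = "{..<p} \<times> {..<n}"
  let ?M = "gauss ?K"
  define q where "q = real p / real n"
  define m where "m = real n - 1"
  define \<kappa> where "\<kappa> = S / (S + q)"
  have q: "q \<ge> 0" by (simp add: q_def)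
  have m: "m \<ge> 4" using n by (simp add: m_def)
  have \<kappa>: "0 \<le> \<kappa>" "\<kappa> \<le> 1" using S q by (auto simp: \<kappa>_def)
  have \<kappa>S: "\<kappa> * S = \<rho>" by (simp add: \<kappa>_def \<rho>_def q_def power2_eq_square)
  have \<kappa>q: "\<kappa> * (S + q) = S" using S q by (simp add: \<kappa>_def)
  have \<rho>: "\<rho> \<ge> 0" using \<kappa>S \<kappa> S by (metis less_imp_le mult_nonneg_nonneg)
  define l where "l = \<kappa> / m"
  have l: "l \<ge> 0" using \<kappa> m by (simp add: l_def)
  define D where "D r \<omega> = (t r + \<eta> i * \<omega> i) * (m * t r + (\<Sum>j\<in>{..<n} - {i}. \<eta> j * \<omega> j))" for r and \<omega> :: "nat \<Rightarrow> real"
  have [measurable]: "D r \<in> borel_measurable (PiM {..<n} (\<lambda>_. borel))" for r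
    unfolding D_def using i
    by (intro borel_measurable_times borel_measurable_add borel_measurable_sum borel_measurable_const
      measurable_component_singleton) auto
  define T where "T \<xi> = (\<Sum>r<p. D r (\<lambda>j\<in>{..<n}. \<xi> (r, j)))" for \<xi> :: "nat \<times> nat \<Rightarrow> real"
  have T: "\<eta> i * (\<Sum>j<n. gram_offdiag p (signal_plus t \<eta> \<xi>) i j * \<eta> j) = T \<xi>" for \<xi>
  proof -
    have "\<eta> i * (\<Sum>j<n. gram_offdiag p (signal_plus t \<eta> \<xi>) i j * \<eta> j) =
      (\<Sum>r<p. (t r + \<eta> i * \<xi> (r, i)) * ((real n - 1) * t r + (\<Sum>j\<in>{..<n} - {i}. \<eta> j * \<xi> (r, j))))"
      by (rule margin_expand[OF i]) (rule label)
    also have "\<dots> = T \<xi>"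
      unfolding T_def D_def m_def
      using i by (intro sum.cong refl arg_cong2[where f = "(*)"] arg_cong2[where f = "(+)"]) auto
    finally show ?thesis .
  qed
  have rowm: "(\<lambda>\<xi>. \<lambda>j\<in>{..<n}. \<xi> (r, j)) \<in> PiM ?K (\<lambda>_. borel) \<rightarrow>\<^sub>M PiM {..<n} (\<lambda>_. borel)" if "r < p" for r
    using that by (intro measurable_restrict) auto
  have [measurable]: "T \<in> borel_measurable (PiM ?K (\<lambda>_. borel))"
    unfolding T_def by (intro borel_measurable_sum measurable_compose[OF rowm]) auto
  define h where "h r \<omega> = ennreal (exp (- l * D r \<omega>))" for r and \<omega> :: "nat \<Rightarrow> real"
  have [measurable]: "h r \<in> borel_measurable (PiM {..<n} (\<lambda>_. borel))" for r
    unfolding h_def by measurable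
  define G where "G r = - \<kappa> * (t r)\<^sup>2 + \<kappa>\<^sup>2 / 2 * (t r)\<^sup>2 + \<kappa>\<^sup>2 * (t r)\<^sup>2 / (2 * (m - 1)) + \<kappa>\<^sup>2 / (2 * (m - 1))" for r
  have "(\<integral>\<^sup>+\<xi>. ennreal (exp (l * (\<beta> * real n * S) - l * T \<xi>)) \<partial>?M) =
     (\<integral>\<^sup>+\<xi>. ennreal (exp (l * (\<beta> * real n * S))) * (\<Prod>r<p. h r (\<lambda>j\<in>{..<n}. \<xi> (r, j))) \<partial>?M)"
  proof (intro nn_integral_cong)
    fix \<xi> :: "nat \<times> nat \<Rightarrow> real"
    have "(\<Prod>r<p. h r (\<lambda>j\<in>{..<n}. \<xi> (r, j))) = ennreal (exp (- l * T \<xi>))"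
      unfolding h_def T_def by (subst prod_ennreal) (auto simp only: exp_ge_zero exp_sum[OF finite_lessThan, symmetric] sum_distrib_left)
    then show "ennreal (exp (l * (\<beta> * real n * S) - l * T \<xi>)) =
        ennreal (exp (l * (\<beta> * real n * S))) * (\<Prod>r<p. h r (\<lambda>j\<in>{..<n}. \<xi> (r, j)))"
      by (simp flip: ennreal_mult exp_add)
  qed
  also have "\<dots> = ennreal (exp (l * (\<beta> * real n * S))) * (\<integral>\<^sup>+\<xi>. (\<Prod>r<p. h r (\<lambda>j\<in>{..<n}. \<xi> (r, j))) \<partial>?M)"
    by (intro nn_integral_cmult borel_measurable_prod_ennreal measurable_compose[OF rowm, folded measurable_cong_sets[OF sets_gauss refl]])
      auto
  also have "(\<integral>\<^sup>+\<xi>. (\<Prod>r<p. h r (\<lambda>j\<in>{..<n}. \<xi> (r, j))) \<partial>?M) = (\<Prod>r<p. \<integral>\<^sup>+\<omega>. h r \<omega> \<partial>gauss {..<n})"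
    by (rule gauss_rows_prod) auto
  also have "\<dots> \<le> (\<Prod>r<p. ennreal (exp (G r)))"
  proof (rule prod_mono_ennreal)
    fix r
    show "(\<integral>\<^sup>+\<omega>. h r \<omega> \<partial>gauss {..<n}) \<le> ennreal (exp (G r))"
      unfolding h_def D_def G_def l_def using n by (intro row_margin_mgf[OF i _ label \<kappa> m_def]) auto
  qed
  also have "(\<Prod>r<p. ennreal (exp (G r))) = ennreal (exp (\<Sum>r<p. G r))"
    by (subst prod_ennreal) (auto simp: exp_sum)
  also have "(\<Sum>r<p. G r) = - \<rho> + \<kappa>\<^sup>2 / 2 * S + \<kappa>\<^sup>2 * S / (2 * (m - 1)) + real p * (\<kappa>\<^sup>2 / (2 * (m - 1)))"
  proof -
    have "(\<Sum>r<p. G r) = - \<kappa> * S + \<kappa>\<^sup>2 / 2 * S + \<kappa>\<^sup>2 * S / (2 * (m - 1)) + real p * (\<kappa>\<^sup>2 / (2 * (m - 1)))"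
      unfolding G_def S_def by (simp add: sum.distrib sum_subtractf sum_distrib_left sum_divide_distrib sum_negf)
    then show ?thesis by (simp add: \<kappa>S)
  qed
  finally have "(\<integral>\<^sup>+\<xi>. ennreal (exp (l * (\<beta> * real n * S) - l * T \<xi>)) \<partial>?M) \<le>
     ennreal (exp (l * (\<beta> * real n * S))) *
     ennreal (exp (- \<rho> + \<kappa>\<^sup>2 / 2 * S + \<kappa>\<^sup>2 * S / (2 * (m - 1)) + real p * (\<kappa>\<^sup>2 / (2 * (m - 1)))))"
    by (simp add: mult_left_mono)
  also have "\<dots> = ennreal (exp (l * (\<beta> * real n * S) + (- \<rho> + \<kappa>\<^sup>2 / 2 * S + \<kappa>\<^sup>2 * S / (2 * (m - 1)) + real p * (\<kappa>\<^sup>2 / (2 * (m - 1))))))"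
    by (subst exp_add) (rule ennreal_mult[symmetric]; simp)
  also have "\<dots> \<le> ennreal (exp (- (\<rho> / 2 * ((real n - 4) / (real n - 2) - 4 * \<beta>))))"
  proof (intro ennreal_leI, simp only: exp_le_cancel_iff)
    have "l * (\<beta> * real n * S) = \<rho> * \<beta> * (real n / m)" by (simp add: l_def \<kappa>S[symmetric])
    also have "\<dots> \<le> \<rho> * \<beta> * 2"
      using \<rho> \<beta> m by (intro mult_left_mono) (auto simp: m_def divide_le_eq)
    finally have 1: "l * (\<beta> * real n * S) \<le> \<rho> * \<beta> * 2" .
    define N where "N = real n - 2"
    have N: "N \<ge> 3" "m - 1 = N" "real n = N + 2" using n by (auto simp: N_def m_def)
    have "\<kappa>\<^sup>2 / 2 * S + \<kappa>\<^sup>2 * S / (2 * (m - 1)) + real p * (\<kappa>\<^sup>2 / (2 * (m - 1))) =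
      \<kappa>\<^sup>2 / 2 * (S * ((N + 1) / N) + q * ((N + 2) / N))"
    proof -
      have "real p = q * (N + 2)" using n by (simp add: q_def N(3)[symmetric])
      then show ?thesis using N(1) by (simp add: N(2) field_simps)
    qed
    also have "\<dots> \<le> \<kappa>\<^sup>2 / 2 * (S * ((N + 2) / N) + q * ((N + 2) / N))"
      using N S q by (intro mult_left_mono add_mono divide_right_mono) auto
    also have "\<dots> = \<kappa> * (\<kappa> * (S + q)) / 2 * ((N + 2) / N)"
      by (simp add: power2_eq_square algebra_simps)
    also have "\<dots> = \<rho> / 2 * ((N + 2) / N)" unfolding \<kappa>q \<kappa>S ..
    finally have 2: "\<kappa>\<^sup>2 / 2 * S + \<kappa>\<^sup>2 * S / (2 * (m - 1)) + real p * (\<kappa>\<^sup>2 / (2 * (m - 1))) \<le> \<rho> / 2 * ((N + 2) / N)" .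
    have two: "(N + 2) / N + (N - 2) / N = 2" using N(1) by (simp add: field_simps)
    have "\<rho> / 2 * ((N + 2) / N) + \<rho> / 2 * ((N - 2) / N) = \<rho>"
      unfolding distrib_left[symmetric] two by simp
    moreover have "(N - 2) / N = (real n - 4) / (real n - 2)" by (simp add: N_def)
    moreover have "\<rho> / 2 * ((real n - 4) / (real n - 2) - 4 * \<beta>) = \<rho> / 2 * ((real n - 4) / (real n - 2)) - \<rho> * \<beta> * 2"
      by (simp add: right_diff_distrib)
    ultimately show "l * (\<beta> * real n * S) + (- \<rho> + \<kappa>\<^sup>2 / 2 * S + \<kappa>\<^sup>2 * S / (2 * (m - 1)) + real p * (\<kappa>\<^sup>2 / (2 * (m - 1))))
      \<le> - (\<rho> / 2 * ((real n - 4) / (real n - 2) - 4 * \<beta>))"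
      using 1 2 by (simp only:)
  qed
  finally have "measure ?M {\<xi> \<in> space ?M. 0 \<le> l * (\<beta> * real n * S) - l * T \<xi>} \<le>
      exp (- (\<rho> / 2 * ((real n - 4) / (real n - 2) - 4 * \<beta>)))"
    by (intro measure_le_exp_moment prob_space_gauss) auto
  moreover have "measure ?M {\<xi> \<in> space ?M. T \<xi> \<le> \<beta> * real n * S} \<le>
      measure ?M {\<xi> \<in> space ?M. 0 \<le> l * (\<beta> * real n * S) - l * T \<xi>}"
  proof (rule finite_measure.finite_measure_mono)
    show "finite_measure ?M" using prob_space_gauss by (rule prob_space.finite_measure)
    show "{\<xi> \<in> space ?M. T \<xi> \<le> \<beta> * real n * S} \<subseteq> {\<xi> \<in> space ?M. 0 \<le> l * (\<beta> * real n * S) - l * T \<xi>}"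
      using l by (auto intro: mult_left_mono)
  qed measurable
  ultimately show ?thesis unfolding T by linarith
qed

section \<open>Risk of iterates started at large Rayleigh quotients\<close>

lemma gauss_component_measurable:
  assumes "k \<in> K"
  shows "(\<lambda>\<xi>. \<xi> k) \<in> borel_measurable (gauss K)"
  by (subst measurable_cong_sets[OF sets_gauss refl]) (rule measurable_component_singleton[OF assms])

lemma label_vectors_label: "\<eta> \<in> label_vectors n \<Longrightarrow> i < n \<Longrightarrow> \<eta> i \<in> {-1, 1}"
  by (auto simp: label_vectors_def PiE_iff)

lemma noise_eq_gauss: "noise p n = gauss ({..<p} \<times> {..<n})"
  by (simp add: noise_def)

lemma estimator_label:
  assumes "est \<in> estimators p n" "Y \<in> space (obs_space p n)" "j < n"
  shows "est Y j \<in> {-1, 1}"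
proof -
  have "est Y \<in> space (PiM {..<n} (\<lambda>_. count_space {-1, 1::real}))"
    using assms(1,2) unfolding estimators_def by (rule measurable_space)
  then have "est Y \<in> PiE {..<n} (\<lambda>_. {-1, 1})" unfolding space_PiM space_count_space .
  moreover have "j \<in> {..<n}" using assms(3) by simp
  ultimately show ?thesis by (rule PiE_mem)
qed

lemma estimator_component_measurable:
  assumes "est \<in> estimators p n" "j < n"
  shows "(\<lambda>Y. est Y j) \<in> borel_measurable (obs_space p n)"
proof -
  have "est \<in> obs_space p n \<rightarrow>\<^sub>M (\<Pi>\<^sub>M j\<in>{..<n}. count_space {-1, 1})"
    using assms(1) unfolding estimators_def .
  moreover have "j \<in> {..<n}" using assms(2) by simp
  ultimately have "(\<lambda>Y. est Y j) \<in> obs_space p n \<rightarrow>\<^sub>M count_space {-1, 1::real}"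
    by (rule measurable_compose[OF _ measurable_component_singleton])
  moreover have "(\<lambda>x. x) \<in> count_space {-1, 1::real} \<rightarrow>\<^sub>M borel" by simp
  ultimately show ?thesis by (rule measurable_compose)
qed

lemma loss_measurable:
  assumes "est \<in> estimators p n"
  shows "(\<lambda>Y. loss n (est Y) \<eta>) \<in> borel_measurable (obs_space p n)"
proof -
  have sums: "(\<lambda>Y. \<Sum>j<n. \<bar>est Y j - \<nu> * \<eta> j\<bar>) \<in> borel_measurable (obs_space p n)" for \<nu>
    by (intro borel_measurable_sum borel_measurable_abs borel_measurable_diff borel_measurable_const
      estimator_component_measurable[OF assms]) simp
  have "(\<lambda>Y. min (\<Sum>j<n. \<bar>est Y j - -1 * \<eta> j\<bar>) (\<Sum>j<n. \<bar>est Y j - 1 * \<eta> j\<bar>)) \<in> borel_measurable (obs_space p n)"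
    by (intro borel_measurable_min sums)
  moreover have "loss n (est Y) \<eta> = min (\<Sum>j<n. \<bar>est Y j - -1 * \<eta> j\<bar>) (\<Sum>j<n. \<bar>est Y j - 1 * \<eta> j\<bar>)" for Y
    unfolding loss_def by simp
  ultimately show ?thesis by (simp only:)
qed

lemma loss_cong: "(\<And>j. j < n \<Longrightarrow> x j = y j) \<Longrightarrow> loss n x \<eta> = loss n y \<eta>"
  unfolding loss_def by (intro arg_cong[where f = Min] image_cong refl sum.cong) auto

text \<open>
  The data as a function of the noise.
\<close>

definition observe ::
  "nat \<Rightarrow> nat \<Rightarrow> real \<Rightarrow> (nat \<Rightarrow> real) \<Rightarrow> (nat \<Rightarrow> real) \<Rightarrow> (nat \<times> nat \<Rightarrow> real) \<Rightarrow> nat \<times> nat \<Rightarrow> real" where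
  "observe p n \<sigma> \<theta> \<eta> \<xi> = (\<lambda>(i, j) \<in> {..<p} \<times> {..<n}. \<theta> i * \<eta> j + \<sigma> * \<xi> (i, j))"

lemma observe_measurable[measurable]:
  "observe p n \<sigma> \<theta> \<eta> \<in> gauss ({..<p} \<times> {..<n}) \<rightarrow>\<^sub>M obs_space p n"
  unfolding observe_def obs_space_def by (rule measurable_restrict) (auto split: prod.split)

lemma risk_eq_gauss:
  assumes "est \<in> estimators p n"
  shows "risk p n \<sigma> est (\<theta>, \<eta>) = (\<integral>\<xi>. loss n (est (observe p n \<sigma> \<theta> \<eta> \<xi>)) \<eta> \<partial>gauss ({..<p} \<times> {..<n}))"
proof -
  have "risk p n \<sigma> est (\<theta>, \<eta>) =
    (\<integral>Y. loss n (est Y) \<eta> \<partial>distr (gauss ({..<p} \<times> {..<n})) (obs_space p n) (observe p n \<sigma> \<theta> \<eta>))"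
    unfolding risk_def obs_law_def noise_eq_gauss prod.case observe_def[abs_def] ..
  also have "\<dots> = (\<integral>\<xi>. loss n (est (observe p n \<sigma> \<theta> \<eta> \<xi>)) \<eta> \<partial>gauss ({..<p} \<times> {..<n}))"
    by (rule integral_distr[OF observe_measurable loss_measurable[OF assms]])
  finally show ?thesis .
qed

lemma snr_square:
  assumes "\<sigma> > 0" "n > 0"
  shows "(snr p n \<sigma> \<Delta>)\<^sup>2 = (\<Delta>\<^sup>2 / \<sigma>\<^sup>2)\<^sup>2 / (\<Delta>\<^sup>2 / \<sigma>\<^sup>2 + real p / real n)"
proof -
  have sq: "(a / sqrt b)\<^sup>2 = a\<^sup>2 / b" if "b \<ge> 0" for a b :: real using that by (simp add: power_divide)
  show ?thesis unfolding snr_def by (rule sq) simp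
qed

text \<open>
  The signal-to-noise ratio is increasing in the norm of the signal, so the smallest admissible
  norm is the worst.
\<close>

lemma ratio_mono:
  fixes x y q :: real
  assumes "0 < x" "x \<le> y" "0 \<le> q"
  shows "x\<^sup>2 / (x + q) \<le> y\<^sup>2 / (y + q)"
proof -
  have "x\<^sup>2 * (y + q) \<le> y\<^sup>2 * (x + q)"
  proof -
    have "x * (x * y) \<le> y * (x * y)" using assms by (intro mult_right_mono) auto
    moreover have "x\<^sup>2 * q \<le> y\<^sup>2 * q" using assms by (intro mult_right_mono power_mono) auto
    ultimately show ?thesis by (simp add: power2_eq_square algebra_simps)
  qed
  then show ?thesis using assms by (simp add: divide_le_eq pos_le_divide_eq mult.commute)
qed

text \<open>
  The estimators to which the analysis applies: the starting vector may depend on the data in any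
  way as long as its Rayleigh quotient is at least that of every label vector. This covers the
  spectral initialisation and also an exact maximiser over label vectors.
\<close>

definition rayleigh_iterate ::
  "nat \<Rightarrow> nat \<Rightarrow> real \<Rightarrow> nat \<Rightarrow> ((nat \<times> nat \<Rightarrow> real) \<Rightarrow> nat \<Rightarrow> real) \<Rightarrow> bool" where
  "rayleigh_iterate p n s k est \<longleftrightarrow> (\<forall>Y\<in>space (obs_space p n). \<exists>v. sqnorm n v > 0 \<and>
     (\<forall>\<eta>\<in>label_vectors n. bilin n (gram_offdiag p Y) \<eta> \<eta> * sqnorm n v \<le> bilin n (gram_offdiag p Y) v v * real n) \<and>
     (\<forall>j<n. est Y j = label_iterate s n (gram_offdiag p Y) v k j))"

text \<open>
  Outside the exceptional event \<open>B\<close> of \<open>deviation_bound_whp\<close> the data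
  satisfy \<open>planted_labels\<close> with signal strength \<open>\<sigma>\<^sup>2S\<close>, and
  \<open>loss_label_iterate\<close> bounds the loss by the number of low margins. On
  \<open>B\<close> the loss is at most \<open>n\<close>. Taking expectations needs only the
  probabilities of \<open>B\<close> and of single low margins.
\<close>

lemma risk_rayleigh_iterate:
  assumes est: "est \<in> estimators p n" and ray: "rayleigh_iterate p n s k est" and s: "s \<in> {-1, 1}"
    and n: "n \<ge> 5" and \<sigma>: "\<sigma> > 0" and \<Delta>: "\<Delta> > 0" and \<beta>: "0 < \<beta>" "\<beta> \<le> 1"
    and \<beta>n: "4 * \<beta> \<le> (real n - 4) / (real n - 2)"
    and R: "snr p n \<sigma> \<Delta> \<ge> 16000 / \<beta>"
    and \<omega>: "(\<theta>, \<eta>) \<in> Omega p n \<Delta>"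
  shows "risk p n \<sigma> est (\<theta>, \<eta>) \<le> 2 * real n / 16 ^ k +
    (4 + 8 / \<beta>) * (real n * exp (- ((snr p n \<sigma> \<Delta>)\<^sup>2 / 2 * ((real n - 4) / (real n - 2) - 4 * \<beta>)))) +
    4 * (real n * exp (- 2 * real n))"
proof -
  let ?K = "{..<p} \<times> {..<n}"
  let ?M = "gauss ?K"
  interpret prob_space ?M by (rule prob_space_gauss)
  define R where "R = snr p n \<sigma> \<Delta>"
  define E where "E = exp (- (R\<^sup>2 / 2 * ((real n - 4) / (real n - 2) - 4 * \<beta>)))"
  have npos: "n > 0" using n by simp
  have \<eta>: "\<eta> \<in> label_vectors n" using \<omega> by (simp add: Omega_def)
  have label: "\<eta> j \<in> {-1, 1}" if "j < n" for j using \<eta> that by (rule label_vectors_label)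
  define t where "t r = \<theta> r / \<sigma>" for r
  define S where "S = (\<Sum>r<p. (t r)\<^sup>2)"
  define q where "q = real p / real n"
  have q: "q \<ge> 0" by (simp add: q_def)
  have "\<Delta> \<le> L2_set \<theta> {..<p}" using \<omega> by (simp add: Omega_def)
  then have "\<Delta>\<^sup>2 \<le> (\<Sum>r<p. (\<theta> r)\<^sup>2)" 
    using power_mono[of \<Delta> "L2_set \<theta> {..<p}" 2] \<Delta> by (simp add: L2_set_def sum_nonneg)
  then have "\<Delta>\<^sup>2 / \<sigma>\<^sup>2 \<le> (\<Sum>r<p. (\<theta> r)\<^sup>2) / \<sigma>\<^sup>2" by (rule divide_right_mono) simp
  also have "\<dots> = S" by (simp add: S_def t_def power_divide sum_divide_distrib)
  finally have \<Delta>S: "\<Delta>\<^sup>2 / \<sigma>\<^sup>2 \<le> S" .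
  have S: "S > 0" 
  proof -
    have "0 < \<Delta>\<^sup>2 / \<sigma>\<^sup>2" using \<Delta> \<sigma> by simp
    then show ?thesis using \<Delta>S by linarith
  qed
  define \<rho> where "\<rho> = S\<^sup>2 / (S + real p / real n)"
  have R\<rho>: "R\<^sup>2 \<le> \<rho>"
    unfolding R_def snr_square[OF \<sigma> npos] \<rho>_def using \<Delta>S \<Delta> \<sigma> q by (intro ratio_mono) (auto simp: q_def)
  have R0: "R \<ge> 16000" 
  proof -
    have "16000 \<le> 16000 / \<beta>" using \<beta> by (simp add: le_divide_eq)
    then show ?thesis using R unfolding R_def by linarith
  qed
  have \<rho>S: "\<rho> \<le> S" "\<rho> * (S + q) = S\<^sup>2"
    using S q by (auto simp: \<rho>_def q_def[symmetric] divide_le_eq power2_eq_square add_pos_nonneg)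
  have S1: "S \<ge> R\<^sup>2" using \<rho>S R\<rho> by linarith
  have S2: "real n * S\<^sup>2 \<ge> R\<^sup>2 * real p"
  proof -
    have "R\<^sup>2 * q \<le> \<rho> * q" using R\<rho> q by (rule mult_right_mono)
    also have "\<dots> \<le> \<rho> * (S + q)" using R\<rho> S by (intro mult_left_mono) (auto intro: order_trans[of _ "R\<^sup>2"])
    finally have "real n * (R\<^sup>2 * q) \<le> real n * S\<^sup>2" unfolding \<rho>S(2) by (intro mult_left_mono) auto
    then show ?thesis using npos by (simp add: q_def)
  qed
  \<comment> \<open>the tolerance in \<open>planted_labels\<close>; it turns the condition \<open>R \<ge>
      1000/\<gamma>\<close> into \<open>R \<ge> 16000/\<beta>\<close>\<close>
  define \<gamma> where "\<gamma> = \<beta> / 16"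
  have \<gamma>: "0 < \<gamma>" "\<gamma> \<le> 1" using \<beta> by (auto simp: \<gamma>_def)
  have R\<gamma>: "R \<ge> 1000 / \<gamma>" using R by (simp add: \<gamma>_def R_def)
  have "\<exists>B \<in> sets ?M. measure ?M B \<le> 4 * exp (- 2 * real n) \<and>
    (\<forall>\<xi>\<in>space ?M - B. \<forall>x.
      \<bar>bilin n (deviation (gram_offdiag p (signal_plus t \<eta> \<xi>)) \<eta> S) x x\<bar> \<le> \<gamma> * real n * S * sqnorm n x)"
    by (rule deviation_bound_whp[OF npos \<gamma> R\<gamma> _ S_def S1 S2]) (rule label)
  then obtain B where B[measurable]: "B \<in> sets ?M" and B2: "measure ?M B \<le> 4 * exp (- 2 * real n) \<and>
    (\<forall>\<xi>\<in>space ?M - B. \<forall>x.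
      \<bar>bilin n (deviation (gram_offdiag p (signal_plus t \<eta> \<xi>)) \<eta> S) x x\<bar> \<le> \<gamma> * real n * S * sqnorm n x)"
    by (rule bexE)
  note PB = B2[THEN conjunct1]
  have good: "\<bar>bilin n (deviation (gram_offdiag p (signal_plus t \<eta> \<xi>)) \<eta> S) x x\<bar> \<le> \<gamma> * real n * S * sqnorm n x"
    if "\<xi> \<in> space ?M - B" for \<xi> x
    using B2[THEN conjunct2, rule_format, OF that] .
  define Lm where "Lm \<xi> = real (low_margin n (gram_offdiag p (signal_plus t \<eta> \<xi>)) \<eta> (\<beta> * real n * S))" for \<xi>
  define A where "A i = {\<xi> \<in> space ?M. \<eta> i * (\<Sum>j<n. gram_offdiag p (signal_plus t \<eta> \<xi>) i j * \<eta> j) \<le> \<beta> * real n * S}" for i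
  have A[measurable]: "A i \<in> sets ?M" if "i < n" for i
  proof -
    have sp: "(\<lambda>\<xi>. signal_plus t \<eta> \<xi> (r, j)) \<in> borel_measurable ?M" if "r < p" "j < n" for r j
      unfolding signal_plus_def prod.case
      by (intro borel_measurable_add borel_measurable_const gauss_component_measurable SigmaI) (use that in simp_all)
    have "(\<lambda>\<xi>. gram_offdiag p (signal_plus t \<eta> \<xi>) i j) \<in> borel_measurable ?M" if j: "j < n" for j
    proof (cases "i = j")
      case True
      show ?thesis unfolding gram_offdiag_def if_P[OF True] by (rule borel_measurable_const)
    next
      case False
      show ?thesis unfolding gram_offdiag_def if_not_P[OF False]
        by (intro borel_measurable_sum borel_measurable_times sp) (use j \<open>i < n\<close> in simp_all)
    qed
    then have [measurable]: "(\<lambda>\<xi>. \<Sum>j<n. gram_offdiag p (signal_plus t \<eta> \<xi>) i j * \<eta> j) \<in> borel_measurable ?M"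
      by (intro borel_measurable_sum borel_measurable_times borel_measurable_const) simp
    show ?thesis unfolding A_def by measurable
  qed
  have PA: "measure ?M (A i) \<le> E" if "i < n" for i
  proof -
    have "measure ?M (A i) \<le> exp (- (\<rho> / 2 * ((real n - 4) / (real n - 2) - 4 * \<beta>)))"
      unfolding A_def by (rule margin_tail[OF that n _ S_def S _ \<rho>_def]) (use label \<beta> in simp_all)
    also have "\<dots> \<le> E" unfolding E_def exp_le_cancel_iff neg_le_iff_le
      using R\<rho> \<beta>n by (intro mult_right_mono divide_right_mono) auto
    finally show ?thesis .
  qed
  have Lm: "Lm \<xi> = (\<Sum>i<n. indicator (A i) \<xi>)" if "\<xi> \<in> space ?M" for \<xi>
    using that by (simp add: Lm_def low_margin_def A_def indicator_def sum.If_cases Int_def)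
  define f where "f \<xi> = loss n (est (observe p n \<sigma> \<theta> \<eta> \<xi>)) \<eta>" for \<xi>
  define g where "g \<xi> = 2 * real n / 16 ^ k + (4 + 8 / \<beta>) * (\<Sum>i<n. indicator (A i) \<xi>) + real n * indicator B \<xi>" for \<xi>
  have obs: "observe p n \<sigma> \<theta> \<eta> \<xi> \<in> space (obs_space p n)" if "\<xi> \<in> space ?M" for \<xi>
    using measurable_space[OF observe_measurable that] .
  have fn: "f \<xi> \<le> real n" if "\<xi> \<in> space ?M" for \<xi>
    unfolding f_def by (intro loss_le_n estimator_label[OF est] obs that label)
  have fg: "f \<xi> \<le> g \<xi>" if \<xi>: "\<xi> \<in> space ?M" for \<xi>
  proof (cases "\<xi> \<in> B")
    case True
    have "0 \<le> 2 * real n / 16 ^ k + (4 + 8 / \<beta>) * (\<Sum>i<n. indicator (A i) \<xi>)"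
      using \<beta> by (intro add_nonneg_nonneg mult_nonneg_nonneg sum_nonneg) auto
    then show ?thesis using fn[OF \<xi>] True by (simp add: g_def)
  next
    case False
    let ?Y = "observe p n \<sigma> \<theta> \<eta> \<xi>" and ?X = "signal_plus t \<eta> \<xi>"
    let ?\<tau> = "\<sigma>\<^sup>2 * S"
    obtain v where v: "sqnorm n v > 0"
      "\<And>\<eta>. \<eta> \<in> label_vectors n \<Longrightarrow> bilin n (gram_offdiag p ?Y) \<eta> \<eta> * sqnorm n v \<le> bilin n (gram_offdiag p ?Y) v v * real n"
      "\<And>j. j < n \<Longrightarrow> est ?Y j = label_iterate s n (gram_offdiag p ?Y) v k j"
      using ray obs[OF \<xi>] unfolding rayleigh_iterate_def by blast
    have Y: "?Y (r, j) = \<sigma> * ?X (r, j)" if "r < p" "j < n" for r j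
      using that \<sigma> by (simp add: observe_def signal_plus_def t_def algebra_simps)
    \<comment> \<open>the data are \<open>\<sigma>\<close> times the normalised data, and the sign iteration
        does not see the scale\<close>
    have gram: "gram_offdiag p ?Y i j = \<sigma>\<^sup>2 * gram_offdiag p ?X i j" if "i < n" "j < n" for i j
      using that Y by (auto simp: gram_offdiag_def sum_distrib_left power2_eq_square mult_ac intro!: sum.cong)
    have dev: "bilin n (deviation (gram_offdiag p ?Y) \<eta> ?\<tau>) x x = \<sigma>\<^sup>2 * bilin n (deviation (gram_offdiag p ?X) \<eta> S) x x" for x
    proof -
      have "bilin n (deviation (gram_offdiag p ?Y) \<eta> ?\<tau>) x x =
        bilin n (\<lambda>i j. \<sigma>\<^sup>2 * deviation (gram_offdiag p ?X) \<eta> S i j) x x"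
        by (intro bilin_cong) (simp add: deviation_def gram algebra_simps)
      then show ?thesis by (simp add: bilin_def sum_distrib_left mult.assoc)
    qed
    interpret planted_labels n "gram_offdiag p ?Y" \<eta> ?\<tau> \<beta>
    proof
      show "0 < n" "0 < \<beta>" "\<beta> \<le> 1" using npos \<beta> by auto
      show "0 < ?\<tau>" using \<sigma> S by simp
      show "gram_offdiag p ?Y i j = gram_offdiag p ?Y j i" for i j by (rule gram_offdiag_sym)
      show "\<eta> i \<in> {-1, 1}" if "i < n" for i using that by (rule label)
      fix x
      have "\<sigma>\<^sup>2 * \<bar>bilin n (deviation (gram_offdiag p ?X) \<eta> S) x x\<bar> \<le> \<sigma>\<^sup>2 * (\<gamma> * real n * S * sqnorm n x)"
        using good[of \<xi> x] \<xi> False by (intro mult_left_mono) auto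
      then show "\<bar>bilin n (deviation (gram_offdiag p ?Y) \<eta> ?\<tau>) x x\<bar> \<le> \<beta> / 16 * real n * ?\<tau> * sqnorm n x"
        unfolding dev by (simp add: abs_mult \<gamma>_def mult_ac)
    qed
    have "f \<xi> = loss n (label_iterate s n (gram_offdiag p ?Y) v k) \<eta>"
      unfolding f_def using v(3) by (rule loss_cong)
    also have "\<dots> \<le> 2 * real n / 16 ^ k + (4 + 8 / \<beta>) * real (low_margin n (gram_offdiag p ?Y) \<eta> (\<beta> * real n * ?\<tau>))"
      by (rule loss_label_iterate[OF s v(1) v(2)[OF \<eta>]])
    also have "low_margin n (gram_offdiag p ?Y) \<eta> (\<beta> * real n * ?\<tau>) = low_margin n (gram_offdiag p ?X) \<eta> (\<beta> * real n * S)"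
    proof -
      have "(\<eta> i * (\<Sum>j<n. gram_offdiag p ?Y i j * \<eta> j) \<le> \<beta> * real n * ?\<tau>) =
        (\<eta> i * (\<Sum>j<n. gram_offdiag p ?X i j * \<eta> j) \<le> \<beta> * real n * S)" if "i < n" for i
      proof -
        have "\<eta> i * (\<Sum>j<n. gram_offdiag p ?Y i j * \<eta> j) = \<sigma>\<^sup>2 * (\<eta> i * (\<Sum>j<n. gram_offdiag p ?X i j * \<eta> j))"
          using that by (simp add: gram sum_distrib_left mult_ac)
        moreover have "\<beta> * real n * ?\<tau> = \<sigma>\<^sup>2 * (\<beta> * real n * S)" by simp
        ultimately show ?thesis using \<sigma> by (simp only: mult_le_cancel_left_pos zero_less_power)
      qed
      then show ?thesis unfolding low_margin_def by (intro arg_cong[where f = card]) auto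
    qed
    also have "real \<dots> = (\<Sum>i<n. indicator (A i) \<xi>)" using Lm[OF \<xi>] by (simp add: Lm_def)
    finally show ?thesis using False by (simp add: g_def)
  qed
  have [measurable]: "f \<in> borel_measurable ?M"
    unfolding f_def by (rule measurable_compose[OF observe_measurable loss_measurable[OF est]])
  have intf: "integrable ?M f"
    using fn loss_nonneg by (intro integrable_const_bound[where B = "real n"] AE_I2) (auto simp: f_def)
  have intA: "integrable ?M (\<lambda>\<xi>. \<Sum>i<n. indicator (A i) \<xi> :: real)"
    by (intro Bochner_Integration.integrable_sum integrable_real_indicator) (auto simp: emeasure_eq_measure)
  have intB: "integrable ?M (\<lambda>\<xi>. indicator B \<xi> :: real)"
    by (intro integrable_real_indicator) (auto simp: emeasure_eq_measure)
  have intg: "integrable ?M g"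
    unfolding g_def using intA intB by (intro Bochner_Integration.integrable_add integrable_mult_right) auto
  have "risk p n \<sigma> est (\<theta>, \<eta>) = (\<integral>\<xi>. f \<xi> \<partial>?M)" by (simp add: risk_eq_gauss[OF est] f_def)
  also have "\<dots> \<le> (\<integral>\<xi>. g \<xi> \<partial>?M)" using intf intg fg by (rule integral_mono)
  also have "\<dots> = 2 * real n / 16 ^ k + (4 + 8 / \<beta>) * (\<Sum>i<n. measure ?M (A i)) + real n * measure ?M B"
  proof -
    have "(\<integral>\<xi>. (\<Sum>i<n. indicator (A i) \<xi> :: real) \<partial>?M) = (\<Sum>i<n. measure ?M (A i))"
      by (subst Bochner_Integration.integral_sum) (auto simp: emeasure_eq_measure)
    moreover have "(\<integral>\<xi>. g \<xi> \<partial>?M) = 2 * real n / 16 ^ k + (4 + 8 / \<beta>) * (\<integral>\<xi>. (\<Sum>i<n. indicator (A i) \<xi> :: real) \<partial>?M)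
        + real n * (\<integral>\<xi>. indicator B \<xi> \<partial>?M)"
      unfolding g_def using intA intB by (simp add: prob_space)
    ultimately show ?thesis by simp
  qed
  also have "\<dots> \<le> 2 * real n / 16 ^ k + (4 + 8 / \<beta>) * (\<Sum>i<n. E) + real n * (4 * exp (- 2 * real n))"
    using PA PB \<beta> by (intro add_mono mult_left_mono sum_mono order_refl) auto
  finally show ?thesis by (simp add: E_def R_def mult_ac)
qed

section \<open>A Bayes lower bound and the case of a known signal\<close>

definition flip :: "nat \<Rightarrow> (nat \<Rightarrow> real) \<Rightarrow> nat \<Rightarrow> real" where
  "flip i \<eta> = (\<lambda>j. if j = i then - \<eta> j else \<eta> j)"

lemma flip_flip: "flip i (flip i \<eta>) = \<eta>"
  by (simp add: flip_def fun_eq_iff)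

lemma flip_label_vectors:
  assumes "\<eta> \<in> label_vectors n" "i < n"
  shows "flip i \<eta> \<in> label_vectors n"
  unfolding label_vectors_def
proof (rule PiE_I)
  fix j assume "j \<in> {..<n}"
  then have "\<eta> j = -1 \<or> \<eta> j = 1" using label_vectors_label[OF assms(1), of j] by simp
  then show "flip i \<eta> j \<in> {-1, 1}" by (auto simp: flip_def)
next
  fix j assume "j \<notin> {..<n}"
  then show "flip i \<eta> j = undefined"
    using assms PiE_arb[of \<eta> "{..<n}" "\<lambda>_. {-1, 1}" j] by (auto simp: flip_def label_vectors_def)
qed

lemma sum_label_flip:
  assumes "i < n"
  shows "(\<Sum>\<eta>\<in>label_vectors n. g (flip i \<eta>)) = (\<Sum>\<eta>\<in>label_vectors n. g \<eta>)"
  using assms by (intro sum.reindex_bij_witness[where i = "flip i" and j = "flip i"])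
    (simp_all only: flip_flip flip_label_vectors)

lemma finite_label_vectors: "finite (label_vectors n)"
  unfolding label_vectors_def by (intro finite_PiE) auto

lemma label_vectors_nonempty: "label_vectors n \<noteq> {}"
  unfolding label_vectors_def by (simp add: PiE_eq_empty_iff)

text \<open>
  With \<open>N\<close> wrong labels there are \<open>2N(n-N)\<close> ordered pairs whose relative
  sign is wrong, and \<open>2N(n-N) \<le> 2n min(N, n-N)\<close>. Relative signs do not change
  with the global sign.
\<close>

lemma mismatched_pairs_le_loss:
  assumes x: "\<And>i. i < n \<Longrightarrow> x i \<in> {-1, 1}" and \<eta>: "\<And>i. i < n \<Longrightarrow> \<eta> i \<in> {-1, 1}"
  shows "(\<Sum>i<n. \<Sum>j\<in>{..<n} - {i}. if x i * x j \<noteq> \<eta> i * \<eta> j then 1 else 0) \<le> real n * loss n x \<eta>"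
proof -
  define d where "d i = x i * \<eta> i" for i
  define N where "N = real (errors n x \<eta>)"
  have d: "d i = (if x i \<noteq> \<eta> i then -1 else 1)" if "i < n" for i
    using x[OF that] \<eta>[OF that] by (auto simp: d_def)
  have sum_d: "(\<Sum>i<n. d i) = real n - 2 * N"
  proof -
    have "(\<Sum>i<n. d i) = (\<Sum>i<n. 1 - 2 * (if x i \<noteq> \<eta> i then 1 else 0))"
      using d by (intro sum.cong) auto
    also have "\<dots> = real n - 2 * (\<Sum>i<n. if x i \<noteq> \<eta> i then 1 else 0)"
      by (simp add: sum_subtractf sum_distrib_left)
    also have "(\<Sum>i<n. if x i \<noteq> \<eta> i then 1 else 0) = N"
      by (simp add: N_def errors_def sum.If_cases Int_def)
    finally show ?thesis .
  qed
  have "(\<Sum>i<n. \<Sum>j\<in>{..<n} - {i}. if x i * x j \<noteq> \<eta> i * \<eta> j then 1 else 0) =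
      (\<Sum>i<n. \<Sum>j<n. (1 - d i * d j) / 2)"
  proof (rule sum.cong[OF refl])
    fix i assume i: "i \<in> {..<n}"
    have "(\<Sum>j\<in>{..<n} - {i}. if x i * x j \<noteq> \<eta> i * \<eta> j then 1 else 0) = (\<Sum>j\<in>{..<n} - {i}. (1 - d i * d j) / 2)"
    proof (intro sum.cong refl)
      fix j assume j: "j \<in> {..<n} - {i}"
      have "x i = -1 \<or> x i = 1" "x j = -1 \<or> x j = 1" "\<eta> i = -1 \<or> \<eta> i = 1" "\<eta> j = -1 \<or> \<eta> j = 1"
        using x[of i] x[of j] \<eta>[of i] \<eta>[of j] i j by auto
      then show "(if x i * x j \<noteq> \<eta> i * \<eta> j then 1 else 0) = (1 - d i * d j) / 2"
        unfolding d_def by (elim disjE) simp_all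
    qed
    also have "\<dots> = (\<Sum>j<n. (1 - d i * d j) / 2)"
      using i d[of i] by (subst sum.remove[of "{..<n}" i]) auto
    finally show "(\<Sum>j\<in>{..<n} - {i}. if x i * x j \<noteq> \<eta> i * \<eta> j then 1 else 0) = (\<Sum>j<n. (1 - d i * d j) / 2)" .
  qed
  also have "\<dots> = (real n * real n - (\<Sum>i<n. d i) * (\<Sum>j<n. d j)) / 2"
    by (simp add: sum_divide_distrib[symmetric] sum_subtractf sum_product)
  also have "\<dots> = 2 * (N * (real n - N))"
  proof -
    have "real n * real n - (real n - 2 * N) * (real n - 2 * N) = 4 * (N * (real n - N))"
      by (simp add: algebra_simps)
    then show ?thesis unfolding sum_d by simp
  qed
  also have "\<dots> \<le> 2 * (real n * min N (real n - N))"
  proof -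
    have N: "0 \<le> N" "N \<le> real n" using errors_le[of n x \<eta>] by (simp_all add: N_def)
    have "N * (real n - N) \<le> N * real n" "N * (real n - N) \<le> real n * (real n - N)"
      using N by (auto intro: mult_left_mono mult_right_mono)
    then show ?thesis by (simp add: min_def mult.commute)
  qed
  also have "\<dots> = real n * loss n x \<eta>" by (simp add: loss_eq_errors[OF x \<eta>] N_def)
  finally show ?thesis .
qed

text \<open>
  Fix a pair \<open>i \<noteq> j\<close>. Flipping label \<open>i\<close> reverses the relative
  sign, so at every data point the estimator gets the pair wrong for \<open>\<eta>\<close> or for
  its flip. On \<open>B\<close> the flip is at least as likely as \<open>\<eta>\<close>, hence the
  two error probabilities add up to at least the mass \<open>e\<close> of \<open>B\<close> under
  \<open>\<eta>\<close>. Averaging over all \<open>\<eta>\<close> and all pairs gives the bound.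
  The family \<open>F\<close> consists of densities with respect to \<open>M\<close>; for the
  Gaussian prior they are mixtures over \<open>\<theta>\<close>.
\<close>

lemma bayes_risk_lower_bound:
  fixes M :: "'y measure" and x :: "'y \<Rightarrow> nat \<Rightarrow> real" and F :: "(nat \<Rightarrow> real) \<Rightarrow> 'y \<Rightarrow> ennreal"
  assumes n: "n > 0"
    and xm: "\<And>j. j < n \<Longrightarrow> (\<lambda>Y. x Y j) \<in> borel_measurable M"
    and xl: "\<And>Y j. Y \<in> space M \<Longrightarrow> j < n \<Longrightarrow> x Y j \<in> {-1, 1}"
    and Fm: "\<And>\<eta>. \<eta> \<in> label_vectors n \<Longrightarrow> F \<eta> \<in> borel_measurable M"
    and lm: "\<And>\<eta>. \<eta> \<in> label_vectors n \<Longrightarrow> (\<lambda>Y. ennreal (loss n (x Y) \<eta>)) \<in> borel_measurable M"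
    and sep: "\<And>\<eta> i. \<eta> \<in> label_vectors n \<Longrightarrow> i < n \<Longrightarrow>
      \<exists>B\<in>sets M. (\<forall>Y\<in>B. F \<eta> Y \<le> F (flip i \<eta>) Y) \<and> e \<le> (\<integral>\<^sup>+Y. F \<eta> Y * indicator B Y \<partial>M)"
    and risk: "\<And>\<eta>. \<eta> \<in> label_vectors n \<Longrightarrow> (\<integral>\<^sup>+Y. ennreal (loss n (x Y) \<eta>) * F \<eta> Y \<partial>M) \<le> c"
  shows "of_nat (n - 1) * e \<le> 2 * c"
proof -
  let ?L = "label_vectors n"
  define I where "I \<eta> i j Y = (if x Y i * x Y j \<noteq> \<eta> i * \<eta> j then 1 else 0 :: ennreal)" for \<eta> :: "nat \<Rightarrow> real" and i j Y
  have Im: "I \<eta> i j \<in> borel_measurable M" if "i < n" "j < n" for \<eta> i j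
  proof -
    note [measurable] = xm[OF that(1)] xm[OF that(2)]
    show ?thesis unfolding I_def by measurable
  qed
  define G where "G \<eta> i j = (\<integral>\<^sup>+Y. I \<eta> i j Y * F \<eta> Y \<partial>M)" for \<eta> i j
  have pair: "e \<le> G \<eta> i j + G (flip i \<eta>) i j" if \<eta>: "\<eta> \<in> ?L" and ij: "i < n" "j < n" "i \<noteq> j" for \<eta> i j
  proof -
    obtain B where B: "B \<in> sets M" and B2: "(\<forall>Y\<in>B. F \<eta> Y \<le> F (flip i \<eta>) Y) \<and> e \<le> (\<integral>\<^sup>+Y. F \<eta> Y * indicator B Y \<partial>M)"
      using sep[OF \<eta> ij(1)] by (rule bexE)
    have \<eta>': "flip i \<eta> \<in> ?L" by (rule flip_label_vectors[OF \<eta> ij(1)])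
    have "\<eta> i = -1 \<or> \<eta> i = 1" "\<eta> j = -1 \<or> \<eta> j = 1"
      using label_vectors_label[OF \<eta>] ij by auto
    then have nz: "\<eta> i * \<eta> j \<noteq> 0" by auto
    have fl: "flip i \<eta> i * flip i \<eta> j = - (\<eta> i * \<eta> j)" using ij(3) by (simp add: flip_def)
    note [measurable] = Fm[OF \<eta>] Fm[OF \<eta>'] Im[OF ij(1,2)]
    have "e \<le> (\<integral>\<^sup>+Y. F \<eta> Y * indicator B Y \<partial>M)" using B2 by blast
    also have "\<dots> \<le> (\<integral>\<^sup>+Y. I \<eta> i j Y * F \<eta> Y + I (flip i \<eta>) i j Y * F (flip i \<eta>) Y \<partial>M)"
    proof (intro nn_integral_mono)
      fix Y
      show "F \<eta> Y * indicator B Y \<le> I \<eta> i j Y * F \<eta> Y + I (flip i \<eta>) i j Y * F (flip i \<eta>) Y"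
      proof (cases "Y \<in> B")
        case True
        then have le: "F \<eta> Y \<le> F (flip i \<eta>) Y" using B2 by blast
        show ?thesis
        proof (cases "x Y i * x Y j = \<eta> i * \<eta> j")
          case eq: True
          then have "I (flip i \<eta>) i j Y = 1" using nz by (simp add: I_def fl)
          then show ?thesis using True le by (simp add: add_increasing)
        next
          case False
          then have "I \<eta> i j Y = 1" by (simp add: I_def)
          then show ?thesis using True by (simp add: add_increasing2)
        qed
      qed simp
    qed
    also have "\<dots> = G \<eta> i j + G (flip i \<eta>) i j"
      unfolding G_def by (rule nn_integral_add) measurable
    finally show ?thesis .
  qed
  have sumpair: "of_nat (card ?L) * e \<le> 2 * (\<Sum>\<eta>\<in>?L. G \<eta> i j)" if ij: "i < n" "j < n" "i \<noteq> j" for i j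
  proof -
    have "of_nat (card ?L) * e = (\<Sum>\<eta>\<in>?L. e)" by simp
    also have "\<dots> \<le> (\<Sum>\<eta>\<in>?L. G \<eta> i j + G (flip i \<eta>) i j)"
      using pair ij by (intro sum_mono) blast
    also have "\<dots> = (\<Sum>\<eta>\<in>?L. G \<eta> i j) + (\<Sum>\<eta>\<in>?L. G \<eta> i j)"
      by (simp add: sum.distrib sum_label_flip[OF ij(1), of "\<lambda>\<eta>. G \<eta> i j"])
    finally show ?thesis by (simp add: mult_2)
  qed
  have loss: "(\<Sum>i<n. \<Sum>j\<in>{..<n} - {i}. G \<eta> i j) \<le> of_nat n * c" if \<eta>: "\<eta> \<in> ?L" for \<eta>
  proof -
    note [measurable] = Fm[OF \<eta>] lm[OF \<eta>]
    have "(\<Sum>i<n. \<Sum>j\<in>{..<n} - {i}. G \<eta> i j) = (\<integral>\<^sup>+Y. (\<Sum>i<n. \<Sum>j\<in>{..<n} - {i}. I \<eta> i j Y * F \<eta> Y) \<partial>M)"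
    proof -
      have m: "(\<lambda>Y. I \<eta> i j Y * F \<eta> Y) \<in> borel_measurable M" if "i < n" "j < n" for i j
        by (intro borel_measurable_times_ennreal Im that Fm \<eta>)
      have "(\<integral>\<^sup>+Y. (\<Sum>i<n. \<Sum>j\<in>{..<n} - {i}. I \<eta> i j Y * F \<eta> Y) \<partial>M) = (\<Sum>i<n. \<integral>\<^sup>+Y. (\<Sum>j\<in>{..<n} - {i}. I \<eta> i j Y * F \<eta> Y) \<partial>M)"
        by (intro nn_integral_sum borel_measurable_sum m) simp_all
      also have "\<dots> = (\<Sum>i<n. \<Sum>j\<in>{..<n} - {i}. G \<eta> i j)"
        unfolding G_def by (intro sum.cong refl nn_integral_sum m) simp_all
      finally show ?thesis by simp
    qed
    also have "\<dots> \<le> (\<integral>\<^sup>+Y. of_nat n * (ennreal (loss n (x Y) \<eta>) * F \<eta> Y) \<partial>M)"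
    proof (intro nn_integral_mono)
      fix Y assume Y: "Y \<in> space M"
      have "(\<Sum>i<n. \<Sum>j\<in>{..<n} - {i}. I \<eta> i j Y) =
          ennreal (\<Sum>i<n. \<Sum>j\<in>{..<n} - {i}. if x Y i * x Y j \<noteq> \<eta> i * \<eta> j then 1 else 0)"
      proof -
        have "(\<Sum>i<n. \<Sum>j\<in>{..<n} - {i}. I \<eta> i j Y) =
          (\<Sum>i<n. \<Sum>j\<in>{..<n} - {i}. ennreal (if x Y i * x Y j \<noteq> \<eta> i * \<eta> j then 1 else 0))"
          unfolding I_def by (intro sum.cong refl) simp
        also have "\<dots> = (\<Sum>i<n. ennreal (\<Sum>j\<in>{..<n} - {i}. if x Y i * x Y j \<noteq> \<eta> i * \<eta> j then 1 else 0))"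
          by (intro sum.cong refl sum_ennreal) simp
        also have "\<dots> = ennreal (\<Sum>i<n. \<Sum>j\<in>{..<n} - {i}. if x Y i * x Y j \<noteq> \<eta> i * \<eta> j then 1 else 0)"
          by (intro sum_ennreal sum_nonneg) simp
        finally show ?thesis .
      qed
      also have "\<dots> \<le> ennreal (real n * loss n (x Y) \<eta>)"
        using xl[OF Y] label_vectors_label[OF \<eta>] by (intro ennreal_leI mismatched_pairs_le_loss)
      also have "\<dots> = of_nat n * ennreal (loss n (x Y) \<eta>)"
        by (simp add: ennreal_mult loss_nonneg ennreal_of_nat_eq_real_of_nat)
      finally have "(\<Sum>i<n. \<Sum>j\<in>{..<n} - {i}. I \<eta> i j Y) * F \<eta> Y \<le> of_nat n * ennreal (loss n (x Y) \<eta>) * F \<eta> Y"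
        by (rule mult_right_mono) simp
      then show "(\<Sum>i<n. \<Sum>j\<in>{..<n} - {i}. I \<eta> i j Y * F \<eta> Y) \<le> of_nat n * (ennreal (loss n (x Y) \<eta>) * F \<eta> Y)"
        by (simp add: sum_distrib_right mult.assoc)
    qed
    also have "\<dots> = of_nat n * (\<integral>\<^sup>+Y. ennreal (loss n (x Y) \<eta>) * F \<eta> Y \<partial>M)"
      by (intro nn_integral_cmult) measurable
    also have "\<dots> \<le> of_nat n * c" using risk[OF \<eta>] by (rule mult_left_mono) simp
    finally show ?thesis .
  qed
  define m where "m = (of_nat (n * card ?L) :: ennreal)"
  have m: "m \<noteq> 0" "m \<noteq> \<top>"
  proof -
    have "n * card ?L \<noteq> 0" using n finite_label_vectors label_vectors_nonempty by (simp add: card_gt_0_iff)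
    then show "m \<noteq> 0" unfolding m_def by (simp only: of_nat_eq_0_iff not_False_eq_True)
    show "m \<noteq> \<top>" unfolding m_def by (rule ennreal_of_nat_neq_top)
  qed
  have "m * (of_nat (n - 1) * e) = (\<Sum>i<n. \<Sum>j\<in>{..<n} - {i}. of_nat (card ?L) * e)"
    unfolding m_def by (simp add: mult_ac)
  also have "\<dots> \<le> (\<Sum>i<n. \<Sum>j\<in>{..<n} - {i}. 2 * (\<Sum>\<eta>\<in>?L. G \<eta> i j))"
    by (intro sum_mono sumpair) auto
  also have "\<dots> = 2 * (\<Sum>i<n. \<Sum>j\<in>{..<n} - {i}. \<Sum>\<eta>\<in>?L. G \<eta> i j)"
    by (simp only: sum_distrib_left)
  also have "(\<Sum>i<n. \<Sum>j\<in>{..<n} - {i}. \<Sum>\<eta>\<in>?L. G \<eta> i j) = (\<Sum>i<n. \<Sum>\<eta>\<in>?L. \<Sum>j\<in>{..<n} - {i}. G \<eta> i j)"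
    by (intro sum.cong refl sum.swap)
  also have "\<dots> = (\<Sum>\<eta>\<in>?L. \<Sum>i<n. \<Sum>j\<in>{..<n} - {i}. G \<eta> i j)" by (rule sum.swap)
  also have "2 * \<dots> \<le> 2 * (\<Sum>\<eta>\<in>?L. of_nat n * c)"
    by (intro mult_left_mono sum_mono loss) simp_all
  also have "\<dots> = m * (2 * c)" unfolding m_def by (simp add: mult_ac)
  finally show ?thesis using ennreal_mult_le_mult_iff[OF m] by blast
qed

text \<open>
  Noise of unit variance is turned into data of noise level \<open>\<sigma>\<close>, so that the
  data become a change of measure of the noise.
\<close>

definition rescale :: "nat \<Rightarrow> nat \<Rightarrow> real \<Rightarrow> (nat \<times> nat \<Rightarrow> real) \<Rightarrow> nat \<times> nat \<Rightarrow> real" where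
  "rescale p n \<sigma> Y = (\<lambda>k\<in>{..<p} \<times> {..<n}. \<sigma> * Y k)"

lemma rescale_measurable: "rescale p n \<sigma> \<in> gauss ({..<p} \<times> {..<n}) \<rightarrow>\<^sub>M obs_space p n"
  unfolding rescale_def[abs_def] obs_space_def
  by (rule measurable_restrict) (intro borel_measurable_times borel_measurable_const gauss_component_measurable)

lemma loss_bounds:
  assumes "est \<in> estimators p n" "\<eta> \<in> label_vectors n" "Y \<in> space (obs_space p n)"
  shows "loss n (est Y) \<eta> \<le> real n"
  using estimator_label[OF assms(1,3)] label_vectors_label[OF assms(2)] by (rule loss_le_n)

lemma risk_nn_integral:
  assumes est: "est \<in> estimators p n" and \<eta>: "\<eta> \<in> label_vectors n"
  shows "ennreal (risk p n \<sigma> est (\<theta>, \<eta>)) =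
    (\<integral>\<^sup>+\<xi>. ennreal (loss n (est (observe p n \<sigma> \<theta> \<eta> \<xi>)) \<eta>) \<partial>gauss ({..<p} \<times> {..<n}))"
proof -
  let ?M = "gauss ({..<p} \<times> {..<n})"
  interpret prob_space ?M by (rule prob_space_gauss)
  have "integrable ?M (\<lambda>\<xi>. loss n (est (observe p n \<sigma> \<theta> \<eta> \<xi>)) \<eta>)"
  proof (rule integrable_const_bound[where B = "real n"])
    show "AE \<xi> in ?M. norm (loss n (est (observe p n \<sigma> \<theta> \<eta> \<xi>)) \<eta>) \<le> real n"
    proof (rule AE_I2)
      fix \<xi> assume "\<xi> \<in> space ?M"
      then have "observe p n \<sigma> \<theta> \<eta> \<xi> \<in> space (obs_space p n)" by (rule measurable_space[OF observe_measurable])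
      from loss_bounds[OF est \<eta> this] loss_nonneg
      show "norm (loss n (est (observe p n \<sigma> \<theta> \<eta> \<xi>)) \<eta>) \<le> real n" by simp
    qed
    show "(\<lambda>\<xi>. loss n (est (observe p n \<sigma> \<theta> \<eta> \<xi>)) \<eta>) \<in> borel_measurable ?M"
      by (rule measurable_compose[OF observe_measurable loss_measurable[OF est]])
  qed
  then show ?thesis
    unfolding risk_eq_gauss[OF est] by (intro nn_integral_eq_integral[symmetric] AE_I2 loss_nonneg)
qed

lemma risk_le_n:
  assumes est: "est \<in> estimators p n" and \<eta>: "\<eta> \<in> label_vectors n"
  shows "risk p n \<sigma> est (\<theta>, \<eta>) \<le> real n"
proof -
  let ?M = "gauss ({..<p} \<times> {..<n})"
  interpret prob_space ?M by (rule prob_space_gauss)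
  have "ennreal (risk p n \<sigma> est (\<theta>, \<eta>)) \<le> (\<integral>\<^sup>+\<xi>. ennreal (real n) \<partial>?M)"
    unfolding risk_nn_integral[OF assms]
    by (intro nn_integral_mono ennreal_leI loss_bounds[OF est \<eta>] measurable_space[OF observe_measurable])
  then have "ennreal (risk p n \<sigma> est (\<theta>, \<eta>)) \<le> ennreal (real n)" by (simp add: emeasure_space_1)
  then show ?thesis by (simp only: ennreal_le_iff[OF of_nat_0_le_iff])
qed

text \<open>
  By \<open>gauss_shift\<close> the risk is an integral over pure noise, with the likelihood ratio
  as density.
\<close>

lemma risk_as_density:
  assumes est: "est \<in> estimators p n" and \<eta>: "\<eta> \<in> label_vectors n"
    and \<theta>: "\<And>r. r < p \<Longrightarrow> \<theta> r = \<sigma> * t r"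
  shows "(\<integral>\<^sup>+Y. ennreal (loss n (est (rescale p n \<sigma> Y)) \<eta>) *
      ennreal (exp (\<Sum>k\<in>{..<p} \<times> {..<n}. t (fst k) * \<eta> (snd k) * Y k - (t (fst k) * \<eta> (snd k))\<^sup>2 / 2)) \<partial>gauss ({..<p} \<times> {..<n})) =
    ennreal (risk p n \<sigma> est (\<theta>, \<eta>))"
proof -
  let ?K = "{..<p} \<times> {..<n}"
  have "(\<lambda>Y. ennreal (loss n (est (rescale p n \<sigma> Y)) \<eta>)) \<in> borel_measurable (gauss ?K)"
    by (intro measurable_compose[OF measurable_compose[OF rescale_measurable loss_measurable[OF est]] measurable_ennreal])
  then have m: "(\<lambda>Y. ennreal (loss n (est (rescale p n \<sigma> Y)) \<eta>)) \<in> borel_measurable (PiM ?K (\<lambda>_. borel))"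
    by (simp only: measurable_cong_sets[OF sets_gauss refl])
  have "rescale p n \<sigma> (\<lambda>k\<in>?K. t (fst k) * \<eta> (snd k) + \<xi> k) = observe p n \<sigma> \<theta> \<eta> \<xi>" for \<xi>
    using \<theta> by (simp add: rescale_def observe_def fun_eq_iff restrict_def distrib_left mult.assoc)
  then have "ennreal (risk p n \<sigma> est (\<theta>, \<eta>)) =
     (\<integral>\<^sup>+\<xi>. ennreal (loss n (est (rescale p n \<sigma> (\<lambda>k\<in>?K. t (fst k) * \<eta> (snd k) + \<xi> k))) \<eta>) \<partial>gauss ?K)"
    by (simp only: risk_nn_integral[OF est \<eta>])
  also have "\<dots> = (\<integral>\<^sup>+Y. ennreal (loss n (est (rescale p n \<sigma> Y)) \<eta>) *
      ennreal (exp (\<Sum>k\<in>?K. t (fst k) * \<eta> (snd k) * Y k - (t (fst k) * \<eta> (snd k))\<^sup>2 / 2)) \<partial>gauss ?K)"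
    by (rule gauss_shift[OF _ m]) simp
  finally show ?thesis by simp
qed

lemma gauss_tail_emeasure: "emeasure std_normal {t<..} = ennreal (gauss_tail t)"
proof -
  interpret prob_space std_normal by (rule prob_space_std_normal)
  show ?thesis by (simp add: gauss_tail_def emeasure_eq_measure)
qed

lemma gauss_tail_nonneg: "gauss_tail t \<ge> 0"
  by (simp add: gauss_tail_def)

lemma gauss_tail_antimono: "s \<le> t \<Longrightarrow> gauss_tail t \<le> gauss_tail s"
proof -
  assume "s \<le> t"
  interpret prob_space std_normal by (rule prob_space_std_normal)
  show ?thesis unfolding gauss_tail_def using \<open>s \<le> t\<close> by (intro finite_measure_mono) auto
qed

text \<open>
  An inequality suffices, and it also holds for \<open>v = 0\<close>.
\<close>

lemma gauss_linear_ge: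
  assumes K: "finite K" and v: "v = sqrt (\<Sum>k\<in>K. (x k)\<^sup>2)"
  shows "ennreal (gauss_tail a) \<le> (\<integral>\<^sup>+\<xi>. indicator {v * a..} (\<Sum>k\<in>K. x k * \<xi> k) \<partial>gauss K)"
proof -
  have v0: "v \<ge> 0" unfolding v by (simp add: sum_nonneg)
  have "ennreal (gauss_tail a) = (\<integral>\<^sup>+z. indicator {a<..} z \<partial>std_normal)"
    by (simp add: gauss_tail_emeasure)
  also have "\<dots> \<le> (\<integral>\<^sup>+z. indicator {v * a..} (v * z) \<partial>std_normal)"
    using v0 by (intro nn_integral_mono) (auto simp: indicator_def intro: mult_left_mono)
  also have "\<dots> = (\<integral>\<^sup>+\<xi>. indicator {v * a..} (\<Sum>k\<in>K. x k * \<xi> k) \<partial>gauss K)"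
    unfolding v by (rule gauss_linear[OF K, symmetric]) simp
  finally show ?thesis .
qed

lemma column_sum:
  fixes i n p :: nat
  assumes "i < n"
  shows "(\<Sum>k\<in>{..<p} \<times> {..<n}. if snd k = i then f k else 0) = (\<Sum>r<p. f (r, i))"
proof -
  have "(\<Sum>k\<in>{..<p} \<times> {..<n}. if snd k = i then f k else 0) = (\<Sum>r<p. \<Sum>j<n. if j = i then f (r, j) else 0)"
    unfolding sum.cartesian_product by (intro sum.cong refl) (auto simp: split_def)
  also have "\<dots> = (\<Sum>r<p. f (r, i))"
  proof (rule sum.cong[OF refl])
    fix r
    have "(\<Sum>j<n. if j = i then f (r, j) else 0) = (if i \<in> {..<n} then f (r, i) else 0)"
      by (rule sum.delta) simp
    then show "(\<Sum>j<n. if j = i then f (r, j) else 0) = f (r, i)" using assms by simp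
  qed
  finally show ?thesis .
qed

text \<open>
  Let the signal be \<open>\<Delta>\<close> times the first unit vector. Then label
  \<open>i\<close> is decided by the sign of one Gaussian with mean
  \<open>\<plusminus>\<Delta>/\<sigma>\<close> and variance 1, and \<open>B\<close> is the event
  that it has the wrong sign.
\<close>

lemma minimax_known_signal:
  assumes n: "n > 0" and p: "p > 0" and \<sigma>: "\<sigma> > 0" and \<Delta>: "\<Delta> > 0"
    and est: "est \<in> estimators p n" and c: "\<And>\<omega>. \<omega> \<in> Omega p n \<Delta> \<Longrightarrow> risk p n \<sigma> est \<omega> \<le> c"
  shows "real (n - 1) * gauss_tail (\<Delta> / \<sigma>) \<le> 2 * c"
proof -
  let ?K = "{..<p} \<times> {..<n}"
  let ?M = "gauss ?K"
  define \<theta> where "\<theta> = (\<lambda>r\<in>{..<p}. if r = 0 then \<Delta> else 0)"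
  define s where "s = \<Delta> / \<sigma>"
  define t where "t r = (if r = 0 then s else 0)" for r :: nat
  have \<theta>t: "\<theta> r = \<sigma> * t r" if "r < p" for r using that \<sigma> by (simp add: \<theta>_def t_def s_def)
  have \<theta>\<Omega>: "(\<theta>, \<eta>) \<in> Omega p n \<Delta>" if "\<eta> \<in> label_vectors n" for \<eta>
  proof -
    have "(\<Sum>r<p. (\<theta> r)\<^sup>2) = (\<Sum>r<p. if r = 0 then \<Delta>\<^sup>2 else 0)" by (intro sum.cong) (auto simp: \<theta>_def)
    also have "\<dots> = \<Delta>\<^sup>2" using p by (simp add: sum.delta)
    finally have "L2_set \<theta> {..<p} = \<Delta>" using \<Delta> by (simp add: L2_set_def)
    then show ?thesis using that by (simp add: Omega_def \<theta>_def)
  qed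
  obtain \<eta>0 where "\<eta>0 \<in> label_vectors n" using label_vectors_nonempty by blast
  then have "risk p n \<sigma> est (\<theta>, \<eta>0) \<le> c" by (intro c \<theta>\<Omega>)
  moreover have "0 \<le> risk p n \<sigma> est (\<theta>, \<eta>0)"
    unfolding risk_eq_gauss[OF est] by (intro Bochner_Integration.integral_nonneg loss_nonneg)
  ultimately have c0: "c \<ge> 0" by linarith
  define F where "F \<eta> Y = ennreal (exp (\<Sum>k\<in>?K. t (fst k) * \<eta> (snd k) * Y k - (t (fst k) * \<eta> (snd k))\<^sup>2 / 2))" for \<eta> Y
  have "of_nat (n - 1) * ennreal (gauss_tail s) \<le> 2 * ennreal c"
  proof (rule bayes_risk_lower_bound[where M = ?M and x = "\<lambda>Y. est (rescale p n \<sigma> Y)" and F = F, OF n])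
    fix j assume "j < n"
    then show "(\<lambda>Y. est (rescale p n \<sigma> Y) j) \<in> borel_measurable ?M"
      by (rule measurable_compose[OF rescale_measurable estimator_component_measurable[OF est]])
  next
    fix Y j assume "Y \<in> space ?M" "j < n"
    then show "est (rescale p n \<sigma> Y) j \<in> {-1, 1}"
      using estimator_label[OF est measurable_space[OF rescale_measurable]] by blast
  next
    fix \<eta> assume "\<eta> \<in> label_vectors n"
    show "F \<eta> \<in> borel_measurable ?M" unfolding F_def by measurable
    show "(\<lambda>Y. ennreal (loss n (est (rescale p n \<sigma> Y)) \<eta>)) \<in> borel_measurable ?M"
      by (intro measurable_compose[OF measurable_compose[OF rescale_measurable loss_measurable[OF est]] measurable_ennreal])
  next
    fix \<eta> assume \<eta>: "\<eta> \<in> label_vectors n"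
    show "(\<integral>\<^sup>+Y. ennreal (loss n (est (rescale p n \<sigma> Y)) \<eta>) * F \<eta> Y \<partial>?M) \<le> ennreal c"
    proof -
      have "(\<integral>\<^sup>+Y. ennreal (loss n (est (rescale p n \<sigma> Y)) \<eta>) * F \<eta> Y \<partial>?M) = ennreal (risk p n \<sigma> est (\<theta>, \<eta>))"
        unfolding F_def by (rule risk_as_density[OF est \<eta>]) (rule \<theta>t)
      then show ?thesis using c[OF \<theta>\<Omega>[OF \<eta>]] by (simp add: ennreal_leI)
    qed
  next
    fix \<eta> i assume \<eta>: "\<eta> \<in> label_vectors n" and i: "i < n"
    have \<eta>2: "\<eta> i * \<eta> i = 1" using label_vectors_label[OF \<eta> i] by auto
    \<comment> \<open>the log-likelihood ratio of the flip against \<open>\<eta>\<close> is twice the linear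
        form with coefficients \<open>x\<close>\<close>
    define x where "x k = (if snd k = i then - \<eta> i * t (fst k) else 0)" for k :: "nat \<times> nat"
    define B where "B = {Y \<in> space ?M. 0 \<le> (\<Sum>k\<in>?K. x k * Y k)}"
    have xm: "(\<lambda>Y. \<Sum>k\<in>?K. x k * Y k) \<in> borel_measurable ?M"
      by (intro borel_measurable_sum borel_measurable_times borel_measurable_const gauss_component_measurable)
    have xm': "(\<lambda>Y. \<Sum>k\<in>?K. x k * Y k) \<in> borel_measurable (PiM ?K (\<lambda>_. borel))"
      using xm by (simp only: measurable_cong_sets[OF sets_gauss refl])
    note [measurable] = xm
    have B: "B \<in> sets ?M" unfolding B_def by measurable
    have le: "F \<eta> Y \<le> F (flip i \<eta>) Y" if Y: "Y \<in> B" for Y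
    proof -
      have "(\<Sum>k\<in>?K. t (fst k) * flip i \<eta> (snd k) * Y k - (t (fst k) * flip i \<eta> (snd k))\<^sup>2 / 2) =
        (\<Sum>k\<in>?K. (t (fst k) * \<eta> (snd k) * Y k - (t (fst k) * \<eta> (snd k))\<^sup>2 / 2) + 2 * (x k * Y k))"
        by (intro sum.cong refl) (auto simp: flip_def x_def)
      also have "\<dots> = (\<Sum>k\<in>?K. t (fst k) * \<eta> (snd k) * Y k - (t (fst k) * \<eta> (snd k))\<^sup>2 / 2) + 2 * (\<Sum>k\<in>?K. x k * Y k)"
        by (simp only: sum.distrib sum_distrib_left)
      finally show ?thesis using Y unfolding F_def B_def by (intro ennreal_leI) simp
    qed
    have x2: "(\<Sum>k\<in>?K. (x k)\<^sup>2) = s\<^sup>2"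
    proof -
      have "(\<Sum>k\<in>?K. (x k)\<^sup>2) = (\<Sum>k\<in>?K. if snd k = i then (t (fst k))\<^sup>2 else 0)"
        using \<eta>2 by (intro sum.cong refl) (simp add: x_def power_mult_distrib power2_eq_square)
      also have "\<dots> = (\<Sum>r<p. if r = 0 then s\<^sup>2 else 0)"
        unfolding column_sum[OF i] by (intro sum.cong refl) (simp add: t_def)
      finally show ?thesis using p by (simp add: sum.delta)
    qed
    have xc: "(\<Sum>k\<in>?K. x k * (t (fst k) * \<eta> (snd k))) = - s\<^sup>2"
    proof -
      have "(\<Sum>k\<in>?K. x k * (t (fst k) * \<eta> (snd k))) = (\<Sum>k\<in>?K. - ((x k)\<^sup>2))"
        using \<eta>2 by (intro sum.cong refl) (simp add: x_def power_mult_distrib power2_eq_square mult_ac)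
      then show ?thesis by (simp add: sum_negf x2)
    qed
    have s0: "s > 0" using \<Delta> \<sigma> by (simp add: s_def)
    have "ennreal (gauss_tail s) \<le> (\<integral>\<^sup>+\<xi>. indicator {s * s..} (\<Sum>k\<in>?K. x k * \<xi> k) \<partial>?M)"
      using s0 by (intro gauss_linear_ge) (simp_all add: x2)
    also have "\<dots> = (\<integral>\<^sup>+\<xi>. indicator {0..} (\<Sum>k\<in>?K. x k * (\<lambda>k\<in>?K. t (fst k) * \<eta> (snd k) + \<xi> k) k) \<partial>?M)"
    proof (intro nn_integral_cong)
      fix \<xi> :: "nat \<times> nat \<Rightarrow> real"
      have "(\<Sum>k\<in>?K. x k * (\<lambda>k\<in>?K. t (fst k) * \<eta> (snd k) + \<xi> k) k) =
        (\<Sum>k\<in>?K. x k * (t (fst k) * \<eta> (snd k))) + (\<Sum>k\<in>?K. x k * \<xi> k)"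
        by (simp add: distrib_left sum.distrib)
      then show "indicator {s * s..} (\<Sum>k\<in>?K. x k * \<xi> k) =
        (indicator {0..} (\<Sum>k\<in>?K. x k * (\<lambda>k\<in>?K. t (fst k) * \<eta> (snd k) + \<xi> k) k) :: ennreal)"
        unfolding xc by (simp add: indicator_def power2_eq_square)
    qed
    also have "\<dots> = (\<integral>\<^sup>+Y. indicator {0..} (\<Sum>k\<in>?K. x k * Y k) * F \<eta> Y \<partial>?M)"
      unfolding F_def
      by (rule gauss_shift) (simp, rule measurable_compose[OF xm'], simp)
    also have "\<dots> = (\<integral>\<^sup>+Y. F \<eta> Y * indicator B Y \<partial>?M)"
      by (intro nn_integral_cong) (simp add: B_def indicator_def)
    finally show "\<exists>B\<in>sets ?M. (\<forall>Y\<in>B. F \<eta> Y \<le> F (flip i \<eta>) Y) \<and> ennreal (gauss_tail s) \<le> (\<integral>\<^sup>+Y. F \<eta> Y * indicator B Y \<partial>?M)"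
      using B le by blast
  qed
  then have "ennreal (real (n - 1) * gauss_tail s) \<le> ennreal (2 * c)"
    using c0 by (simp add: ennreal_mult gauss_tail_nonneg ennreal_of_nat_eq_real_of_nat)
  then show ?thesis using c0 by (simp add: s_def)
qed

section \<open>Lower bound from a Gaussian prior\<close>

text \<open>
  The rate in the Chernoff bound, with parameter \<open>\<delta>/4\<close>, for a chi-square
  variable with \<open>p\<close> degrees of freedom to be at most \<open>p/(1+\<delta>)\<close>.
\<close>

definition shell_rate :: "real \<Rightarrow> real" where
  "shell_rate \<delta> = exp (\<delta> / (4 * (1 + \<delta>))) / sqrt (1 + \<delta> / 2)"

text \<open>
  The rate in the Chernoff bound, with parameter \<open>\<delta>/(4(1+\<delta>))\<close>, for a
  chi-square variable with \<open>p\<close> degrees of freedom to exceed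
  \<open>(1+\<delta>)p\<close>.
\<close>

definition sum_rate :: "real \<Rightarrow> real" where
  "sum_rate \<delta> = exp (- \<delta> / 4) / sqrt (1 - \<delta> / (2 * (1 + \<delta>)))"

text \<open>
  Both claims follow from \<open>1 + y \<le> e\<^sup>y\<close> for \<open>x =
  \<delta>/(2(1+\<delta>))\<close>, because \<open>(1-x)(1+\<delta>/2) > 1\<close>.
\<close>

lemma rates_lt_1:
  assumes \<delta>: "\<delta> > 0"
  shows "0 \<le> shell_rate \<delta>" "shell_rate \<delta> < 1" "0 \<le> sum_rate \<delta>" "sum_rate \<delta> < 1"
proof -
  define x where "x = \<delta> / (2 * (1 + \<delta>))"
  have x: "x < 1" "x \<ge> 0" using \<delta> by (auto simp: x_def divide_less_eq)
  have inv: "1 / (1 - x) < 1 + \<delta> / 2"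
  proof -
    have "1 < (1 - x) * (1 + \<delta> / 2)" using \<delta> by (simp add: x_def field_simps)
    then show ?thesis using x by (simp add: divide_less_eq mult.commute)
  qed
  have sq: "(exp (x / 2))\<^sup>2 = exp x" "(exp (- \<delta> / 4))\<^sup>2 = exp (- (\<delta> / 2))"
    by (simp_all flip: exp_double)
  have ex: "exp x \<le> 1 / (1 - x)"
  proof -
    have "1 - x \<le> exp (- x)" using exp_ge_add_one_self[of "- x"] by simp
    then have "(1 - x) * exp x \<le> exp (- x) * exp x" by (intro mult_right_mono) auto
    also have "\<dots> = 1" by (simp flip: exp_add)
    finally show ?thesis using x by (simp add: pos_le_divide_eq mult.commute)
  qed
  have "exp x < 1 + \<delta> / 2" using ex inv by linarith
  then have "exp (x / 2) < sqrt (1 + \<delta> / 2)"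
    unfolding sq(1)[symmetric] by (intro real_less_rsqrt)
  moreover have "exp (x / 2) = exp (\<delta> / (4 * (1 + \<delta>)))" by (simp add: x_def)
  ultimately show "shell_rate \<delta> < 1" using \<delta> by (simp add: shell_rate_def divide_less_eq)
  show "0 \<le> shell_rate \<delta>" using \<delta> by (simp add: shell_rate_def)
  have "1 / (1 - x) < exp (\<delta> / 2)" using inv exp_ge_add_one_self[of "\<delta> / 2"] by linarith
  then have "1 < exp (\<delta> / 2) * (1 - x)" using x by (simp add: divide_less_eq)
  then have "exp (- (\<delta> / 2)) * 1 < exp (- (\<delta> / 2)) * (exp (\<delta> / 2) * (1 - x))"
    by (intro mult_strict_left_mono) auto
  also have "\<dots> = 1 - x" by (simp add: exp_minus)
  finally have "(exp (- \<delta> / 4))\<^sup>2 < 1 - x" unfolding sq(2) by simp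
  then have "exp (- \<delta> / 4) < sqrt (1 - x)" by (intro real_less_rsqrt)
  then show "sum_rate \<delta> < 1" using x unfolding sum_rate_def x_def[symmetric] by (simp add: divide_less_eq)
  show "0 \<le> sum_rate \<delta>" using x unfolding sum_rate_def x_def[symmetric] by simp
qed

text \<open>
  The prior mass outside the parameter set: the prior variance is chosen such that
  \<open>\<parallel>\<theta>\<parallel> \<le> \<Delta>\<close> means that a chi-square variable is
  at most \<open>p/(1+\<delta>)\<close>.
\<close>

lemma gauss_norm_small:
  assumes \<delta>: "\<delta> > 0"
  shows "measure (gauss {..<p}) {z \<in> space (gauss {..<p}). (\<Sum>r<p. (z r)\<^sup>2) \<le> real p / (1 + \<delta>)} \<le> shell_rate \<delta> ^ p"
proof -
  let ?M = "gauss {..<p}"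
  define l where "l = \<delta> / 4"
  have l: "l > 0" using \<delta> by (simp add: l_def)
  define X where "X z = l * (real p / (1 + \<delta>)) - l * (\<Sum>r<p. (z r)\<^sup>2)" for z :: "nat \<Rightarrow> real"
  have Xm: "X \<in> borel_measurable ?M"
    unfolding X_def by (intro borel_measurable_diff borel_measurable_times borel_measurable_const
      borel_measurable_sum borel_measurable_power gauss_component_measurable)
  have "(\<integral>\<^sup>+z. ennreal (exp (X z)) \<partial>?M) =
    (\<integral>\<^sup>+z. ennreal (exp (l * (real p / (1 + \<delta>)))) * ennreal (exp (\<Sum>r<p. 0 * z r + (- l) * (z r)\<^sup>2)) \<partial>?M)"
    by (intro nn_integral_cong) (simp add: X_def sum_distrib_left sum_negf flip: ennreal_mult exp_add)
  also have "\<dots> = ennreal (exp (l * (real p / (1 + \<delta>)))) * (\<integral>\<^sup>+z. ennreal (exp (\<Sum>r<p. 0 * z r + (- l) * (z r)\<^sup>2)) \<partial>?M)"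
    by (intro nn_integral_cmult measurable_compose[OF _ measurable_ennreal] borel_measurable_exp
      measurable_compose[OF _ borel_measurable_exp] borel_measurable_sum borel_measurable_add borel_measurable_times
      borel_measurable_const borel_measurable_power gauss_component_measurable)
  also have "(\<integral>\<^sup>+z. ennreal (exp (\<Sum>r<p. 0 * z r + (- l) * (z r)\<^sup>2)) \<partial>?M) = ennreal (\<Prod>r<p. tilt_factor 0 (- l))"
    using l by (intro gauss_exp_quadratic) auto
  also have "ennreal (exp (l * (real p / (1 + \<delta>)))) * ennreal (\<Prod>r<p. tilt_factor 0 (- l)) = ennreal (shell_rate \<delta> ^ p)"
  proof -
    have "exp (l * (real p / (1 + \<delta>))) = exp (\<delta> / (4 * (1 + \<delta>))) ^ p"
      by (simp add: l_def exp_of_nat_mult[symmetric])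
    moreover have "tilt_factor 0 (- l) = 1 / sqrt (1 + \<delta> / 2)"
      by (simp add: tilt_factor_def l_def)
    ultimately have "exp (l * (real p / (1 + \<delta>))) * (\<Prod>r<p. tilt_factor 0 (- l)) = shell_rate \<delta> ^ p"
      by (simp add: shell_rate_def power_divide)
    moreover have "tilt_factor 0 (- l) \<ge> 0" using l by (intro tilt_factor_nonneg) simp
    ultimately show ?thesis by (simp flip: ennreal_mult add: prod_nonneg)
  qed
  finally have "measure ?M {z \<in> space ?M. 0 \<le> X z} \<le> shell_rate \<delta> ^ p"
    using rates_lt_1[OF \<delta>] by (intro measure_le_exp_moment prob_space_gauss Xm) auto
  moreover have "((\<Sum>r<p. (z r)\<^sup>2) \<le> real p / (1 + \<delta>)) = (0 \<le> X z)" for z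
    using mult_le_cancel_left_pos[OF l, of "\<Sum>r<p. (z r)\<^sup>2" "real p / (1 + \<delta>)"]
    unfolding X_def by linarith
  ultimately show ?thesis by (simp only:)
qed

text \<open>
  The sufficient statistic for \<open>\<theta>\<close> given the labels.
\<close>

definition row_sum :: "nat set \<Rightarrow> (nat \<Rightarrow> real) \<Rightarrow> (nat \<times> nat \<Rightarrow> real) \<Rightarrow> nat \<Rightarrow> real" where
  "row_sum J \<eta> Y r = (\<Sum>j\<in>J. \<eta> j * Y (r, j))"

lemma row_sum_measurable:
  "r \<in> I \<Longrightarrow> (\<lambda>Y. row_sum J \<eta> Y r) \<in> borel_measurable (gauss (I \<times> J))"
  unfolding row_sum_def
  by (intro borel_measurable_sum borel_measurable_times borel_measurable_const gauss_component_measurable) auto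

lemma row_sum_exp_moment:
  fixes p :: nat
  assumes J: "finite J" and m: "m = (\<Sum>j\<in>J. (\<eta> j)\<^sup>2)" and b: "b * m < 1/2" and w: "w \<ge> 0"
  shows "(\<integral>\<^sup>+Y. ennreal (\<Prod>r<p. w * exp (b * (row_sum J \<eta> Y r)\<^sup>2)) \<partial>gauss ({..<p} \<times> J)) =
    ennreal ((w * tilt_factor 0 (b * m)) ^ p)"
proof -
  have m0: "m \<ge> 0" unfolding m by (simp add: sum_nonneg)
  define h where "h \<omega> = ennreal (w * exp (b * (\<Sum>j\<in>J. \<eta> j * \<omega> j)\<^sup>2))" for \<omega> :: "nat \<Rightarrow> real"
  have hm: "h \<in> borel_measurable (PiM J (\<lambda>_. borel))"
    unfolding h_def by measurable
  have "(\<integral>\<^sup>+Y. ennreal (\<Prod>r<p. w * exp (b * (row_sum J \<eta> Y r)\<^sup>2)) \<partial>gauss ({..<p} \<times> J)) =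
     (\<integral>\<^sup>+Y. (\<Prod>r<p. h (\<lambda>j\<in>J. Y (r, j))) \<partial>gauss ({..<p} \<times> J))"
    using w by (intro nn_integral_cong) (simp add: h_def row_sum_def prod_ennreal)
  also have "\<dots> = (\<Prod>r<p. \<integral>\<^sup>+\<omega>. h \<omega> \<partial>gauss J)"
    using J hm by (intro gauss_rows_prod) auto
  also have "(\<integral>\<^sup>+\<omega>. h \<omega> \<partial>gauss J) = (\<integral>\<^sup>+z. ennreal (w * exp (b * (sqrt m * z)\<^sup>2)) \<partial>std_normal)"
    unfolding h_def m by (rule gauss_linear[where f = "\<lambda>s. ennreal (w * exp (b * s\<^sup>2))", OF J]) simp
  also have "\<dots> = (\<integral>\<^sup>+z. ennreal w * ennreal (exp (0 * z + (b * m) * z\<^sup>2)) \<partial>std_normal)"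
    using m0 w by (intro nn_integral_cong) (simp add: power_mult_distrib mult.assoc ennreal_mult)
  also have "\<dots> = ennreal w * ennreal (tilt_factor 0 (b * m))"
    using b by (subst nn_integral_cmult, measurable) (subst std_normal_exp_quadratic, auto)
  also have "\<dots> = ennreal (w * tilt_factor 0 (b * m))"
    using w b by (intro ennreal_mult[symmetric] tilt_factor_nonneg) auto
  finally show ?thesis
    using w b by (simp add: ennreal_power tilt_factor_nonneg)
qed

text \<open>
  The product \<open>\<Prod>\<^sub>r w exp(q/2 (row_sum r)\<^sup>2)\<close> is the density, with
  respect to pure noise, of the columns in \<open>J\<close> when \<open>\<theta>\<close> has
  independent Gaussian components of variance \<open>T2\<close>. Under it the row sums are
  independent Gaussians of variance \<open>m(1 + m T2)\<close>. Their squares sum to about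
  \<open>p\<close> times this, and a Chernoff bound for the upper tail, computed by one more tilt,
  quantifies this.
\<close>

lemma row_sum_concentration:
  assumes J: "finite J" and m: "m = (\<Sum>j\<in>J. (\<eta> j)\<^sup>2)" "m > 0" and T: "T2 \<ge> 0" and \<delta>: "\<delta> > 0" and p: "p > 0"
    and w: "w = 1 / sqrt (1 + m * T2)" and q: "q = T2 / (1 + m * T2)"
  shows "ennreal (1 - sum_rate \<delta>) \<le> (\<integral>\<^sup>+Y. ennreal (\<Prod>r<p. w * exp (q / 2 * (row_sum J \<eta> Y r)\<^sup>2)) *
      indicator {..(1 + \<delta>) * real p * (m * (1 + m * T2))} (\<Sum>r<p. (row_sum J \<eta> Y r)\<^sup>2) \<partial>gauss ({..<p} \<times> J))"
proof -
  let ?M = "gauss ({..<p} \<times> J)"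
  define V where "V = m * (1 + m * T2)"
  define U where "U = (1 + \<delta>) * real p * V"
  define W where "W Y = (\<Prod>r<p. w * exp (q / 2 * (row_sum J \<eta> Y r)\<^sup>2))" for Y
  define S where "S Y = (\<Sum>r<p. (row_sum J \<eta> Y r)\<^sup>2)" for Y
  define x where "x = \<delta> / (2 * (1 + \<delta>))"
  \<comment> \<open>the Chernoff parameter; \<open>q/2 + b\<close> stays below the critical value
      \<open>1/(2m)\<close> because \<open>x < 1\<close>\<close>
  define b where "b = x / (2 * V)"
  have pos: "1 + m * T2 > 0" using m(2) T by (simp add: add_pos_nonneg)
  have V: "V > 0" using m(2) pos by (simp add: V_def)
  have x: "x < 1" "x > 0" using \<delta> by (auto simp: x_def divide_less_eq)
  have w0: "w \<ge> 0" using pos by (simp add: w)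
  have qm: "1 - 2 * (q / 2 * m) = 1 / (1 + m * T2)" using pos by (simp add: q field_simps)
  have bm: "2 * (b * m) = x / (1 + m * T2)" 
  proof -
    have "2 * (x / (2 * (m * D)) * m) = x / D" if "D > 0" for D using m(2) that by (simp add: field_simps)
    from this[OF pos] show ?thesis by (simp add: b_def V_def)
  qed
  have qbm: "1 - 2 * ((q / 2 + b) * m) = (1 - x) / (1 + m * T2)"
    using qm bm by (simp add: distrib_right diff_divide_distrib)
  have lt1: "q / 2 * m < 1/2"
  proof -
    have "1 / (1 + m * T2) > 0" using pos by simp
    then show ?thesis unfolding qm[symmetric] by linarith
  qed
  have lt2: "(q / 2 + b) * m < 1/2"
  proof -
    have "(1 - x) / (1 + m * T2) > 0" using pos x by simp
    then show ?thesis unfolding qbm[symmetric] by linarith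
  qed
  have rm: "(\<lambda>Y. row_sum J \<eta> Y r) \<in> borel_measurable ?M" if "r \<in> {..<p}" for r
    using that by (rule row_sum_measurable)
  have Sm: "S \<in> borel_measurable ?M" unfolding S_def
    by (intro borel_measurable_sum borel_measurable_power rm)
  have Wm: "W \<in> borel_measurable ?M" unfolding W_def
    by (intro borel_measurable_prod borel_measurable_times borel_measurable_const
      measurable_compose[OF _ borel_measurable_exp] borel_measurable_power rm)
  note [measurable] = Sm Wm
  have W0: "W Y \<ge> 0" for Y unfolding W_def using w0 by (intro prod_nonneg) auto
  have "(\<integral>\<^sup>+Y. ennreal (W Y) \<partial>?M) = ennreal ((w * tilt_factor 0 (q / 2 * m)) ^ p)"
    unfolding W_def by (rule row_sum_exp_moment[OF J m(1) lt1 w0])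
  also have "w * tilt_factor 0 (q / 2 * m) = 1"
    unfolding tilt_factor_def qm w using pos by (simp add: real_sqrt_divide)
  finally have total: "(\<integral>\<^sup>+Y. ennreal (W Y) \<partial>?M) = 1" by simp
  have tail: "(\<integral>\<^sup>+Y. ennreal (W Y) * indicator {U<..} (S Y) \<partial>?M) \<le> ennreal (sum_rate \<delta>)"
  proof -
    have "(\<integral>\<^sup>+Y. ennreal (W Y) * indicator {U<..} (S Y) \<partial>?M) \<le>
       (\<integral>\<^sup>+Y. ennreal (exp (- b * U)) * ennreal (\<Prod>r<p. w * exp ((q / 2 + b) * (row_sum J \<eta> Y r)\<^sup>2)) \<partial>?M)"
    proof (intro nn_integral_mono)
      fix Y
      have e: "(\<Prod>r<p. w * exp ((q / 2 + b) * (row_sum J \<eta> Y r)\<^sup>2)) = W Y * exp (b * S Y)"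
        unfolding W_def S_def by (simp add: distrib_right exp_add prod.distrib sum_distrib_left exp_sum mult.assoc)
      have "W Y * indicator {U<..} (S Y) \<le> exp (- b * U) * (W Y * exp (b * S Y))"
      proof (cases "S Y > U")
        case True
        then have "0 \<le> b * (S Y - U)" using x V by (simp add: b_def)
        then have "1 \<le> exp (- b * U) * exp (b * S Y)" by (simp add: algebra_simps flip: exp_add)
        then have "W Y * 1 \<le> W Y * (exp (- b * U) * exp (b * S Y))" using W0 by (rule mult_left_mono)
        then show ?thesis using True by (simp add: mult_ac)
      qed (use W0 in simp)
      then have "ennreal (W Y * indicator {U<..} (S Y)) \<le> ennreal (exp (- b * U) * (W Y * exp (b * S Y)))"
        by (rule ennreal_leI)
      then show "ennreal (W Y) * indicator {U<..} (S Y) \<le>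
        ennreal (exp (- b * U)) * ennreal (\<Prod>r<p. w * exp ((q / 2 + b) * (row_sum J \<eta> Y r)\<^sup>2))"
        unfolding e by (simp add: ennreal_mult W0 ennreal_indicator)
    qed
    also have "\<dots> = ennreal (exp (- b * U)) * (\<integral>\<^sup>+Y. ennreal (\<Prod>r<p. w * exp ((q / 2 + b) * (row_sum J \<eta> Y r)\<^sup>2)) \<partial>?M)"
      by (intro nn_integral_cmult measurable_compose[OF _ measurable_ennreal] borel_measurable_prod borel_measurable_times borel_measurable_const
        measurable_compose[OF _ borel_measurable_exp] borel_measurable_power rm)
    also have "\<dots> = ennreal (exp (- b * U)) * ennreal ((w * tilt_factor 0 ((q / 2 + b) * m)) ^ p)"
      by (subst row_sum_exp_moment[OF J m(1) lt2 w0]) (rule refl)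
    also have "w * tilt_factor 0 ((q / 2 + b) * m) = 1 / sqrt (1 - x)"
      unfolding tilt_factor_def qbm w using pos x by (simp add: real_sqrt_divide)
    also have "exp (- b * U) = exp (- \<delta> / 4) ^ p"
    proof -
      have "b * U = x * (1 + \<delta>) * real p / 2" using V by (simp add: b_def U_def)
      also have "x * (1 + \<delta>) = \<delta> / 2"
      proof -
        have "\<delta> / (2 * d) * d = \<delta> / 2" if "d > 0" for d using that by simp
        from this[of "1 + \<delta>"] show ?thesis using \<delta> unfolding x_def by linarith
      qed
      finally have "b * U = real p * (\<delta> / 4)" by simp
      then show ?thesis by (simp add: exp_of_nat_mult[symmetric])
    qed
    also have "ennreal (exp (- \<delta> / 4) ^ p) * ennreal ((1 / sqrt (1 - x)) ^ p) = ennreal (sum_rate \<delta> ^ p)"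
      using x unfolding sum_rate_def x_def[symmetric] by (simp add: power_divide flip: ennreal_mult)
    also have "\<dots> \<le> ennreal (sum_rate \<delta>)"
      using rates_lt_1[OF \<delta>] power_decreasing[of 1 p "sum_rate \<delta>"] p by (intro ennreal_leI) simp
    finally show ?thesis .
  qed
  have "(\<integral>\<^sup>+Y. ennreal (W Y) \<partial>?M) =
      (\<integral>\<^sup>+Y. ennreal (W Y) * indicator {..U} (S Y) + ennreal (W Y) * indicator {U<..} (S Y) \<partial>?M)"
    by (intro nn_integral_cong) (auto simp: indicator_def)
  also have "\<dots> = (\<integral>\<^sup>+Y. ennreal (W Y) * indicator {..U} (S Y) \<partial>?M) + (\<integral>\<^sup>+Y. ennreal (W Y) * indicator {U<..} (S Y) \<partial>?M)"
    by (rule nn_integral_add) measurable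
  also have "\<dots> \<le> (\<integral>\<^sup>+Y. ennreal (W Y) * indicator {..U} (S Y) \<partial>?M) + ennreal (sum_rate \<delta>)"
    using tail by (rule add_left_mono)
  finally have "1 \<le> (\<integral>\<^sup>+Y. ennreal (W Y) * indicator {..U} (S Y) \<partial>?M) + ennreal (sum_rate \<delta>)"
    unfolding total .
  then have "1 - ennreal (sum_rate \<delta>) \<le> (\<integral>\<^sup>+Y. ennreal (W Y) * indicator {..U} (S Y) \<partial>?M)"
    by (simp add: ennreal_minus_le_iff add.commute)
  moreover have "1 - ennreal (sum_rate \<delta>) = ennreal (1 - sum_rate \<delta>)"
    using rates_lt_1[OF \<delta>] by (simp flip: ennreal_1 add: ennreal_minus)
  ultimately show ?thesis by (simp add: W_def S_def U_def V_def)
qed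

text \<open>
  Given the other columns with row sums \<open>s\<close>, the density of column \<open>i\<close>
  with label \<open>h\<close> is a tilt with linear part \<open>\<kappa>hs\<close> and quadratic
  part \<open>\<kappa>/2\<close>, hence Gaussian with mean \<open>\<kappa>hs/(1-\<kappa>)\<close>
  and variance \<open>1/(1-\<kappa>)\<close>. The label is misjudged if its inner product with
  \<open>h s\<close> is not positive, and this event has probability
  \<open>\<Phi>\<^sup>c(\<kappa>|s|/\<surd>(1-\<kappa>))\<close>. The product on the left is the
  total mass of the tilt.
\<close>

lemma posterior_sign_error:
  fixes s :: "nat \<Rightarrow> real" and i p :: nat
  assumes \<kappa>: "0 \<le> \<kappa>" "\<kappa> < 1" and h: "h * h = 1"
  defines "V \<equiv> (\<Sum>r<p. (s r)\<^sup>2)"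
  shows "ennreal (\<Prod>r<p. exp (\<kappa>\<^sup>2 * (s r)\<^sup>2 / (2 * (1 - \<kappa>))) / sqrt (1 - \<kappa>)) * ennreal (gauss_tail (\<kappa> * sqrt V / sqrt (1 - \<kappa>))) \<le>
    (\<integral>\<^sup>+y. indicator {..0} (\<Sum>k\<in>{..<p} \<times> {i}. h * s (fst k) * y k) *
      ennreal (exp (\<Sum>k\<in>{..<p} \<times> {i}. \<kappa> * h * s (fst k) * y k + \<kappa> / 2 * (y k)\<^sup>2)) \<partial>gauss ({..<p} \<times> {i}))"
proof -
  let ?K = "{..<p} \<times> {i}"
  have sumK: "(\<Sum>k\<in>?K. f (fst k)) = (\<Sum>r<p. f r)" for f :: "nat \<Rightarrow> real"
    by (simp add: sum.cartesian_product')
  have prodK: "(\<Prod>k\<in>?K. f (fst k)) = (\<Prod>r<p. f r)" for f :: "nat \<Rightarrow> real"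
    by (simp add: prod.cartesian_product')
  define R where "R = sqrt (1 - \<kappa>)"
  have R: "R > 0" "R * R = 1 - \<kappa>" using \<kappa> by (auto simp: R_def)
  have V0: "V \<ge> 0" unfolding V_def by (simp add: sum_nonneg)
  have h2: "h\<^sup>2 = 1" using h by (simp add: power2_eq_square)
  have fm: "(\<lambda>y. indicator {..0} (\<Sum>k\<in>?K. h * s (fst k) * y k) :: ennreal) \<in> borel_measurable (PiM ?K (\<lambda>_. borel))"
    by measurable
  have tilt: "tilt_factor (\<kappa> * h * s (fst k)) (\<kappa> / 2) = exp (\<kappa>\<^sup>2 * (s (fst k))\<^sup>2 / (2 * (1 - \<kappa>))) / sqrt (1 - \<kappa>)" for k :: "nat \<times> nat"
    by (simp add: tilt_factor_def power_mult_distrib h2)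
  have "(\<integral>\<^sup>+y. indicator {..0} (\<Sum>k\<in>?K. h * s (fst k) * y k) *
      ennreal (exp (\<Sum>k\<in>?K. \<kappa> * h * s (fst k) * y k + \<kappa> / 2 * (y k)\<^sup>2)) \<partial>gauss ?K) =
    ennreal (\<Prod>k\<in>?K. tilt_factor (\<kappa> * h * s (fst k)) (\<kappa> / 2)) *
    (\<integral>\<^sup>+y. indicator {..0} (\<Sum>k\<in>?K. h * s (fst k) * (\<lambda>k\<in>?K. \<kappa> * h * s (fst k) / (1 - 2 * (\<kappa> / 2)) + y k / sqrt (1 - 2 * (\<kappa> / 2))) k) \<partial>gauss ?K)"
    using \<kappa> by (intro gauss_tilt fm) auto
  also have "(\<Prod>k\<in>?K. tilt_factor (\<kappa> * h * s (fst k)) (\<kappa> / 2)) = (\<Prod>r<p. exp (\<kappa>\<^sup>2 * (s r)\<^sup>2 / (2 * (1 - \<kappa>))) / sqrt (1 - \<kappa>))"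
    unfolding tilt by (rule prodK)
  also have "(\<integral>\<^sup>+y. indicator {..0} (\<Sum>k\<in>?K. h * s (fst k) * (\<lambda>k\<in>?K. \<kappa> * h * s (fst k) / (1 - 2 * (\<kappa> / 2)) + y k / sqrt (1 - 2 * (\<kappa> / 2))) k) \<partial>gauss ?K) =
     (\<integral>\<^sup>+y. indicator {sqrt V * (\<kappa> * sqrt V / R)..} (\<Sum>k\<in>?K. (- h * s (fst k)) * y k) \<partial>gauss ?K)"
  proof (intro nn_integral_cong)
    fix y :: "nat \<times> nat \<Rightarrow> real"
    define Z where "Z = (\<Sum>k\<in>?K. (- h * s (fst k)) * y k)"
    have "(\<Sum>k\<in>?K. h * s (fst k) * (\<lambda>k\<in>?K. \<kappa> * h * s (fst k) / (1 - 2 * (\<kappa> / 2)) + y k / sqrt (1 - 2 * (\<kappa> / 2))) k) =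
      (\<Sum>k\<in>?K. \<kappa> / (1 - \<kappa>) * (s (fst k))\<^sup>2 - 1 / R * ((- h * s (fst k)) * y k))"
      using h by (intro sum.cong refl) (simp add: R_def power2_eq_square algebra_simps)
    also have "\<dots> = \<kappa> / (1 - \<kappa>) * (\<Sum>k\<in>?K. (s (fst k))\<^sup>2) - 1 / R * Z"
      by (simp only: sum_subtractf Z_def sum_distrib_left)
    also have "(\<Sum>k\<in>?K. (s (fst k))\<^sup>2) = V" unfolding V_def by (rule sumK)
    also have "\<kappa> / (1 - \<kappa>) * V - 1 / R * Z = 1 / R * (\<kappa> * V / R - Z)"
      unfolding R(2)[symmetric] using R(1) by (simp add: field_simps)
    finally have e: "(\<Sum>k\<in>?K. h * s (fst k) * (\<lambda>k\<in>?K. \<kappa> * h * s (fst k) / (1 - 2 * (\<kappa> / 2)) + y k / sqrt (1 - 2 * (\<kappa> / 2))) k) =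
      1 / R * (\<kappa> * V / R - Z)" .
    have "sqrt V * (\<kappa> * sqrt V / R) = \<kappa> * (sqrt V * sqrt V) / R" by simp
    also have "\<dots> = \<kappa> * V / R" using V0 by simp
    finally have e2: "sqrt V * (\<kappa> * sqrt V / R) = \<kappa> * V / R" .
    have iff: "(1 / R * (c - Z) \<le> 0) = (c \<le> Z)" for c
      using R(1) by (simp add: divide_le_0_iff)
    show "(indicator {..0} (\<Sum>k\<in>?K. h * s (fst k) * (\<lambda>k\<in>?K. \<kappa> * h * s (fst k) / (1 - 2 * (\<kappa> / 2)) + y k / sqrt (1 - 2 * (\<kappa> / 2))) k) :: ennreal) =
      indicator {sqrt V * (\<kappa> * sqrt V / R)..} (\<Sum>k\<in>?K. (- h * s (fst k)) * y k)"
      unfolding e e2 Z_def[symmetric] indicator_def atMost_iff atLeast_iff iff ..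
  qed
  finally have eq: "(\<integral>\<^sup>+y. indicator {..0} (\<Sum>k\<in>?K. h * s (fst k) * y k) *
      ennreal (exp (\<Sum>k\<in>?K. \<kappa> * h * s (fst k) * y k + \<kappa> / 2 * (y k)\<^sup>2)) \<partial>gauss ?K) =
    ennreal (\<Prod>r<p. exp (\<kappa>\<^sup>2 * (s r)\<^sup>2 / (2 * (1 - \<kappa>))) / sqrt (1 - \<kappa>)) *
    (\<integral>\<^sup>+y. indicator {sqrt V * (\<kappa> * sqrt V / R)..} (\<Sum>k\<in>?K. (- h * s (fst k)) * y k) \<partial>gauss ?K)" .
  have "ennreal (gauss_tail (\<kappa> * sqrt V / R)) \<le>
    (\<integral>\<^sup>+y. indicator {sqrt V * (\<kappa> * sqrt V / R)..} (\<Sum>k\<in>?K. (- h * s (fst k)) * y k) \<partial>gauss ?K)"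
  proof (rule gauss_linear_ge)
    have "(\<Sum>k\<in>?K. (- h * s (fst k))\<^sup>2) = (\<Sum>k\<in>?K. (s (fst k))\<^sup>2)"
      by (simp add: power_mult_distrib h2)
    also have "\<dots> = V" unfolding V_def by (rule sumK)
    finally show "sqrt V = sqrt (\<Sum>k\<in>?K. (- h * s (fst k))\<^sup>2)" by simp
  qed simp
  then show ?thesis unfolding eq R_def by (rule mult_left_mono) simp
qed

text \<open>
  For row sums of the typical size of \<open>row_sum_concentration\<close>, the argument of the
  Gaussian tail in \<open>posterior_sign_error\<close> is the signal-to-noise ratio up to the
  factor \<open>(1+\<delta>)\<^sup>2\<close>: with \<open>s =
  \<Delta>\<^sup>2/\<sigma>\<^sup>2\<close> and \<open>q = p/n\<close> its square is at most
  \<open>(1+\<delta>)\<^sup>3 s\<^sup>2/(q + (1+\<delta>)s)\<close>.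
\<close>

lemma gaussian_prior_threshold:
  assumes n: "n > 0" and p: "p > 0" and \<sigma>: "\<sigma> > 0" and \<Delta>: "\<Delta> > 0" and \<delta>: "\<delta> > 0"
    and T2: "T2 = (1 + \<delta>) * (\<Delta>\<^sup>2 / \<sigma>\<^sup>2) / real p" and m: "m = real n - 1"
    and \<kappa>: "\<kappa> = T2 / (1 + real n * T2)"
  shows "\<kappa> * sqrt ((1 + \<delta>) * real p * (m * (1 + m * T2))) / sqrt (1 - \<kappa>) \<le> snr p n \<sigma> \<Delta> * (1 + \<delta>)\<^sup>2"
proof -
  define s where "s = \<Delta>\<^sup>2 / \<sigma>\<^sup>2"
  define q where "q = real p / real n"
  define U where "U = (1 + \<delta>) * real p * (m * (1 + m * T2))"
  have s: "s > 0" using \<Delta> \<sigma> by (simp add: s_def)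
  have q: "q > 0" using n p by (simp add: q_def)
  have T: "T2 > 0" "real p * T2 = (1 + \<delta>) * s" 
    unfolding T2 s_def[symmetric] using s \<delta> p by simp_all
  have m0: "m \<ge> 0" "m \<le> real n" using n by (simp_all add: m)
  have pos: "1 + real n * T2 > 0" "1 + m * T2 > 0" using T m0 by (auto intro: add_pos_nonneg)
  have "\<kappa> * (1 + real n * T2) = T2" using pos by (simp add: \<kappa>)
  then have \<kappa>': "\<kappa> * (1 + m * T2) = T2 * (1 - \<kappa>)" by (simp add: m algebra_simps)
  have \<kappa>1: "\<kappa> \<ge> 0" "1 - \<kappa> > 0"
  proof -
    show "\<kappa> \<ge> 0" using T pos by (simp add: \<kappa>)
    have "T2 \<le> real n * T2" using T n by simp
    then have "T2 < 1 + real n * T2" by linarith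
    then show "1 - \<kappa> > 0" using pos by (simp add: \<kappa> divide_less_eq)
  qed
  have U0: "U \<ge> 0" unfolding U_def using \<delta> m0 pos by (intro mult_nonneg_nonneg) auto
  have "(\<kappa> * sqrt U / sqrt (1 - \<kappa>))\<^sup>2 = \<kappa>\<^sup>2 * U / (1 - \<kappa>)"
    using U0 \<kappa>1 by (simp add: power_divide power_mult_distrib)
  also have "\<dots> = \<kappa> * (1 + \<delta>) * real p * m * (\<kappa> * (1 + m * T2)) / (1 - \<kappa>)"
    by (simp add: U_def power2_eq_square mult_ac)
  also have "\<dots> = \<kappa> * (1 + \<delta>) * m * (real p * T2)" unfolding \<kappa>' using \<kappa>1 by simp
  also have "\<dots> \<le> \<kappa> * (1 + \<delta>) * real n * (real p * T2)"
    using \<kappa>1 \<delta> m0 T s by (intro mult_right_mono mult_left_mono) auto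
  also have "\<dots> = (1 + \<delta>) * (real p * T2)\<^sup>2 / (q + real p * T2)"
  proof -
    have k: "\<kappa> * real n = real p * T2 / (q + real p * T2)"
    proof -
      have "real n * (q + real p * T2) = real p * (1 + real n * T2)" using n by (simp add: q_def algebra_simps)
      moreover have "q + real p * T2 > 0" using q T(1) p by (intro add_pos_pos mult_pos_pos) auto
      ultimately show ?thesis using pos n p by (simp add: \<kappa> frac_eq_eq mult_ac)
    qed
    have "\<kappa> * (1 + \<delta>) * real n * (real p * T2) = (1 + \<delta>) * (real p * T2) * (\<kappa> * real n)"
      by (simp only: mult_ac)
    also have "\<dots> = (1 + \<delta>) * (real p * T2)\<^sup>2 / (q + real p * T2)"
      unfolding k by (simp add: power2_eq_square mult.assoc)
    finally show ?thesis .
  qed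
  also have "\<dots> = (1 + \<delta>) ^ 3 * s\<^sup>2 / (q + (1 + \<delta>) * s)"
    unfolding T(2) by (simp add: power_mult_distrib power2_eq_square power3_eq_cube mult_ac)
  also have "\<dots> \<le> (1 + \<delta>) ^ 4 * s\<^sup>2 / (q + s)"
    using \<delta> s q by (intro frac_le mult_right_mono power_increasing) (auto intro: add_pos_pos)
  also have "\<dots> = (snr p n \<sigma> \<Delta> * (1 + \<delta>)\<^sup>2)\<^sup>2"
    by (simp add: snr_square[OF \<sigma> n] power_mult_distrib s_def q_def add.commute flip: power_mult)
  finally have sq: "(\<kappa> * sqrt U / sqrt (1 - \<kappa>))\<^sup>2 \<le> (snr p n \<sigma> \<Delta> * (1 + \<delta>)\<^sup>2)\<^sup>2" .
  have "0 \<le> snr p n \<sigma> \<Delta> * (1 + \<delta>)\<^sup>2" using s q by (simp add: snr_def)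
  with sq show ?thesis unfolding U_def by (rule power2_le_imp_le)
qed

text \<open>
  The components of \<open>\<theta>/\<sigma>\<close> get the prior variance \<open>T2 =
  (1+\<delta>)\<Delta>\<^sup>2/(\<sigma>\<^sup>2p)\<close>. The mixture density \<open>F\<close>
  of the data is then explicit. Signals that are too small have prior mass at most
  \<open>shell_rate \<delta> ^ p\<close>, and there the risk is bounded by \<open>n\<close>. For
  \<open>bayes_risk_lower_bound\<close>, \<open>B\<close> is the event that column
  \<open>i\<close> points away from the row sums of the others, and its mass is obtained by
  integrating over column \<open>i\<close> first (\<open>posterior_sign_error\<close>) and then
  over the others (\<open>row_sum_concentration\<close>).
\<close>

lemma minimax_gaussian_prior:
  assumes n2: "n \<ge> 2" and p: "p > 0" and \<sigma>: "\<sigma> > 0" and \<Delta>: "\<Delta> > 0" and \<delta>: "\<delta> > 0"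
    and est: "est \<in> estimators p n" and c: "\<And>\<omega>. \<omega> \<in> Omega p n \<Delta> \<Longrightarrow> risk p n \<sigma> est \<omega> \<le> c" and c0: "c \<ge> 0"
  shows "real (n - 1) * ((1 - sum_rate \<delta>) * gauss_tail (snr p n \<sigma> \<Delta> * (1 + \<delta>)\<^sup>2)) \<le> 2 * (c + real n * shell_rate \<delta> ^ p)"
proof -
  let ?K = "{..<p} \<times> {..<n}"
  let ?M = "gauss ?K"
  let ?P = "gauss {..<p}"
  have n: "n > 0" using n2 by simp
  interpret PM: prob_space ?P by (rule prob_space_gauss)
  interpret PS: pair_sigma_finite ?P ?M
    by (intro pair_sigma_finite.intro prob_space_imp_sigma_finite prob_space_gauss)
  interpret PN: product_sigma_finite "\<lambda>_ :: nat \<times> nat. std_normal" by (rule product_sigma_std_normal)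
  define T2 where "T2 = (1 + \<delta>) * (\<Delta>\<^sup>2 / \<sigma>\<^sup>2) / real p"
  define \<tau> where "\<tau> = sqrt T2"
  define m where "m = real n - 1"
  define \<kappa> where "\<kappa> = T2 / (1 + real n * T2)"
  define g where "g = gauss_tail (snr p n \<sigma> \<Delta> * (1 + \<delta>)\<^sup>2)"
  have T: "T2 > 0" using \<delta> \<Delta> \<sigma> p by (simp add: T2_def)
  have \<tau>2: "\<tau>\<^sup>2 = T2" using T by (simp add: \<tau>_def)
  have m: "m > 0" using n2 by (simp add: m_def)
  have pos: "1 + real n * T2 > 0" "1 + m * T2 > 0" using T m by (auto intro: add_pos_nonneg)
  have \<kappa>1: "0 \<le> \<kappa>" "\<kappa> < 1"
  proof -
    show "\<kappa> \<ge> 0" using T pos by (simp add: \<kappa>_def)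
    have "T2 \<le> real n * T2" using T n by simp
    then have "T2 < 1 + real n * T2" by linarith
    then show "\<kappa> < 1" using pos by (simp add: \<kappa>_def divide_less_eq)
  qed
  have \<kappa>m: "(1 + real n * T2) * (1 - \<kappa>) = 1 + m * T2"
  proof -
    have "\<kappa> * (1 + real n * T2) = T2" using pos by (simp add: \<kappa>_def)
    then show ?thesis by (simp add: m_def algebra_simps)
  qed
  \<comment> \<open>\<open>L\<close> is the likelihood given the signal \<open>\<tau> z\<close>, and
      \<open>F\<close> its mean over a standard Gaussian \<open>z\<close>\<close>
  define L where "L \<eta> z Y = ennreal (exp (\<Sum>k\<in>?K. (\<tau> * z (fst k)) * \<eta> (snd k) * Y k - ((\<tau> * z (fst k)) * \<eta> (snd k))\<^sup>2 / 2))"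
    for \<eta> :: "nat \<Rightarrow> real" and z and Y :: "nat \<times> nat \<Rightarrow> real"
  define D where "D = sqrt (1 + real n * T2)"
  define F where "F \<eta> Y = ennreal (\<Prod>r<p. exp (\<kappa> / 2 * (row_sum {..<n} \<eta> Y r)\<^sup>2) / D)" for \<eta> Y
  have F_mix: "F \<eta> Y = (\<integral>\<^sup>+z. L \<eta> z Y \<partial>?P)" if \<eta>: "\<eta> \<in> label_vectors n" for \<eta> Y
  proof -
    have \<eta>2: "(\<eta> j)\<^sup>2 = 1" if "j < n" for j using label_vectors_label[OF \<eta> that] by auto
    have "(\<integral>\<^sup>+z. L \<eta> z Y \<partial>?P) =
      (\<integral>\<^sup>+z. ennreal (exp (\<Sum>r<p. (\<tau> * row_sum {..<n} \<eta> Y r) * z r + (- (real n * T2 / 2)) * (z r)\<^sup>2)) \<partial>?P)"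
    proof (rule nn_integral_cong)
      fix z :: "nat \<Rightarrow> real"
      have "(\<Sum>k\<in>?K. (\<tau> * z (fst k)) * \<eta> (snd k) * Y k - ((\<tau> * z (fst k)) * \<eta> (snd k))\<^sup>2 / 2) =
        (\<Sum>r<p. \<Sum>j<n. (\<tau> * z r) * \<eta> j * Y (r, j) - ((\<tau> * z r) * \<eta> j)\<^sup>2 / 2)"
        unfolding sum.cartesian_product by (rule sum.cong[OF refl]) (auto simp: split_def)
      also have "\<dots> = (\<Sum>r<p. (\<tau> * row_sum {..<n} \<eta> Y r) * z r + (- (real n * T2 / 2)) * (z r)\<^sup>2)"
      proof (rule sum.cong[OF refl])
        fix r
        have "(\<Sum>j<n. (\<tau> * z r) * \<eta> j * Y (r, j) - ((\<tau> * z r) * \<eta> j)\<^sup>2 / 2) =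
          (\<Sum>j<n. (\<tau> * z r) * (\<eta> j * Y (r, j)) - T2 * (z r)\<^sup>2 / 2)"
          using \<eta>2 by (intro sum.cong refl) (simp add: power_mult_distrib \<tau>2)
        also have "\<dots> = (\<tau> * z r) * row_sum {..<n} \<eta> Y r - real n * (T2 * (z r)\<^sup>2 / 2)"
          by (simp add: sum_subtractf row_sum_def flip: sum_distrib_left)
        finally show "(\<Sum>j<n. (\<tau> * z r) * \<eta> j * Y (r, j) - ((\<tau> * z r) * \<eta> j)\<^sup>2 / 2) =
          (\<tau> * row_sum {..<n} \<eta> Y r) * z r + (- (real n * T2 / 2)) * (z r)\<^sup>2" by simp
      qed
      finally show "L \<eta> z Y = ennreal (exp (\<Sum>r<p. (\<tau> * row_sum {..<n} \<eta> Y r) * z r + (- (real n * T2 / 2)) * (z r)\<^sup>2))"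
        unfolding L_def by (simp only:)
    qed
    also have "\<dots> = ennreal (\<Prod>r<p. tilt_factor (\<tau> * row_sum {..<n} \<eta> Y r) (- (real n * T2 / 2)))"
    proof (rule gauss_exp_quadratic)
      have "0 \<le> real n * T2" using T by simp
      then show "- (real n * T2 / 2) < 1 / 2" by linarith
    qed simp
    finally have mix: "(\<integral>\<^sup>+z. L \<eta> z Y \<partial>?P) = ennreal (\<Prod>r<p. tilt_factor (\<tau> * row_sum {..<n} \<eta> Y r) (- (real n * T2 / 2)))" .
    have "tilt_factor (\<tau> * u) (- (real n * T2 / 2)) = exp (\<kappa> / 2 * u\<^sup>2) / D" for u
      unfolding tilt_factor_def D_def \<kappa>_def by (simp add: power_mult_distrib \<tau>2)
    then show ?thesis unfolding F_def mix by (simp only:)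
  qed
  have row_m: "(\<lambda>Y. row_sum {..<n} \<eta> Y r) \<in> borel_measurable ?M" if "r \<in> {..<p}" for r \<eta>
    using that by (rule row_sum_measurable)
  have Fm: "F \<eta> \<in> borel_measurable ?M" for \<eta>
    unfolding F_def
    by (intro measurable_compose[OF _ measurable_ennreal] borel_measurable_prod borel_measurable_divide borel_measurable_times
      borel_measurable_const measurable_compose[OF _ borel_measurable_exp] borel_measurable_power row_m)
  have lm: "(\<lambda>Y. ennreal (loss n (est (rescale p n \<sigma> Y)) \<eta>)) \<in> borel_measurable ?M" for \<eta>
    by (intro measurable_compose[OF measurable_compose[OF rescale_measurable loss_measurable[OF est]] measurable_ennreal])
  have main: "of_nat (n - 1) * ennreal ((1 - sum_rate \<delta>) * g) \<le> 2 * ennreal (c + real n * shell_rate \<delta> ^ p)"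
  proof (rule bayes_risk_lower_bound[where M = ?M and x = "\<lambda>Y. est (rescale p n \<sigma> Y)" and F = F, OF n])
    fix j assume "j < n"
    then show "(\<lambda>Y. est (rescale p n \<sigma> Y) j) \<in> borel_measurable ?M"
      by (rule measurable_compose[OF rescale_measurable estimator_component_measurable[OF est]])
  next
    fix Y j assume "Y \<in> space ?M" "j < n"
    then show "est (rescale p n \<sigma> Y) j \<in> {-1, 1}"
      using estimator_label[OF est measurable_space[OF rescale_measurable]] by blast
  next
    fix \<eta> assume \<eta>: "\<eta> \<in> label_vectors n"
    show "F \<eta> \<in> borel_measurable ?M" by (rule Fm)
    show "(\<lambda>Y. ennreal (loss n (est (rescale p n \<sigma> Y)) \<eta>)) \<in> borel_measurable ?M" by (rule lm)
    define l where "l Y = ennreal (loss n (est (rescale p n \<sigma> Y)) \<eta>)" for Y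
    have lm': "l \<in> borel_measurable ?M" unfolding l_def by (rule lm)
    define \<theta> where "\<theta> z = (\<lambda>r\<in>{..<p}. \<sigma> * (\<tau> * z r))" for z :: "nat \<Rightarrow> real"
    define Bad where "Bad = {z \<in> space ?P. (\<Sum>r<p. (z r)\<^sup>2) \<le> real p / (1 + \<delta>)}"
    have Badm: "Bad \<in> sets ?P"
    proof -
      have [measurable]: "(\<lambda>z. \<Sum>r<p. (z r)\<^sup>2) \<in> borel_measurable ?P"
        by (intro borel_measurable_sum borel_measurable_power gauss_component_measurable)
      show ?thesis unfolding Bad_def by measurable
    qed
    have zm: "(\<lambda>w. fst w r) \<in> borel_measurable (?P \<Otimes>\<^sub>M ?M)" if "r \<in> {..<p}" for r
      using that by (rule measurable_compose[OF measurable_fst gauss_component_measurable])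
    have ym: "(\<lambda>w. snd w k) \<in> borel_measurable (?P \<Otimes>\<^sub>M ?M)" if "k \<in> ?K" for k
      using that by (rule measurable_compose[OF measurable_snd gauss_component_measurable])
    have Lm: "(\<lambda>w. l (snd w) * L \<eta> (fst w) (snd w)) \<in> borel_measurable (?P \<Otimes>\<^sub>M ?M)"
      unfolding L_def
      by (intro borel_measurable_times_ennreal measurable_compose[OF measurable_snd lm'] measurable_compose[OF _ measurable_ennreal]
        measurable_compose[OF _ borel_measurable_exp] borel_measurable_sum borel_measurable_diff borel_measurable_divide
        borel_measurable_power borel_measurable_times borel_measurable_const zm ym) auto
    have LmY: "(\<lambda>z. L \<eta> z Y) \<in> borel_measurable ?P" for Y
      unfolding L_def
      by (intro measurable_compose[OF _ measurable_ennreal]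
        measurable_compose[OF _ borel_measurable_exp] borel_measurable_sum borel_measurable_diff borel_measurable_divide
        borel_measurable_power borel_measurable_times borel_measurable_const gauss_component_measurable) auto
    have "(\<integral>\<^sup>+Y. l Y * F \<eta> Y \<partial>?M) = (\<integral>\<^sup>+Y. (\<integral>\<^sup>+z. l Y * L \<eta> z Y \<partial>?P) \<partial>?M)"
      unfolding F_mix[OF \<eta>] by (intro nn_integral_cong nn_integral_cmult[symmetric] LmY)
    also have "\<dots> = (\<integral>\<^sup>+z. (\<integral>\<^sup>+Y. l Y * L \<eta> z Y \<partial>?M) \<partial>?P)"
      by (rule PS.Fubini') (simp only: split_def Lm)
    also have "\<dots> = (\<integral>\<^sup>+z. ennreal (risk p n \<sigma> est (\<theta> z, \<eta>)) \<partial>?P)"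
      unfolding l_def L_def
    proof (rule nn_integral_cong)
      fix z :: "nat \<Rightarrow> real"
      show "(\<integral>\<^sup>+Y. ennreal (loss n (est (rescale p n \<sigma> Y)) \<eta>) *
          ennreal (exp (\<Sum>k\<in>?K. (\<tau> * z (fst k)) * \<eta> (snd k) * Y k - ((\<tau> * z (fst k)) * \<eta> (snd k))\<^sup>2 / 2)) \<partial>?M) =
        ennreal (risk p n \<sigma> est (\<theta> z, \<eta>))"
        by (rule risk_as_density[OF est \<eta>, where t = "\<lambda>r. \<tau> * z r"]) (simp add: \<theta>_def)
    qed
    also have "\<dots> \<le> (\<integral>\<^sup>+z. ennreal c + ennreal (real n) * indicator Bad z \<partial>?P)"
    proof (rule nn_integral_mono)
      fix z assume z: "z \<in> space ?P"
      show "ennreal (risk p n \<sigma> est (\<theta> z, \<eta>)) \<le> ennreal c + ennreal (real n) * indicator Bad z"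
      proof (cases "z \<in> Bad")
        case True
        have "ennreal (risk p n \<sigma> est (\<theta> z, \<eta>)) \<le> ennreal (real n)" by (intro ennreal_leI risk_le_n[OF est \<eta>])
        then show ?thesis using True by (simp add: add_increasing)
      next
        case False
        then have big: "real p / (1 + \<delta>) < (\<Sum>r<p. (z r)\<^sup>2)" using z by (simp add: Bad_def)
        have "\<Delta>\<^sup>2 = \<sigma>\<^sup>2 * T2 * (real p / (1 + \<delta>))" using p \<sigma> \<delta> by (simp add: T2_def)
        also have "\<dots> \<le> \<sigma>\<^sup>2 * T2 * (\<Sum>r<p. (z r)\<^sup>2)" using big T by (intro mult_left_mono) auto
        also have "\<dots> = (\<Sum>r<p. (\<theta> z r)\<^sup>2)"
          by (simp add: \<theta>_def sum_distrib_left power_mult_distrib \<tau>2 mult.assoc)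
        finally have "\<Delta> \<le> L2_set (\<theta> z) {..<p}" unfolding L2_set_def by (rule real_le_rsqrt)
        then have "(\<theta> z, \<eta>) \<in> Omega p n \<Delta>" using \<eta> by (simp add: Omega_def \<theta>_def)
        then have "risk p n \<sigma> est (\<theta> z, \<eta>) \<le> c" by (rule c)
        then show ?thesis using False by (simp add: ennreal_leI)
      qed
    qed
    also have "\<dots> = ennreal c + ennreal (real n) * emeasure ?P Bad"
      using Badm by (subst nn_integral_add) (auto simp: PM.emeasure_space_1 nn_integral_cmult_indicator)
    also have "\<dots> \<le> ennreal c + ennreal (real n) * ennreal (shell_rate \<delta> ^ p)"
      using gauss_norm_small[OF \<delta>, of p] unfolding PM.emeasure_eq_measure Bad_def
      by (intro add_left_mono mult_left_mono ennreal_leI) auto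
    also have "\<dots> = ennreal (c + real n * shell_rate \<delta> ^ p)"
      using rates_lt_1[OF \<delta>] c0 by (simp add: ennreal_mult)
    finally show "(\<integral>\<^sup>+Y. ennreal (loss n (est (rescale p n \<sigma> Y)) \<eta>) * F \<eta> Y \<partial>?M) \<le> ennreal (c + real n * shell_rate \<delta> ^ p)"
      unfolding l_def .
  next
    fix \<eta> i assume \<eta>: "\<eta> \<in> label_vectors n" and i: "i < n"
    have \<eta>2: "\<eta> j * \<eta> j = 1" if "j < n" for j using label_vectors_label[OF \<eta> that] by auto
    define J where "J = {..<n} - {i}"
    have J: "finite J" "{..<n} = insert i J" "i \<notin> J" using i by (auto simp: J_def)
    have mJ: "m = (\<Sum>j\<in>J. (\<eta> j)\<^sup>2)"
    proof -
      have "(\<Sum>j\<in>J. (\<eta> j)\<^sup>2) = (\<Sum>j\<in>J. 1)" using \<eta>2 by (intro sum.cong refl) (simp add: J_def power2_eq_square)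
      also have "\<dots> = m" using i by (simp add: J_def m_def of_nat_diff)
      finally show ?thesis by simp
    qed
    have rs: "row_sum {..<n} \<eta> Y r = \<eta> i * Y (r, i) + row_sum J \<eta> Y r" for Y r
      unfolding row_sum_def J(2) using J by simp
    have rsf: "row_sum {..<n} (flip i \<eta>) Y r = - (\<eta> i * Y (r, i)) + row_sum J \<eta> Y r" for Y r
    proof -
      have "(\<Sum>j\<in>J. flip i \<eta> j * Y (r, j)) = (\<Sum>j\<in>J. \<eta> j * Y (r, j))"
        using J(3) by (intro sum.cong refl) (auto simp: flip_def)
      then show ?thesis unfolding row_sum_def J(2) using J by (simp add: flip_def)
    qed
    define C where "C Y = (\<Sum>r<p. \<eta> i * row_sum J \<eta> Y r * Y (r, i))" for Y
    have rJm: "(\<lambda>Y. row_sum J \<eta> Y r) \<in> borel_measurable ?M" if "r \<in> {..<p}" for r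
      unfolding row_sum_def using that J(2)
      by (intro borel_measurable_sum borel_measurable_times borel_measurable_const gauss_component_measurable) auto
    have Cm: "C \<in> borel_measurable ?M"
      unfolding C_def using i
      by (intro borel_measurable_sum borel_measurable_times borel_measurable_const rJm gauss_component_measurable) auto
    define B where "B = {Y \<in> space ?M. C Y \<le> 0}"
    have Bs: "B \<in> sets ?M"
    proof -
      note [measurable] = Cm
      show ?thesis unfolding B_def by measurable
    qed
    have Ble: "F \<eta> Y \<le> F (flip i \<eta>) Y" if Y: "Y \<in> B" for Y
    proof -
      have e: "(\<Prod>r<p. exp (\<kappa> / 2 * (x r)\<^sup>2) / D) = exp (\<kappa> / 2 * (\<Sum>r<p. (x r)\<^sup>2)) / D ^ p" for x :: "nat \<Rightarrow> real"
        by (simp add: prod_dividef sum_distrib_left exp_sum)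
      have "(\<Sum>r<p. (row_sum {..<n} \<eta> Y r)\<^sup>2) = (\<Sum>r<p. (row_sum {..<n} (flip i \<eta>) Y r)\<^sup>2 + 4 * (\<eta> i * row_sum J \<eta> Y r * Y (r, i)))"
        unfolding rs rsf by (intro sum.cong refl) (simp add: power2_eq_square algebra_simps)
      also have "\<dots> = (\<Sum>r<p. (row_sum {..<n} (flip i \<eta>) Y r)\<^sup>2) + 4 * C Y"
        by (simp only: sum.distrib sum_distrib_left C_def)
      finally have "(\<Sum>r<p. (row_sum {..<n} \<eta> Y r)\<^sup>2) \<le> (\<Sum>r<p. (row_sum {..<n} (flip i \<eta>) Y r)\<^sup>2)"
        using Y by (simp add: B_def)
      then have "\<kappa> / 2 * (\<Sum>r<p. (row_sum {..<n} \<eta> Y r)\<^sup>2) \<le> \<kappa> / 2 * (\<Sum>r<p. (row_sum {..<n} (flip i \<eta>) Y r)\<^sup>2)"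
        using \<kappa>1 by (intro mult_left_mono) auto
      then show ?thesis unfolding F_def e
        using pos by (intro ennreal_leI divide_right_mono) (auto simp: D_def)
    qed
    let ?K' = "{..<p} \<times> J" and ?Ki = "{..<p} \<times> {i}"
    have K: "?K = ?K' \<union> ?Ki" "?K' \<inter> ?Ki = {}" using J by auto
    define w where "w = 1 / sqrt (1 + m * T2)"
    define q where "q = T2 / (1 + m * T2)"
    define U where "U = (1 + \<delta>) * real p * (m * (1 + m * T2))"
    define V where "V x = (\<Sum>r<p. (row_sum J \<eta> x r)\<^sup>2)" for x
    define W where "W x = (\<Prod>r<p. w * exp (q / 2 * (row_sum J \<eta> x r)\<^sup>2))" for x
    have g_le: "g \<le> gauss_tail (\<kappa> * sqrt v / sqrt (1 - \<kappa>))" if "v \<le> U" for v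
    proof -
      have "\<kappa> * sqrt v / sqrt (1 - \<kappa>) \<le> \<kappa> * sqrt U / sqrt (1 - \<kappa>)"
        using that \<kappa>1 by (intro divide_right_mono mult_left_mono) auto
      also have "\<dots> \<le> snr p n \<sigma> \<Delta> * (1 + \<delta>)\<^sup>2"
        unfolding U_def by (rule gaussian_prior_threshold[OF n p \<sigma> \<Delta> \<delta> T2_def m_def \<kappa>_def])
      finally show ?thesis unfolding g_def by (rule gauss_tail_antimono)
    qed
    have inner: "ennreal (W x) * indicator {..U} (V x) * ennreal g \<le>
        (\<integral>\<^sup>+y. F \<eta> (merge ?K' ?Ki (x, y)) * indicator {..0} (C (merge ?K' ?Ki (x, y))) \<partial>gauss ?Ki)" for x
    proof (cases "V x \<le> U")
      case True
      define s where "s r = row_sum J \<eta> x r" for r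
      have m1: "row_sum J \<eta> (merge ?K' ?Ki (x, y)) r = s r" if "r < p" for y r
        unfolding row_sum_def s_def using that J by (intro sum.cong refl) (auto simp: merge_def)
      have m2: "merge ?K' ?Ki (x, y) (r, i) = y (r, i)" if "r < p" for y r
        using that J by (simp add: merge_def)
      have sumK: "(\<Sum>k\<in>?Ki. f k) = (\<Sum>r<p. f (r, i))" for f :: "nat \<times> nat \<Rightarrow> real"
        by (simp add: sum.cartesian_product')
      have Cmerge: "C (merge ?K' ?Ki (x, y)) = (\<Sum>k\<in>?Ki. \<eta> i * s (fst k) * y k)" for y
        unfolding C_def sumK using m1 m2 by (intro sum.cong refl) simp
      have Fmerge: "F \<eta> (merge ?K' ?Ki (x, y)) = ennreal (\<Prod>r<p. exp (\<kappa> / 2 * (s r)\<^sup>2) / D) *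
          ennreal (exp (\<Sum>k\<in>?Ki. \<kappa> * \<eta> i * s (fst k) * y k + \<kappa> / 2 * (y k)\<^sup>2))" for y
      proof -
        have "(\<Prod>r<p. exp (\<kappa> / 2 * (row_sum {..<n} \<eta> (merge ?K' ?Ki (x, y)) r)\<^sup>2) / D) =
          (\<Prod>r<p. exp (\<kappa> / 2 * (s r)\<^sup>2) / D * exp (\<kappa> * \<eta> i * s r * y (r, i) + \<kappa> / 2 * (y (r, i))\<^sup>2))"
        proof (rule prod.cong[OF refl])
          fix r assume "r \<in> {..<p}"
          then have r: "row_sum {..<n} \<eta> (merge ?K' ?Ki (x, y)) r = \<eta> i * y (r, i) + s r"
            unfolding rs using m1 m2 by simp
          have "\<kappa> / 2 * (\<eta> i * y (r, i) + s r)\<^sup>2 =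
              \<kappa> / 2 * (s r)\<^sup>2 + (\<kappa> * \<eta> i * s r * y (r, i) + \<kappa> / 2 * ((\<eta> i * \<eta> i) * (y (r, i))\<^sup>2))"
            by (simp add: power2_eq_square algebra_simps)
          then have "exp (\<kappa> / 2 * (\<eta> i * y (r, i) + s r)\<^sup>2) =
              exp (\<kappa> / 2 * (s r)\<^sup>2) * exp (\<kappa> * \<eta> i * s r * y (r, i) + \<kappa> / 2 * (y (r, i))\<^sup>2)"
            unfolding \<eta>2[OF i] mult_1_left by (simp only: exp_add)
          then show "exp (\<kappa> / 2 * (row_sum {..<n} \<eta> (merge ?K' ?Ki (x, y)) r)\<^sup>2) / D =
            exp (\<kappa> / 2 * (s r)\<^sup>2) / D * exp (\<kappa> * \<eta> i * s r * y (r, i) + \<kappa> / 2 * (y (r, i))\<^sup>2)"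
            unfolding r by simp
        qed
        also have "\<dots> = (\<Prod>r<p. exp (\<kappa> / 2 * (s r)\<^sup>2) / D) *
            exp (\<Sum>k\<in>?Ki. \<kappa> * \<eta> i * s (fst k) * y k + \<kappa> / 2 * (y k)\<^sup>2)"
          unfolding prod.distrib sumK fst_conv by (simp only: exp_sum[OF finite_lessThan])
        finally have "F \<eta> (merge ?K' ?Ki (x, y)) = ennreal ((\<Prod>r<p. exp (\<kappa> / 2 * (s r)\<^sup>2) / D) *
            exp (\<Sum>k\<in>?Ki. \<kappa> * \<eta> i * s (fst k) * y k + \<kappa> / 2 * (y k)\<^sup>2))" unfolding F_def by (rule arg_cong)
        also have "\<dots> = ennreal (\<Prod>r<p. exp (\<kappa> / 2 * (s r)\<^sup>2) / D) *
            ennreal (exp (\<Sum>k\<in>?Ki. \<kappa> * \<eta> i * s (fst k) * y k + \<kappa> / 2 * (y k)\<^sup>2))"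
          using pos by (intro ennreal_mult prod_nonneg) (simp_all add: D_def)
        finally show ?thesis .
      qed
      \<comment> \<open>the density of the other columns times the total mass of the tilt for column
          \<open>i\<close>\<close>
      have Wx: "W x = (\<Prod>r<p. exp (\<kappa> / 2 * (s r)\<^sup>2) / D) * (\<Prod>r<p. exp (\<kappa>\<^sup>2 * (s r)\<^sup>2 / (2 * (1 - \<kappa>))) / sqrt (1 - \<kappa>))"
        unfolding W_def s_def[symmetric] prod.distrib[symmetric]
      proof (rule prod.cong[OF refl])
        fix r
        have q\<kappa>: "q = \<kappa> / (1 - \<kappa>)"
          unfolding q_def \<kappa>m[symmetric] using pos \<kappa>1 by (simp add: \<kappa>_def)
        have "\<kappa> / 2 * (s r)\<^sup>2 + \<kappa>\<^sup>2 * (s r)\<^sup>2 / (2 * (1 - \<kappa>)) = q / 2 * (s r)\<^sup>2"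
          unfolding q\<kappa> using \<kappa>1 by (simp add: field_simps power2_eq_square)
        moreover have "w = 1 / (D * sqrt (1 - \<kappa>))"
          unfolding w_def D_def \<kappa>m[symmetric] by (simp add: real_sqrt_mult)
        ultimately show "w * exp (q / 2 * (s r)\<^sup>2) = exp (\<kappa> / 2 * (s r)\<^sup>2) / D * (exp (\<kappa>\<^sup>2 * (s r)\<^sup>2 / (2 * (1 - \<kappa>))) / sqrt (1 - \<kappa>))"
          by (simp flip: exp_add)
      qed
      have Vs: "V x = (\<Sum>r<p. (s r)\<^sup>2)" by (simp add: V_def s_def)
      define P1 where "P1 = (\<Prod>r<p. exp (\<kappa> / 2 * (s r)\<^sup>2) / D)"
      define P2 where "P2 = (\<Prod>r<p. exp (\<kappa>\<^sup>2 * (s r)\<^sup>2 / (2 * (1 - \<kappa>))) / sqrt (1 - \<kappa>))"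
      have P: "P1 \<ge> 0" "P2 \<ge> 0" unfolding P1_def P2_def using pos \<kappa>1 by (auto simp: D_def intro!: prod_nonneg)
      have "ennreal (W x) * indicator {..U} (V x) * ennreal g = ennreal P1 * (ennreal P2 * ennreal g)"
        using True P unfolding Wx P1_def[symmetric] P2_def[symmetric] by (simp add: ennreal_mult mult.assoc)
      also have "\<dots> \<le> ennreal P1 * (ennreal P2 * ennreal (gauss_tail (\<kappa> * sqrt (V x) / sqrt (1 - \<kappa>))))"
        using g_le[OF True] by (intro mult_left_mono ennreal_leI) auto
      also have "\<dots> \<le> ennreal P1 * (\<integral>\<^sup>+y. indicator {..0} (\<Sum>k\<in>?Ki. \<eta> i * s (fst k) * y k) *
          ennreal (exp (\<Sum>k\<in>?Ki. \<kappa> * \<eta> i * s (fst k) * y k + \<kappa> / 2 * (y k)\<^sup>2)) \<partial>gauss ?Ki)"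
        unfolding P2_def Vs by (intro mult_left_mono posterior_sign_error[OF \<kappa>1 \<eta>2[OF i]]) simp
      also have "\<dots> = (\<integral>\<^sup>+y. ennreal P1 * (indicator {..0} (\<Sum>k\<in>?Ki. \<eta> i * s (fst k) * y k) *
          ennreal (exp (\<Sum>k\<in>?Ki. \<kappa> * \<eta> i * s (fst k) * y k + \<kappa> / 2 * (y k)\<^sup>2))) \<partial>gauss ?Ki)"
        by (rule nn_integral_cmult[symmetric]) measurable
      also have "\<dots> = (\<integral>\<^sup>+y. F \<eta> (merge ?K' ?Ki (x, y)) * indicator {..0} (C (merge ?K' ?Ki (x, y))) \<partial>gauss ?Ki)"
        unfolding Fmerge Cmerge P1_def by (intro nn_integral_cong) (simp only: mult_ac)
      finally show ?thesis .
    qed simp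
    have rK'm: "(\<lambda>x. row_sum J \<eta> x r) \<in> borel_measurable (gauss ?K')" if "r \<in> {..<p}" for r
      using that by (rule row_sum_measurable)
    have WVm: "(\<lambda>x. ennreal (W x) * indicator {..U} (V x)) \<in> borel_measurable (gauss ?K')"
    proof -
      have [measurable]: "V \<in> borel_measurable (gauss ?K')"
        unfolding V_def by (intro borel_measurable_sum borel_measurable_power rK'm)
      have [measurable]: "W \<in> borel_measurable (gauss ?K')"
        unfolding W_def by (intro borel_measurable_prod borel_measurable_times borel_measurable_const
          measurable_compose[OF _ borel_measurable_exp] borel_measurable_power rK'm)
      show ?thesis by measurable
    qed
    have "ennreal ((1 - sum_rate \<delta>) * g) = ennreal (1 - sum_rate \<delta>) * ennreal g"
      using rates_lt_1[OF \<delta>] by (intro ennreal_mult) (auto simp: g_def gauss_tail_nonneg)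
    also have "\<dots> \<le> (\<integral>\<^sup>+x. ennreal (W x) * indicator {..U} (V x) \<partial>gauss ?K') * ennreal g"
      unfolding W_def V_def U_def
      by (intro mult_right_mono row_sum_concentration[OF J(1) mJ m less_imp_le[OF T] \<delta> p w_def q_def]) simp
    also have "\<dots> = (\<integral>\<^sup>+x. ennreal (W x) * indicator {..U} (V x) * ennreal g \<partial>gauss ?K')"
      by (rule nn_integral_multc[symmetric]) (rule WVm)
    also have "\<dots> \<le> (\<integral>\<^sup>+x. (\<integral>\<^sup>+y. F \<eta> (merge ?K' ?Ki (x, y)) * indicator {..0} (C (merge ?K' ?Ki (x, y))) \<partial>gauss ?Ki) \<partial>gauss ?K')"
      by (rule nn_integral_mono) (rule inner)
    also have "\<dots> = (\<integral>\<^sup>+Y. F \<eta> Y * indicator {..0} (C Y) \<partial>gauss (?K' \<union> ?Ki))"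
    proof (rule PN.product_nn_integral_fold[symmetric, OF K(2)])
      show "(\<lambda>Y. F \<eta> Y * indicator {..0} (C Y)) \<in> borel_measurable (gauss (?K' \<union> ?Ki))"
        unfolding K(1)[symmetric] by (intro borel_measurable_times_ennreal Fm measurable_compose[OF Cm]) simp
    qed (use J(1) in auto)
    also have "\<dots> = (\<integral>\<^sup>+Y. F \<eta> Y * indicator B Y \<partial>?M)"
      unfolding K(1)[symmetric] by (intro nn_integral_cong) (simp add: B_def indicator_def)
    finally show "\<exists>B\<in>sets ?M. (\<forall>Y\<in>B. F \<eta> Y \<le> F (flip i \<eta>) Y) \<and> ennreal ((1 - sum_rate \<delta>) * g) \<le> (\<integral>\<^sup>+Y. F \<eta> Y * indicator B Y \<partial>?M)"
      using Bs Ble by blast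
  qed
  have "ennreal (real (n - 1) * ((1 - sum_rate \<delta>) * g)) \<le> ennreal (2 * (c + real n * shell_rate \<delta> ^ p))"
  proof -
    have "ennreal (real (n - 1) * ((1 - sum_rate \<delta>) * g)) = of_nat (n - 1) * ennreal ((1 - sum_rate \<delta>) * g)"
      using rates_lt_1[OF \<delta>] by (subst ennreal_mult) (auto simp: g_def gauss_tail_nonneg ennreal_of_nat_eq_real_of_nat)
    also note main
    also have "2 * ennreal (c + real n * shell_rate \<delta> ^ p) = ennreal (2 * (c + real n * shell_rate \<delta> ^ p))"
    proof -
      have "0 \<le> c + real n * shell_rate \<delta> ^ p" using rates_lt_1[OF \<delta>] c0 by simp
      then have "ennreal (2 * (c + real n * shell_rate \<delta> ^ p)) = ennreal 2 * ennreal (c + real n * shell_rate \<delta> ^ p)"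
        by (intro ennreal_mult) simp_all
      then show ?thesis by (simp only: ennreal_numeral)
    qed
    finally show ?thesis .
  qed
  moreover have "0 \<le> 2 * (c + real n * shell_rate \<delta> ^ p)" using rates_lt_1[OF \<delta>] c0 by simp
  ultimately show ?thesis by (simp only: ennreal_le_iff g_def)
qed

section \<open>Gaussian tails and the minimax lower bound\<close>

lemma gauss_tail_le_exp:
  assumes "t \<ge> 0"
  shows "gauss_tail t \<le> exp (- (t\<^sup>2 / 2))"
proof -
  interpret prob_space std_normal by (rule prob_space_std_normal)
  have "(\<integral>\<^sup>+z. ennreal (exp (t * z - t\<^sup>2)) \<partial>std_normal) =
    (\<integral>\<^sup>+z. ennreal (exp (- t\<^sup>2)) * ennreal (exp (t * z + 0 * z\<^sup>2)) \<partial>std_normal)"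
    by (intro nn_integral_cong) (simp flip: ennreal_mult exp_add)
  also have "\<dots> = ennreal (exp (- t\<^sup>2)) * ennreal (tilt_factor t 0)"
    by (subst nn_integral_cmult, measurable) (subst std_normal_exp_quadratic, auto)
  also have "\<dots> = ennreal (exp (- (t\<^sup>2 / 2)))"
    by (simp add: tilt_factor_def flip: ennreal_mult exp_add)
  finally have "measure std_normal {z \<in> space std_normal. 0 \<le> t * z - t\<^sup>2} \<le> exp (- (t\<^sup>2 / 2))"
    by (intro measure_le_exp_moment prob_space_std_normal) auto
  moreover have "gauss_tail t \<le> measure std_normal {z \<in> space std_normal. 0 \<le> t * z - t\<^sup>2}"
    unfolding gauss_tail_def
    using assms by (intro finite_measure_mono) (auto simp: power2_eq_square intro: mult_left_mono)
  ultimately show ?thesis by linarith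
qed

text \<open>
  On an interval of length 1 to the right of \<open>t\<close> the density is at least its value at
  \<open>t + 1\<close>. The shift by 1 is harmless because the theorem leaves a factor \<open>1 -
  \<epsilon>\<close> in the argument.
\<close>

lemma gauss_tail_ge_exp:
  assumes t: "t \<ge> 0"
  shows "exp (- ((t + 1)\<^sup>2 / 2)) / sqrt (2 * pi) \<le> gauss_tail t"
proof -
  define d where "d = std_normal_density (t + 1)"
  have "ennreal d = (\<integral>\<^sup>+z. ennreal d * indicator {t<..t + 1} z \<partial>lborel)"
    by (subst nn_integral_cmult_indicator) auto
  also have "\<dots> \<le> (\<integral>\<^sup>+z. ennreal (std_normal_density z) * indicator {t<..} z \<partial>lborel)"
  proof (intro nn_integral_mono)
    fix z :: real
    show "ennreal d * indicator {t<..t + 1} z \<le> ennreal (std_normal_density z) * indicator {t<..} z"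
    proof (cases "z \<in> {t<..t + 1}")
      case True
      then have "z\<^sup>2 \<le> (t + 1)\<^sup>2" using t by (intro power_mono) auto
      then have "d \<le> std_normal_density z"
        unfolding d_def std_normal_density_def by (intro mult_left_mono) auto
      then show ?thesis using True by (simp add: ennreal_leI)
    qed simp
  qed
  also have "\<dots> = emeasure std_normal {t<..}" by (subst emeasure_density) auto
  also have "\<dots> = ennreal (gauss_tail t)" by (rule gauss_tail_emeasure)
  finally have "d \<le> gauss_tail t" by (simp add: gauss_tail_nonneg)
  then show ?thesis by (simp add: d_def std_normal_density_def)
qed

lemma gauss_tail_pos: "gauss_tail t > 0"
proof -
  have "0 < exp (- ((max t 0 + 1)\<^sup>2 / 2)) / sqrt (2 * pi)" by simp
  also have "\<dots> \<le> gauss_tail (max t 0)" by (rule gauss_tail_ge_exp) simp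
  also have "\<dots> \<le> gauss_tail t" by (rule gauss_tail_antimono) simp
  finally show ?thesis .
qed

lemma gauss_tail_tendsto_0_iff:
  "((\<lambda>n. gauss_tail (f n)) \<longlongrightarrow> 0) F \<longleftrightarrow> filterlim f at_top F"
proof
  assume lim: "((\<lambda>n. gauss_tail (f n)) \<longlongrightarrow> 0) F"
  show "filterlim f at_top F" unfolding filterlim_at_top
  proof
    fix Z
    have "\<forall>\<^sub>F n in F. gauss_tail (f n) < gauss_tail Z"
      using lim gauss_tail_pos by (rule order_tendstoD(2))
    then show "\<forall>\<^sub>F n in F. Z \<le> f n"
    proof (rule eventually_mono)
      fix n assume "gauss_tail (f n) < gauss_tail Z"
      then show "Z \<le> f n" using gauss_tail_antimono[of "f n" Z] by linarith
    qed
  qed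
next
  assume f: "filterlim f at_top F"
  have ex: "((\<lambda>n. exp (- f n)) \<longlongrightarrow> 0) F"
    by (rule filterlim_compose[OF exp_at_bot filterlim_compose[OF filterlim_uminus_at_bot_at_top f]])
  show "((\<lambda>n. gauss_tail (f n)) \<longlongrightarrow> 0) F"
  proof (rule tendsto_sandwich[OF _ _ tendsto_const ex])
    show "\<forall>\<^sub>F n in F. 0 \<le> gauss_tail (f n)" by (simp add: gauss_tail_nonneg)
    have "\<forall>\<^sub>F n in F. 2 \<le> f n" using f by (simp add: filterlim_at_top)
    then show "\<forall>\<^sub>F n in F. gauss_tail (f n) \<le> exp (- f n)"
    proof (rule eventually_mono)
      fix n assume n: "2 \<le> f n"
      have "gauss_tail (f n) \<le> exp (- ((f n)\<^sup>2 / 2))" using n by (intro gauss_tail_le_exp) simp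
      also have "2 * f n \<le> f n * f n" using n by (intro mult_right_mono) auto
      then have "exp (- ((f n)\<^sup>2 / 2)) \<le> exp (- f n)" by (simp add: power2_eq_square)
      finally show "gauss_tail (f n) \<le> exp (- f n)" .
    qed
  qed
qed

lemma snr_nonneg: "snr p n \<sigma> \<Delta> \<ge> 0"
  by (simp add: snr_def)

lemma Omega_antimono:
  assumes "\<Delta> \<le> D"
  shows "Omega p n D \<subseteq> Omega p n \<Delta>"
  unfolding Omega_def
proof (rule Sigma_mono[OF subsetI subset_refl])
  fix \<theta> assume t: "\<theta> \<in> {\<theta> \<in> {..<p} \<rightarrow>\<^sub>E UNIV. D \<le> L2_set \<theta> {..<p}}"
  show "\<theta> \<in> {\<theta> \<in> {..<p} \<rightarrow>\<^sub>E UNIV. \<Delta> \<le> L2_set \<theta> {..<p}}"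
    unfolding mem_Collect_eq
    by (rule conjI[OF conjunct1[OF CollectD[OF t]] order_trans[OF assms conjunct2[OF CollectD[OF t]]]])
qed

text \<open>
  If \<open>p/n \<le> \<epsilon>\<Delta>\<^sup>2/\<sigma>\<^sup>2\<close>, then
  \<open>\<Delta>/\<sigma> \<le> snr (1+\<epsilon>)\<close> and a known signal gives the claim.
  Otherwise the Gaussian prior does, provided that \<open>p\<close> is at least
  \<open>\<epsilon>n\<close>, so that its error term is small. This holds once \<open>snr \<ge>
  1\<close>, since then \<open>\<Delta>\<^sup>2/\<sigma>\<^sup>2 \<ge> 1\<close>. If \<open>snr <
  1\<close>, the bound is applied to a larger \<open>\<Delta>\<close> with \<open>snr = 1\<close>:
  the parameter set shrinks, and the maximum with 1 in the claim records it.
\<close>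

lemma minimax_lower_bound:
  assumes n: "n \<ge> 2" and p: "p > 0" and \<sigma>: "\<sigma> > 0" and \<Delta>: "\<Delta> > 0" and \<epsilon>: "0 < \<epsilon>" "\<epsilon> \<le> 1"
    and est: "est \<in> estimators p n" and c: "\<And>\<omega>. \<omega> \<in> Omega p n \<Delta> \<Longrightarrow> risk p n \<sigma> est \<omega> \<le> c" and c0: "c \<ge> 0"
  shows "real (n - 1) * ((1 - sum_rate (\<epsilon> / 3)) * gauss_tail (max (snr p n \<sigma> \<Delta>) 1 * (1 + \<epsilon>))) \<le>
    2 * (c + real n * shell_rate (\<epsilon> / 3) powr (\<epsilon> * real n))"
proof -
  have npos: "n > 0" using n by simp
  define q where "q = real p / real n"
  have q: "q > 0" using p npos by (simp add: q_def)
  define \<delta> where "\<delta> = \<epsilon> / 3"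
  have \<delta>: "\<delta> > 0" using \<epsilon> by (simp add: \<delta>_def)
  note rates = rates_lt_1[OF \<delta>]
  \<comment> \<open>the value of \<open>\<Delta>\<^sup>2/\<sigma>\<^sup>2\<close> at which \<open>snr =
      1\<close>, that is, the positive root of \<open>u\<^sup>2 = u + q\<close>\<close>
  define u where "u = (1 + sqrt (1 + 4 * q)) / 2"
  have u: "u > 0" "u\<^sup>2 = u + q"
  proof -
    show "u > 0" using q by (simp add: u_def add_pos_nonneg)
    have "(sqrt (1 + 4 * q))\<^sup>2 = 1 + 4 * q" using q by simp
    then show "u\<^sup>2 = u + q" by (simp add: u_def power2_eq_square field_simps)
  qed
  define D1 where "D1 = \<sigma> * sqrt u"
  have D1: "D1 > 0" "D1\<^sup>2 / \<sigma>\<^sup>2 = u" using u \<sigma> by (simp_all add: D1_def power_mult_distrib)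
  have snr1: "snr p n \<sigma> D1 = 1"
    unfolding snr_def D1(2) q_def[symmetric] u(2)[symmetric] using u(1) by simp
  define D where "D = (if snr p n \<sigma> \<Delta> < 1 then D1 else \<Delta>)"
  have D: "D > 0" using D1 \<Delta> by (simp add: D_def)
  have \<Delta>D: "\<Delta> \<le> D"
  proof (cases "snr p n \<sigma> \<Delta> < 1")
    case True
    have "\<Delta> \<le> D1"
    proof (rule ccontr)
      assume "\<not> \<Delta> \<le> D1"
      then have "D1\<^sup>2 / \<sigma>\<^sup>2 \<le> \<Delta>\<^sup>2 / \<sigma>\<^sup>2" using D1 by (intro divide_right_mono power_mono) auto
      then have "(snr p n \<sigma> D1)\<^sup>2 \<le> (snr p n \<sigma> \<Delta>)\<^sup>2"
        unfolding snr_square[OF \<sigma> npos] using D1 u q by (intro ratio_mono) (auto simp: q_def)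
      then have "1 \<le> (snr p n \<sigma> \<Delta>)\<^sup>2" by (simp add: snr1)
      moreover have "(snr p n \<sigma> \<Delta>)\<^sup>2 < 1" using True snr_nonneg[of p n \<sigma> \<Delta>] by (simp add: power_less_one_iff abs_square_less_1)
      ultimately show False by simp
    qed
    then show ?thesis using True by (simp add: D_def)
  qed (simp add: D_def)
  have cD: "risk p n \<sigma> est \<omega> \<le> c" if "\<omega> \<in> Omega p n D" for \<omega>
    by (rule c) (rule subsetD[OF Omega_antimono[OF \<Delta>D] that])
  define r where "r = max (snr p n \<sigma> \<Delta>) 1"
  have r: "r = snr p n \<sigma> D" "r \<ge> 1" by (auto simp: r_def D_def snr1)
  define s where "s = D\<^sup>2 / \<sigma>\<^sup>2"
  have s: "s > 0" using D \<sigma> by (simp add: s_def)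
  have rs: "r\<^sup>2 * (s + q) = s\<^sup>2"
    unfolding r(1) snr_square[OF \<sigma> npos] s_def[symmetric] q_def[symmetric] 
    using add_pos_pos[OF s q] by simp
  have "1 * (s + q) \<le> r\<^sup>2 * (s + q)" using r(2) s q by (intro mult_right_mono) auto
  then have "s * 1 \<le> s * s" using q unfolding rs by (simp add: power2_eq_square)
  then have s1: "s \<ge> 1" using s by simp
  have "real (n - 1) * ((1 - sum_rate \<delta>) * gauss_tail (r * (1 + \<epsilon>))) \<le> 2 * (c + real n * shell_rate \<delta> powr (\<epsilon> * real n))"
  proof (cases "q \<le> \<epsilon> * s")
    case True
    have "s\<^sup>2 \<le> (r\<^sup>2 * (1 + \<epsilon>)) * s"
    proof -
      have "s\<^sup>2 = r\<^sup>2 * (s + q)" by (simp add: rs)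
      also have "\<dots> \<le> r\<^sup>2 * (s + \<epsilon> * s)" using True by (intro mult_left_mono) auto
      finally show ?thesis by (simp add: algebra_simps)
    qed
    then have "s * s \<le> (r\<^sup>2 * (1 + \<epsilon>)) * s" by (simp only: power2_eq_square[of s])
    then have "s \<le> r\<^sup>2 * (1 + \<epsilon>)" by (rule mult_right_le_imp_le[OF _ s])
    also have "\<dots> \<le> r\<^sup>2 * (1 + \<epsilon>)\<^sup>2" using \<epsilon> self_le_power[of "1 + \<epsilon>" 2] by (intro mult_left_mono) auto
    finally have "(D / \<sigma>)\<^sup>2 \<le> (r * (1 + \<epsilon>))\<^sup>2"
      by (simp only: s_def power_divide power_mult_distrib)
    moreover have "0 \<le> r * (1 + \<epsilon>)" using r(2) \<epsilon>(1) by (intro mult_nonneg_nonneg) linarith+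
    ultimately have "D / \<sigma> \<le> r * (1 + \<epsilon>)" by (rule power2_le_imp_le)
    then have "gauss_tail (r * (1 + \<epsilon>)) \<le> gauss_tail (D / \<sigma>)" by (rule gauss_tail_antimono)
    moreover have "(1 - sum_rate \<delta>) * gauss_tail (r * (1 + \<epsilon>)) \<le> 1 * gauss_tail (r * (1 + \<epsilon>))"
      using rates by (intro mult_right_mono gauss_tail_nonneg) auto
    ultimately have "(1 - sum_rate \<delta>) * gauss_tail (r * (1 + \<epsilon>)) \<le> gauss_tail (D / \<sigma>)" by linarith
    then have "real (n - 1) * ((1 - sum_rate \<delta>) * gauss_tail (r * (1 + \<epsilon>))) \<le> real (n - 1) * gauss_tail (D / \<sigma>)"
      by (rule mult_left_mono) simp
    also have "\<dots> \<le> 2 * c" by (rule minimax_known_signal[OF npos p \<sigma> D est cD])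
    also have "\<dots> \<le> 2 * (c + real n * shell_rate \<delta> powr (\<epsilon> * real n))" by simp
    finally show ?thesis .
  next
    case False
    have "\<epsilon> * 1 \<le> \<epsilon> * s" using s1 \<epsilon> by (intro mult_left_mono) auto
    then have "\<epsilon> < q" using False by linarith
    then have pn: "\<epsilon> * real n \<le> real p" using npos by (simp add: q_def less_divide_eq)
    have sp: "shell_rate \<delta> > 0" using \<delta> by (simp add: shell_rate_def)
    have "shell_rate \<delta> ^ p = shell_rate \<delta> powr real p" using sp by (simp add: powr_realpow)
    also have "\<dots> \<le> shell_rate \<delta> powr (\<epsilon> * real n)" using pn rates by (intro powr_mono') auto
    finally have sh: "shell_rate \<delta> ^ p \<le> shell_rate \<delta> powr (\<epsilon> * real n)" .
    have "\<epsilon> * \<epsilon> \<le> 1 * \<epsilon>" using \<epsilon> by (intro mult_right_mono) auto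
    \<comment> \<open>\<open>\<delta> = \<epsilon>/3\<close> is small enough for this, as \<open>\<epsilon>
        \<le> 1\<close>\<close>
    then have "(1 + \<delta>)\<^sup>2 \<le> 1 + \<epsilon>" using \<epsilon> by (simp add: \<delta>_def power2_eq_square field_simps)
    then have "r * (1 + \<delta>)\<^sup>2 \<le> r * (1 + \<epsilon>)" using r(2) by (intro mult_left_mono) linarith+
    then have "gauss_tail (r * (1 + \<epsilon>)) \<le> gauss_tail (snr p n \<sigma> D * (1 + \<delta>)\<^sup>2)"
      unfolding r(1) by (rule gauss_tail_antimono)
    then have "real (n - 1) * ((1 - sum_rate \<delta>) * gauss_tail (r * (1 + \<epsilon>))) \<le>
      real (n - 1) * ((1 - sum_rate \<delta>) * gauss_tail (snr p n \<sigma> D * (1 + \<delta>)\<^sup>2))"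
      using rates by (intro mult_left_mono) auto
    also have "\<dots> \<le> 2 * (c + real n * shell_rate \<delta> ^ p)"
      by (rule minimax_gaussian_prior[OF n p \<sigma> D \<delta> est cD c0])
    also have "\<dots> \<le> 2 * (c + real n * shell_rate \<delta> powr (\<epsilon> * real n))"
      using sh by (intro mult_left_mono add_left_mono) auto
    finally show ?thesis .
  qed
  then show ?thesis by (simp add: r_def \<delta>_def)
qed

section \<open>Estimators with large Rayleigh quotients\<close>

lemma label_iterate_cong:
  assumes a: "\<And>i j. i < n \<Longrightarrow> j < n \<Longrightarrow> a i j = b i j" and i: "i < n"
  shows "label_iterate s n a v k i = label_iterate s n b v k i"
  using i
proof (induction k arbitrary: i)
  case 0
  show ?case by (simp only: label_iterate.simps)
next
  case (Suc k)
  have "(\<Sum>j<n. a i j * label_iterate s n a v k j) = (\<Sum>j<n. b i j * label_iterate s n b v k j)"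
    using Suc a by (intro sum.cong refl) (simp only: lessThan_iff)
  then show ?case by (simp only: label_iterate.simps)
qed

lemma sign_with_measurable: "sign_with s \<in> borel_measurable borel"
  unfolding sign_with_def[abs_def] by measurable

lemma label_iterate_measurable:
  assumes a: "\<And>i j. i < n \<Longrightarrow> j < n \<Longrightarrow> (\<lambda>Y. a Y i j) \<in> borel_measurable M"
    and v: "\<And>i. i < n \<Longrightarrow> (\<lambda>Y. v Y i) \<in> borel_measurable M" and i: "i < n"
  shows "(\<lambda>Y. label_iterate s n (a Y) (v Y) k i) \<in> borel_measurable M"
  using i
proof (induction k arbitrary: i)
  case 0
  show ?case unfolding label_iterate.simps by (rule measurable_compose[OF v[OF 0] sign_with_measurable])
next
  case (Suc k)
  have "(\<lambda>Y. \<Sum>j<n. a Y i j * label_iterate s n (a Y) (v Y) k j) \<in> borel_measurable M"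
    by (intro borel_measurable_sum borel_measurable_times a Suc) simp_all
  then show ?case unfolding label_iterate.simps by (rule measurable_compose[OF _ sign_with_measurable])
qed

lemma obs_component_measurable:
  "k \<in> {..<p} \<times> {..<n} \<Longrightarrow> (\<lambda>Y. Y k) \<in> borel_measurable (obs_space p n)"
  unfolding obs_space_def by (rule measurable_component_singleton)

lemma gram_offdiag_measurable:
  assumes "i < n" "j < n"
  shows "(\<lambda>Y. gram_offdiag p Y i j) \<in> borel_measurable (obs_space p n)"
proof (cases "i = j")
  case True
  show ?thesis unfolding gram_offdiag_def if_P[OF True] by (rule borel_measurable_const)
next
  case False
  show ?thesis unfolding gram_offdiag_def if_not_P[OF False]
    by (intro borel_measurable_sum borel_measurable_times obs_component_measurable) (use assms in simp_all)
qed

lemma estimator_of_components: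
  assumes m: "\<And>j. j < n \<Longrightarrow> (\<lambda>Y. x Y j) \<in> borel_measurable (obs_space p n)"
    and l: "\<And>Y j. j < n \<Longrightarrow> x Y j \<in> {-1, 1}"
  shows "(\<lambda>Y. \<lambda>j\<in>{..<n}. x Y j) \<in> estimators p n"
  unfolding estimators_def
proof (rule measurable_restrict)
  fix j assume "j \<in> {..<n}"
  then have j: "j < n" by simp
  show "(\<lambda>Y. x Y j) \<in> obs_space p n \<rightarrow>\<^sub>M count_space {-1, 1}"
  proof (subst measurable_count_space_eq2)
    show "finite {-1, 1 :: real}" by simp
    have "(\<lambda>Y. x Y j) -` {a} \<inter> space (obs_space p n) \<in> sets (obs_space p n)" for a
      by (rule measurable_sets[OF m[OF j]]) simp
    then show "(\<lambda>Y. x Y j) \<in> space (obs_space p n) \<rightarrow> {-1, 1} \<and>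
      (\<forall>a\<in>{-1, 1}. (\<lambda>Y. x Y j) -` {a} \<inter> space (obs_space p n) \<in> sets (obs_space p n))"
      using l[OF j] by blast
  qed
qed

lemma sqnorm_label_vector: "\<eta> \<in> label_vectors n \<Longrightarrow> sqnorm n \<eta> = real n"
proof -
  assume \<eta>: "\<eta> \<in> label_vectors n"
  have "(\<eta> i)\<^sup>2 = 1" if "i < n" for i using label_vectors_label[OF \<eta> that] by auto
  then show ?thesis by (simp add: sqnorm_def)
qed

lemma spectral_iterate_estimator:
  assumes s: "s \<in> {-1, 1}" and v: "spectral_choice p n vhat"
  shows "spectral_iterate p n s vhat k \<in> estimators p n"
    and "rayleigh_iterate p n s k (spectral_iterate p n s vhat k)"
proof -
  have vm: "(\<lambda>Y. vec_index (vhat Y) j) \<in> borel_measurable (obs_space p n)" if "j < n" for j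
    using v that by (simp add: spectral_choice_def)
  have top: "top_eigenvector (hollow_gram p n Y) (vhat Y)" if "Y \<in> space (obs_space p n)" for Y
    using v that by (simp add: spectral_choice_def)
  define x where "x Y j = label_iterate s n (gram_offdiag p Y) (\<lambda>i. vec_index (vhat Y) i) k j" for Y j
  have eq: "spectral_iterate p n s vhat k Y = (\<lambda>j\<in>{..<n}. x Y j)" if Y: "Y \<in> space (obs_space p n)" for Y
    unfolding spectral_iterate_def
  proof (rule restrict_ext)
    fix j assume "j \<in> {..<n}"
    then have j: "j < n" by simp
    have "vec_index (sign_iterate s (hollow_gram p n Y) (vhat Y) k) j =
      label_iterate s n (\<lambda>i j. hollow_gram p n Y $$ (i, j)) (\<lambda>i. vec_index (vhat Y) i) k j"
      using sign_iterate_eq_label_iterate[OF hollow_gram_carrier top_eigenvector_rayleigh(1)[OF top[OF Y]]] j by blast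
    also have "\<dots> = x Y j" unfolding x_def by (rule label_iterate_cong[OF hollow_gram_index j])
    finally show "vec_index (sign_iterate s (hollow_gram p n Y) (vhat Y) k) j = x Y j" .
  qed
  have "(\<lambda>Y. \<lambda>j\<in>{..<n}. x Y j) \<in> estimators p n"
  proof (rule estimator_of_components)
    fix j assume "j < n"
    then show "(\<lambda>Y. x Y j) \<in> borel_measurable (obs_space p n)"
      unfolding x_def by (intro label_iterate_measurable gram_offdiag_measurable vm)
    show "x Y j \<in> {-1, 1}" for Y unfolding x_def by (rule label_iterate_label[OF s])
  qed
  moreover have "(spectral_iterate p n s vhat k \<in> estimators p n) = ((\<lambda>Y. \<lambda>j\<in>{..<n}. x Y j) \<in> estimators p n)"
    unfolding estimators_def by (rule measurable_cong) (rule eq)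
  ultimately show "spectral_iterate p n s vhat k \<in> estimators p n" by blast
  show "rayleigh_iterate p n s k (spectral_iterate p n s vhat k)"
    unfolding rayleigh_iterate_def
  proof (intro ballI exI conjI allI impI)
    fix Y assume Y: "Y \<in> space (obs_space p n)"
    show "sqnorm n (\<lambda>i. vec_index (vhat Y) i) > 0" by (rule top_eigenvector_rayleigh(2)[OF top[OF Y]])
    show "bilin n (gram_offdiag p Y) \<eta> \<eta> * sqnorm n (\<lambda>i. vec_index (vhat Y) i) \<le>
      bilin n (gram_offdiag p Y) (\<lambda>i. vec_index (vhat Y) i) (\<lambda>i. vec_index (vhat Y) i) * real n"
      if "\<eta> \<in> label_vectors n" for \<eta>
      using top_eigenvector_rayleigh(3)[OF top[OF Y], of \<eta>] by (simp add: sqnorm_label_vector[OF that])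
    show "spectral_iterate p n s vhat k Y j = label_iterate s n (gram_offdiag p Y) (\<lambda>i. vec_index (vhat Y) i) k j"
      if "j < n" for j
      using that by (simp add: eq[OF Y] x_def)
  qed
qed

text \<open>
  Over a finite set a maximiser can be built by comparing the candidates one after another, which
  is a measurable procedure.
\<close>

lemma measurable_maximizer:
  fixes Q :: "'a \<Rightarrow> 'y \<Rightarrow> real"
  assumes "finite A" "A \<noteq> {}" and "\<And>a. a \<in> A \<Longrightarrow> Q a \<in> borel_measurable M"
  shows "\<exists>g \<in> M \<rightarrow>\<^sub>M count_space A. \<forall>Y\<in>space M. \<forall>a\<in>A. Q a Y \<le> Q (g Y) Y"
  using assms
proof (induction A rule: finite_ne_induct)
  case (singleton a)
  show ?case by (rule bexI[of _ "\<lambda>_. a"]) auto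
next
  case (insert a A)
  then obtain g where g: "g \<in> M \<rightarrow>\<^sub>M count_space A" and g2: "\<forall>Y\<in>space M. \<forall>a\<in>A. Q a Y \<le> Q (g Y) Y" by blast
  have gA: "g Y \<in> A" if "Y \<in> space M" for Y using measurable_space[OF g that] by simp
  have gm: "g \<in> M \<rightarrow>\<^sub>M count_space (insert a A)"
    by (rule measurable_compose[OF g, of "\<lambda>x. x"]) simp
  have "(\<lambda>Y. Q (g Y) Y) \<in> borel_measurable M"
    by (rule measurable_compose_countable'[OF _ g]) (use insert.prems insert.hyps in \<open>auto intro: countable_finite\<close>)
  then have P: "{Y \<in> space M. Q (g Y) Y < Q a Y} \<in> sets M"
    by (rule borel_measurable_less) (rule insert.prems, simp)
  show ?case
  proof (rule bexI[of _ "\<lambda>Y. if Q (g Y) Y < Q a Y then a else g Y"])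
    show "\<forall>Y\<in>space M. \<forall>b\<in>insert a A. Q b Y \<le> Q (if Q (g Y) Y < Q a Y then a else g Y) Y"
    proof (intro ballI)
      fix Y b assume "Y \<in> space M" "b \<in> insert a A"
      then have "b = a \<or> Q b Y \<le> Q (g Y) Y" using g2 by blast
      then show "Q b Y \<le> Q (if Q (g Y) Y < Q a Y then a else g Y) Y" by auto
    qed
    show "(\<lambda>Y. if Q (g Y) Y < Q a Y then a else g Y) \<in> M \<rightarrow>\<^sub>M count_space (insert a A)"
      by (rule measurable_If[OF _ gm P]) simp
  qed
qed

text \<open>
  Starting at a label vector that maximises the quadratic form satisfies the Rayleigh condition by
  definition, and finitely many candidates make the choice measurable.
\<close>

lemma rayleigh_iterate_exists:
  assumes s: "s \<in> {-1, 1}" and n: "n > 0"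
  shows "\<exists>est \<in> estimators p n. rayleigh_iterate p n s k est"
proof -
  define Q where "Q \<eta> Y = bilin n (gram_offdiag p Y) \<eta> \<eta>" for \<eta> Y
  have "Q \<eta> \<in> borel_measurable (obs_space p n)" for \<eta>
    unfolding Q_def bilin_def
    by (intro borel_measurable_sum borel_measurable_times borel_measurable_const gram_offdiag_measurable) simp_all
  then obtain g where g: "g \<in> obs_space p n \<rightarrow>\<^sub>M count_space (label_vectors n)"
    and g2: "\<forall>Y\<in>space (obs_space p n). \<forall>\<eta>\<in>label_vectors n. Q \<eta> Y \<le> Q (g Y) Y"
    using measurable_maximizer[OF finite_label_vectors label_vectors_nonempty, where Q = Q and M = "obs_space p n"] by blast
  have gm: "(\<lambda>Y. g Y i) \<in> borel_measurable (obs_space p n)" for i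
    by (rule measurable_compose[OF g]) simp
  define x where "x Y j = label_iterate s n (gram_offdiag p Y) (g Y) k j" for Y j
  have "(\<lambda>Y. \<lambda>j\<in>{..<n}. x Y j) \<in> estimators p n"
  proof (rule estimator_of_components)
    fix j assume "j < n"
    then show "(\<lambda>Y. x Y j) \<in> borel_measurable (obs_space p n)"
      unfolding x_def by (intro label_iterate_measurable gram_offdiag_measurable gm)
    show "x Y j \<in> {-1, 1}" for Y unfolding x_def by (rule label_iterate_label[OF s])
  qed
  moreover have "rayleigh_iterate p n s k (\<lambda>Y. \<lambda>j\<in>{..<n}. x Y j)"
    unfolding rayleigh_iterate_def
  proof (intro ballI exI conjI allI impI)
    fix Y assume Y: "Y \<in> space (obs_space p n)"
    have "g Y \<in> label_vectors n" using measurable_space[OF g Y] by simp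
    then have gn: "sqnorm n (g Y) = real n" by (rule sqnorm_label_vector)
    show "sqnorm n (g Y) > 0" using n by (simp add: gn)
    show "bilin n (gram_offdiag p Y) \<eta> \<eta> * sqnorm n (g Y) \<le> bilin n (gram_offdiag p Y) (g Y) (g Y) * real n"
      if "\<eta> \<in> label_vectors n" for \<eta>
      using g2 Y that unfolding gn Q_def by (intro mult_right_mono) auto
    show "(\<lambda>j\<in>{..<n}. x Y j) j = label_iterate s n (gram_offdiag p Y) (g Y) k j" if "j < n" for j
      using that by (simp add: x_def)
  qed
  ultimately show ?thesis by blast
qed

section \<open>Limits\<close>

lemma Omega_nonempty:
  assumes p: "p > 0" and \<Delta>: "\<Delta> > 0"
  shows "Omega p n \<Delta> \<noteq> {}"
proof -
  define \<theta> where "\<theta> = (\<lambda>r\<in>{..<p}. if r = 0 then \<Delta> else 0)"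
  obtain \<eta> where \<eta>: "\<eta> \<in> label_vectors n" using label_vectors_nonempty by blast
  have "(\<Sum>r<p. (\<theta> r)\<^sup>2) = (\<Sum>r<p. if r = 0 then \<Delta>\<^sup>2 else 0)" by (intro sum.cong) (auto simp: \<theta>_def)
  also have "\<dots> = \<Delta>\<^sup>2" using p by (simp add: sum.delta)
  finally have "L2_set \<theta> {..<p} = \<Delta>" using \<Delta> by (simp add: L2_set_def)
  then have "(\<theta>, \<eta>) \<in> Omega p n \<Delta>" using \<eta> by (simp add: Omega_def \<theta>_def)
  then show ?thesis by blast
qed

lemma risk_nonneg: "est \<in> estimators p n \<Longrightarrow> 0 \<le> risk p n \<sigma> est \<omega>"
  by (cases \<omega>) (simp only: risk_eq_gauss Bochner_Integration.integral_nonneg loss_nonneg)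

text \<open>
  Here the number of iterations enters: \<open>16 \<ge> e\<^sup>2\<close>, so \<open>\<lfloor>3 ln
  n\<rfloor>\<close> contractions by 16 gain more than the factor \<open>n\<^sup>2\<close> up to a
  constant, and the initial error count times \<open>n\<close> vanishes.
\<close>

lemma div_16_power_log:
  assumes "n \<ge> 1"
  shows "real n / 16 ^ nat \<lfloor>3 * ln (real n)\<rfloor> \<le> exp 2 / real n"
proof -
  define k where "k = nat \<lfloor>3 * ln (real n)\<rfloor>"
  have n: "real n > 0" using assms by simp
  have "ln (real n) \<ge> 0" using assms by simp
  then have k: "real k \<ge> 3 * ln (real n) - 1" unfolding k_def by linarith
  have "exp 2 = exp (1::real) * exp 1" by (simp flip: exp_add)
  also have "\<dots> \<le> 3 * 3" by (intro mult_mono exp_le) auto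
  finally have e2: "exp (2::real) \<le> 16" by simp
  have "real n * real n * exp (- 2) \<le> 16 ^ k"
  proof -
    have "real n * real n * exp (- 2) = exp (2 * ln (real n) - 2)"
      using n by (simp add: exp_diff exp_minus exp_double power2_eq_square divide_inverse)
    also have "\<dots> \<le> exp (2 * real k)" using k \<open>ln (real n) \<ge> 0\<close> by simp
    also have "\<dots> = exp 2 ^ k" by (simp add: exp_of_nat_mult[symmetric] mult.commute)
    also have "\<dots> \<le> 16 ^ k" using e2 by (intro power_mono) auto
    finally show ?thesis .
  qed
  then have "real n / 16 ^ k \<le> real n / (real n * real n * exp (- 2))"
    using n by (intro divide_left_mono) auto
  also have "\<dots> = exp 2 / real n" using n by (simp add: exp_minus field_simps)
  finally show ?thesis by (simp only: k_def)
qed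

text \<open>
  The bound of \<open>risk_rayleigh_iterate\<close> after \<open>\<lfloor>3 ln n\<rfloor>\<close>
  steps.
\<close>

definition risk_bound :: "real \<Rightarrow> real \<Rightarrow> nat \<Rightarrow> real" where
  "risk_bound \<beta> R n = 2 * (exp 2 / real n) +
    (4 + 8 / \<beta>) * (real n * exp (- (R\<^sup>2 / 2 * ((real n - 4) / (real n - 2) - 4 * \<beta>)))) +
    4 * (real n * exp (- 2 * real n))"

text \<open>
  The weight \<open>w\<close> is \<open>1/n\<close> for almost full recovery and 1 for exact
  recovery.
\<close>

lemma SUP_risk_tendsto_0:
  fixes p :: "nat \<Rightarrow> nat" and \<sigma> \<Delta> :: "nat \<Rightarrow> real"
  assumes p: "\<And>n. n \<ge> 2 \<Longrightarrow> p n > 0" and \<sigma>: "\<And>n. n \<ge> 2 \<Longrightarrow> \<sigma> n > 0" and \<Delta>: "\<And>n. n \<ge> 2 \<Longrightarrow> \<Delta> n > 0"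
    and est: "\<And>n. n \<ge> 2 \<Longrightarrow> est n \<in> estimators (p n) n"
    and ray: "\<And>n. n \<ge> 2 \<Longrightarrow> rayleigh_iterate (p n) n s (nat \<lfloor>3 * ln (real n)\<rfloor>) (est n)"
    and s: "s \<in> {-1, 1}" and \<beta>: "0 < \<beta>" "\<beta> \<le> 1/100"
    and r: "filterlim (\<lambda>n. snr (p n) n (\<sigma> n) (\<Delta> n)) at_top sequentially"
    and w: "\<And>n. w n \<ge> 0"
    and lim: "(\<lambda>n. w n * risk_bound \<beta> (snr (p n) n (\<sigma> n) (\<Delta> n)) n) \<longlonglongrightarrow> 0"
  shows "(\<lambda>n. SUP \<omega> \<in> Omega (p n) n (\<Delta> n). ereal (w n * risk (p n) n (\<sigma> n) (est n) \<omega>)) \<longlonglongrightarrow> 0"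
proof -
  have "(\<lambda>n. ereal (w n * risk_bound \<beta> (snr (p n) n (\<sigma> n) (\<Delta> n)) n)) \<longlonglongrightarrow> ereal 0"
    using lim by (simp only: lim_ereal)
  then have lim': "(\<lambda>n. ereal (w n * risk_bound \<beta> (snr (p n) n (\<sigma> n) (\<Delta> n)) n)) \<longlonglongrightarrow> 0"
    by (simp only: zero_ereal_def)
  have large: "\<forall>\<^sub>F n in sequentially. 16000 / \<beta> \<le> snr (p n) n (\<sigma> n) (\<Delta> n)"
    using r by (simp add: filterlim_at_top)
  show ?thesis
  proof (rule tendsto_sandwich[OF _ _ tendsto_const lim'])
    show "\<forall>\<^sub>F n in sequentially. 0 \<le> (SUP \<omega> \<in> Omega (p n) n (\<Delta> n). ereal (w n * risk (p n) n (\<sigma> n) (est n) \<omega>))"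
      using eventually_ge_at_top[of 2]
    proof (rule eventually_mono)
      fix n :: nat assume n: "2 \<le> n"
      obtain \<omega> where \<omega>: "\<omega> \<in> Omega (p n) n (\<Delta> n)" using Omega_nonempty[OF p[OF n] \<Delta>[OF n]] by blast
      have "0 \<le> ereal (w n * risk (p n) n (\<sigma> n) (est n) \<omega>)"
        using w risk_nonneg[OF est[OF n]] by simp
      then show "0 \<le> (SUP \<omega> \<in> Omega (p n) n (\<Delta> n). ereal (w n * risk (p n) n (\<sigma> n) (est n) \<omega>))"
        by (rule SUP_upper2[OF \<omega>])
    qed
    show "\<forall>\<^sub>F n in sequentially. (SUP \<omega> \<in> Omega (p n) n (\<Delta> n). ereal (w n * risk (p n) n (\<sigma> n) (est n) \<omega>)) \<le>
      ereal (w n * risk_bound \<beta> (snr (p n) n (\<sigma> n) (\<Delta> n)) n)"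
      using eventually_conj[OF eventually_ge_at_top[of 5] large]
    proof (rule eventually_mono)
      fix n :: nat assume "5 \<le> n \<and> 16000 / \<beta> \<le> snr (p n) n (\<sigma> n) (\<Delta> n)"
      then have n: "n \<ge> 5" "n \<ge> 2" and R: "16000 / \<beta> \<le> snr (p n) n (\<sigma> n) (\<Delta> n)" by auto
      show "(SUP \<omega> \<in> Omega (p n) n (\<Delta> n). ereal (w n * risk (p n) n (\<sigma> n) (est n) \<omega>)) \<le>
        ereal (w n * risk_bound \<beta> (snr (p n) n (\<sigma> n) (\<Delta> n)) n)"
      proof (rule SUP_least)
        fix \<omega> assume \<omega>: "\<omega> \<in> Omega (p n) n (\<Delta> n)"
        obtain \<theta> \<eta> where e: "\<omega> = (\<theta>, \<eta>)" by (cases \<omega>)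
        have b: "4 * \<beta> \<le> (real n - 4) / (real n - 2)"
        proof -
          have "4 * \<beta> * (real n - 2) \<le> 1 / 25 * (real n - 2)" using \<beta> n by (intro mult_right_mono) auto
          also have "\<dots> \<le> real n - 4" using n by simp
          finally show ?thesis using n by (simp add: pos_le_divide_eq)
        qed
        have "risk (p n) n (\<sigma> n) (est n) \<omega> \<le> 2 * real n / 16 ^ nat \<lfloor>3 * ln (real n)\<rfloor> +
          (4 + 8 / \<beta>) * (real n * exp (- ((snr (p n) n (\<sigma> n) (\<Delta> n))\<^sup>2 / 2 * ((real n - 4) / (real n - 2) - 4 * \<beta>)))) +
          4 * (real n * exp (- 2 * real n))"
          unfolding e
          by (rule risk_rayleigh_iterate[OF est[OF n(2)] ray[OF n(2)] s n(1) \<sigma>[OF n(2)] \<Delta>[OF n(2)] \<beta>(1) _ b R \<omega>[unfolded e]])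
            (use \<beta> in simp)
        also have "\<dots> \<le> risk_bound \<beta> (snr (p n) n (\<sigma> n) (\<Delta> n)) n"
          unfolding risk_bound_def using div_16_power_log[of n] n by (intro add_right_mono) simp
        finally have "w n * risk (p n) n (\<sigma> n) (est n) \<omega> \<le> w n * risk_bound \<beta> (snr (p n) n (\<sigma> n) (\<Delta> n)) n"
          using w by (rule mult_left_mono)
        then show "ereal (w n * risk (p n) n (\<sigma> n) (est n) \<omega>) \<le> ereal (w n * risk_bound \<beta> (snr (p n) n (\<sigma> n) (\<Delta> n)) n)"
          by (simp only: ereal_less_eq)
      qed
    qed
  qed
qed

lemma n_exp_tendsto_0: "(\<lambda>n. real n * exp (- 2 * real n)) \<longlonglongrightarrow> 0"
  by real_asymp

lemma n_powr_tendsto_0: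
  assumes "0 \<le> x" "x < 1" "\<epsilon> > 0"
  shows "(\<lambda>n. real n * x powr (\<epsilon> * real n)) \<longlonglongrightarrow> 0"
proof (cases "x = 0")
  case True
  then show ?thesis by simp
next
  case False
  then have x: "x > 0" using assms by simp
  have lt: "x powr \<epsilon> < 1" using powr_less_mono2[of \<epsilon> x 1] x assms by simp
  have "(\<lambda>n. of_nat n * (x powr \<epsilon>) ^ n) \<longlonglongrightarrow> 0"
    using lt by (intro powser_times_n_limit_0) simp
  moreover have "x powr (\<epsilon> * real n) = (x powr \<epsilon>) ^ n" for n
    using x by (simp add: powr_realpow[symmetric] powr_powr)
  ultimately show ?thesis by simp
qed

text \<open>
  Divided by \<open>n\<close>, the middle term is a constant times \<open>exp(-c
  snr\<^sup>2)\<close> with \<open>c\<close> at least \<open>1/4\<close>, so that \<open>snr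
  \<rightarrow> \<infinity>\<close> suffices. Any fixed small \<open>\<beta>\<close> would do.
\<close>

lemma risk_bound_mean_tendsto_0:
  assumes r: "filterlim r at_top sequentially"
  shows "(\<lambda>n. 1 / real n * risk_bound (1/100) (r n) n) \<longlonglongrightarrow> 0"
proof -
  define h where "h n = exp (- ((r n)\<^sup>2 / 2 * ((real n - 4) / (real n - 2) - 4 * (1/100))))" for n
  have rr: "(\<lambda>n. exp (- (1/2 * r n))) \<longlonglongrightarrow> 0"
    by (rule filterlim_compose[OF exp_at_bot filterlim_compose[OF filterlim_uminus_at_bot_at_top
      filterlim_tendsto_pos_mult_at_top[OF tendsto_const _ r]]]) simp
  have h: "h \<longlonglongrightarrow> 0"
  proof (rule tendsto_sandwich[OF _ _ tendsto_const rr])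
    show "\<forall>\<^sub>F n in sequentially. 0 \<le> h n" by (simp add: h_def)
    have "\<forall>\<^sub>F n in sequentially. 2 \<le> r n" using r by (simp add: filterlim_at_top)
    from eventually_conj[OF eventually_ge_at_top[of 7] this]
    show "\<forall>\<^sub>F n in sequentially. h n \<le> exp (- (1/2 * r n))"
    proof (rule eventually_mono)
      fix n :: nat assume "7 \<le> n \<and> 2 \<le> r n"
      then have n: "n \<ge> 7" and rn: "r n \<ge> 2" by auto
      have "1/2 + 1/25 \<le> (real n - 4) / (real n - 2)" using n by (simp add: pos_le_divide_eq)
      then have "1/2 \<le> (real n - 4) / (real n - 2) - 4 * (1/100)" by linarith
      then have "(r n)\<^sup>2 / 2 * (1/2) \<le> (r n)\<^sup>2 / 2 * ((real n - 4) / (real n - 2) - 4 * (1/100))"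
        by (intro mult_left_mono) auto
      moreover have "1/2 * r n \<le> (r n)\<^sup>2 / 2 * (1/2)"
      proof -
        have "r n * 2 \<le> r n * r n" using rn by (intro mult_left_mono) auto
        then show ?thesis by (simp add: power2_eq_square)
      qed
      ultimately have "1/2 * r n \<le> (r n)\<^sup>2 / 2 * ((real n - 4) / (real n - 2) - 4 * (1/100))"
        by (rule order_trans[rotated])
      then show "h n \<le> exp (- (1/2 * r n))" by (simp only: h_def exp_le_cancel_iff neg_le_iff_le)
    qed
  qed
  have "(\<lambda>n. 2 * (exp 2 / (real n * real n)) + (4 + 8 / (1/100)) * h n + 4 * exp (- 2 * real n)) \<longlonglongrightarrow>
      2 * 0 + (4 + 8 / (1/100)) * 0 + 4 * 0"
    by (intro tendsto_intros h) real_asymp+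
  then have "(\<lambda>n. 2 * (exp 2 / (real n * real n)) + (4 + 8 / (1/100)) * h n + 4 * exp (- 2 * real n)) \<longlonglongrightarrow> 0" by simp
  then show ?thesis
  proof (rule Lim_transform_eventually)
    show "\<forall>\<^sub>F n in sequentially. 2 * (exp 2 / (real n * real n)) + (4 + 8 / (1/100)) * h n + 4 * exp (- 2 * real n) =
      1 / real n * risk_bound (1/100) (r n) n"
      using eventually_gt_at_top[of 0]
      by (rule eventually_mono) (simp add: risk_bound_def h_def distrib_left)
  qed
qed

text \<open>
  Exact recovery needs the sharp exponent. With \<open>\<beta> = \<epsilon>/32\<close> and
  \<open>n\<close> large, the factor in the exponent is at least
  \<open>(1-\<epsilon>/2)\<^sup>2\<close>, and \<open>r(1-\<epsilon>/2) \<ge> r(1-\<epsilon>) +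
  1\<close> as soon as \<open>r \<ge> 2/\<epsilon>\<close>. So the term is at most a constant
  times \<open>n \<Phi>\<^sup>c(r(1-\<epsilon>))\<close> by \<open>gauss_tail_ge_exp\<close>. The
  factor 1 is the weight of exact recovery.
\<close>

lemma risk_bound_tendsto_0:
  assumes \<epsilon>: "0 < \<epsilon>" "\<epsilon> \<le> 1/4" and r: "filterlim r at_top sequentially"
    and lim: "(\<lambda>n. real n * gauss_tail (r n * (1 - \<epsilon>))) \<longlonglongrightarrow> 0"
  shows "(\<lambda>n. 1 * risk_bound (\<epsilon> / 32) (r n) n) \<longlonglongrightarrow> 0"
proof -
  define h where "h n = real n * exp (- ((r n)\<^sup>2 / 2 * ((real n - 4) / (real n - 2) - 4 * (\<epsilon> / 32))))" for n
  have lim2: "(\<lambda>n. sqrt (2 * pi) * (real n * gauss_tail (r n * (1 - \<epsilon>)))) \<longlonglongrightarrow> 0"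
    using tendsto_mult[OF tendsto_const lim, of "sqrt (2 * pi)"] by simp
  have h: "h \<longlonglongrightarrow> 0"
  proof (rule tendsto_sandwich[OF _ _ tendsto_const lim2])
    show "\<forall>\<^sub>F n in sequentially. 0 \<le> h n" by (simp add: h_def)
    have "\<forall>\<^sub>F n in sequentially. 2 / \<epsilon> \<le> r n" using r by (simp add: filterlim_at_top)
    moreover have "\<forall>\<^sub>F n in sequentially. 2 + 16 / \<epsilon> \<le> real n"
      using filterlim_real_sequentially by (simp only: filterlim_at_top)
    ultimately have "\<forall>\<^sub>F n in sequentially. 2 / \<epsilon> \<le> r n \<and> 2 + 16 / \<epsilon> \<le> real n" by (rule eventually_conj)
    then show "\<forall>\<^sub>F n in sequentially. h n \<le> sqrt (2 * pi) * (real n * gauss_tail (r n * (1 - \<epsilon>)))"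
    proof (rule eventually_mono)
      fix n assume a: "2 / \<epsilon> \<le> r n \<and> 2 + 16 / \<epsilon> \<le> real n"
      have re: "1 \<le> r n * (\<epsilon> / 2)"
      proof -
        have "2 / \<epsilon> * (\<epsilon> / 2) \<le> r n * (\<epsilon> / 2)" using a \<epsilon> by (intro mult_right_mono) auto
        then show ?thesis using \<epsilon> by simp
      qed
      have r0: "0 \<le> r n" using a \<epsilon> by (smt (verit) divide_pos_pos)
      have n2: "real n - 2 \<ge> 16 / \<epsilon>" using a by simp
      have "16 / \<epsilon> > 0" using \<epsilon> by simp
      then have n0: "real n - 2 > 0" using n2 by linarith
      have "2 / (real n - 2) \<le> \<epsilon> / 8"
        using n2 n0 \<epsilon> by (simp add: divide_le_eq le_divide_eq mult.commute)
      moreover have "(real n - 4) / (real n - 2) = 1 - 2 / (real n - 2)" using n0 by (simp add: field_simps)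
      moreover have "(1 - \<epsilon> / 2)\<^sup>2 \<le> 1 - \<epsilon> / 2"
        using power_decreasing[of 1 2 "1 - \<epsilon> / 2"] \<epsilon> by simp
      ultimately have c: "(1 - \<epsilon> / 2)\<^sup>2 \<le> (real n - 4) / (real n - 2) - 4 * (\<epsilon> / 32)" using \<epsilon> by linarith
      have t0: "0 \<le> r n * (1 - \<epsilon>)" using r0 \<epsilon> by simp
      have "r n * (1 - \<epsilon>) + 1 \<le> r n * (1 - \<epsilon> / 2)" using re by (simp add: algebra_simps)
      then have "(r n * (1 - \<epsilon>) + 1)\<^sup>2 \<le> (r n * (1 - \<epsilon> / 2))\<^sup>2" using t0 by (intro power_mono) auto
      also have "\<dots> = (r n)\<^sup>2 * (1 - \<epsilon> / 2)\<^sup>2" by (rule power_mult_distrib)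
      also have "\<dots> \<le> (r n)\<^sup>2 * ((real n - 4) / (real n - 2) - 4 * (\<epsilon> / 32))"
        using c by (rule mult_left_mono) simp
      finally have "(r n * (1 - \<epsilon>) + 1)\<^sup>2 / 2 \<le> (r n)\<^sup>2 * ((real n - 4) / (real n - 2) - 4 * (\<epsilon> / 32)) / 2"
        by (rule divide_right_mono) simp
      then have "(r n * (1 - \<epsilon>) + 1)\<^sup>2 / 2 \<le> (r n)\<^sup>2 / 2 * ((real n - 4) / (real n - 2) - 4 * (\<epsilon> / 32))"
        by (simp only: times_divide_eq_left)
      then have "exp (- ((r n)\<^sup>2 / 2 * ((real n - 4) / (real n - 2) - 4 * (\<epsilon> / 32)))) \<le> exp (- ((r n * (1 - \<epsilon>) + 1)\<^sup>2 / 2))"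
        by (simp only: exp_le_cancel_iff neg_le_iff_le)
      also have "\<dots> \<le> sqrt (2 * pi) * gauss_tail (r n * (1 - \<epsilon>))"
      proof -
        have "exp (- ((r n * (1 - \<epsilon>) + 1)\<^sup>2 / 2)) = sqrt (2 * pi) * (exp (- ((r n * (1 - \<epsilon>) + 1)\<^sup>2 / 2)) / sqrt (2 * pi))"
          by simp
        also have "\<dots> \<le> sqrt (2 * pi) * gauss_tail (r n * (1 - \<epsilon>))"
          by (intro mult_left_mono gauss_tail_ge_exp[OF t0]) simp
        finally show ?thesis .
      qed
      finally have "h n \<le> real n * (sqrt (2 * pi) * gauss_tail (r n * (1 - \<epsilon>)))"
        unfolding h_def by (rule mult_left_mono) simp
      then show "h n \<le> sqrt (2 * pi) * (real n * gauss_tail (r n * (1 - \<epsilon>)))" by (simp only: mult.left_commute)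
    qed
  qed
  have "(\<lambda>n. 2 * (exp 2 / real n) + (4 + 8 / (\<epsilon> / 32)) * h n + 4 * (real n * exp (- 2 * real n))) \<longlonglongrightarrow>
      2 * 0 + (4 + 8 / (\<epsilon> / 32)) * 0 + 4 * 0"
    by (intro tendsto_add tendsto_mult tendsto_const h n_exp_tendsto_0) real_asymp
  then show ?thesis unfolding risk_bound_def h_def by simp
qed

text \<open>
  \<open>minimax_lower_bound\<close> with \<open>\<epsilon> = 1\<close> and \<open>c =
  n\<gamma>\<close> bounds \<open>\<Phi>\<^sup>c(2 max(snr, 1))\<close> by a multiple of
  \<open>\<gamma>\<close>. Since \<open>\<gamma>\<close> can be taken arbitrarily small,
  \<open>snr\<close> must tend to infinity.
\<close>

lemma snr_limit_of_almost_full_recovery: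
  fixes p :: "nat \<Rightarrow> nat" and \<sigma> \<Delta> :: "nat \<Rightarrow> real"
  assumes p: "\<And>n. n \<ge> 2 \<Longrightarrow> p n > 0" and \<sigma>: "\<And>n. n \<ge> 2 \<Longrightarrow> \<sigma> n > 0" and \<Delta>: "\<And>n. n \<ge> 2 \<Longrightarrow> \<Delta> n > 0"
    and est: "achieves_almost_full_recovery p \<sigma> \<Delta> est"
  shows "filterlim (\<lambda>n. snr (p n) n (\<sigma> n) (\<Delta> n)) at_top sequentially"
proof -
  define r where "r n = snr (p n) n (\<sigma> n) (\<Delta> n)" for n
  define A where "A n = (SUP \<omega> \<in> Omega (p n) n (\<Delta> n). ereal (1 / real n * risk (p n) n (\<sigma> n) (est n) \<omega>))" for n
  have lim: "A \<longlonglongrightarrow> 0" and E: "\<And>n. n \<ge> 2 \<Longrightarrow> est n \<in> estimators (p n) n"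
    using est unfolding achieves_almost_full_recovery_def A_def by blast+
  define a where "a = 1 - sum_rate (1/3)"
  define b where "b = shell_rate (1/3)"
  have a: "a > 0" and b: "0 \<le> b" "b < 1" using rates_lt_1[of "1/3"] by (simp_all add: a_def b_def)
  have "(\<lambda>n. gauss_tail (max (r n) 1 * 2)) \<longlonglongrightarrow> 0"
  proof (rule tendstoI)
    fix e :: real assume e: "e > 0"
    \<comment> \<open>chosen such that the constant 8 lost below ends at \<open>e/2\<close>\<close>
    define \<gamma> where "\<gamma> = a * e / 16"
    have \<gamma>: "\<gamma> > 0" using a e by (simp add: \<gamma>_def)
    have "\<forall>\<^sub>F n in sequentially. A n < ereal \<gamma>"
      by (rule order_tendstoD(2)[OF lim]) (use \<gamma> in simp)
    moreover have "\<forall>\<^sub>F n in sequentially. real n * b powr (1 * real n) < \<gamma>"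
      using n_powr_tendsto_0[OF b, of 1] \<gamma> by (intro order_tendstoD(2)) auto
    ultimately have "\<forall>\<^sub>F n in sequentially. (A n < ereal \<gamma> \<and> real n * b powr (1 * real n) < \<gamma>) \<and> 2 \<le> n"
      by (intro eventually_conj eventually_ge_at_top)
    then show "\<forall>\<^sub>F n in sequentially. dist (gauss_tail (max (r n) 1 * 2)) 0 < e"
    proof (rule eventually_mono)
      fix n assume "(A n < ereal \<gamma> \<and> real n * b powr (1 * real n) < \<gamma>) \<and> 2 \<le> n"
      then have An: "A n < ereal \<gamma>" and bn: "real n * b powr (1 * real n) < \<gamma>" and n: "2 \<le> n" by auto
      define g where "g = gauss_tail (max (r n) 1 * 2)"
      have risk: "risk (p n) n (\<sigma> n) (est n) \<omega> \<le> real n * \<gamma>" if "\<omega> \<in> Omega (p n) n (\<Delta> n)" for \<omega>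
      proof -
        have "ereal (1 / real n * risk (p n) n (\<sigma> n) (est n) \<omega>) \<le> A n" unfolding A_def using that by (rule SUP_upper)
        then have "ereal (1 / real n * risk (p n) n (\<sigma> n) (est n) \<omega>) < ereal \<gamma>" using An by (rule order_le_less_trans)
        then have "1 / real n * risk (p n) n (\<sigma> n) (est n) \<omega> < \<gamma>" by (simp only: less_ereal.simps)
        then show ?thesis using n by (simp add: divide_less_eq mult.commute)
      qed
      have "real (n - 1) * (a * g) \<le> 2 * (real n * \<gamma> + real n * b powr (1 * real n))"
      proof -
        have "0 \<le> real n * \<gamma>" using \<gamma> by simp
        then show ?thesis
          using minimax_lower_bound[where \<epsilon> = 1 and est = "est n" and c = "real n * \<gamma>", OF n p[OF n] \<sigma>[OF n] \<Delta>[OF n]]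
            E[OF n] risk by (simp add: a_def b_def g_def r_def)
      qed
      also have "real n * b powr (1 * real n) \<le> real n * \<gamma>"
        using bn n \<gamma> by (intro order_trans[OF less_imp_le[OF bn]]) simp
      finally have "real (n - 1) * (a * g) \<le> real n * (4 * \<gamma>)" by (simp add: mult_ac)
      moreover have "real n / 2 * (a * g) \<le> real (n - 1) * (a * g)"
        using n a by (intro mult_right_mono) (auto simp: g_def gauss_tail_nonneg of_nat_diff)
      ultimately have "real n * (a * g) \<le> real n * (8 * \<gamma>)" by simp
      then have "a * g \<le> 8 * \<gamma>" using n by simp
      also have "\<dots> = a * (e / 2)" by (simp add: \<gamma>_def)
      finally have "g \<le> e / 2" using a by simp
      then show "dist (gauss_tail (max (r n) 1 * 2)) 0 < e"
        using e gauss_tail_nonneg[of "max (r n) 1 * 2"] by (simp add: g_def dist_real_def)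
    qed
  qed
  then have top: "filterlim (\<lambda>n. max (r n) 1 * 2) at_top sequentially"
    by (simp only: gauss_tail_tendsto_0_iff)
  show ?thesis unfolding r_def[symmetric] filterlim_at_top
  proof
    fix Z
    have "\<forall>\<^sub>F n in sequentially. max Z 2 * 2 \<le> max (r n) 1 * 2" using top by (simp only: filterlim_at_top)
    then show "\<forall>\<^sub>F n in sequentially. Z \<le> r n" by (rule eventually_mono) (simp add: max_def split: if_splits)
  qed
qed

text \<open>
  If \<open>n \<Phi>\<^sup>c(r(1+\<epsilon>))\<close> stays away from 0, then so does \<open>n
  \<Phi>\<^sup>c(max(r, 1)(1+\<epsilon>))\<close>, trivially so when \<open>r < 1\<close>, and
  \<open>minimax_lower_bound\<close> keeps the risk of every estimator away from 0.
\<close>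

lemma exact_recovery_impossible_below:
  fixes p :: "nat \<Rightarrow> nat" and \<sigma> \<Delta> :: "nat \<Rightarrow> real"
  assumes p: "\<And>n. n \<ge> 2 \<Longrightarrow> p n > 0" and \<sigma>: "\<And>n. n \<ge> 2 \<Longrightarrow> \<sigma> n > 0" and \<Delta>: "\<And>n. n \<ge> 2 \<Longrightarrow> \<Delta> n > 0"
    and r: "\<And>n. n \<ge> 2 \<Longrightarrow> r n = snr (p n) n (\<sigma> n) (\<Delta> n)" and \<epsilon>0: "\<epsilon>0 > 0"
    and liminf: "liminf (\<lambda>n. ereal (real n * gauss_tail (r n * (1 + \<epsilon>0)))) > 0"
  shows "exact_recovery_impossible p \<sigma> \<Delta>"
proof -
  \<comment> \<open>a smaller \<open>\<epsilon>\<close> makes the assumption on the tail weaker, and the minimax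
      bound needs \<open>\<epsilon> \<le> 1\<close>\<close>
  define \<epsilon> where "\<epsilon> = min \<epsilon>0 1"
  have \<epsilon>: "0 < \<epsilon>" "\<epsilon> \<le> 1" "\<epsilon> \<le> \<epsilon>0" using \<epsilon>0 by (auto simp: \<epsilon>_def)
  obtain y where y: "0 < ereal y" "ereal y < liminf (\<lambda>n. ereal (real n * gauss_tail (r n * (1 + \<epsilon>0))))"
    using ereal_dense2[OF liminf] by blast
  have y0: "y > 0" using y(1) by simp
  have ev: "\<forall>\<^sub>F n in sequentially. ereal y < ereal (real n * gauss_tail (r n * (1 + \<epsilon>0)))"
    using y(2) by (rule less_LiminfD)
  define a where "a = 1 - sum_rate (\<epsilon> / 3)"
  define b where "b = shell_rate (\<epsilon> / 3)"
  have "\<epsilon> / 3 > 0" using \<epsilon> by simp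
  from rates_lt_1[OF this] have a: "a > 0" and b: "0 \<le> b" "b < 1" by (simp_all add: a_def b_def)
  \<comment> \<open>a common lower bound for \<open>n\<close> times the tail: \<open>y\<close> if \<open>r \<ge>
      1\<close>, and \<open>\<Phi>\<^sup>c(2)\<close> if \<open>r < 1\<close>\<close>
  define g0 where "g0 = min y (gauss_tail 2)"
  have g0: "g0 > 0" using y0 gauss_tail_pos by (simp add: g0_def)
  define c where "c = a * g0 / 16"
  have c: "c > 0" using a g0 by (simp add: c_def)
  have ev2: "\<forall>\<^sub>F n in sequentially. real n * b powr (\<epsilon> * real n) < c"
    using n_powr_tendsto_0[OF b \<epsilon>(1)] c by (intro order_tendstoD(2)) auto
  have "\<forall>\<^sub>F n in sequentially. ereal c \<le> (INF est \<in> estimators (p n) n. SUP \<omega> \<in> Omega (p n) n (\<Delta> n). ereal (risk (p n) n (\<sigma> n) est \<omega>))"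
    using eventually_conj[OF eventually_conj[OF ev ev2] eventually_ge_at_top[of 2]]
  proof (rule eventually_mono)
    fix n assume "(ereal y < ereal (real n * gauss_tail (r n * (1 + \<epsilon>0))) \<and> real n * b powr (\<epsilon> * real n) < c) \<and> 2 \<le> n"
    then have yn: "y < real n * gauss_tail (r n * (1 + \<epsilon>0))" and bn: "real n * b powr (\<epsilon> * real n) < c" and n: "2 \<le> n" by auto
    define R where "R = snr (p n) n (\<sigma> n) (\<Delta> n)"
    define g where "g = gauss_tail (max R 1 * (1 + \<epsilon>))"
    have R: "R = r n" "R \<ge> 0" using r[OF n] snr_nonneg by (simp_all add: R_def)
    have ng: "g0 \<le> real n * g"
    proof (cases "R \<ge> 1")
      case True
      have "R * (1 + \<epsilon>) \<le> R * (1 + \<epsilon>0)" using R \<epsilon> by (intro mult_left_mono) auto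
      then have "gauss_tail (R * (1 + \<epsilon>0)) \<le> g" unfolding g_def using True by (simp add: max_absorb1 gauss_tail_antimono)
      then have "real n * gauss_tail (R * (1 + \<epsilon>0)) \<le> real n * g" by (rule mult_left_mono) simp
      then show ?thesis using yn by (simp add: g0_def R(1))
    next
      case False
      then have "gauss_tail 2 \<le> g" unfolding g_def using \<epsilon> by (intro gauss_tail_antimono) simp
      moreover have "1 * g \<le> real n * g" using n by (intro mult_right_mono) (auto simp: g_def gauss_tail_nonneg)
      ultimately show ?thesis by (simp add: g0_def)
    qed
    show "ereal c \<le> (INF est \<in> estimators (p n) n. SUP \<omega> \<in> Omega (p n) n (\<Delta> n). ereal (risk (p n) n (\<sigma> n) est \<omega>))"
    proof (rule INF_greatest)
      fix est assume est: "est \<in> estimators (p n) n"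
      show "ereal c \<le> (SUP \<omega> \<in> Omega (p n) n (\<Delta> n). ereal (risk (p n) n (\<sigma> n) est \<omega>))"
      proof (rule ccontr)
        assume "\<not> ereal c \<le> (SUP \<omega> \<in> Omega (p n) n (\<Delta> n). ereal (risk (p n) n (\<sigma> n) est \<omega>))"
        then have lt: "(SUP \<omega> \<in> Omega (p n) n (\<Delta> n). ereal (risk (p n) n (\<sigma> n) est \<omega>)) < ereal c" by (simp only: not_le)
        have risk: "risk (p n) n (\<sigma> n) est \<omega> \<le> c" if "\<omega> \<in> Omega (p n) n (\<Delta> n)" for \<omega>
        proof -
          have "ereal (risk (p n) n (\<sigma> n) est \<omega>) < ereal c"
            using lt by (rule order_le_less_trans[OF SUP_upper[OF that]])
          then show ?thesis by (simp only: less_ereal.simps less_imp_le)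
        qed
        have "real (n - 1) * (a * g) \<le> 2 * (c + real n * b powr (\<epsilon> * real n))"
          unfolding a_def b_def g_def R_def
          by (rule minimax_lower_bound[OF n p[OF n] \<sigma>[OF n] \<Delta>[OF n] \<epsilon>(1,2) est risk less_imp_le[OF c]])
        also have "2 * (c + real n * b powr (\<epsilon> * real n)) < 4 * c"
        proof -
          have "2 * (c + x) < 4 * c" if "x < c" for x :: real using that by simp
          from this[OF bn] show ?thesis .
        qed
        finally have up: "real (n - 1) * (a * g) < 4 * c" .
        have "real n / 2 * (a * g) \<le> real (n - 1) * (a * g)"
          using n a by (intro mult_right_mono) (auto simp: g_def gauss_tail_nonneg of_nat_diff)
        moreover have "a * g0 \<le> a * (real n * g)" using ng a by (intro mult_left_mono) auto
        ultimately have "a * g0 / 2 \<le> real (n - 1) * (a * g)" by (simp add: mult_ac)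
        then have "8 * c < 4 * c" using up by (simp add: c_def)
        then show False using c by simp
      qed
    qed
  qed
  then have "ereal c \<le> liminf (\<lambda>n. INF est \<in> estimators (p n) n. SUP \<omega> \<in> Omega (p n) n (\<Delta> n). ereal (risk (p n) n (\<sigma> n) est \<omega>))"
    by (rule Liminf_bounded)
  moreover have "0 < ereal c" using c by simp
  ultimately show ?thesis unfolding exact_recovery_impossible_def by (rule order_less_le_trans[rotated])
qed

theorem theorem6:
  fixes p :: "nat \<Rightarrow> nat" and \<sigma> \<Delta> r :: "nat \<Rightarrow> real"
  assumes p_pos: "\<And>n. n \<ge> 2 \<Longrightarrow> p n > 0"
    and sigma_pos: "\<And>n. n \<ge> 2 \<Longrightarrow> \<sigma> n > 0"
    and Delta_pos: "\<And>n. n \<ge> 2 \<Longrightarrow> \<Delta> n > 0"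
    and r_def: "\<And>n. n \<ge> 2 \<Longrightarrow> r n = snr (p n) n (\<sigma> n) (\<Delta> n)"
  shows
    "(almost_full_recovery_possible p \<sigma> \<Delta> \<longleftrightarrow> (\<lambda>n. gauss_tail (r n)) \<longlonglongrightarrow> 0) \<and>
     ((\<lambda>n. gauss_tail (r n)) \<longlonglongrightarrow> 0 \<longrightarrow>
       (\<forall>s\<^sub>0 \<in> {-1, 1}. \<forall>vhat. (\<forall>n\<ge>2. spectral_choice (p n) n (vhat n)) \<longrightarrow>
         achieves_almost_full_recovery p \<sigma> \<Delta>
           (\<lambda>n. spectral_iterate (p n) n s\<^sub>0 (vhat n) (nat \<lfloor>3 * ln (real n)\<rfloor>)))) \<and>
     ((\<exists>\<epsilon>>0. liminf (\<lambda>n. ereal (real n * gauss_tail (r n * (1 + \<epsilon>)))) > 0) \<longrightarrow>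
       exact_recovery_impossible p \<sigma> \<Delta>) \<and>
     ((\<exists>\<epsilon>>0. (\<lambda>n. real n * gauss_tail (r n * (1 - \<epsilon>))) \<longlonglongrightarrow> 0) \<longrightarrow>
       exact_recovery_possible p \<sigma> \<Delta> \<and>
       (\<forall>s\<^sub>0 \<in> {-1, 1}. \<forall>vhat. (\<forall>n\<ge>2. spectral_choice (p n) n (vhat n)) \<longrightarrow>
         achieves_exact_recovery p \<sigma> \<Delta>
           (\<lambda>n. spectral_iterate (p n) n s\<^sub>0 (vhat n) (nat \<lfloor>3 * ln (real n)\<rfloor>))))"
proof -
  let ?R = "\<lambda>n. snr (p n) n (\<sigma> n) (\<Delta> n)"
  let ?k = "\<lambda>n. nat \<lfloor>3 * ln (real n)\<rfloor>"
  have eqR: "\<forall>\<^sub>F n in sequentially. r n = ?R n"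
    using eventually_ge_at_top[of 2] by (rule eventually_mono) (rule r_def)
  have rR: "filterlim r at_top sequentially = filterlim ?R at_top sequentially"
    by (rule filterlim_cong[OF refl refl eqR])
  have tail: "((\<lambda>n. gauss_tail (r n)) \<longlonglongrightarrow> 0) = filterlim ?R at_top sequentially"
    using gauss_tail_tendsto_0_iff[of r sequentially] rR by blast
  \<comment> \<open>both parts treat all \<open>rayleigh_iterate\<close> estimators at once, so that the
      possibility claims follow from the maximising label vector and the claims on
      \<open>\<eta>\<^sup>k\<close> from the eigenvector\<close>
  have almost: "achieves_almost_full_recovery p \<sigma> \<Delta> est"
    if lim: "filterlim ?R at_top sequentially" and s: "s \<in> {-1, 1}"
      and est: "\<And>n. n \<ge> 2 \<Longrightarrow> est n \<in> estimators (p n) n"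
      and ray: "\<And>n. n \<ge> 2 \<Longrightarrow> rayleigh_iterate (p n) n s (?k n) (est n)" for s est
    unfolding achieves_almost_full_recovery_def
    using SUP_risk_tendsto_0[OF p_pos sigma_pos Delta_pos est ray s _ _ lim _ risk_bound_mean_tendsto_0[OF lim]] est by simp
  have exact: "achieves_exact_recovery p \<sigma> \<Delta> est"
    if hyp: "\<exists>\<epsilon>>0. (\<lambda>n. real n * gauss_tail (r n * (1 - \<epsilon>))) \<longlonglongrightarrow> 0" and s: "s \<in> {-1, 1}"
      and est: "\<And>n. n \<ge> 2 \<Longrightarrow> est n \<in> estimators (p n) n"
      and ray: "\<And>n. n \<ge> 2 \<Longrightarrow> rayleigh_iterate (p n) n s (?k n) (est n)" for s est
  proof -
    obtain \<epsilon>0 where \<epsilon>0: "\<epsilon>0 > 0" and lim0: "(\<lambda>n. real n * gauss_tail (r n * (1 - \<epsilon>0))) \<longlonglongrightarrow> 0" using hyp by blast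
    define \<epsilon> where "\<epsilon> = min \<epsilon>0 (1/4)"
    have \<epsilon>: "0 < \<epsilon>" "\<epsilon> \<le> 1/4" "\<epsilon> \<le> \<epsilon>0" using \<epsilon>0 by (auto simp: \<epsilon>_def)
    have tails: "\<forall>\<^sub>F n in sequentially. real n * gauss_tail (?R n * (1 - \<epsilon>)) \<le> real n * gauss_tail (r n * (1 - \<epsilon>0))"
      using eqR
    proof (rule eventually_mono)
      fix n assume rn: "r n = ?R n"
      have "?R n * (1 - \<epsilon>0) \<le> ?R n * (1 - \<epsilon>)" using \<epsilon> snr_nonneg by (intro mult_left_mono) auto
      then show "real n * gauss_tail (?R n * (1 - \<epsilon>)) \<le> real n * gauss_tail (r n * (1 - \<epsilon>0))"
        unfolding rn by (rule mult_left_mono[OF gauss_tail_antimono of_nat_0_le_iff])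
    qed
    have lim: "(\<lambda>n. real n * gauss_tail (?R n * (1 - \<epsilon>))) \<longlonglongrightarrow> 0"
      by (rule tendsto_sandwich[OF _ tails tendsto_const lim0]) (simp add: gauss_tail_nonneg)
    have "(\<lambda>n. gauss_tail (?R n * (1 - \<epsilon>))) \<longlonglongrightarrow> 0"
    proof (rule tendsto_sandwich[OF _ _ tendsto_const lim])
      show "\<forall>\<^sub>F n in sequentially. gauss_tail (?R n * (1 - \<epsilon>)) \<le> real n * gauss_tail (?R n * (1 - \<epsilon>))"
        using eventually_ge_at_top[of 1]
      proof (rule eventually_mono)
        fix n :: nat assume "1 \<le> n"
        then have "1 * gauss_tail (?R n * (1 - \<epsilon>)) \<le> real n * gauss_tail (?R n * (1 - \<epsilon>))"
          by (intro mult_right_mono gauss_tail_nonneg) simp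
        then show "gauss_tail (?R n * (1 - \<epsilon>)) \<le> real n * gauss_tail (?R n * (1 - \<epsilon>))" by simp
      qed
    qed (simp add: gauss_tail_nonneg)
    then have top: "filterlim (\<lambda>n. ?R n * (1 - \<epsilon>)) at_top sequentially"
      by (simp only: gauss_tail_tendsto_0_iff)
    have R: "filterlim ?R at_top sequentially"
      using top
    proof (rule filterlim_at_top_mono)
      show "\<forall>\<^sub>F n in sequentially. ?R n * (1 - \<epsilon>) \<le> ?R n"
        using \<epsilon> snr_nonneg by (intro always_eventually allI mult_left_le) auto
    qed
    have \<beta>: "0 < \<epsilon> / 32" "\<epsilon> / 32 \<le> 1/100" using \<epsilon> by auto
    show ?thesis
      unfolding achieves_exact_recovery_def
      using SUP_risk_tendsto_0[OF p_pos sigma_pos Delta_pos est ray s \<beta> R _ risk_bound_tendsto_0[OF \<epsilon>(1,2) R lim]] est by simp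
  qed
  have "\<exists>est. \<forall>n\<ge>2. est n \<in> estimators (p n) n \<and> rayleigh_iterate (p n) n 1 (?k n) (est n)"
  proof (intro choice allI)
    fix n :: nat
    show "\<exists>e. n \<ge> 2 \<longrightarrow> e \<in> estimators (p n) n \<and> rayleigh_iterate (p n) n 1 (?k n) e"
      using rayleigh_iterate_exists[of 1 n "p n" "?k n"] by (cases "n \<ge> 2") auto
  qed
  then obtain est0 where est0: "\<And>n. n \<ge> 2 \<Longrightarrow> est0 n \<in> estimators (p n) n"
    "\<And>n. n \<ge> 2 \<Longrightarrow> rayleigh_iterate (p n) n 1 (?k n) (est0 n)" by blast
  have one: "(1 :: real) \<in> {-1, 1}" by simp
  have i1: "almost_full_recovery_possible p \<sigma> \<Delta> \<longleftrightarrow> (\<lambda>n. gauss_tail (r n)) \<longlonglongrightarrow> 0"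
  proof
    assume "almost_full_recovery_possible p \<sigma> \<Delta>"
    then obtain est where est: "achieves_almost_full_recovery p \<sigma> \<Delta> est"
      unfolding almost_full_recovery_possible_def by blast
    show "(\<lambda>n. gauss_tail (r n)) \<longlonglongrightarrow> 0"
      unfolding tail by (rule snr_limit_of_almost_full_recovery[OF p_pos sigma_pos Delta_pos est])
  next
    assume "(\<lambda>n. gauss_tail (r n)) \<longlonglongrightarrow> 0"
    then have "filterlim ?R at_top sequentially" unfolding tail .
    from almost[OF this one est0] show "almost_full_recovery_possible p \<sigma> \<Delta>"
      unfolding almost_full_recovery_possible_def by blast
  qed
  have i2: "achieves_almost_full_recovery p \<sigma> \<Delta> (\<lambda>n. spectral_iterate (p n) n s (vhat n) (?k n))"
    if "(\<lambda>n. gauss_tail (r n)) \<longlonglongrightarrow> 0" "s \<in> {-1, 1}" "\<forall>n\<ge>2. spectral_choice (p n) n (vhat n)" for s vhat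
    using that(1) unfolding tail
    by (rule almost[OF _ that(2)]) (use spectral_iterate_estimator[OF that(2)] that(3) in blast)+
  have ii1: "exact_recovery_impossible p \<sigma> \<Delta>"
    if low: "\<exists>\<epsilon>>0. liminf (\<lambda>n. ereal (real n * gauss_tail (r n * (1 + \<epsilon>)))) > 0"
  proof -
    obtain \<epsilon> where \<epsilon>: "\<epsilon> > 0" "liminf (\<lambda>n. ereal (real n * gauss_tail (r n * (1 + \<epsilon>)))) > 0" using low by blast
    show ?thesis by (rule exact_recovery_impossible_below[OF p_pos sigma_pos Delta_pos r_def \<epsilon>])
  qed
  have ii2: "exact_recovery_possible p \<sigma> \<Delta>"
    if "\<exists>\<epsilon>>0. (\<lambda>n. real n * gauss_tail (r n * (1 - \<epsilon>))) \<longlonglongrightarrow> 0"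
    unfolding exact_recovery_possible_def using exact[OF that one est0] by blast
  have ii3: "achieves_exact_recovery p \<sigma> \<Delta> (\<lambda>n. spectral_iterate (p n) n s (vhat n) (?k n))"
    if "\<exists>\<epsilon>>0. (\<lambda>n. real n * gauss_tail (r n * (1 - \<epsilon>))) \<longlonglongrightarrow> 0" "s \<in> {-1, 1}"
      "\<forall>n\<ge>2. spectral_choice (p n) n (vhat n)" for s vhat
    by (rule exact[OF that(1,2)]) (use spectral_iterate_estimator[OF that(2)] that(3) in blast)+
  show ?thesis using i1 i2 ii1 ii2 ii3 by blast
qed

end
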